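(* Let $n\ge2$, $s\in(\frac12,1]$, and let $\mathcal M$ be either $\mathcal A^{1+s}$ or, for some fixed point $\mathbf z\in\mathbb R^n$, $\mathcal A^{1+s}_{\mathbf z}$. If two knots $\gamma_0$ and $\gamma_1$ lie in the same connected component of $\mathcal M$ then they are $C^1$-ambiently isotopic. If, on the other hand, two knots $\gamma_0,\gamma_1\in\mathcal M$ are $C^1$-isotopic in $\mathbb R^n$, then they lie in the same connected component of $\mathcal M$.
   Context: $\mathbb R/\mathbb Z$ is the circle of length $1$. $H^{1+s}(\mathbb R/\mathbb Z,\mathbb R^n)=W^{1+s,2}(\mathbb R/\mathbb Z,\mathbb R^n)$ is the (for $s<1$ fractional) Sobolev Hilbert space of $1$-periodic functions, which embeds compactly into $C^1$ for $s>\frac12$. $\mathcal A^{1+s}=\{\gamma\in H^{1+s}(\mathbb R/\mathbb Z,\mathbb R^n):\gamma|_{[0,1)}\text{ injective},\ |\gamma'|=1\}$ and $\mathcal A^{1+s}_{\mathbf z}=\{\gamma\in\mathcal A^{1+s}:\gamma(0)=\mathbf z\}$, with the $H^{1+s}$-topology. Two knots $\gamma_0,\gamma_1$ are $C^1$-isotopic if there is $J\in C^1(\mathbb R/\mathbb Z\times[0,1],\mathbb R^n)$ with $J(\cdot,0)=\gamma_0$, $J(\cdot,1)=\gamma_1$ such that $J(\cdot,\sigma)$ is a $C^1$-embedding (injective immersion) for every $\sigma\in[0,1]$. They are $C^1$-ambiently isotopic if there is a continuous $F:\mathbb R^n\times[0,1]\to\mathbb R^n$ such that each $F(\cdot,t)$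 is a $C^1$-diffeomorphism of $\mathbb R^n$, $F(\cdot,0)=\mathrm{Id}$, and $F(\gamma_0(\mathbb R/\mathbb Z),1)=\gamma_1(\mathbb R/\mathbb Z)$. *)

theory Defs
  imports "HOL-Analysis.Analysis"
begin

text \<open>
  Functions on the circle of length 1 are functions on \<open>real\<close> of period 1, expressed by the
  library's \<open>periodic_fun_simple'\<close>.
\<close>

subsection \<open>Sobolev spaces on the circle\<close>

definition L2_sq :: "(real \<Rightarrow> 'b::euclidean_space) \<Rightarrow> ennreal" where
  "L2_sq f = (\<integral>\<^sup>+x\<in>{0..1}. ennreal ((norm (f x))\<^sup>2) \<partial>lborel)"

definition L2_circle :: "(real \<Rightarrow> 'b::euclidean_space) set" where
  "L2_circle = {f. periodic_fun_simple' f \<and> f \<in> borel_measurable borel \<and> L2_sq f < \<infinity>}"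

definition test_function :: "(real \<Rightarrow> real) \<Rightarrow> bool" where
  "test_function \<phi> \<longleftrightarrow>
     periodic_fun_simple' \<phi> \<and> (\<forall>k. (deriv ^^ k) \<phi> differentiable_on UNIV)"

definition has_weak_deriv ::
    "(real \<Rightarrow> 'b::euclidean_space) \<Rightarrow> (real \<Rightarrow> 'b) \<Rightarrow> bool" where
  "has_weak_deriv f g \<longleftrightarrow> f \<in> L2_circle \<and> g \<in> L2_circle \<and>
     (\<forall>\<phi>. test_function \<phi> \<longrightarrow>
        (LINT x:{0..1}|lborel. deriv \<phi> x *\<^sub>R f x) = - (LINT x:{0..1}|lborel. \<phi> x *\<^sub>R g x))"

text \<open>
  Weak derivatives are unique only up to null sets. The choice of representative does not affect
  any of the integrals below.
\<close>

definition weak_deriv :: "(real \<Rightarrow> 'b::euclidean_space) \<Rightarrow> real \<Rightarrow> 'b" where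
  "weak_deriv f = (SOME g. has_weak_deriv f g)"

text \<open>
  The Gagliardo (Sobolev--Slobodeckij) seminorm, with \<open>\<bar>w\<bar>\<close>, \<open>w \<in> [-1/2, 1/2]\<close>, the intrinsic
  distance of \<open>u + w\<close> and \<open>u\<close> on the circle.
\<close>

definition gagliardo_sq :: "real \<Rightarrow> (real \<Rightarrow> 'b::euclidean_space) \<Rightarrow> ennreal" where
  "gagliardo_sq s f =
     (\<integral>\<^sup>+u\<in>{0..1}. (\<integral>\<^sup>+w\<in>{-1/2..1/2}.
        ennreal ((norm (f (u + w) - f u))\<^sup>2 / \<bar>w\<bar> powr (1 + 2 * s)) \<partial>lborel) \<partial>lborel)"

text \<open>The space \<open>H\<^sup>s\<close> and the square of its top-order seminorm, for \<open>0 < s \<le> 1\<close>.\<close>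

definition H_circle :: "real \<Rightarrow> (real \<Rightarrow> 'b::euclidean_space) set" where
  "H_circle s = {f \<in> L2_circle.
     if s < 1 then gagliardo_sq s f < \<infinity> else (\<exists>g. has_weak_deriv f g)}"

definition H_seminorm_sq :: "real \<Rightarrow> (real \<Rightarrow> 'b::euclidean_space) \<Rightarrow> ennreal" where
  "H_seminorm_sq s f = (if s < 1 then gagliardo_sq s f else L2_sq (weak_deriv f))"

text \<open>
  The space \<open>H\<^sup>1\<^sup>+\<^sup>s\<close>, for \<open>0 < s \<le> 1\<close>. Each class has exactly one continuous representative, and
  the class is identified with it.
\<close>

definition H1_circle :: "real \<Rightarrow> (real \<Rightarrow> 'b::euclidean_space) set" where
  "H1_circle s = {f. continuous_on UNIV f \<and> (\<exists>g \<in> H_circle s. has_weak_deriv f g)}"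

definition H1_norm :: "real \<Rightarrow> (real \<Rightarrow> 'b::euclidean_space) \<Rightarrow> real" where
  "H1_norm s f =
     sqrt (enn2real (L2_sq f + L2_sq (weak_deriv f) + H_seminorm_sq s (weak_deriv f)))"

definition H1_topology :: "real \<Rightarrow> (real \<Rightarrow> 'b::euclidean_space) topology" where
  "H1_topology s = Metric_space.mtopology (H1_circle s) (\<lambda>f g. H1_norm s (\<lambda>x. f x - g x))"

subsection \<open>Spaces of arclength parametrized knots\<close>

definition knots :: "real \<Rightarrow> (real \<Rightarrow> 'b::euclidean_space) set" where
  "knots s = {\<gamma> \<in> H1_circle s. inj_on \<gamma> {0..<1} \<and>
     (\<forall>x. \<exists>v. (\<gamma> has_vector_derivative v) (at x) \<and> norm v = 1)}"

definition knots_at :: "real \<Rightarrow> 'b \<Rightarrow> (real \<Rightarrow> 'b::euclidean_space) set" where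
  "knots_at s z = {\<gamma> \<in> knots s. \<gamma> 0 = z}"

subsection \<open>Isotopies\<close>

text \<open>
  \<open>C1_on S f\<close> uses derivatives within \<open>S\<close>, hence one-sided ones at boundary points. It is used
  for \<open>S = UNIV\<close> and \<open>S = UNIV \<times> {0..1}\<close>, where these derivatives are unique.
\<close>

definition C1_on ::
    "'a::real_normed_vector set \<Rightarrow> ('a \<Rightarrow> 'b::real_normed_vector) \<Rightarrow> bool" where
  "C1_on S f \<longleftrightarrow> (\<exists>D :: 'a \<Rightarrow> 'a \<Rightarrow>\<^sub>L 'b. continuous_on S D \<and>
     (\<forall>x\<in>S. (f has_derivative blinfun_apply (D x)) (at x within S)))"

definition C1_diffeo :: "('b::euclidean_space \<Rightarrow> 'b) \<Rightarrow> bool" where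
  "C1_diffeo f \<longleftrightarrow> bij f \<and> C1_on UNIV f \<and> C1_on UNIV (inv f)"

definition C1_embedding :: "(real \<Rightarrow> 'b::euclidean_space) \<Rightarrow> bool" where
  "C1_embedding \<gamma> \<longleftrightarrow> periodic_fun_simple' \<gamma> \<and> \<gamma> C1_differentiable_on UNIV \<and>
     inj_on \<gamma> {0..<1} \<and> (\<forall>x. vector_derivative \<gamma> (at x) \<noteq> 0)"

definition C1_isotopic ::
    "(real \<Rightarrow> 'b::euclidean_space) \<Rightarrow> (real \<Rightarrow> 'b) \<Rightarrow> bool" where
  "C1_isotopic \<gamma>0 \<gamma>1 \<longleftrightarrow> (\<exists>J :: real \<times> real \<Rightarrow> 'b.
     C1_on (UNIV \<times> {0..1}) J \<and>
     (\<forall>x. J (x, 0) = \<gamma>0 x) \<and> (\<forall>x. J (x, 1) = \<gamma>1 x) \<and>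
     (\<forall>\<sigma>\<in>{0..1}. C1_embedding (\<lambda>x. J (x, \<sigma>))))"

definition C1_ambient_isotopic ::
    "(real \<Rightarrow> 'b::euclidean_space) \<Rightarrow> (real \<Rightarrow> 'b) \<Rightarrow> bool" where
  "C1_ambient_isotopic \<gamma>0 \<gamma>1 \<longleftrightarrow> (\<exists>F :: 'b \<times> real \<Rightarrow> 'b.
     continuous_on (UNIV \<times> {0..1}) F \<and>
     (\<forall>t\<in>{0..1}. C1_diffeo (\<lambda>x. F (x, t))) \<and>
     (\<forall>x. F (x, 0) = x) \<and>
     (\<lambda>x. F (x, 1)) ` range \<gamma>0 = range \<gamma>1)"

end

theory Submission
  imports Defs
begin

text \<open>
  Both implications rest on the embedding of \<open>H\<^sup>1\<^sup>+\<^sup>s\<close> into \<open>C\<^sup>1\<close> for \<open>s > 1/2\<close>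
  (\<open>H1_sup_bound\<close>). Its proof represents a weak derivative as the density of an absolutely
  continuous function (\<open>has_weak_deriv_primitive\<close>) and compares the difference quotients at the
  scales \<open>r\<close> and \<open>r/2\<close> by means of the Gagliardo seminorm (\<open>morrey_step\<close>); the resulting
  geometric series converges exactly because \<open>s > 1/2\<close>. In the limit case \<open>s = 1\<close> the derivative is
  itself absolutely continuous.

  \<^bold>\<open>Components consist of isotopic knots.\<close> Let \<open>\<eta>\<close> be \<open>C\<^sup>1\<close>-close to a knot \<open>\<gamma>\<close>. The
  displacement \<open>\<eta> - \<gamma>\<close>, a small vector field along \<open>\<gamma>\<close>, extends to a field \<open>h\<close> on the whole
  space with derivative of norm at most \<open>1/2\<close> (\<open>extension_from_knot\<close>). By the contraction principle
  every \<open>id + t h\<close> with \<open>0 \<le> t \<le> 1\<close> is a diffeomorphism, and \<open>id + h\<close> maps \<open>\<gamma>\<close> to \<open>\<eta>\<close>. So the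
  classes of ambiently isotopic knots are open in the Sobolev topology, and a connected set meets
  only one of them.

  \<^bold>\<open>Isotopic knots lie in one component.\<close> Knots of unit speed are handled through their
  tangents: up to translation, a closed curve of unit speed and length \<open>1\<close> is a continuous
  1-periodic map \<open>T\<close> into the unit sphere with \<open>\<integral> T = 0\<close>. Two such tangents near \<open>T\<close> can be
  interpolated linearly, but the interpolations \<open>w\<close> have neither unit length nor, once normalized,
  mean zero. Subtracting a suitable constant vector \<open>V w\<close>, the geometric median of the curve \<open>w\<close>,
  before the normalization repairs both: \<open>\<integral> sgn (w - V w) = 0\<close> (\<open>balancing\<close>). The median depends
  on \<open>w\<close> in a Lipschitz way, it vanishes if \<open>w\<close> is already the tangent of a closed curve, and
  it leaves the regularity of \<open>w\<close> untouched. Therefore all Sobolev knots with tangents close to the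
  tangent of one fixed \<open>C\<^sup>1\<close> knot belong to the same component (\<open>close_knots_connected\<close>). They exist
  arbitrarily close to the given tangent, because one can balance a difference quotient of the
  \<open>C\<^sup>1\<close> knot in place of an interpolation (\<open>knot_approximation\<close>). Along a \<open>C\<^sup>1\<close> isotopy, with each
  stage rescaled to length \<open>1\<close> and reparametrized by arclength, the tangents vary continuously in
  the uniform norm (\<open>isotopy_unit_speed\<close>). So the component of the Sobolev knots near the stage
  \<open>\<sigma>\<close> is locally constant in \<open>\<sigma>\<close>, and hence the same at both ends. Only tangents are compared,
  so no regularity of the reparametrization beyond \<open>C\<^sup>1\<close> is ever asked for, and the base point can be
  prescribed at will, which settles \<open>knots\<close> and \<open>knots_at\<close> at the same time.
\<close>

section \<open>Primitives of integrable functions\<close>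

text \<open>Absolute continuity of \<open>f\<close> with density \<open>g\<close>, expressed by increments and integrals instead
  of derivatives almost everywhere. This is the form in which a weak derivative comes, and it
  is stable under \<open>C\<^sup>1\<close> maps.\<close>

definition primitive_of :: "(real \<Rightarrow> 'b::euclidean_space) \<Rightarrow> (real \<Rightarrow> 'b) \<Rightarrow> bool" where
  "primitive_of f g \<longleftrightarrow>
     (\<forall>a b. a \<le> b \<longrightarrow> g absolutely_integrable_on {a..b} \<and> (g has_integral (f b - f a)) {a..b})"

lemma primitive_ofI:
  assumes "\<And>a b. a \<le> b \<Longrightarrow> g absolutely_integrable_on {a..b}"
    and "\<And>a b. a \<le> b \<Longrightarrow> integral {a..b} g = f b - f a"
  shows "primitive_of f g"
  using assms unfolding primitive_of_def
  by (metis absolutely_integrable_on_def has_integral_integral)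

lemma primitive_of_absolutely_integrable:
  assumes "primitive_of f g" shows "g absolutely_integrable_on {a..b}"
  using assms by (cases "a \<le> b") (auto simp: primitive_of_def)

lemma primitive_of_has_integral:
  assumes "primitive_of f g" "a \<le> b" shows "(g has_integral (f b - f a)) {a..b}"
  using assms by (auto simp: primitive_of_def)

lemma primitive_of_norm_integrable:
  assumes "primitive_of f g" shows "(\<lambda>x. norm (g x)) integrable_on {a..b}"
  using primitive_of_absolutely_integrable[OF assms] absolutely_integrable_on_def by blast

lemma primitive_of_C1:
  fixes f :: "real \<Rightarrow> 'b::euclidean_space"
  assumes "\<And>x. (f has_vector_derivative f' x) (at x)" and "continuous_on UNIV f'"
  shows "primitive_of f f'"
  unfolding primitive_of_def
proof (intro allI impI conjI)
  fix a b :: real assume "a \<le> b"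
  show "f' absolutely_integrable_on {a..b}"
    by (rule absolutely_integrable_continuous_real) (rule continuous_on_subset[OF assms(2)], simp)
  show "(f' has_integral (f b - f a)) {a..b}"
    by (rule fundamental_theorem_of_calculus[OF \<open>a \<le> b\<close>])
       (use assms(1) has_vector_derivative_at_within in blast)
qed

lemma primitive_of_linear:
  assumes "primitive_of f g" "bounded_linear h"
  shows "primitive_of (\<lambda>x. h (f x)) (\<lambda>x. h (g x))"
  unfolding primitive_of_def
proof (intro allI impI conjI)
  fix a b :: real assume ab: "a \<le> b"
  show "(\<lambda>x. h (g x)) absolutely_integrable_on {a..b}"
    using absolutely_integrable_linear[OF primitive_of_absolutely_integrable[OF assms(1)] assms(2)]
    by (simp add: o_def)
  show "((\<lambda>x. h (g x)) has_integral h (f b) - h (f a)) {a..b}"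
    using has_integral_linear[OF primitive_of_has_integral[OF assms(1) ab] assms(2)]
    by (simp add: o_def linear_diff bounded_linear.linear[OF assms(2)])
qed

lemma primitive_of_add:
  assumes "primitive_of f g" "primitive_of f' g'"
  shows "primitive_of (\<lambda>x. f x + f' x) (\<lambda>x. g x + g' x)"
  unfolding primitive_of_def
proof (intro allI impI conjI)
  fix a b :: real assume ab: "a \<le> b"
  show "(\<lambda>x. g x + g' x) absolutely_integrable_on {a..b}"
    using assms primitive_of_absolutely_integrable by (intro set_integral_add) auto
  show "((\<lambda>x. g x + g' x) has_integral (f b + f' b - (f a + f' a))) {a..b}"
    using has_integral_add[OF primitive_of_has_integral[OF assms(1) ab] primitive_of_has_integral[OF assms(2) ab]]
    by (simp add: algebra_simps)
qed

lemma primitive_of_diff: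
  assumes "primitive_of f g" "primitive_of f' g'"
  shows "primitive_of (\<lambda>x. f x - f' x) (\<lambda>x. g x - g' x)"
  using primitive_of_add[OF assms(1) primitive_of_linear[OF assms(2) bounded_linear_minus[OF bounded_linear_ident]]]
  by simp

lemma primitive_of_Pair:
  assumes "primitive_of f g" "primitive_of f' g'"
  shows "primitive_of (\<lambda>x. (f x, f' x)) (\<lambda>x. (g x, g' x))"
proof -
  have 1: "bounded_linear (\<lambda>u::'a. (u, 0::'b))" and 2: "bounded_linear (\<lambda>u::'b. (0::'a, u))"
    by (intro bounded_linear_Pair bounded_linear_ident bounded_linear_zero)+
  show ?thesis
    using primitive_of_add[OF primitive_of_linear[OF assms(1) 1] primitive_of_linear[OF assms(2) 2]]
    by simp
qed

lemma primitive_of_norm_le: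
  assumes "primitive_of f g" "a \<le> b"
  shows "norm (f b - f a) \<le> integral {a..b} (\<lambda>x. norm (g x))"
  using primitive_of_has_integral[OF assms] primitive_of_norm_integrable[OF assms(1)]
  by (metis has_integral_iff integral_norm_bound_integral order_refl)

lemma primitive_of_continuous:
  assumes "primitive_of f g" shows "continuous_on UNIV f"
proof -
  have "isCont f x" for x
  proof -
    have "continuous_on {x-1..x+1} (\<lambda>u. f (x-1) + integral {x-1..u} g)"
      using primitive_of_has_integral[OF assms, of "x-1" "x+1"]
      by (intro continuous_intros indefinite_integral_continuous_1) auto
    moreover have "f (x-1) + integral {x-1..u} g = f u" if "u \<in> {x-1..x+1}" for u
      using primitive_of_has_integral[OF assms, of "x-1" u] that by (auto simp: integral_unique)
    ultimately have "continuous_on {x-1..x+1} f"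
      using continuous_on_cong by (metis (no_types, lifting))
    then show "isCont f x"
      by (rule continuous_on_interior) (auto simp: interior_atLeastAtMost_real)
  qed
  then show ?thesis by (simp add: continuous_on_eq_continuous_at)
qed

text \<open>On a short interval around \<open>x\<close> the derivative \<open>D (w t)\<close> stays within \<open>\<epsilon>/2\<close> of the linear map
  \<open>A = D (w x)\<close>. Replacing \<open>\<Phi>\<close> by \<open>A\<close> costs at most \<open>\<epsilon>/2 \<integral> \<bar>g\<bar>\<close> in the increment (mean value
  inequality) and as much in the integral, and for \<open>A\<close> itself the chain rule is the linearity of
  the integral.\<close>

lemma chain_rule_local:
  fixes w :: "real \<Rightarrow> 'a::euclidean_space" and \<Phi> :: "'a \<Rightarrow> 'b::euclidean_space"
    and D :: "'a \<Rightarrow> 'a \<Rightarrow>\<^sub>L 'b"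
  assumes w: "primitive_of w g"
    and S: "open S" "\<And>x. w x \<in> S"
    and D: "\<And>p. p \<in> S \<Longrightarrow> (\<Phi> has_derivative D p) (at p)" "continuous_on S D"
    and int: "\<And>a b. (\<lambda>t. D (w t) (g t)) absolutely_integrable_on {a..b}"
    and "\<epsilon> > 0"
  shows "\<exists>d>0. \<forall>a b. a \<le> x \<and> x \<le> b \<and> b - a < d \<longrightarrow>
    norm (\<Phi> (w b) - \<Phi> (w a) - integral {a..b} (\<lambda>t. D (w t) (g t)))
      \<le> \<epsilon> * integral {a..b} (\<lambda>t. norm (g t))"
proof -
  have "isCont D (w x)" using S D(2) continuous_on_eq_continuous_at by blast
  then obtain \<rho>1 where \<rho>1: "\<rho>1 > 0" "\<And>p. dist p (w x) < \<rho>1 \<Longrightarrow> dist (D p) (D (w x)) < \<epsilon>/2"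
    unfolding continuous_at_eps_delta using \<open>\<epsilon> > 0\<close> half_gt_zero by blast
  obtain \<rho>2 where \<rho>2: "\<rho>2 > 0" "ball (w x) \<rho>2 \<subseteq> S" using S open_contains_ball by blast
  define \<rho> where "\<rho> = min \<rho>1 \<rho>2"
  have \<rho>: "\<rho> > 0" "ball (w x) \<rho> \<subseteq> S" using \<rho>1 \<rho>2 by (auto simp: \<rho>_def)
  have near: "norm (D p - D (w x)) \<le> \<epsilon>/2" if "p \<in> ball (w x) \<rho>" for p
    using \<rho>1(2)[of p] that by (auto simp: \<rho>_def dist_norm norm_minus_commute)
  have "isCont w x" using primitive_of_continuous[OF w] by (simp add: continuous_on_eq_continuous_at)
  then obtain d where d: "d > 0" "\<And>y. dist y x < d \<Longrightarrow> dist (w y) (w x) < \<rho>"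
    using \<rho>(1) unfolding continuous_at_eps_delta by blast
  have "norm (\<Phi> (w b) - \<Phi> (w a) - integral {a..b} (\<lambda>t. D (w t) (g t)))
      \<le> \<epsilon> * integral {a..b} (\<lambda>t. norm (g t))" if ab: "a \<le> x" "x \<le> b" "b - a < d" for a b
  proof -
    let ?A = "D (w x)"
    let ?I = "integral {a..b} (\<lambda>t. norm (g t))"
    have inb: "w t \<in> ball (w x) \<rho>" if "t \<in> {a..b}" for t
      using d(2)[of t] that ab by (auto simp: dist_real_def dist_commute)
    have "norm ((\<Phi> (w b) - ?A (w b)) - (\<Phi> (w a) - ?A (w a))) \<le> \<epsilon>/2 * norm (w b - w a)"
    proof (rule differentiable_bound[of "ball (w x) \<rho>" _ "\<lambda>p h. D p h - ?A h"])
      fix p assume p: "p \<in> ball (w x) \<rho>"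
      then have "p \<in> S" using \<rho> by auto
      show "((\<lambda>p. \<Phi> p - ?A p) has_derivative (\<lambda>h. D p h - ?A h)) (at p within ball (w x) \<rho>)"
        by (rule has_derivative_at_withinI) (auto intro!: derivative_eq_intros D(1) \<open>p \<in> S\<close>)
      have "(\<lambda>h. D p h - ?A h) = blinfun_apply (D p - ?A)"
        by (auto simp: blinfun.diff_left)
      then show "onorm (\<lambda>h. D p h - ?A h) \<le> \<epsilon>/2"
        using near[OF p] by (simp add: norm_blinfun.rep_eq)
    qed (use inb ab in auto)
    also have "\<dots> \<le> \<epsilon>/2 * ?I"
      using primitive_of_norm_le[OF w, of a b] ab \<open>\<epsilon>>0\<close> by (intro mult_left_mono) auto
    finally have 1: "norm ((\<Phi> (w b) - \<Phi> (w a)) - ?A (w b - w a)) \<le> \<epsilon>/2 * ?I"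
      by (simp add: blinfun.diff_right algebra_simps)
    have gi: "(g has_integral (w b - w a)) {a..b}" using primitive_of_has_integral[OF w] ab by auto
    have Ai: "((\<lambda>t. ?A (g t)) has_integral ?A (w b - w a)) {a..b}"
      using has_integral_linear[OF gi blinfun.bounded_linear_right] by (simp add: o_def)
    have Di: "((\<lambda>t. D (w t) (g t)) has_integral integral {a..b} (\<lambda>t. D (w t) (g t))) {a..b}"
      using int[of a b] absolutely_integrable_on_def integrable_integral by blast
    have ni: "((\<lambda>t. \<epsilon>/2 * norm (g t)) has_integral \<epsilon>/2 * ?I) {a..b}"
      using has_integral_mult_right[OF integrable_integral[OF primitive_of_norm_integrable[OF w, of a b]], of "\<epsilon>/2"] .
    have "norm (integral {a..b} (\<lambda>t. D (w t) (g t) - ?A (g t))) \<le> integral {a..b} (\<lambda>t. \<epsilon>/2 * norm (g t))"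
    proof (rule integral_norm_bound_integral)
      show "(\<lambda>t. D (w t) (g t) - ?A (g t)) integrable_on {a..b}"
        using has_integral_diff[OF Di Ai] by blast
      show "(\<lambda>t. \<epsilon>/2 * norm (g t)) integrable_on {a..b}" using ni by blast
      fix t assume t: "t \<in> {a..b}"
      have "norm (D (w t) (g t) - ?A (g t)) \<le> norm (D (w t) - ?A) * norm (g t)"
        by (metis blinfun.diff_left norm_blinfun)
      also have "\<dots> \<le> \<epsilon>/2 * norm (g t)" by (intro mult_right_mono near inb t) auto
      finally show "norm (D (w t) (g t) - ?A (g t)) \<le> \<epsilon>/2 * norm (g t)" .
    qed
    then have 2: "norm (integral {a..b} (\<lambda>t. D (w t) (g t)) - ?A (w b - w a)) \<le> \<epsilon>/2 * ?I"
      by (simp only: integral_unique[OF has_integral_diff[OF Di Ai]] integral_unique[OF ni])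
    show ?thesis
      using norm_triangle_le_diff[of "\<Phi> (w b) - \<Phi> (w a) - ?A (w b - w a)"
        "integral {a..b} (\<lambda>t. D (w t) (g t)) - ?A (w b - w a)" "\<epsilon> * ?I"] 1 2
      by (simp add: field_simps)
  qed
  then show ?thesis using d(1) by blast
qed

text \<open>In coordinates \<open>A t (g t)\<close> is a finite sum of products of a continuous function with an
  integrable one.\<close>

lemma absolutely_integrable_blinfun_apply:
  fixes A :: "real \<Rightarrow> 'a::euclidean_space \<Rightarrow>\<^sub>L 'b::euclidean_space"
  assumes "continuous_on {a..b} A" "g absolutely_integrable_on {a..b}"
  shows "(\<lambda>t. A t (g t)) absolutely_integrable_on {a..b}"
proof -
  have "(\<lambda>t. \<Sum>i\<in>Basis. (g t \<bullet> i) *\<^sub>R A t i) absolutely_integrable_on {a..b}"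
  proof (rule absolutely_integrable_sum)
    fix i :: 'a
    have c: "continuous_on {a..b} (\<lambda>t. A t i)" by (intro continuous_intros assms(1))
    have "(\<lambda>t. (\<lambda>v r. r *\<^sub>R v) (A t i) (g t \<bullet> i)) absolutely_integrable_on {a..b}"
    proof (rule absolutely_integrable_bounded_measurable_product[where h="\<lambda>(v::'b) r::real. r *\<^sub>R v"])
      show "bilinear (\<lambda>(v::'b) r::real. r *\<^sub>R v)"
        by (auto simp: bilinear_def linear_iff algebra_simps)
      show "(\<lambda>t. A t i) \<in> borel_measurable (lebesgue_on {a..b})"
        by (rule continuous_imp_measurable_on_sets_lebesgue[OF c]) auto
      show "bounded ((\<lambda>t. A t i) ` {a..b})"
        using compact_continuous_image[OF c compact_Icc] compact_imp_bounded by blast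
      show "(\<lambda>t. g t \<bullet> i) absolutely_integrable_on {a..b}"
        using absolutely_integrable_linear[OF assms(2) bounded_linear_inner_left[of i]] by (simp add: o_def)
    qed auto
    then show "(\<lambda>t. (g t \<bullet> i) *\<^sub>R A t i) absolutely_integrable_on {a..b}" by simp
  qed auto
  moreover have "(\<Sum>i\<in>Basis. (g t \<bullet> i) *\<^sub>R A t i) = A t (g t)" for t
    by (simp add: blinfun.sum_right[symmetric] blinfun.scaleR_right[symmetric] euclidean_representation)
  ultimately show ?thesis by simp
qed

text \<open>The error bound of \<open>chain_rule_local\<close> is additive over adjacent intervals, so bisection
  carries it from short intervals to all of them; then \<open>\<epsilon>\<close> tends to \<open>0\<close>.\<close>

lemma primitive_of_compose:
  fixes w :: "real \<Rightarrow> 'a::euclidean_space" and \<Phi> :: "'a \<Rightarrow> 'b::euclidean_space"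
    and D :: "'a \<Rightarrow> 'a \<Rightarrow>\<^sub>L 'b"
  assumes w: "primitive_of w g"
    and S: "open S" "\<And>x. w x \<in> S"
    and D: "\<And>p. p \<in> S \<Longrightarrow> (\<Phi> has_derivative D p) (at p)" "continuous_on S D"
  shows "primitive_of (\<lambda>x. \<Phi> (w x)) (\<lambda>t. D (w t) (g t))"
proof (rule primitive_ofI)
  have contD: "continuous_on X (\<lambda>t. D (w t))" for X
    by (rule continuous_on_compose2[OF D(2) continuous_on_subset[OF primitive_of_continuous[OF w]]])
       (use S in auto)
  show int: "(\<lambda>t. D (w t) (g t)) absolutely_integrable_on {a..b}" for a b
    by (intro absolutely_integrable_blinfun_apply contD primitive_of_absolutely_integrable[OF w])
  have int': "(\<lambda>t. D (w t) (g t)) integrable_on {a..b}" for a b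
    using int absolutely_integrable_on_def by blast
  show "integral {a..b} (\<lambda>t. D (w t) (g t)) = \<Phi> (w b) - \<Phi> (w a)" if ab: "a \<le> b" for a b
  proof -
    define H where "H a b = norm (\<Phi> (w b) - \<Phi> (w a) - integral {a..b} (\<lambda>t. D (w t) (g t)))" for a b
    have "H a b \<le> \<epsilon> * integral {a..b} (\<lambda>t. norm (g t))" if "\<epsilon> > 0" for \<epsilon>
      using ab
    proof (induction rule: Bolzano)
      case (trans a b c)
      have "integral {a..b} (\<lambda>t. norm (g t)) + integral {b..c} (\<lambda>t. norm (g t))
          = integral {a..c} (\<lambda>t. norm (g t))"
        by (intro Henstock_Kurzweil_Integration.integral_combine trans primitive_of_norm_integrable[OF w])
      moreover have "integral {a..b} (\<lambda>t. D (w t) (g t)) + integral {b..c} (\<lambda>t. D (w t) (g t))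
          = integral {a..c} (\<lambda>t. D (w t) (g t))"
        by (intro Henstock_Kurzweil_Integration.integral_combine trans int')
      moreover have "H a c \<le> H a b + H b c"
        unfolding H_def calculation(2)[symmetric]
        by (rule order_trans[OF _ norm_triangle_ineq]) (simp add: algebra_simps)
      moreover have "\<epsilon> * integral {a..c} (\<lambda>t. norm (g t))
          = \<epsilon> * integral {a..b} (\<lambda>t. norm (g t)) + \<epsilon> * integral {b..c} (\<lambda>t. norm (g t))"
        unfolding calculation(1)[symmetric] by (simp add: algebra_simps)
      ultimately show ?case using trans by linarith
    next
      case (local x)
      then show ?case unfolding H_def
        using chain_rule_local[OF w S D int \<open>\<epsilon> > 0\<close>] by blast
    qed
    then have le: "H a b \<le> \<epsilon> * integral {a..b} (\<lambda>t. norm (g t))" if "\<epsilon> > 0" for \<epsilon> using that by blast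
    have "H a b \<le> 0"
    proof (rule field_le_epsilon)
      fix e :: real assume "e > 0"
      let ?I = "integral {a..b} (\<lambda>t. norm (g t))"
      have "?I \<ge> 0" by (intro integral_nonneg primitive_of_norm_integrable[OF w]) auto
      then have "e/(?I+1) > 0" "e/(?I+1) * ?I \<le> e" using \<open>e > 0\<close> by (auto simp: field_simps)
      then show "H a b \<le> 0 + e" using le[of "e/(?I+1)"] by simp
    qed
    then show ?thesis by (simp add: H_def)
  qed
qed

section \<open>Uniqueness and existence of primitives\<close>

lemma primitive_of_unique_const:
  assumes "primitive_of f (\<lambda>_. 0)" shows "f x = f y"
proof -
  have "f b = f a" if "a \<le> b" for a b
    using has_integral_unique[OF primitive_of_has_integral[OF assms that] has_integral_0] by simp
  then show ?thesis by (metis linear)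
qed

lemma borel_absolutely_integrable_iff:
  fixes f :: "real \<Rightarrow> 'b::euclidean_space"
  assumes "f \<in> borel_measurable borel" "S \<in> sets borel"
  shows "f absolutely_integrable_on S \<longleftrightarrow> set_integrable lborel S f"
proof -
  have "(\<lambda>x. indicator S x *\<^sub>R f x) \<in> borel_measurable lborel" using assms by measurable
  then show ?thesis unfolding set_integrable_def using integrable_completion by blast
qed

text \<open>On a bounded window the positive and the negative part of \<open>h\<close> are densities of two
  finite measures that agree on all half-lines. Such measures are equal, and then so are their
  densities almost everywhere.\<close>

lemma ae_zero_of_integrals_zero_real:
  fixes h :: "real \<Rightarrow> real"
  assumes [measurable]: "h \<in> borel_measurable borel"
    and int: "\<And>a b. set_integrable lborel {a..b} h"
    and zero: "\<And>a b. (LINT x:{a..b}|lborel. h x) = 0"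
  shows "AE x in lborel. h x = 0"
proof -
  have AEn: "AE x in lborel. x \<in> {- real n..real n} \<longrightarrow> h x = 0" for n :: nat
  proof -
    let ?I = "{- real n..real n}"
    \<comment> \<open>The coercion to \<open>ennreal\<close> truncates at \<open>0\<close>, so these are the two parts of \<open>h\<close>.\<close>
    let ?p = "\<lambda>x. ennreal (indicator ?I x * h x)" and ?m = "\<lambda>x. ennreal (indicator ?I x * - h x)"
    have eq: "(\<integral>\<^sup>+x. ?p x * indicator {c<..} x \<partial>lborel) = (\<integral>\<^sup>+x. ?m x * indicator {c<..} x \<partial>lborel)
        \<and> (\<integral>\<^sup>+x. ?p x * indicator {c<..} x \<partial>lborel) < \<infinity>" for c :: real
    proof -
      let ?S = "{max c (-real n)..real n}"
      have *: "(\<integral>\<^sup>+x. ennreal (indicator ?I x * k x) * indicator {c<..} x \<partial>lborel)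
        = (\<integral>\<^sup>+x. ennreal (indicator ?S x * k x) \<partial>lborel)" for k :: "real \<Rightarrow> real"
        by (rule nn_integral_cong_AE, rule AE_mp[OF AE_lborel_singleton[of c]])
           (auto split: split_indicator)
      have i: "integrable lborel (\<lambda>x. indicator ?S x * h x)"
        using int[of "max c (-real n)" "real n"] by (simp add: set_integrable_def)
      have z: "(LINT x|lborel. indicator ?S x * h x) = 0"
        using zero[of "max c (-real n)" "real n"] by (simp add: set_lebesgue_integral_def)
      have fin: "(\<integral>\<^sup>+x. ennreal (indicator ?S x * h x) \<partial>lborel) < \<infinity>"
        "(\<integral>\<^sup>+x. ennreal (- (indicator ?S x * h x)) \<partial>lborel) < \<infinity>"
        using i by (auto simp: real_integrable_def less_top)
      have "enn2real (\<integral>\<^sup>+x. ennreal (indicator ?S x * h x) \<partial>lborel)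
         = enn2real (\<integral>\<^sup>+x. ennreal (- (indicator ?S x * h x)) \<partial>lborel)"
        using real_lebesgue_integral_def[OF i] z by simp
      then have "ennreal (enn2real (\<integral>\<^sup>+x. ennreal (indicator ?S x * h x) \<partial>lborel))
         = ennreal (enn2real (\<integral>\<^sup>+x. ennreal (- (indicator ?S x * h x)) \<partial>lborel))" by (rule arg_cong)
      then have "(\<integral>\<^sup>+x. ennreal (indicator ?S x * h x) \<partial>lborel) = (\<integral>\<^sup>+x. ennreal (indicator ?S x * - h x) \<partial>lborel)"
        using fin by (simp only: ennreal_enn2real infinity_ennreal_def mult_minus_right)
      then show ?thesis unfolding * using fin by (simp only: simp_thms)
    qed
    have "density lborel ?p = density lborel ?m"
    proof (rule measure_eqI_lessThan)
      show "emeasure (density lborel ?p) {x<..} < \<infinity>" for x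
        using eq[of x] by (subst emeasure_density) auto
      show "emeasure (density lborel ?p) {x<..} = emeasure (density lborel ?m) {x<..}" for x
        using eq[of x, THEN conjunct1] by (subst (1 2) emeasure_density) simp_all
    qed auto
    then have "AE x in lborel. ?p x = ?m x"
      by (intro sigma_finite_measure.density_unique[OF sigma_finite_lborel]) auto
    then show ?thesis
    proof eventually_elim
      case (elim x)
      show ?case
      proof
        assume "x \<in> ?I"
        then have "ennreal (h x) = ennreal (- h x)" using elim by simp
        then show "h x = 0"
          by (cases "h x" "0::real" rule: linorder_cases) (auto simp: ennreal_neg ennreal_eq_0_iff)
      qed
    qed
  qed
  then have "AE x in lborel. \<forall>n::nat. x \<in> {- real n..real n} \<longrightarrow> h x = 0"
    by (subst AE_all_countable) blast
  then show ?thesis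
  proof eventually_elim
    case (elim x)
    obtain n :: nat where "\<bar>x\<bar> \<le> real n" using real_arch_simple by blast
    then show ?case using elim[rule_format, of n] by (simp add: abs_le_iff)
  qed
qed

lemma primitive_of_unique_AE:
  fixes g g' :: "real \<Rightarrow> 'b::euclidean_space"
  assumes "primitive_of f g" "primitive_of f g'"
    and [measurable]: "g \<in> borel_measurable borel" "g' \<in> borel_measurable borel"
  shows "AE x in lborel. g x = g' x"
proof -
  have "AE x in lborel. (g x - g' x) \<bullet> i = 0" if "i \<in> Basis" for i
  proof (rule ae_zero_of_integrals_zero_real)
    have p: "primitive_of (\<lambda>x. (f x - f x) \<bullet> i) (\<lambda>x. (g x - g' x) \<bullet> i)"
      by (rule primitive_of_linear[OF primitive_of_diff[OF assms(1,2)]]) (rule bounded_linear_inner_left)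
    show m: "(\<lambda>x. (g x - g' x) \<bullet> i) \<in> borel_measurable borel" by measurable
    show si: "set_integrable lborel {a..b} (\<lambda>x. (g x - g' x) \<bullet> i)" for a b
      using primitive_of_absolutely_integrable[OF p] borel_absolutely_integrable_iff[OF m] by auto
    show "(LINT x:{a..b}|lborel. (g x - g' x) \<bullet> i) = 0" for a b
      using set_borel_integral_eq_integral(2)[OF si[of a b]] primitive_of_has_integral[OF p, of a b]
      by (cases "a \<le> b") (auto simp: integral_unique)
  qed
  then have "AE x in lborel. \<forall>i\<in>Basis. (g x - g' x) \<bullet> i = 0"
    by (subst AE_finite_all) auto
  then show ?thesis
    by eventually_elim (metis (no_types, lifting) euclidean_eqI inner_diff_left right_minus_eq)
qed

lemma primitive_exists:
  fixes g :: "real \<Rightarrow> 'b::euclidean_space"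
  assumes "\<And>a b. g absolutely_integrable_on {a..b}"
  shows "\<exists>G. primitive_of G g \<and> G 0 = 0"
proof -
  have int: "g integrable_on {a..b}" for a b using assms absolutely_integrable_on_def by blast
  define G where "G x = (if x \<ge> 0 then integral {0..x} g else - integral {x..0} g)" for x
  have "integral {a..b} g = G b - G a" if "a \<le> b" for a b
  proof -
    consider "0 \<le> a" | "a < 0" "0 \<le> b" | "b < 0" by linarith
    then show ?thesis
    proof cases
      case 1
      then show ?thesis
        using Henstock_Kurzweil_Integration.integral_combine[of 0 a b g] that int by (auto simp: G_def algebra_simps)
    next
      case 2
      then show ?thesis
        using Henstock_Kurzweil_Integration.integral_combine[of a 0 b g] that int by (auto simp: G_def algebra_simps)
    next
      case 3
      then show ?thesis
        using Henstock_Kurzweil_Integration.integral_combine[of a b 0 g] that int by (auto simp: G_def algebra_simps)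
    qed
  qed
  then have "primitive_of G g" using assms by (intro primitive_ofI) auto
  then show ?thesis by (auto simp: G_def)
qed

lemma primitive_of_shift:
  assumes "primitive_of f g" shows "primitive_of (\<lambda>x. f (x + c)) (\<lambda>x. g (x + c))"
proof -
  have gi: "((\<lambda>x. g (x + c)) has_integral f (b + c) - f (a + c)) {a..b}" if "a \<le> b" for a b
    using has_integral_shift_real_ivl[OF primitive_of_has_integral[OF assms, of "a+c" "b+c"], of c] that by simp
  moreover have "(\<lambda>x. norm (g (x + c))) integrable_on {a..b}" for a b
  proof -
    have "(\<lambda>x. norm (g x)) integrable_on {a + c..b + c}" by (rule primitive_of_norm_integrable[OF assms])
    from has_integral_shift_real_ivl[OF integrable_integral[OF this], of c]
    show ?thesis by (auto simp: integrable_on_def)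
  qed
  ultimately show ?thesis
    unfolding primitive_of_def absolutely_integrable_on_def by blast
qed

lemma primitive_of_periodic:
  assumes "primitive_of f g" "\<And>x. g (x + 1) = g x" "f 1 = f 0"
  shows "f (x + 1) = f x"
proof -
  have "primitive_of (\<lambda>x. f (x + 1) - f x) (\<lambda>x. 0)"
    using primitive_of_diff[OF primitive_of_shift[OF assms(1), of 1] assms(1)] assms(2) by simp
  from primitive_of_unique_const[OF this, of x 0] assms(3) show ?thesis by simp
qed

lemma integral_period:
  fixes f :: "real \<Rightarrow> 'b::euclidean_space"
  assumes "\<And>a b. f absolutely_integrable_on {a..b}" "\<And>x. f (x + 1) = f x"
  shows "integral {a..a+1} f = integral {0..1} f"
proof -
  obtain F where F: "primitive_of F f" using primitive_exists[OF assms(1)] by blast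
  have "primitive_of (\<lambda>x. F (x + 1) - F x) (\<lambda>x. 0)"
    using primitive_of_diff[OF primitive_of_shift[OF F, of 1] F] assms(2) by simp
  from primitive_of_unique_const[OF this, of a 0]
  show ?thesis using primitive_of_has_integral[OF F, of a "a+1"] primitive_of_has_integral[OF F, of 0 1]
    by (simp add: integral_unique)
qed

section \<open>Trigonometric polynomials as test functions\<close>

text \<open>Trigonometric polynomials are test functions, they form an algebra, and up to their
  mean they are derivatives of each other. They take the place of mollifiers: the powers of
  \<open>(1 + cos (2 * pi * (x - c))) / 2\<close> concentrate at \<open>c\<close>.\<close>

inductive trig_poly :: "(real \<Rightarrow> real) \<Rightarrow> bool" where
  const: "trig_poly (\<lambda>_. c)"
| cos: "trig_poly (\<lambda>x. c * cos (2 * pi * of_int m * x))"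
| sin: "trig_poly (\<lambda>x. c * sin (2 * pi * of_int m * x))"
| add: "trig_poly f \<Longrightarrow> trig_poly g \<Longrightarrow> trig_poly (\<lambda>x. f x + g x)"

lemma trig_poly_scale: "trig_poly f \<Longrightarrow> trig_poly (\<lambda>x. c * f x)"
proof (induction rule: trig_poly.induct)
  case (const d) then show ?case using trig_poly.const[of "c*d"] by simp
next
  case (cos d m) then show ?case using trig_poly.cos[of "c*d" m] by (simp add: mult.assoc)
next
  case (sin d m) then show ?case using trig_poly.sin[of "c*d" m] by (simp add: mult.assoc)
next
  case (add f g) then show ?case using trig_poly.add by (simp add: distrib_left)
qed

lemma trig_poly_mult: "trig_poly f \<Longrightarrow> trig_poly g \<Longrightarrow> trig_poly (\<lambda>x. f x * g x)"
proof (induction f rule: trig_poly.induct)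
  case (const c)
  then show ?case by (rule trig_poly_scale)
next
  case (cos c m)
  from \<open>trig_poly g\<close> show ?case
  proof (induction g rule: trig_poly.induct)
    case (const d)
    then show ?case using trig_poly_scale[OF trig_poly.cos[of c m], of d] by (simp add: mult.commute)
  next
    case (cos d k)
    have "(\<lambda>x. c * cos (2 * pi * of_int m * x) * (d * cos (2 * pi * of_int k * x)))
      = (\<lambda>x. (c*d/2) * cos (2 * pi * of_int (m - k) * x) + (c*d/2) * cos (2 * pi * of_int (m + k) * x))"
      by (auto simp: algebra_simps cos_diff cos_add)
    then show ?case by (simp only: trig_poly.intros)
  next
    case (sin d k)
    have "(\<lambda>x. c * cos (2 * pi * of_int m * x) * (d * sin (2 * pi * of_int k * x)))
      = (\<lambda>x. (c*d/2) * sin (2 * pi * of_int (k + m) * x) + (c*d/2) * sin (2 * pi * of_int (k - m) * x))"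
      by (auto simp: algebra_simps sin_diff sin_add)
    then show ?case by (simp only: trig_poly.intros)
  next
    case (add f g)
    then show ?case using trig_poly.add by (simp add: distrib_left)
  qed
next
  case (sin c m)
  from \<open>trig_poly g\<close> show ?case
  proof (induction g rule: trig_poly.induct)
    case (const d)
    then show ?case using trig_poly_scale[OF trig_poly.sin[of c m], of d] by (simp add: mult.commute)
  next
    case (cos d k)
    have "(\<lambda>x. c * sin (2 * pi * of_int m * x) * (d * cos (2 * pi * of_int k * x)))
      = (\<lambda>x. (c*d/2) * sin (2 * pi * of_int (m + k) * x) + (c*d/2) * sin (2 * pi * of_int (m - k) * x))"
      by (auto simp: algebra_simps sin_diff sin_add)
    then show ?case by (simp only: trig_poly.intros)
  next
    case (sin d k)
    have "(\<lambda>x. c * sin (2 * pi * of_int m * x) * (d * sin (2 * pi * of_int k * x)))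
      = (\<lambda>x. (c*d/2) * cos (2 * pi * of_int (m - k) * x) + (-(c*d)/2) * cos (2 * pi * of_int (m + k) * x))"
      by (auto simp: algebra_simps cos_diff cos_add)
    then show ?case by (simp only: trig_poly.intros)
  next
    case (add f g)
    then show ?case using trig_poly.add by (simp add: distrib_left)
  qed
next
  case (add f g)
  then show ?case using trig_poly.add by (simp add: distrib_right)
qed

lemma trig_poly_power: "trig_poly f \<Longrightarrow> trig_poly (\<lambda>x. f x ^ k)"
  by (induction k) (auto intro: trig_poly.const[of 1, simplified] trig_poly_mult)

lemma trig_poly_deriv:
  "trig_poly f \<Longrightarrow> \<exists>f'. trig_poly f' \<and> (\<forall>x. (f has_real_derivative f' x) (at x))"
proof (induction rule: trig_poly.induct)
  case (const c) then show ?case by (intro exI[of _ "\<lambda>_. 0"]) (auto intro: trig_poly.const)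
next
  case (cos c m) then show ?case
    by (intro exI[of _ "\<lambda>x. (- (c * (2 * pi * of_int m))) * sin (2 * pi * of_int m * x)"] conjI trig_poly.sin)
       (auto intro!: derivative_eq_intros)
next
  case (sin c m) then show ?case
    by (intro exI[of _ "\<lambda>x. (c * (2 * pi * of_int m)) * cos (2 * pi * of_int m * x)"] conjI trig_poly.cos)
       (auto intro!: derivative_eq_intros)
next
  case (add f g)
  then obtain f' g' where "trig_poly f'" "trig_poly g'" "\<forall>x. (f has_real_derivative f' x) (at x)"
    "\<forall>x. (g has_real_derivative g' x) (at x)" by blast
  then show ?case
    by (intro exI[of _ "\<lambda>x. f' x + g' x"]) (auto intro: trig_poly.add DERIV_add)
qed

text \<open>The constant \<open>c\<close> is the mean of \<open>f\<close>; only a mean-free function has a periodic primitive.\<close>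

lemma trig_poly_primitive:
  "trig_poly f \<Longrightarrow> \<exists>F c. trig_poly F \<and> (\<forall>x. (F has_real_derivative f x - c) (at x))"
proof (induction rule: trig_poly.induct)
  case (const c) show ?case
    by (intro exI[of _ "\<lambda>_. 0"] exI[of _ c]) (auto intro: trig_poly.const)
next
  case (cos c m)
  show ?case
  proof (cases "m = 0")
    case True then show ?thesis by (intro exI[of _ "\<lambda>_. 0"] exI[of _ c]) (auto intro: trig_poly.const)
  next
    case False
    then show ?thesis
      by (intro exI[of _ "\<lambda>x. c / (2 * pi * of_int m) * sin (2 * pi * of_int m * x)"] exI[of _ 0] conjI trig_poly.sin)
        (auto intro!: derivative_eq_intros)
  qed
next
  case (sin c m)
  show ?case
  proof (cases "m = 0")
    case True then show ?thesis by (intro exI[of _ "\<lambda>_. 0"] exI[of _ 0]) (auto intro: trig_poly.const)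
  next
    case False
    then show ?thesis
      by (intro exI[of _ "\<lambda>x. (- c / (2 * pi * of_int m)) * cos (2 * pi * of_int m * x)"] exI[of _ 0] conjI trig_poly.cos)
        (auto intro!: derivative_eq_intros)
  qed
next
  case (add f g)
  then obtain F c G d where "trig_poly F" "trig_poly G" "\<forall>x. (F has_real_derivative f x - c) (at x)"
    "\<forall>x. (G has_real_derivative g x - d) (at x)" by blast
  then show ?case
    by (intro exI[of _ "\<lambda>x. F x + G x"] exI[of _ "c + d"]) (auto intro!: trig_poly.add derivative_eq_intros)
qed

lemma trig_poly_periodic: "trig_poly f \<Longrightarrow> f (x + 1) = f x"
proof (induction rule: trig_poly.induct)
  case (cos c m)
  have "cos (2 * pi * of_int m * x + of_int m * (2 * pi)) = cos (2 * pi * of_int m * x)"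
    using cos.plus_of_int[of "2 * pi * of_int m * x" m] unfolding of_real_eq_id id_apply .
  moreover have "2 * pi * of_int m * (x + 1) = 2 * pi * of_int m * x + of_int m * (2 * pi)" by (simp add: algebra_simps)
  ultimately show ?case by simp
next
  case (sin c m)
  have "sin (2 * pi * of_int m * x + of_int m * (2 * pi)) = sin (2 * pi * of_int m * x)"
    using sin.plus_of_int[of "2 * pi * of_int m * x" m] unfolding of_real_eq_id id_apply .
  moreover have "2 * pi * of_int m * (x + 1) = 2 * pi * of_int m * x + of_int m * (2 * pi)" by (simp add: algebra_simps)
  ultimately show ?case by simp
qed auto

lemma trig_poly_continuous: "trig_poly f \<Longrightarrow> continuous_on S f"
  by (induction rule: trig_poly.induct) (auto intro!: continuous_intros)

lemma trig_poly_test_function: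
  assumes "trig_poly f" shows "test_function f"
proof -
  have "trig_poly ((deriv ^^ k) f)" for k
  proof (induction k)
    case (Suc k)
    then obtain f' where "trig_poly f'" "\<forall>x. ((deriv ^^ k) f has_real_derivative f' x) (at x)"
      using trig_poly_deriv by blast
    moreover from this have "deriv ((deriv ^^ k) f) = f'" by (auto intro: DERIV_imp_deriv)
    ultimately show ?case by simp
  qed (use assms in simp)
  then have "(deriv ^^ k) f differentiable_on UNIV" for k
    using trig_poly_deriv unfolding differentiable_on_def
    by (meson real_differentiable_def differentiable_at_withinI)
  then show ?thesis using trig_poly_periodic[OF assms]
    by (auto simp: test_function_def periodic_fun_simple'_def)
qed

lemma trig_poly_peak: "trig_poly (\<lambda>x. ((1 + cos (2 * pi * (x - c))) / 2) ^ k)"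
proof -
  have "(\<lambda>x. (1 + cos (2 * pi * (x - c))) / 2)
    = (\<lambda>x. 1/2 + ((cos (2*pi*c)/2) * cos (2 * pi * of_int 1 * x) + (sin (2*pi*c)/2) * sin (2 * pi * of_int 1 * x)))"
    by (auto simp: algebra_simps cos_diff add_divide_distrib)
  then have "trig_poly (\<lambda>x. (1 + cos (2 * pi * (x - c))) / 2)"
    by (simp only: trig_poly.intros)
  then show ?thesis by (rule trig_poly_power)
qed


text \<open>Test against the powers \<open>p ^ k\<close> of the raised cosine peaking at \<open>c\<close>. If \<open>u \<ge> e > 0\<close> held for
  \<open>\<bar>x - c\<bar> \<le> d\<close>, the points with \<open>\<bar>x - c\<bar> \<le> d/2\<close> would contribute at least \<open>e * d * p (c + d/2) ^ k\<close>
  to the integral, and the points outside the larger interval could cancel at most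
  \<open>B * p (c + d) ^ k\<close>, which is exponentially smaller.\<close>

lemma no_positive_value_of_trig_orthogonal:
  fixes u :: "real \<Rightarrow> real"
  assumes cont: "continuous_on UNIV u" and per: "\<And>x. u (x + 1) = u x"
    and orth: "\<And>\<psi>. trig_poly \<psi> \<Longrightarrow> integral {0..1} (\<lambda>x. \<psi> x * u x) = 0"
  shows "u c \<le> 0"
proof (rule ccontr)
  assume "\<not> u c \<le> 0"
  define e where "e = u c / 2"
  have "e > 0" using \<open>\<not> u c \<le> 0\<close> by (simp add: e_def)
  have "isCont u c" using cont by (simp add: continuous_on_eq_continuous_at)
  then obtain d0 where d0: "d0 > 0" "\<And>x. dist x c < d0 \<Longrightarrow> dist (u x) (u c) < e"
    using \<open>e > 0\<close> unfolding continuous_at_eps_delta by blast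
  define d where "d = min (d0/2) (1/4)"
  have d: "0 < d" "d \<le> 1/4" "d < d0" using d0(1) by (auto simp: d_def)
  have near: "u x \<ge> e" if "\<bar>x - c\<bar> \<le> d" for x
  proof -
    have "dist (u x) (u c) < e" using that d by (intro d0(2)) (auto simp: dist_real_def)
    then show ?thesis unfolding e_def dist_real_def by linarith
  qed
  let ?I = "{c - 1/2..c + 1/2}"
  have "compact (u ` ?I)"
    by (rule compact_continuous_image[OF continuous_on_subset[OF cont]]) auto
  then obtain B where B: "B > 0" "\<And>x. x \<in> ?I \<Longrightarrow> \<bar>u x\<bar> \<le> B"
    using compact_imp_bounded bounded_pos by (metis image_eqI real_norm_def)
  define p where "p x = (1 + cos (2 * pi * (x - c))) / 2" for x
  have p_abs: "p x = (1 + cos (2 * pi * \<bar>x - c\<bar>)) / 2" for x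
  proof -
    have "2 * pi * \<bar>x - c\<bar> = \<bar>2 * pi * (x - c)\<bar>" by (simp add: abs_mult)
    then show ?thesis by (simp only: p_def cos_abs_real)
  qed
  have "0 \<le> (1 + cos y) / 2" for y :: real using cos_ge_minus_one[of y] by (simp add: real_0_le_add_iff)
  then have p0: "p x \<ge> 0" for x unfolding p_def .
  have mono: "p x \<ge> p y" if "\<bar>x - c\<bar> \<le> \<bar>y - c\<bar>" "\<bar>y - c\<bar> \<le> 1/2" for x y
    unfolding p_abs using that by (intro divide_right_mono add_left_mono cos_monotone_0_pi_le mult_left_mono) auto
  have strict: "p (c + d) < p (c + d/2)"
    unfolding p_def using d by (intro divide_strict_right_mono add_strict_left_mono cos_monotone_0_pi) auto
  have key: "e * d * p (c + d/2) ^ k \<le> B * p (c + d) ^ k" for k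
  proof -
    let ?h = "\<lambda>x. p x ^ k * u x + B * p (c + d) ^ k"
    have trig: "trig_poly (\<lambda>x. p x ^ k)" unfolding p_def by (rule trig_poly_peak)
    have conth: "continuous_on S ?h" for S
      by (intro continuous_intros trig_poly_continuous[OF trig] continuous_on_subset[OF cont]) auto
    have h_nonneg: "?h x \<ge> 0" if "x \<in> ?I" for x
    proof (cases "\<bar>x - c\<bar> \<le> d")
      case True
      then show ?thesis using near[OF True] \<open>e > 0\<close> p0 B(1) by (auto intro!: add_nonneg_nonneg mult_nonneg_nonneg)
    next
      case False
      have "\<bar>p x ^ k * u x\<bar> \<le> p (c + d) ^ k * B"
        unfolding abs_mult power_abs using p0[of x] False that d
        by (intro mult_mono power_mono B(2)) (auto intro!: mono p0 zero_le_power simp: abs_if split: if_splits)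
      then show ?thesis by (simp add: mult.commute abs_le_iff)
    qed
    let ?J = "{c - d/2..c + d/2}"
    have "e * d * p (c + d/2) ^ k = integral ?J (\<lambda>x. e * p (c + d/2) ^ k)"
      using d by simp
    also have "\<dots> \<le> integral ?J ?h"
    proof (rule integral_le)
      show "?h integrable_on ?J" by (rule integrable_continuous_real[OF conth])
      fix x assume x: "x \<in> ?J"
      then have "\<bar>x - c\<bar> \<le> d" using d by (auto simp: abs_le_iff)
      then have "e \<le> u x" by (rule near)
      moreover have "p (c + d/2) ^ k \<le> p x ^ k"
        using x d by (intro power_mono mono p0) (auto simp: abs_if split: if_splits)
      ultimately have "e * p (c + d/2) ^ k \<le> u x * p x ^ k"
        using \<open>e > 0\<close> by (intro mult_mono zero_le_power p0) auto
      then show "e * p (c + d/2) ^ k \<le> ?h x" using B(1) p0[of "c+d"] by (simp add: mult.commute add_increasing2)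
    qed auto
    also have "\<dots> \<le> integral ?I ?h"
      by (rule integral_subset_le) (use d h_nonneg in \<open>auto intro!: integrable_continuous_real[OF conth]\<close>)
    also have "\<dots> = integral {c - 1/2..c - 1/2 + 1} (\<lambda>x. p x ^ k * u x) + B * p (c + d) ^ k"
    proof -
      have i: "(\<lambda>x. p x ^ k * u x) integrable_on ?I"
        by (intro integrable_continuous_real continuous_intros trig_poly_continuous[OF trig] continuous_on_subset[OF cont]) auto
      show ?thesis using integral_add[OF i integrable_const_ivl[of "B * p (c + d) ^ k"]] by (simp add: algebra_simps)
    qed
    also have "integral {c - 1/2..c - 1/2 + 1} (\<lambda>x. p x ^ k * u x) = 0"
    proof (subst integral_period)
      show "(\<lambda>x. p x ^ k * u x) absolutely_integrable_on {a..b}" for a b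
        by (intro absolutely_integrable_continuous_real continuous_intros trig_poly_continuous[OF trig] continuous_on_subset[OF cont]) auto
      show "p (x + 1) ^ k * u (x + 1) = p x ^ k * u x" for x
        using per trig_poly_periodic[OF trig] by simp
    qed (rule orth[OF trig])
    finally show ?thesis by simp
  qed
  define q where "q = p (c + d) / p (c + d/2)"
  have q: "0 \<le> q" "q < 1" "p (c + d/2) > 0" using strict p0[of "c+d"] by (auto simp: q_def)
  have "e * d / B \<le> q ^ k" for k
    using key[of k] q(3) B(1) by (simp add: q_def power_divide field_simps)
  moreover obtain k where "q ^ k < e * d / B"
    using real_arch_pow_inv[of "e * d / B" q] q \<open>e > 0\<close> d B by auto
  ultimately show False by (metis not_le)
qed

text \<open>The product rule is the chain rule for the bilinear map \<open>*\<^sub>R\<close>.\<close>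

lemma primitive_of_scaleR:
  fixes F :: "real \<Rightarrow> 'b::euclidean_space"
  assumes "primitive_of \<phi> \<phi>'" "primitive_of F g"
  shows "primitive_of (\<lambda>x. \<phi> x *\<^sub>R F x) (\<lambda>x. \<phi>' x *\<^sub>R F x + \<phi> x *\<^sub>R g x)"
proof -
  define D :: "real \<times> 'b \<Rightarrow> (real \<times> 'b) \<Rightarrow>\<^sub>L 'b" where
    "D p = (blinfun_scaleR_left (snd p) o\<^sub>L fst_blinfun) + (blinfun_scaleR_right (fst p) o\<^sub>L snd_blinfun)" for p
  have D: "D p h = fst h *\<^sub>R snd p + fst p *\<^sub>R snd h" for p h
    by (simp add: D_def blinfun.add_left blinfun_scaleR_right.rep_eq)
  have "primitive_of (\<lambda>x. (\<lambda>p. fst p *\<^sub>R snd p) (\<phi> x, F x)) (\<lambda>x. D (\<phi> x, F x) (\<phi>' x, g x))"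
  proof (rule primitive_of_compose[OF primitive_of_Pair[OF assms], of UNIV])
    show "((\<lambda>p. fst p *\<^sub>R snd p) has_derivative D p) (at p)" for p :: "real \<times> 'b"
      unfolding D by (auto intro!: derivative_eq_intros simp: algebra_simps)
    show "continuous_on UNIV D" unfolding D_def
      by (intro continuous_intros bounded_linear.continuous_on[OF bounded_linear_blinfun_scaleR_left]
          bounded_linear.continuous_on[OF bounded_linear_blinfun_scaleR_right]
          bounded_bilinear.continuous_on[OF bounded_bilinear_blinfun_compose])
  qed auto
  then show ?thesis by (simp add: D)
qed

section \<open>Integrals over a period\<close>

lemma nn_integral_shift_interval:
  fixes p :: "real \<Rightarrow> ennreal"
  assumes [measurable]: "p \<in> borel_measurable borel"
  shows "(\<integral>\<^sup>+x\<in>{a..b}. p x \<partial>lborel) = (\<integral>\<^sup>+x\<in>{a-c..b-c}. p (x + c) \<partial>lborel)"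
  by (subst nn_integral_real_affine[of _ 1 c])
     (auto intro!: nn_integral_cong simp: add.commute split: split_indicator)

lemma nn_integral_period:
  fixes p :: "real \<Rightarrow> ennreal"
  assumes [measurable]: "p \<in> borel_measurable borel" and per: "\<And>x. p (x + 1) = p x"
  shows "(\<integral>\<^sup>+x\<in>{a..a+1}. p x \<partial>lborel) = (\<integral>\<^sup>+x\<in>{0..1}. p x \<partial>lborel)"
proof -
  interpret periodic_fun_simple' p by standard (rule per)
  define k where "k = real_of_int \<lfloor>a\<rfloor>"
  have k: "k \<le> a" "a < k + 1" by (auto simp: k_def)
  have split: "(\<integral>\<^sup>+x\<in>{r..t}. p x \<partial>lborel) = (\<integral>\<^sup>+x\<in>{r..s}. p x \<partial>lborel) + (\<integral>\<^sup>+x\<in>{s..t}. p x \<partial>lborel)"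
    if "r \<le> s" "s \<le> t" for r s t
    by (subst nn_integral_add[symmetric], simp, simp, rule nn_integral_cong_AE,
        rule AE_mp[OF AE_lborel_singleton[of s]]) (use that in \<open>auto split: split_indicator\<close>)
  have "(\<integral>\<^sup>+x\<in>{a..a+1}. p x \<partial>lborel) = (\<integral>\<^sup>+x\<in>{a..k+1}. p x \<partial>lborel) + (\<integral>\<^sup>+x\<in>{k+1..a+1}. p x \<partial>lborel)"
    using k by (intro split) auto
  also have "(\<integral>\<^sup>+x\<in>{k+1..a+1}. p x \<partial>lborel) = (\<integral>\<^sup>+x\<in>{k..a}. p x \<partial>lborel)"
    by (subst nn_integral_shift_interval[of _ _ _ 1]) (auto simp: per)
  also have "(\<integral>\<^sup>+x\<in>{a..k+1}. p x \<partial>lborel) + \<dots> = (\<integral>\<^sup>+x\<in>{k..k+1}. p x \<partial>lborel)"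
    using k by (subst add.commute) (intro split[symmetric], auto)
  also have "\<dots> = (\<integral>\<^sup>+x\<in>{0..1}. p x \<partial>lborel)"
    by (subst nn_integral_shift_interval[of _ _ _ k]) (auto simp: k_def plus_of_int)
  finally show ?thesis .
qed

lemma L2_circle_measurable [measurable_dest]: "f \<in> L2_circle \<Longrightarrow> f \<in> borel_measurable borel"
  by (simp add: L2_circle_def)

lemma L2_circle_periodic: "f \<in> L2_circle \<Longrightarrow> f (x + 1) = f x"
  by (simp add: L2_circle_def periodic_fun_simple'_def)

lemma L2_circle_absolutely_integrable:
  fixes f :: "real \<Rightarrow> 'b::euclidean_space"
  assumes f: "f \<in> L2_circle" shows "f absolutely_integrable_on {a..b}"
proof -
  have [measurable]: "f \<in> borel_measurable borel" by (rule L2_circle_measurable[OF f])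
  have fin: "(\<integral>\<^sup>+x\<in>{c..c+1}. ennreal (norm (f x)) \<partial>lborel) < \<infinity>" for c
  proof -
    have "(\<integral>\<^sup>+x\<in>{c..c+1}. ennreal (norm (f x)) \<partial>lborel)
        \<le> (\<integral>\<^sup>+x. (indicator {c..c+1} x + ennreal ((norm (f x))\<^sup>2) * indicator {c..c+1} x) \<partial>lborel)"
    proof (rule nn_integral_mono)
      fix x :: real
      \<comment> \<open>On a bounded interval this makes square integrable functions integrable.\<close>
      have "norm (f x) \<le> 1 + (norm (f x))\<^sup>2"
        using zero_le_power2[of "norm (f x) - 1/2"] by (simp add: power2_eq_square algebra_simps)
      then have "ennreal (norm (f x)) \<le> 1 + ennreal ((norm (f x))\<^sup>2)"
        by (metis ennreal_1 ennreal_leI ennreal_plus zero_le_one zero_le_power2)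
      then show "ennreal (norm (f x)) * indicator {c..c+1} x
          \<le> indicator {c..c+1} x + ennreal ((norm (f x))\<^sup>2) * indicator {c..c+1} x"
        by (auto split: split_indicator)
    qed
    also have "\<dots> = 1 + (\<integral>\<^sup>+x\<in>{c..c+1}. ennreal ((norm (f x))\<^sup>2) \<partial>lborel)"
      by (subst nn_integral_add) auto
    also have "\<dots> = 1 + L2_sq f"
      unfolding L2_sq_def by (subst nn_integral_period) (auto simp: L2_circle_periodic[OF f])
    also have "\<dots> < \<infinity>" using f by (auto simp: L2_circle_def ennreal_add_less_top less_top)
    finally show ?thesis .
  qed
  have unit: "set_integrable lborel {c..c+1} f" for c
    unfolding set_integrable_def
    by (rule integrableI_bounded)
       (use fin[of c] in \<open>auto simp: ennreal_mult ennreal_indicator mult.commute\<close>)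
  have "set_integrable lborel {- real n..real n} f" for n
  proof (induction n)
    case 0
    show ?case by (rule set_integrable_subset[OF unit[of 0]]) auto
  next
    case (Suc n)
    have "set_integrable lborel ({-real n - 1..-real n - 1 + 1} \<union> {-real n..real n} \<union> {real n..real n + 1}) f"
      by (intro set_integrable_Un Suc unit) auto
    moreover have "{-real n - 1..-real n - 1 + 1} \<union> {-real n..real n} \<union> {real n..real n + 1} = {- real (Suc n)..real (Suc n)}"
      by auto
    ultimately show ?case by simp
  qed
  moreover obtain n :: nat where "max \<bar>a\<bar> \<bar>b\<bar> \<le> real n" using real_arch_simple by blast
  then have "{a..b} \<subseteq> {- real n..real n}" by auto
  ultimately have "set_integrable lborel {a..b} f" by (metis set_integrable_subset borel_closed closed_atLeastAtMost sets_lborel)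
  then show ?thesis by (subst borel_absolutely_integrable_iff) auto
qed

lemma LINT_scaleR_eq_integral:
  fixes f :: "real \<Rightarrow> 'b::euclidean_space"
  assumes \<phi>: "continuous_on UNIV \<phi>" and f: "f \<in> L2_circle"
  shows "(\<lambda>x. \<phi> x *\<^sub>R f x) absolutely_integrable_on {a..b}"
    and "(LINT x:{a..b}|lborel. \<phi> x *\<^sub>R f x) = integral {a..b} (\<lambda>x. \<phi> x *\<^sub>R f x)"
proof -
  have [measurable]: "f \<in> borel_measurable borel" by (rule L2_circle_measurable[OF f])
  have [measurable]: "\<phi> \<in> borel_measurable borel" by (rule borel_measurable_continuous_onI[OF \<phi>])
  have "(\<lambda>x. blinfun_scaleR_right (\<phi> x) (f x)) absolutely_integrable_on {a..b}"
    by (intro absolutely_integrable_blinfun_apply L2_circle_absolutely_integrable f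
         bounded_linear.continuous_on[OF bounded_linear_blinfun_scaleR_right] continuous_on_subset[OF \<phi>]) auto
  then show 1: "(\<lambda>x. \<phi> x *\<^sub>R f x) absolutely_integrable_on {a..b}"
    by (simp add: blinfun_scaleR_right.rep_eq)
  then have "set_integrable lborel {a..b} (\<lambda>x. \<phi> x *\<^sub>R f x)"
    by (subst (asm) borel_absolutely_integrable_iff) auto
  then show "(LINT x:{a..b}|lborel. \<phi> x *\<^sub>R f x) = integral {a..b} (\<lambda>x. \<phi> x *\<^sub>R f x)"
    by (rule set_borel_integral_eq_integral)
qed

section \<open>Quadratic bounds for the seminorms\<close>

text \<open>The set where two continuous functions differ is open, and open null sets are empty.\<close>

lemma continuous_AE_eq:
  fixes f g :: "real \<Rightarrow> 'b::euclidean_space"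
  assumes "continuous_on UNIV f" "continuous_on UNIV g" "AE x in lborel. f x = g x"
  shows "f x = g x"
proof -
  let ?S = "{x. f x \<noteq> g x}"
  have "open ?S" using assms(1,2) by (rule open_Collect_neq)
  have "?S \<in> sets lborel" using \<open>open ?S\<close> by simp
  then have "?S \<in> null_sets lborel" using assms(3) by (simp add: AE_iff_null_sets)
  then have "negligible ?S" by (simp add: negligible_iff_null_sets null_sets_completionI)
  then have "?S = {}" using open_not_negligible[OF \<open>open ?S\<close>] by blast
  then show ?thesis by blast
qed

lemma L2_sq_cong_AE:
  assumes "AE x in lborel. f x = g x" shows "L2_sq f = L2_sq g"
  unfolding L2_sq_def by (rule nn_integral_cong_AE) (use assms in \<open>auto elim: eventually_mono\<close>)

lemma L2_sq_period:
  assumes "f \<in> L2_circle"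
  shows "(\<integral>\<^sup>+x\<in>{a..a+1}. ennreal ((norm (f x))\<^sup>2) \<partial>lborel) = L2_sq f"
proof -
  have [measurable]: "f \<in> borel_measurable borel" by (rule L2_circle_measurable[OF assms])
  show ?thesis unfolding L2_sq_def
    by (rule nn_integral_period) (auto simp: L2_circle_periodic[OF assms])
qed

text \<open>Convexity of the square, with the weight \<open>l\<close> left free. Integrated, and optimized over \<open>l\<close>
  at the very end (\<open>sqrt_le_of_weighted_bounds\<close>), it yields the triangle inequality for the
  Sobolev norm without an inner product on the Sobolev space.\<close>

lemma norm_sum_sq_le:
  fixes a b :: "'b::real_normed_vector"
  assumes "0 < l" "l < 1"
  shows "(norm (a + b))\<^sup>2 \<le> (norm a)\<^sup>2 / l + (norm b)\<^sup>2 / (1 - l)"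
proof -
  have "(norm (a + b))\<^sup>2 \<le> (norm a + norm b)\<^sup>2" by (intro power_mono norm_triangle_ineq) auto
  also have "\<dots> \<le> (norm a)\<^sup>2 / l + (norm b)\<^sup>2 / (1 - l)"
  proof -
    have "(norm a)\<^sup>2 / l + (norm b)\<^sup>2 / (1 - l) - (norm a + norm b)\<^sup>2
      = ((1 - l) * norm a - l * norm b)\<^sup>2 / (l * (1 - l))"
      using assms by (simp add: divide_simps) (simp add: power2_eq_square algebra_simps)
    moreover have "\<dots> \<ge> 0" using assms by (intro divide_nonneg_nonneg) auto
    ultimately show ?thesis by linarith
  qed
  finally show ?thesis .
qed

lemma ennreal_norm_sum_sq_le:
  fixes a b :: "'b::real_normed_vector"
  assumes "0 < l" "l < 1"
  shows "ennreal ((norm (a + b))\<^sup>2 / c) \<le> ennreal (1 / l) * ennreal ((norm a)\<^sup>2 / c) + ennreal (1 / (1 - l)) * ennreal ((norm b)\<^sup>2 / c)"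
proof (cases "c \<ge> 0")
  case True
  have "(norm (a + b))\<^sup>2 / c \<le> ((norm a)\<^sup>2 / l + (norm b)\<^sup>2 / (1 - l)) / c"
    by (intro divide_right_mono norm_sum_sq_le assms True)
  also have "\<dots> = (1/l) * ((norm a)\<^sup>2 / c) + (1/(1-l)) * ((norm b)\<^sup>2 / c)" by (simp add: add_divide_distrib)
  finally show ?thesis using assms True by (subst (1 2) ennreal_mult[symmetric]) (auto simp flip: ennreal_plus intro!: ennreal_leI)
next
  case False
  then have "(norm (a + b))\<^sup>2 / c \<le> 0" by (intro divide_nonneg_nonpos) auto
  then show ?thesis by (simp add: ennreal_neg)
qed

lemma L2_sq_add_le:
  fixes f g :: "real \<Rightarrow> 'b::euclidean_space"
  assumes [measurable]: "f \<in> borel_measurable borel" "g \<in> borel_measurable borel" and l: "0 < l" "l < 1"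
  shows "L2_sq (\<lambda>x. f x + g x) \<le> ennreal (1/l) * L2_sq f + ennreal (1/(1-l)) * L2_sq g"
proof -
  have "L2_sq (\<lambda>x. f x + g x)
     \<le> (\<integral>\<^sup>+x. ennreal (1/l) * (ennreal ((norm (f x))\<^sup>2) * indicator {0..1} x)
          + ennreal (1/(1-l)) * (ennreal ((norm (g x))\<^sup>2) * indicator {0..1} x) \<partial>lborel)"
    unfolding L2_sq_def
    by (intro nn_integral_mono) (use ennreal_norm_sum_sq_le[OF l, of _ _ 1] in \<open>auto split: split_indicator\<close>)
  also have "\<dots> = ennreal (1/l) * L2_sq f + ennreal (1/(1-l)) * L2_sq g"
    unfolding L2_sq_def by (subst nn_integral_add) (auto simp: nn_integral_cmult)
  finally show ?thesis .
qed

text \<open>The integrand of \<^const>\<open>gagliardo_sq\<close>, cut off in the inner variable, so that bounds and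
  measurability can be stated for the iterated integral as a whole.\<close>

definition gagliardo_integrand :: "real \<Rightarrow> (real \<Rightarrow> 'b::euclidean_space) \<Rightarrow> real \<Rightarrow> real \<Rightarrow> ennreal" where
  "gagliardo_integrand s h u w
     = ennreal ((norm (h (u + w) - h u))\<^sup>2 / \<bar>w\<bar> powr (1 + 2 * s)) * indicator {-1/2..1/2} w"

lemma gagliardo_sq_eq:
  "gagliardo_sq s h = (\<integral>\<^sup>+u. (\<integral>\<^sup>+w. gagliardo_integrand s h u w \<partial>lborel) * indicator {0..1} u \<partial>lborel)"
  unfolding gagliardo_sq_def gagliardo_integrand_def ..

lemma gagliardo_integrand_measurable:
  assumes [measurable]: "h \<in> borel_measurable borel"
  shows "(\<lambda>w. gagliardo_integrand s h u w) \<in> borel_measurable borel"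
    and "(\<lambda>(u, w). gagliardo_integrand s h u w) \<in> borel_measurable (borel \<Otimes>\<^sub>M borel)"
  by (auto simp: gagliardo_integrand_def)

lemma gagliardo_sq_add_le:
  fixes f g :: "real \<Rightarrow> 'b::euclidean_space"
  assumes [measurable]: "f \<in> borel_measurable borel" "g \<in> borel_measurable borel" and l: "0 < l" "l < 1"
  shows "gagliardo_sq s (\<lambda>x. f x + g x) \<le> ennreal (1/l) * gagliardo_sq s f + ennreal (1/(1-l)) * gagliardo_sq s g"
proof -
  let ?q = "gagliardo_integrand s"
  note [measurable] = gagliardo_integrand_measurable[OF assms(1)] gagliardo_integrand_measurable[OF assms(2)]
  have "(\<integral>\<^sup>+w. ?q (\<lambda>x. f x + g x) u w \<partial>lborel)
      \<le> (\<integral>\<^sup>+w. ennreal (1/l) * ?q f u w + ennreal (1/(1-l)) * ?q g u w \<partial>lborel)" for u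
    by (intro nn_integral_mono)
       (use ennreal_norm_sum_sq_le[OF l] in \<open>auto simp: gagliardo_integrand_def add_diff_add split: split_indicator\<close>)
  also have "\<dots> u = ennreal (1/l) * (\<integral>\<^sup>+w. ?q f u w \<partial>lborel) + ennreal (1/(1-l)) * (\<integral>\<^sup>+w. ?q g u w \<partial>lborel)" for u
    by (subst nn_integral_add) (auto simp: nn_integral_cmult)
  finally have "gagliardo_sq s (\<lambda>x. f x + g x)
     \<le> (\<integral>\<^sup>+u. ennreal (1/l) * ((\<integral>\<^sup>+w. ?q f u w \<partial>lborel) * indicator {0..1} u)
          + ennreal (1/(1-l)) * ((\<integral>\<^sup>+w. ?q g u w \<partial>lborel) * indicator {0..1} u) \<partial>lborel)"
    unfolding gagliardo_sq_eq by (intro nn_integral_mono) (auto split: split_indicator)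
  also have "\<dots> = ennreal (1/l) * gagliardo_sq s f + ennreal (1/(1-l)) * gagliardo_sq s g"
    unfolding gagliardo_sq_eq by (subst nn_integral_add) (auto simp: nn_integral_cmult)
  finally show ?thesis .
qed

lemma L2_circle_add:
  fixes f g :: "real \<Rightarrow> 'b::euclidean_space"
  assumes "f \<in> L2_circle" "g \<in> L2_circle"
  shows "(\<lambda>x. f x + g x) \<in> L2_circle"
proof -
  have m[measurable]: "f \<in> borel_measurable borel" "g \<in> borel_measurable borel"
    using assms L2_circle_measurable by auto
  have "L2_sq (\<lambda>x. f x + g x) \<le> ennreal (1/(1/2)) * L2_sq f + ennreal (1/(1-1/2)) * L2_sq g"
    by (rule L2_sq_add_le[OF m]) auto
  also have "\<dots> < \<infinity>" using assms by (auto simp: L2_circle_def ennreal_mult_less_top)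
  finally show ?thesis using assms by (auto simp: L2_circle_def periodic_fun_simple'_def)
qed

lemma L2_circle_minus:
  fixes f :: "real \<Rightarrow> 'b::euclidean_space"
  assumes "f \<in> L2_circle" shows "(\<lambda>x. - f x) \<in> L2_circle"
  using assms by (auto simp: L2_circle_def periodic_fun_simple'_def L2_sq_def)

lemma L2_circle_diff:
  fixes f g :: "real \<Rightarrow> 'b::euclidean_space"
  assumes "f \<in> L2_circle" "g \<in> L2_circle"
  shows "(\<lambda>x. f x - g x) \<in> L2_circle"
  using L2_circle_add[OF assms(1) L2_circle_minus[OF assms(2)]] by simp

lemma L2_sq_le_sup:
  assumes "\<And>x. norm (f x) \<le> B" shows "L2_sq f \<le> ennreal (B\<^sup>2)"
proof -
  have "L2_sq f \<le> (\<integral>\<^sup>+x. ennreal (B\<^sup>2) * indicator {0..1} (x::real) \<partial>lborel)"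
    unfolding L2_sq_def by (intro nn_integral_mono mult_right_mono ennreal_leI power_mono assms) auto
  also have "\<dots> = ennreal (B\<^sup>2)" by (subst nn_integral_cmult) auto
  finally show ?thesis .
qed

lemma periodic_bounded:
  fixes f :: "real \<Rightarrow> 'b::euclidean_space"
  assumes "continuous_on UNIV f" "\<And>x. f (x + 1) = f x"
  obtains B where "B > 0" "\<And>x. norm (f x) \<le> B"
proof -
  interpret periodic_fun_simple' f by standard (rule assms)
  have "bounded (f ` {0..1})"
    by (intro compact_imp_bounded compact_continuous_image continuous_on_subset[OF assms(1)]) auto
  then obtain B where B: "B > 0" "\<And>x. x \<in> {0..1} \<Longrightarrow> norm (f x) \<le> B" unfolding bounded_pos by auto
  have "norm (f x) \<le> B" for x
  proof -
    have "f x = f (frac x)" using minus_of_int[of x "\<lfloor>x\<rfloor>"] by (simp add: frac_def)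
    then show ?thesis using B(2)[of "frac x"] by (simp add: frac_lt_1 less_imp_le)
  qed
  then show ?thesis using B(1) that by blast
qed

lemma continuous_periodic_L2_circle:
  fixes f :: "real \<Rightarrow> 'b::euclidean_space"
  assumes "continuous_on UNIV f" "\<And>x. f (x + 1) = f x"
  shows "f \<in> L2_circle"
proof -
  obtain B where "\<And>x. norm (f x) \<le> B" using periodic_bounded[OF assms] by blast
  then have "L2_sq f \<le> ennreal (B\<^sup>2)" by (rule L2_sq_le_sup)
  then have "L2_sq f < \<infinity>" by (metis ennreal_less_top infinity_ennreal_def order_le_less_trans)
  then show ?thesis using assms borel_measurable_continuous_onI[OF assms(1)]
    by (auto simp: L2_circle_def periodic_fun_simple'_def)
qed

section \<open>Weak derivatives and primitives\<close>

text \<open>Up to its mean, \<open>\<psi>\<close> is the derivative of a trigonometric polynomial, and constants are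
  orthogonal to functions of mean zero.\<close>

lemma trig_orthogonal_to_mean_free:
  fixes h :: "real \<Rightarrow> 'b::euclidean_space"
  assumes h: "h \<in> L2_circle"
    and orth: "\<And>F f. trig_poly F \<Longrightarrow> trig_poly f \<Longrightarrow> (\<And>x. (F has_real_derivative f x) (at x))
      \<Longrightarrow> integral {0..1} (\<lambda>x. f x *\<^sub>R h x) = 0"
    and \<psi>: "trig_poly \<psi>"
  shows "integral {0..1} (\<lambda>x. \<psi> x *\<^sub>R (h x - integral {0..1} h)) = 0"
proof -
  define M where "M = integral {0..1} h"
  obtain F c where F: "trig_poly F" "\<And>x. (F has_real_derivative \<psi> x - c) (at x)"
    using trig_poly_primitive[OF \<psi>] by blast
  have t: "trig_poly (\<lambda>x. \<psi> x - c)" using trig_poly.add[OF \<psi> trig_poly.const[of "-c"]] by simp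
  have c\<psi>: "continuous_on S \<psi>" for S by (rule trig_poly_continuous[OF \<psi>])
  have i1: "(\<lambda>x. \<psi> x *\<^sub>R h x) integrable_on {0..1}" "(\<lambda>x. c *\<^sub>R h x) integrable_on {0..1}"
    using LINT_scaleR_eq_integral(1)[OF _ h, of \<psi> 0 1] LINT_scaleR_eq_integral(1)[OF _ h, of "\<lambda>_. c" 0 1] c\<psi>
    by (auto simp: absolutely_integrable_on_def)
  have i2: "\<psi> integrable_on {0..1}"
    by (intro integrable_continuous_real c\<psi>)
  have "((\<lambda>x. \<psi> x - c) has_integral (F 1 - F 0)) {0..1}"
    by (rule fundamental_theorem_of_calculus)
       (use F(2) in \<open>auto simp flip: has_real_derivative_iff_has_vector_derivative intro: has_field_derivative_at_within\<close>)
  moreover have "F 1 = F 0" using trig_poly_periodic[OF F(1), of 0] by simp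
  ultimately have "((\<lambda>x. \<psi> x - c) has_integral 0) {0..1}" by simp
  from has_integral_add[OF this has_integral_const_real[of c 0 1]]
  have int\<psi>: "integral {0..1} \<psi> = c" by (simp add: integral_unique)
  have "0 = integral {0..1} (\<lambda>x. \<psi> x *\<^sub>R h x - c *\<^sub>R h x)"
    using orth[OF F(1) t F(2)] by (simp add: scaleR_diff_left)
  also have "\<dots> = integral {0..1} (\<lambda>x. \<psi> x *\<^sub>R h x) - c *\<^sub>R M"
    by (subst integral_diff[OF i1(1,2)]) (simp add: M_def)
  also have "c *\<^sub>R M = integral {0..1} (\<lambda>x. \<psi> x *\<^sub>R M)"
    using integral_linear[OF i2 bounded_linear_scaleR_left[of M]] int\<psi> by (simp add: o_def)
  also have "integral {0..1} (\<lambda>x. \<psi> x *\<^sub>R h x) - integral {0..1} (\<lambda>x. \<psi> x *\<^sub>R M)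
      = integral {0..1} (\<lambda>x. \<psi> x *\<^sub>R (h x - M))"
    by (subst integral_diff[symmetric])
       (auto simp: scaleR_diff_right intro!: i1 integrable_continuous_real continuous_intros c\<psi>)
  finally show ?thesis by (simp add: M_def)
qed

text \<open>The lemma of du Bois-Reymond for continuous functions: \<open>H\<close> minus its mean is orthogonal
  to all trigonometric polynomials (\<open>trig_orthogonal_to_mean_free\<close>), so neither its components
  nor their negatives can take a positive value.\<close>

lemma weakly_constant_imp_constant:
  fixes H :: "real \<Rightarrow> 'b::euclidean_space"
  assumes cont: "continuous_on UNIV H" and per: "\<And>x. H (x + 1) = H x"
    and orth: "\<And>F f. trig_poly F \<Longrightarrow> trig_poly f \<Longrightarrow> (\<And>x. (F has_real_derivative f x) (at x))
      \<Longrightarrow> integral {0..1} (\<lambda>x. f x *\<^sub>R H x) = 0"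
  shows "H x = H y"
proof -
  define M where "M = integral {0..1} H"
  have cH: "continuous_on S H" for S using cont continuous_on_subset by blast
  have orth': "integral {0..1} (\<lambda>x. \<psi> x *\<^sub>R (H x - M)) = 0" if \<psi>: "trig_poly \<psi>" for \<psi>
    unfolding M_def
    by (rule trig_orthogonal_to_mean_free[OF continuous_periodic_L2_circle[OF cont per] orth \<psi>])
  have comp: "integral {0..1} (\<lambda>x. \<psi> x * (s * ((H x - M) \<bullet> i))) = 0" if \<psi>: "trig_poly \<psi>" for \<psi> i s
  proof -
    have i: "(\<lambda>x. \<psi> x *\<^sub>R (H x - M)) integrable_on {0..1}"
      by (intro integrable_continuous_real continuous_intros cH trig_poly_continuous[OF \<psi>])
    have "integral {0..1} (\<lambda>x. s * ((\<psi> x *\<^sub>R (H x - M)) \<bullet> i)) = 0"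
      using integral_linear[OF i bounded_linear_inner_left[of i]] orth'[OF \<psi>] by (simp add: o_def)
    then show ?thesis by (simp add: mult.left_commute)
  qed
  have "(H x - M) \<bullet> i = 0" for x i
  proof -
    have *: "s * ((H x - M) \<bullet> i) \<le> 0" for s
      by (rule no_positive_value_of_trig_orthogonal[where u = "\<lambda>x. s * ((H x - M) \<bullet> i)"])
         (auto intro!: continuous_intros cH comp simp: per)
    show ?thesis using *[of 1] *[of "-1"] by simp
  qed
  then have "H x = M" for x by (metis inner_eq_zero_iff right_minus_eq)
  then show ?thesis by simp
qed

lemma test_function_C1:
  assumes "test_function \<phi>"
  shows "(\<phi> has_real_derivative deriv \<phi> x) (at x)" "continuous_on UNIV (deriv \<phi>)" "\<phi> (x + 1) = \<phi> x"
proof -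
  have d: "(deriv ^^ k) \<phi> differentiable_on UNIV" for k using assms by (auto simp: test_function_def)
  have "\<phi> differentiable (at x)" using d[of 0] by (simp add: differentiable_on_def)
  then show "(\<phi> has_real_derivative deriv \<phi> x) (at x)"
    by (metis DERIV_imp_deriv real_differentiable_def)
  show "continuous_on UNIV (deriv \<phi>)" using d[of 1] differentiable_imp_continuous_on by auto
  show "\<phi> (x + 1) = \<phi> x" using assms by (auto simp: test_function_def periodic_fun_simple'_def)
qed

lemma test_function_continuous:
  assumes "test_function \<phi>"
  shows "continuous_on S \<phi>" "continuous_on S (deriv \<phi>)"
  using test_function_C1(1)[OF assms] test_function_C1(2)[OF assms]
  by (auto intro: DERIV_continuous_on has_field_derivative_at_within continuous_on_subset)

lemma test_function_by_parts:
  fixes F :: "real \<Rightarrow> 'b::euclidean_space"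
  assumes \<phi>: "test_function \<phi>" and F: "primitive_of F g" "\<And>x. F (x + 1) = F x" "g \<in> L2_circle"
  shows "integral {0..1} (\<lambda>x. deriv \<phi> x *\<^sub>R F x) = - integral {0..1} (\<lambda>x. \<phi> x *\<^sub>R g x)"
proof -
  have c: "continuous_on S \<phi>" "continuous_on S (deriv \<phi>)" for S
    by (intro test_function_continuous[OF \<phi>])+
  have "primitive_of \<phi> (deriv \<phi>)"
    by (rule primitive_of_C1) (use test_function_C1[OF \<phi>] has_real_derivative_iff_has_vector_derivative in auto)
  from primitive_of_has_integral[OF primitive_of_scaleR[OF this F(1)], of 0 1]
  have h0: "((\<lambda>x. deriv \<phi> x *\<^sub>R F x + \<phi> x *\<^sub>R g x) has_integral 0) {0..1}"
    using F(2)[of 0] test_function_C1(3)[OF \<phi>, of 0] by simp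
  have i1: "(\<lambda>x. deriv \<phi> x *\<^sub>R F x) integrable_on {0..1}"
    by (intro integrable_continuous_real continuous_intros c continuous_on_subset[OF primitive_of_continuous[OF F(1)]]) auto
  have i2: "(\<lambda>x. \<phi> x *\<^sub>R g x) integrable_on {0..1}"
    using LINT_scaleR_eq_integral(1)[OF c(1) F(3)] absolutely_integrable_on_def by blast
  show ?thesis
    using integral_add[OF i1 i2] integral_unique[OF h0] by (simp add: eq_neg_iff_add_eq_0)
qed

lemma has_weak_deriv_integral:
  assumes "has_weak_deriv f g" and \<phi>: "test_function \<phi>"
  shows "integral {0..1} (\<lambda>x. deriv \<phi> x *\<^sub>R f x) = - integral {0..1} (\<lambda>x. \<phi> x *\<^sub>R g x)"
proof -
  have fg: "f \<in> L2_circle" "g \<in> L2_circle" using assms(1) by (auto simp: has_weak_deriv_def)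
  have c: "continuous_on UNIV \<phi>" "continuous_on UNIV (deriv \<phi>)"
    by (intro test_function_continuous[OF \<phi>])+
  have "(LINT x:{0..1}|lborel. deriv \<phi> x *\<^sub>R f x) = - (LINT x:{0..1}|lborel. \<phi> x *\<^sub>R g x)"
    using assms by (simp add: has_weak_deriv_def)
  then show ?thesis
    unfolding LINT_scaleR_eq_integral(2)[OF c(2) fg(1)] LINT_scaleR_eq_integral(2)[OF c(1) fg(2)] .
qed

lemma primitive_has_weak_deriv:
  fixes F :: "real \<Rightarrow> 'b::euclidean_space"
  assumes F: "primitive_of F g" "\<And>x. F (x + 1) = F x" and g: "g \<in> L2_circle"
  shows "has_weak_deriv F g"
proof -
  have FL: "F \<in> L2_circle" by (rule continuous_periodic_L2_circle[OF primitive_of_continuous[OF F(1)] F(2)])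
  have "(LINT x:{0..1}|lborel. deriv \<phi> x *\<^sub>R F x) = - (LINT x:{0..1}|lborel. \<phi> x *\<^sub>R g x)"
    if \<phi>: "test_function \<phi>" for \<phi>
  proof -
    have c: "continuous_on UNIV \<phi>" "continuous_on UNIV (deriv \<phi>)"
      by (intro test_function_continuous[OF \<phi>])+
    show ?thesis
      using LINT_scaleR_eq_integral(2)[OF c(2) FL] LINT_scaleR_eq_integral(2)[OF c(1) g]
        test_function_by_parts[OF \<phi> F g] by simp
  qed
  then show ?thesis using FL g by (auto simp: has_weak_deriv_def)
qed

text \<open>A primitive \<open>F\<close> of \<open>g\<close> has the same weak derivative as \<open>f\<close>, so \<open>h = f - F\<close> is weakly constant.
  As \<open>h\<close> is only square integrable, \<open>weakly_constant_imp_constant\<close> is applied to the continuous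
  primitive \<open>H\<close> of \<open>h\<close> minus its mean. Since \<open>H\<close> is constant, its density vanishes almost
  everywhere.\<close>

lemma has_weak_deriv_primitive:
  fixes f :: "real \<Rightarrow> 'b::euclidean_space"
  assumes fg: "has_weak_deriv f g"
  obtains F where "primitive_of F g" "\<And>x. F (x + 1) = F x" "AE x in lborel. f x = F x"
proof -
  have f: "f \<in> L2_circle" and g: "g \<in> L2_circle" using fg by (auto simp: has_weak_deriv_def)
  obtain F where F: "primitive_of F g"
    using primitive_exists[OF L2_circle_absolutely_integrable[OF g]] by blast
  have "test_function (\<lambda>_. 1)" by (rule trig_poly_test_function[OF trig_poly.const])
  \<comment> \<open>Tested against a constant, a weak derivative has mean zero, which makes \<open>F\<close> periodic.\<close>
  from has_weak_deriv_integral[OF fg this] have "integral {0..1} g = 0" by simp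
  then have "F 1 = F 0" using primitive_of_has_integral[OF F, of 0 1] by (simp add: integral_unique)
  then have Fper: "F (x + 1) = F x" for x
    by (rule primitive_of_periodic[OF F L2_circle_periodic[OF g]])
  have FL: "F \<in> L2_circle" by (rule continuous_periodic_L2_circle[OF primitive_of_continuous[OF F] Fper])
  define h where "h x = f x - F x" for x
  have hL: "h \<in> L2_circle" unfolding h_def by (rule L2_circle_diff[OF f FL])
  have horth: "integral {0..1} (\<lambda>x. \<phi>' x *\<^sub>R h x) = 0"
    if t: "trig_poly \<phi>" "trig_poly \<phi>'" "\<And>x. (\<phi> has_real_derivative \<phi>' x) (at x)" for \<phi> \<phi>'
  proof -
    have T: "test_function \<phi>" by (rule trig_poly_test_function[OF t(1)])
    have d: "deriv \<phi> = \<phi>'" using t(3) DERIV_imp_deriv by blast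
    have c: "continuous_on UNIV \<phi>'" by (rule trig_poly_continuous[OF t(2)])
    have "integral {0..1} (\<lambda>x. \<phi>' x *\<^sub>R h x)
      = integral {0..1} (\<lambda>x. \<phi>' x *\<^sub>R f x) - integral {0..1} (\<lambda>x. \<phi>' x *\<^sub>R F x)"
      unfolding h_def scaleR_diff_right
      by (rule integral_diff)
         (use LINT_scaleR_eq_integral(1)[OF c f, of 0 1] LINT_scaleR_eq_integral(1)[OF c FL, of 0 1]
           in \<open>auto simp: absolutely_integrable_on_def\<close>)
    then show ?thesis
      using has_weak_deriv_integral[OF fg T] test_function_by_parts[OF T F Fper g] d by simp
  qed
  define m where "m = integral {0..1} h"
  have hm: "(\<lambda>x. h x - m) \<in> L2_circle"
    by (intro L2_circle_diff hL continuous_periodic_L2_circle) auto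
  obtain H where H: "primitive_of H (\<lambda>x. h x - m)"
    using primitive_exists[OF L2_circle_absolutely_integrable[OF hm]] by blast
  have "integral {0..1} (\<lambda>x. h x - m) = 0"
    using L2_circle_absolutely_integrable[OF hL, of 0 1]
    by (subst integral_diff) (auto simp: absolutely_integrable_on_def m_def)
  then have "H 1 = H 0" using primitive_of_has_integral[OF H, of 0 1] by (simp add: integral_unique)
  then have Hper: "H (x + 1) = H x" for x
    by (rule primitive_of_periodic[OF H L2_circle_periodic[OF hm]])
  have "H x = H y" for x y
  proof (rule weakly_constant_imp_constant[OF primitive_of_continuous[OF H] Hper])
    fix \<phi> \<phi>' assume t: "trig_poly \<phi>" "trig_poly \<phi>'" "\<And>x. (\<phi> has_real_derivative \<phi>' x) (at x)"
    have T: "test_function \<phi>" by (rule trig_poly_test_function[OF t(1)])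
    have d: "deriv \<phi> = \<phi>'" using t(3) DERIV_imp_deriv by blast
    show "integral {0..1} (\<lambda>x. \<phi>' x *\<^sub>R H x) = 0"
      unfolding d[symmetric] test_function_by_parts[OF T H Hper hm] m_def neg_equal_0_iff_equal
      by (rule trig_orthogonal_to_mean_free[OF hL horth t(1)])
  qed
  then have Hc: "H = (\<lambda>_. H 0)" by blast
  have "primitive_of (\<lambda>_. H 0) (\<lambda>_. 0)" by (rule primitive_of_C1) auto
  then have "AE x in lborel. h x - m = 0"
    using H Hc by (intro primitive_of_unique_AE[of "\<lambda>_. H 0"]) (auto intro: L2_circle_measurable[OF hm])
  then have "AE x in lborel. f x = F x + m" by eventually_elim (simp add: h_def algebra_simps)
  moreover have "primitive_of (\<lambda>x. F x + m) g"
    using primitive_of_add[OF F primitive_of_C1[of "\<lambda>_. m" "\<lambda>_. 0"]] by simp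
  ultimately show ?thesis using that[of "\<lambda>x. F x + m"] Fper by simp
qed

lemma has_weak_deriv_continuous_primitive:
  fixes f :: "real \<Rightarrow> 'b::euclidean_space"
  assumes "has_weak_deriv f g" "continuous_on UNIV f"
  shows "primitive_of f g"
proof -
  obtain F where F: "primitive_of F g" "AE x in lborel. f x = F x"
    using has_weak_deriv_primitive[OF assms(1)] by blast
  have "f = F" using continuous_AE_eq[OF assms(2) primitive_of_continuous[OF F(1)] F(2)] by blast
  then show ?thesis using F by simp
qed

lemma has_weak_deriv_unique_AE:
  assumes "has_weak_deriv f g" "has_weak_deriv f g'"
  shows "AE x in lborel. g x = g' x"
proof -
  obtain F where F: "primitive_of F g" "AE x in lborel. f x = F x"
    using has_weak_deriv_primitive[OF assms(1)] by blast
  obtain F' where F': "primitive_of F' g'" "AE x in lborel. f x = F' x"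
    using has_weak_deriv_primitive[OF assms(2)] by blast
  have "AE x in lborel. F x = F' x" using F(2) F'(2) by eventually_elim simp
  then have "F = F'"
    using continuous_AE_eq[OF primitive_of_continuous[OF F(1)] primitive_of_continuous[OF F'(1)]] by blast
  moreover have "g \<in> borel_measurable borel" "g' \<in> borel_measurable borel"
    using assms L2_circle_measurable by (auto simp: has_weak_deriv_def)
  ultimately show ?thesis using primitive_of_unique_AE F F' by metis
qed

lemma LINT_cong_AE:
  fixes g g' :: "real \<Rightarrow> 'b::euclidean_space"
  assumes "AE x in lborel. g x = g' x" "g \<in> L2_circle" "g' \<in> L2_circle" "continuous_on UNIV \<phi>"
  shows "(LINT x:{0..1}|lborel. \<phi> x *\<^sub>R g x) = (LINT x:{0..1}|lborel. \<phi> x *\<^sub>R g' x)"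
proof -
  have [measurable]: "g \<in> borel_measurable borel" "g' \<in> borel_measurable borel" "\<phi> \<in> borel_measurable borel"
    using assms L2_circle_measurable borel_measurable_continuous_onI by auto
  show ?thesis unfolding set_lebesgue_integral_def
    by (rule integral_cong_AE) (use assms(1) in \<open>auto elim: eventually_mono\<close>)
qed

lemma has_weak_deriv_cong_AE:
  assumes fg: "has_weak_deriv f g" and "AE x in lborel. f x = f' x" "f' \<in> L2_circle"
    "AE x in lborel. g x = g' x" "g' \<in> L2_circle"
  shows "has_weak_deriv f' g'"
proof -
  have f: "f \<in> L2_circle" and g: "g \<in> L2_circle" using fg by (auto simp: has_weak_deriv_def)
  have "(LINT x:{0..1}|lborel. deriv \<phi> x *\<^sub>R f' x) = - (LINT x:{0..1}|lborel. \<phi> x *\<^sub>R g' x)"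
    if \<phi>: "test_function \<phi>" for \<phi>
  proof -
    have c: "continuous_on UNIV \<phi>" "continuous_on UNIV (deriv \<phi>)"
      by (intro test_function_continuous[OF \<phi>])+
    have "(LINT x:{0..1}|lborel. deriv \<phi> x *\<^sub>R f x) = - (LINT x:{0..1}|lborel. \<phi> x *\<^sub>R g x)"
      using fg \<phi> by (simp add: has_weak_deriv_def)
    then show ?thesis
      unfolding LINT_cong_AE[OF assms(2) f assms(3) c(2)] LINT_cong_AE[OF assms(4) g assms(5) c(1)] .
  qed
  then show ?thesis using assms by (auto simp: has_weak_deriv_def)
qed

lemma has_weak_deriv_add:
  fixes f f' :: "real \<Rightarrow> 'b::euclidean_space"
  assumes "has_weak_deriv f g" "has_weak_deriv f' g'"
  shows "has_weak_deriv (\<lambda>x. f x + f' x) (\<lambda>x. g x + g' x)"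
proof -
  have L: "f \<in> L2_circle" "f' \<in> L2_circle" "g \<in> L2_circle" "g' \<in> L2_circle"
    using assms by (auto simp: has_weak_deriv_def)
  obtain F where F: "primitive_of F g" "\<And>x. F (x + 1) = F x" "AE x in lborel. f x = F x"
    using has_weak_deriv_primitive[OF assms(1)] by blast
  obtain F' where F': "primitive_of F' g'" "\<And>x. F' (x + 1) = F' x" "AE x in lborel. f' x = F' x"
    using has_weak_deriv_primitive[OF assms(2)] by blast
  have "has_weak_deriv (\<lambda>x. F x + F' x) (\<lambda>x. g x + g' x)"
    by (rule primitive_has_weak_deriv[OF primitive_of_add[OF F(1) F'(1)]])
       (auto simp: F F' intro: L2_circle_add L)
  then show ?thesis
    by (rule has_weak_deriv_cong_AE) (use F(3) F'(3) L L2_circle_add in \<open>auto elim: eventually_elim2\<close>)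
qed

lemma has_weak_deriv_minus:
  fixes f :: "real \<Rightarrow> 'b::euclidean_space"
  assumes "has_weak_deriv f g"
  shows "has_weak_deriv (\<lambda>x. - f x) (\<lambda>x. - g x)"
  using assms by (auto simp: has_weak_deriv_def L2_circle_minus set_lebesgue_integral_def)

lemma has_weak_deriv_weak_deriv:
  assumes "has_weak_deriv f g" shows "has_weak_deriv f (weak_deriv f)"
  unfolding weak_deriv_def using assms by (rule someI[of "has_weak_deriv f"])

section \<open>The Sobolev space as a metric space\<close>

lemma gagliardo_sq_cong_AE:
  fixes f g :: "real \<Rightarrow> 'b::euclidean_space"
  assumes [measurable]: "f \<in> borel_measurable borel" "g \<in> borel_measurable borel"
    and ae: "AE x in lborel. f x = g x"
  shows "gagliardo_sq s f = gagliardo_sq s g"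
proof -
  have shift: "AE w in lborel. f (u + w) = g (u + w)" for u
    using AE_borel_affine[OF _ _ ae, of 1 u] by simp
  have "(\<integral>\<^sup>+w\<in>{-1/2..1/2}. ennreal ((norm (f (u + w) - f u))\<^sup>2 / \<bar>w\<bar> powr (1 + 2 * s)) \<partial>lborel)
      = (\<integral>\<^sup>+w\<in>{-1/2..1/2}. ennreal ((norm (g (u + w) - g u))\<^sup>2 / \<bar>w\<bar> powr (1 + 2 * s)) \<partial>lborel)"
    if "f u = g u" for u
    by (rule nn_integral_cong_AE) (use shift[of u] that in \<open>auto elim: eventually_mono\<close>)
  then show ?thesis unfolding gagliardo_sq_def
    by (intro nn_integral_cong_AE) (use ae in \<open>auto elim!: eventually_mono\<close>)
qed

lemma has_weak_deriv_cong_left: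
  assumes "AE x in lborel. f x = f' x" "f \<in> L2_circle" "f' \<in> L2_circle"
  shows "has_weak_deriv f h \<longleftrightarrow> has_weak_deriv f' h"
proof -
  have ae': "AE x in lborel. f' x = f x" using assms(1) by (auto elim: eventually_mono)
  have "has_weak_deriv f' h" if "has_weak_deriv f h"
    by (rule has_weak_deriv_cong_AE[OF that assms(1,3)]) (use that in \<open>auto simp: has_weak_deriv_def\<close>)
  moreover have "has_weak_deriv f h" if "has_weak_deriv f' h"
    by (rule has_weak_deriv_cong_AE[OF that ae' assms(2)]) (use that in \<open>auto simp: has_weak_deriv_def\<close>)
  ultimately show ?thesis by blast
qed

lemma H_circle_L2: "g \<in> H_circle s \<Longrightarrow> g \<in> L2_circle"
  by (simp add: H_circle_def)

lemma H_circle_cong_AE: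
  assumes "g \<in> H_circle s" "AE x in lborel. g x = g' x" "g' \<in> L2_circle"
  shows "g' \<in> H_circle s" "H_seminorm_sq s g' = H_seminorm_sq s g"
proof -
  have gL: "g \<in> L2_circle" by (rule H_circle_L2[OF assms(1)])
  have ae': "AE x in lborel. g' x = g x" using assms(2) by (auto elim: eventually_mono)
  have 1: "gagliardo_sq s g' = gagliardo_sq s g" 
    by (rule gagliardo_sq_cong_AE[OF _ _ ae']) (use assms(3) gL L2_circle_measurable in auto)
  have w: "has_weak_deriv g h \<longleftrightarrow> has_weak_deriv g' h" for h
    by (rule has_weak_deriv_cong_left[OF assms(2) gL assms(3)])
  then have w: "has_weak_deriv g' = has_weak_deriv g" by blast
  then have "weak_deriv g' = weak_deriv g" by (simp add: weak_deriv_def)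
  with 1 w show "g' \<in> H_circle s" "H_seminorm_sq s g' = H_seminorm_sq s g"
    using assms by (auto simp: H_circle_def H_seminorm_sq_def)
qed

lemma H_seminorm_sq_finite: "g \<in> H_circle s \<Longrightarrow> H_seminorm_sq s g < \<infinity>"
  unfolding H_circle_def H_seminorm_sq_def
  by (auto split: if_splits dest: has_weak_deriv_weak_deriv simp: has_weak_deriv_def L2_circle_def)

lemma H_seminorm_sq_1:
  assumes "has_weak_deriv g g2" shows "H_seminorm_sq 1 g = L2_sq g2"
  unfolding H_seminorm_sq_def
  using L2_sq_cong_AE[OF has_weak_deriv_unique_AE[OF has_weak_deriv_weak_deriv[OF assms] assms]] by simp

lemma H_circle_add:
  assumes s: "s \<le> 1" and f: "f \<in> H_circle s" and g: "g \<in> H_circle s"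
  shows "(\<lambda>x. f x + g x) \<in> H_circle s"
    and "0 < l \<Longrightarrow> l < 1 \<Longrightarrow> H_seminorm_sq s (\<lambda>x. f x + g x)
      \<le> ennreal (1/l) * H_seminorm_sq s f + ennreal (1/(1-l)) * H_seminorm_sq s g"
proof -
  have L: "f \<in> L2_circle" "g \<in> L2_circle" using f g by (auto intro: H_circle_L2)
  have m: "f \<in> borel_measurable borel" "g \<in> borel_measurable borel" using L L2_circle_measurable by auto
  have "(\<lambda>x. f x + g x) \<in> H_circle s \<and> (0 < l \<and> l < 1 \<longrightarrow> H_seminorm_sq s (\<lambda>x. f x + g x)
      \<le> ennreal (1/l) * H_seminorm_sq s f + ennreal (1/(1-l)) * H_seminorm_sq s g)"
  proof (cases "s < 1")
    case True
    have "gagliardo_sq s (\<lambda>x. f x + g x)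
      \<le> ennreal (1/(1/2)) * gagliardo_sq s f + ennreal (1/(1-1/2)) * gagliardo_sq s g"
      by (rule gagliardo_sq_add_le[OF m]) auto
    also have "\<dots> < \<infinity>" using f g True by (auto simp: H_circle_def ennreal_mult_less_top)
    finally show ?thesis
      using True gagliardo_sq_add_le[OF m, of l s] L2_circle_add[OF L]
      by (auto simp: H_circle_def H_seminorm_sq_def)
  next
    case False
    then have s1: "s = 1" using s by simp
    obtain f' g' where d: "has_weak_deriv f f'" "has_weak_deriv g g'"
      using f g s1 by (auto simp: H_circle_def)
    have m': "f' \<in> borel_measurable borel" "g' \<in> borel_measurable borel"
      using d L2_circle_measurable by (auto simp: has_weak_deriv_def)
    show ?thesis
      using has_weak_deriv_add[OF d] L2_sq_add_le[OF m', of l] L2_circle_add[OF L] d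
      unfolding s1 by (auto simp: H_circle_def H_seminorm_sq_1)
  qed
  then show "(\<lambda>x. f x + g x) \<in> H_circle s"
    and "0 < l \<Longrightarrow> l < 1 \<Longrightarrow> H_seminorm_sq s (\<lambda>x. f x + g x)
      \<le> ennreal (1/l) * H_seminorm_sq s f + ennreal (1/(1-l)) * H_seminorm_sq s g" by auto
qed

lemma L2_sq_minus: "L2_sq (\<lambda>x. - f x) = L2_sq f"
  by (simp add: L2_sq_def)

lemma gagliardo_sq_minus: "gagliardo_sq s (\<lambda>x. - g x) = gagliardo_sq s g"
proof -
  have "norm (- g (u + w) - - g u) = norm (g (u + w) - g u)" for u w
    using norm_minus_commute[of "g u" "g (u + w)"] by simp
  then show ?thesis unfolding gagliardo_sq_def by (simp only:)
qed

lemma H_circle_minus: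
  assumes s: "s \<le> 1" and g: "g \<in> H_circle s"
  shows "(\<lambda>x. - g x) \<in> H_circle s" and "H_seminorm_sq s (\<lambda>x. - g x) = H_seminorm_sq s g"
proof -
  have L: "g \<in> L2_circle" using g by (auto intro: H_circle_L2)
  have "(\<lambda>x. - g x) \<in> H_circle s \<and> H_seminorm_sq s (\<lambda>x. - g x) = H_seminorm_sq s g"
  proof (cases "s < 1")
    case True
    show ?thesis using True g L2_circle_minus[OF L] gagliardo_sq_minus[of s g] by (auto simp: H_circle_def H_seminorm_sq_def)
  next
    case False
    then have s1: "s = 1" using s by simp
    obtain g' where d: "has_weak_deriv g g'" using g s1 by (auto simp: H_circle_def)
    show ?thesis
      using has_weak_deriv_minus[OF d] L2_circle_minus[OF L] d
      unfolding s1 by (auto simp: H_circle_def H_seminorm_sq_1 L2_sq_minus)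
  qed
  then show "(\<lambda>x. - g x) \<in> H_circle s" "H_seminorm_sq s (\<lambda>x. - g x) = H_seminorm_sq s g" by auto
qed

text \<open>The square of \<^const>\<open>H1_norm\<close> with the weak derivative as an argument: the norm refers to a
  chosen weak derivative, computations come with a particular one.\<close>

definition H1_energy :: "real \<Rightarrow> (real \<Rightarrow> 'b::euclidean_space) \<Rightarrow> (real \<Rightarrow> 'b) \<Rightarrow> ennreal" where
  "H1_energy s f g = L2_sq f + L2_sq g + H_seminorm_sq s g"

lemma H1_norm_eq_energy:
  assumes "has_weak_deriv f g" "g \<in> H_circle s"
  shows "H1_norm s f = sqrt (enn2real (H1_energy s f g))"
proof -
  have w: "has_weak_deriv f (weak_deriv f)" by (rule has_weak_deriv_weak_deriv[OF assms(1)])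
  have ae: "AE x in lborel. g x = weak_deriv f x" by (rule has_weak_deriv_unique_AE[OF assms(1) w])
  have L: "weak_deriv f \<in> L2_circle" using w by (simp add: has_weak_deriv_def)
  show ?thesis
    unfolding H1_norm_def H1_energy_def
    using L2_sq_cong_AE[OF ae] H_circle_cong_AE(2)[OF assms(2) ae L] by simp
qed

lemma H1_energy_finite:
  assumes "has_weak_deriv f g" "g \<in> H_circle s"
  shows "H1_energy s f g < \<infinity>"
  using assms H_seminorm_sq_finite[OF assms(2)]
  by (auto simp: H1_energy_def has_weak_deriv_def L2_circle_def)

lemma ennreal_H1_norm_sq:
  assumes "has_weak_deriv f g" "g \<in> H_circle s"
  shows "ennreal ((H1_norm s f)\<^sup>2) = H1_energy s f g"
  using H1_energy_finite[OF assms] by (simp add: H1_norm_eq_energy[OF assms])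

lemma H1_norm_nonneg: "H1_norm s f \<ge> 0"
  by (simp add: H1_norm_def)

lemma H1_circleE:
  assumes "f \<in> H1_circle s"
  obtains g where "continuous_on UNIV f" "g \<in> H_circle s" "has_weak_deriv f g" "primitive_of f g"
    "\<And>x. f (x + 1) = f x"
  using assms has_weak_deriv_continuous_primitive L2_circle_periodic
  unfolding H1_circle_def has_weak_deriv_def by blast

text \<open>The optimal weight is \<open>l = a / (a + b)\<close>. Enlarging \<open>a\<close> and \<open>b\<close> by \<open>e/2\<close> keeps it strictly
  between \<open>0\<close> and \<open>1\<close> if one of them vanishes.\<close>

lemma sqrt_le_of_weighted_bounds:
  fixes a b c :: real
  assumes "0 \<le> a" "0 \<le> b" and le: "\<And>l. 0 < l \<Longrightarrow> l < 1 \<Longrightarrow> c \<le> a\<^sup>2 / l + b\<^sup>2 / (1 - l)"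
  shows "sqrt c \<le> a + b"
proof -
  have "sqrt c \<le> a + b + e" if "e > 0" for e
  proof -
    define x y where "x = a + e/2" and "y = b + e/2"
    have xy: "x > 0" "y > 0" using assms that by (auto simp: x_def y_def)
    have "c \<le> a\<^sup>2 / (x / (x + y)) + b\<^sup>2 / (1 - x / (x + y))" using xy by (intro le) auto
    also have "\<dots> \<le> x\<^sup>2 / (x / (x + y)) + y\<^sup>2 / (1 - x / (x + y))"
      using xy assms(1,2) that
      by (intro add_mono divide_right_mono power_mono) (auto simp: x_def y_def)
    also have "\<dots> = (x + y)\<^sup>2"
    proof -
      have 1: "1 - x / (x + y) = y / (x + y)" using xy by (simp add: field_simps)
      have 2: "x\<^sup>2 / (x / (x + y)) = x * (x + y)" "y\<^sup>2 / (y / (x + y)) = y * (x + y)"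
        using xy by (simp_all add: power2_eq_square)
      show ?thesis unfolding 1 2 by (simp add: power2_eq_square algebra_simps)
    qed
    finally have "sqrt c \<le> x + y" using xy by (intro real_le_lsqrt) auto
    then show ?thesis by (simp add: x_def y_def)
  qed
  then show ?thesis by (rule field_le_epsilon)
qed

lemma H1_circle_add:
  assumes s: "s \<le> 1" and f: "f \<in> H1_circle s" and g: "g \<in> H1_circle s"
  shows "(\<lambda>x. f x + g x) \<in> H1_circle s" "H1_norm s (\<lambda>x. f x + g x) \<le> H1_norm s f + H1_norm s g"
proof -
  obtain f' where f': "continuous_on UNIV f" "f' \<in> H_circle s" "has_weak_deriv f f'" using f by (rule H1_circleE)
  obtain g' where g': "continuous_on UNIV g" "g' \<in> H_circle s" "has_weak_deriv g g'" using g by (rule H1_circleE)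
  let ?h = "\<lambda>x. f x + g x" and ?h' = "\<lambda>x. f' x + g' x"
  have h: "has_weak_deriv ?h ?h'" by (rule has_weak_deriv_add[OF f'(3) g'(3)])
  have h': "?h' \<in> H_circle s" by (rule H_circle_add(1)[OF s f'(2) g'(2)])
  show "?h \<in> H1_circle s"
    using h h' f' g' by (auto simp: H1_circle_def intro!: continuous_intros)
  have m: "f \<in> borel_measurable borel" "g \<in> borel_measurable borel"
      "f' \<in> borel_measurable borel" "g' \<in> borel_measurable borel"
    using f' g' L2_circle_measurable by (auto simp: has_weak_deriv_def)
  have "(H1_norm s ?h)\<^sup>2 \<le> (H1_norm s f)\<^sup>2 / l + (H1_norm s g)\<^sup>2 / (1 - l)" if l: "0 < l" "l < 1" for l
  proof -
    have "ennreal ((H1_norm s ?h)\<^sup>2) \<le> ennreal (1/l) * H1_energy s f f' + ennreal (1/(1-l)) * H1_energy s g g'"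
      unfolding ennreal_H1_norm_sq[OF h h'] H1_energy_def distrib_left
      using add_mono[OF add_mono[OF L2_sq_add_le[OF m(1,2) l] L2_sq_add_le[OF m(3,4) l]]
        H_circle_add(2)[OF s f'(2) g'(2) l]]
      by (simp only: ac_simps)
    also have "\<dots> = ennreal ((H1_norm s f)\<^sup>2 / l + (H1_norm s g)\<^sup>2 / (1 - l))"
      unfolding ennreal_H1_norm_sq[OF f'(3,2), symmetric] ennreal_H1_norm_sq[OF g'(3,2), symmetric]
      using l by (simp add: ennreal_mult[symmetric] ennreal_plus[symmetric] del: ennreal_plus)
    finally show ?thesis using l by (subst (asm) ennreal_le_iff) auto
  qed
  from sqrt_le_of_weighted_bounds[OF H1_norm_nonneg H1_norm_nonneg this]
  show "H1_norm s ?h \<le> H1_norm s f + H1_norm s g" using H1_norm_nonneg by simp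
qed

lemma H1_circle_minus:
  assumes s: "s \<le> 1" and f: "f \<in> H1_circle s"
  shows "(\<lambda>x. - f x) \<in> H1_circle s" "H1_norm s (\<lambda>x. - f x) = H1_norm s f"
proof -
  obtain f' where f': "continuous_on UNIV f" "f' \<in> H_circle s" "has_weak_deriv f f'" using f by (rule H1_circleE)
  have h: "has_weak_deriv (\<lambda>x. - f x) (\<lambda>x. - f' x)" by (rule has_weak_deriv_minus[OF f'(3)])
  note h' = H_circle_minus[OF s f'(2)]
  show "(\<lambda>x. - f x) \<in> H1_circle s"
    using h h' f' by (auto simp: H1_circle_def intro!: continuous_intros)
  show "H1_norm s (\<lambda>x. - f x) = H1_norm s f"
    unfolding H1_norm_eq_energy[OF h h'(1)] H1_norm_eq_energy[OF f'(3,2)] H1_energy_def h'(2) L2_sq_minus ..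
qed

lemma H1_circle_diff:
  assumes s: "s \<le> 1" and f: "f \<in> H1_circle s" and g: "g \<in> H1_circle s"
  shows "(\<lambda>x. f x - g x) \<in> H1_circle s"
  using H1_circle_add(1)[OF s f H1_circle_minus(1)[OF s g]] by simp

lemma H1_norm_eq_0_imp:
  assumes f: "f \<in> H1_circle s" and z: "H1_norm s f = 0"
  shows "f x = 0"
proof -
  obtain f' where f': "continuous_on UNIV f" "f' \<in> H_circle s" "has_weak_deriv f f'" "primitive_of f f'" "\<And>x. f (x + 1) = f x"
    using f by (rule H1_circleE) (rule that)
  have [measurable]: "f \<in> borel_measurable borel" by (rule borel_measurable_continuous_onI[OF f'(1)])
  have "H1_energy s f f' = 0" using ennreal_H1_norm_sq[OF f'(3,2)] z by simp
  then have "L2_sq f = 0" by (simp add: H1_energy_def)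
  then have "AE x in lborel. x \<in> {0..1} \<longrightarrow> f x = 0"
    unfolding L2_sq_def by (subst (asm) nn_integral_0_iff_AE) (auto simp: indicator_def elim: eventually_mono)
  then have A: "AE x in lborel. x \<in> {0<..<1} \<longrightarrow> f x = 0" by eventually_elim auto
  let ?S = "{x. f x \<noteq> 0} \<inter> {0<..<1}"
  have "open ?S" by (intro open_Int open_Collect_neq f'(1)) auto
  have "?S \<in> null_sets lborel" using A \<open>open ?S\<close> by (subst AE_iff_null_sets) (auto elim: eventually_mono)
  then have "negligible ?S" by (simp add: negligible_iff_null_sets null_sets_completionI)
  then have "?S = {}" using open_not_negligible[OF \<open>open ?S\<close>] by blast
  then have z1: "f x = 0" if "x \<in> {0<..<1}" for x using that by blast
  have "f x = 0" if "x \<in> closure {0<..<1}" for x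
    by (rule continuous_constant_on_closure[OF _ z1 that]) (use f'(1) continuous_on_subset in auto)
  then have z2: "f x = 0" if "x \<in> {0..1}" for x using that by (simp add: closure_greaterThanLessThan)
  interpret periodic_fun_simple' f by standard (rule f')
  have "f x = f (frac x)" using minus_of_int[of x "\<lfloor>x\<rfloor>"] by (simp add: frac_def)
  then show ?thesis using z2[of "frac x"] by (simp add: frac_lt_1 less_imp_le)
qed

text \<open>A metric in the sense of \<^locale>\<open>Metric_space\<close> is symmetric also outside its carrier.
  There the weak derivative may be the arbitrary choice from an empty set, which is the same for
  a function and its negative.\<close>

lemma weak_deriv_minus_cases:
  fixes k :: "real \<Rightarrow> 'b::euclidean_space"
  shows "weak_deriv (\<lambda>x. - k x) = weak_deriv k
    \<or> (weak_deriv k \<in> L2_circle \<and> weak_deriv (\<lambda>x. - k x) \<in> L2_circle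
        \<and> (AE x in lborel. weak_deriv (\<lambda>x. - k x) x = - weak_deriv k x))"
proof (cases "\<exists>g. has_weak_deriv k g")
  case True
  then obtain g where g: "has_weak_deriv k g" by blast
  have 1: "has_weak_deriv k (weak_deriv k)" by (rule has_weak_deriv_weak_deriv[OF g])
  have 2: "has_weak_deriv (\<lambda>x. - k x) (weak_deriv (\<lambda>x. - k x))"
    by (rule has_weak_deriv_weak_deriv[OF has_weak_deriv_minus[OF g]])
  show ?thesis using has_weak_deriv_unique_AE[OF 2 has_weak_deriv_minus[OF 1]] 1 2
    by (auto simp: has_weak_deriv_def)
next
  case False
  then have "has_weak_deriv k = (\<lambda>_. False)" by auto
  moreover have "has_weak_deriv (\<lambda>x. - k x) = (\<lambda>_. False)"
    using False has_weak_deriv_minus[of "\<lambda>x. - k x"] by auto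
  ultimately show ?thesis by (simp add: weak_deriv_def)
qed

lemma L2_sq_weak_deriv_minus:
  fixes k :: "real \<Rightarrow> 'b::euclidean_space"
  shows "L2_sq (weak_deriv (\<lambda>x. - k x)) = L2_sq (weak_deriv k)"
  using weak_deriv_minus_cases[of k]
proof (elim disjE conjE)
  assume "AE x in lborel. weak_deriv (\<lambda>x. - k x) x = - weak_deriv k x"
  then have "L2_sq (weak_deriv (\<lambda>x. - k x)) = L2_sq (\<lambda>x. - weak_deriv k x)" by (rule L2_sq_cong_AE)
  then show ?thesis by (simp only: L2_sq_minus)
qed simp

lemma H1_norm_minus:
  fixes k :: "real \<Rightarrow> 'b::euclidean_space"
  shows "H1_norm s (\<lambda>x. - k x) = H1_norm s k"
proof -
  have "H_seminorm_sq s (weak_deriv (\<lambda>x. - k x)) = H_seminorm_sq s (weak_deriv k)"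
    using weak_deriv_minus_cases[of k]
  proof (elim disjE conjE)
    assume L: "weak_deriv k \<in> L2_circle" "weak_deriv (\<lambda>x. - k x) \<in> L2_circle"
      and ae: "AE x in lborel. weak_deriv (\<lambda>x. - k x) x = - weak_deriv k x"
    have "has_weak_deriv (weak_deriv (\<lambda>x. - k x)) h \<longleftrightarrow> has_weak_deriv (\<lambda>x. - weak_deriv k x) h" for h
      by (rule has_weak_deriv_cong_left[OF ae L(2) L2_circle_minus[OF L(1)]])
    then have "weak_deriv (weak_deriv (\<lambda>x. - k x)) = weak_deriv (\<lambda>x. - weak_deriv k x)"
      by (simp add: weak_deriv_def)
    then show ?thesis
      using gagliardo_sq_cong_AE[OF L(2)[THEN L2_circle_measurable] L2_circle_minus[OF L(1), THEN L2_circle_measurable] ae, of s] L2_sq_weak_deriv_minus[of "weak_deriv k"]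
      by (simp add: H_seminorm_sq_def gagliardo_sq_minus)
  qed simp
  then show ?thesis by (simp add: H1_norm_def L2_sq_minus L2_sq_weak_deriv_minus)
qed

lemma Metric_space_H1:
  assumes s: "s \<le> 1"
  shows "Metric_space (H1_circle s) (\<lambda>f g :: real \<Rightarrow> 'b::euclidean_space. H1_norm s (\<lambda>x. f x - g x))"
proof
  fix f g h :: "real \<Rightarrow> 'b"
  show "0 \<le> H1_norm s (\<lambda>x. f x - g x)" by (rule H1_norm_nonneg)
  show "H1_norm s (\<lambda>x. f x - g x) = H1_norm s (\<lambda>x. g x - f x)"
    using H1_norm_minus[of s "\<lambda>x. f x - g x"] by simp
  assume f: "f \<in> H1_circle s" and g: "g \<in> H1_circle s"
  note d = H1_circle_diff[OF s f g]
  show "H1_norm s (\<lambda>x. f x - g x) = 0 \<longleftrightarrow> f = g"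
  proof
    assume "H1_norm s (\<lambda>x. f x - g x) = 0"
    from H1_norm_eq_0_imp[OF d this] show "f = g" by auto
  next
    assume "f = g"
    have "primitive_of (\<lambda>_::real. 0::'b) (\<lambda>_. 0)" by (rule primitive_of_C1) auto
    moreover have z: "(\<lambda>_. 0::'b) \<in> L2_circle" by (rule continuous_periodic_L2_circle) auto
    ultimately have w: "has_weak_deriv (\<lambda>_. 0::'b) (\<lambda>_. 0)" by (intro primitive_has_weak_deriv) auto
    have g0: "gagliardo_sq s (\<lambda>_. 0::'b) = 0" "L2_sq (\<lambda>_. 0::'b) = 0" by (auto simp: gagliardo_sq_def L2_sq_def)
    have h: "(\<lambda>_. 0::'b) \<in> H_circle s" using z w g0 by (auto simp: H_circle_def)
    have "H_seminorm_sq s (\<lambda>_. 0::'b) = 0"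
      using s g0 H_seminorm_sq_1[OF w] by (cases "s < 1") (auto simp: H_seminorm_sq_def)
    then show "H1_norm s (\<lambda>x. f x - g x) = 0"
      using H1_norm_eq_energy[OF w h] g0 \<open>f = g\<close> by (simp add: H1_energy_def)
  qed
  assume h: "h \<in> H1_circle s"
  show "H1_norm s (\<lambda>x. f x - h x) \<le> H1_norm s (\<lambda>x. f x - g x) + H1_norm s (\<lambda>x. g x - h x)"
    using H1_circle_add(2)[OF s d H1_circle_diff[OF s g h]] by simp
qed

section \<open>The embedding of \<open>H\<^sup>1\<^sup>+\<^sup>s\<close> into \<open>C\<^sup>1\<close>\<close>

text \<open>Jensen's inequality for the square, by Cauchy-Schwarz against the indicator of the
  interval.\<close>

lemma norm_minus_average_sq_le:
  fixes h :: "real \<Rightarrow> 'b::euclidean_space"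
  assumes h: "h absolutely_integrable_on {a..b}" and [measurable]: "h \<in> borel_measurable borel" and ab: "a < b"
  shows "ennreal ((norm (c - (1/(b-a)) *\<^sub>R integral {a..b} h))\<^sup>2)
    \<le> ennreal (1/(b-a)) * (\<integral>\<^sup>+x\<in>{a..b}. ennreal ((norm (c - h x))\<^sup>2) \<partial>lborel)"
proof -
  let ?k = "\<lambda>x. c - h x"
  let ?I = "integral {a..b} (\<lambda>x. norm (?k x))"
  have ka: "?k absolutely_integrable_on {a..b}"
    by (intro set_integral_diff h absolutely_integrable_continuous_real) auto
  have ki: "?k integrable_on {a..b}" "(\<lambda>x. norm (?k x)) integrable_on {a..b}" and hi: "h integrable_on {a..b}"
    using ka h unfolding absolutely_integrable_on_def by auto
  have "c - (1/(b-a)) *\<^sub>R integral {a..b} h = (1/(b-a)) *\<^sub>R integral {a..b} ?k"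
    using ab hi by (subst integral_diff) (auto simp: scaleR_diff_right)
  then have "norm (c - (1/(b-a)) *\<^sub>R integral {a..b} h) \<le> (1/(b-a)) * ?I"
    using ab integral_norm_bound_integral[OF ki(1,2)] by (simp add: divide_right_mono)
  then have "(norm (c - (1/(b-a)) *\<^sub>R integral {a..b} h))\<^sup>2 \<le> ((1/(b-a)) * ?I)\<^sup>2" by (intro power_mono) auto
  then have "ennreal ((norm (c - (1/(b-a)) *\<^sub>R integral {a..b} h))\<^sup>2) \<le> ennreal ((1/(b-a))\<^sup>2 * ?I\<^sup>2)"
    by (intro ennreal_leI) (simp add: power_mult_distrib power_divide)
  also have "\<dots> = ennreal ((1/(b-a))\<^sup>2) * (ennreal ?I)\<^sup>2"
    using ki(2) by (simp add: ennreal_mult' ennreal_power integral_nonneg)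
  also have "ennreal ?I = (\<integral>\<^sup>+x\<in>{a..b}. ennreal (norm (?k x)) \<partial>lborel)"
  proof -
    have si: "set_integrable lborel {a..b} (\<lambda>x. norm (?k x))"
      using absolutely_integrable_norm[OF ka] by (subst borel_absolutely_integrable_iff[symmetric]) (auto simp: o_def)
    have "ennreal ?I = ennreal (LINT x|lborel. indicator {a..b} x * norm (?k x))"
      using set_borel_integral_eq_integral(2)[OF si] by (simp add: set_lebesgue_integral_def)
    also have "\<dots> = (\<integral>\<^sup>+x. ennreal (indicator {a..b} x * norm (?k x)) \<partial>lborel)"
      using si by (intro nn_integral_eq_integral[symmetric]) (auto simp: set_integrable_def)
    also have "\<dots> = (\<integral>\<^sup>+x\<in>{a..b}. ennreal (norm (?k x)) \<partial>lborel)"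
      by (intro nn_integral_cong) (auto split: split_indicator)
    finally show ?thesis .
  qed
  also have "\<dots>\<^sup>2 = (\<integral>\<^sup>+x. indicator {a..b} x * ennreal (norm (?k x)) \<partial>lborel)\<^sup>2"
    by (simp add: mult.commute)
  also have "\<dots> = (\<integral>\<^sup>+x. indicator {a..b} x * (ennreal (norm (?k x)) * indicator {a..b} x) \<partial>lborel)\<^sup>2"
    by (intro arg_cong[where f = "\<lambda>x. x\<^sup>2"] nn_integral_cong) (auto split: split_indicator)
  also have "\<dots> \<le> (\<integral>\<^sup>+x. (indicator {a..b} x)\<^sup>2 \<partial>lborel) * (\<integral>\<^sup>+x. (ennreal (norm (?k x)) * indicator {a..b} x)\<^sup>2 \<partial>lborel)"
    by (rule Cauchy_Schwarz_nn_integral) auto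
  also have "(\<integral>\<^sup>+x. (indicator {a..b} x)\<^sup>2 \<partial>lborel) = (\<integral>\<^sup>+x. indicator {a..b} x \<partial>lborel)"
    by (intro nn_integral_cong) (auto split: split_indicator)
  also have "\<dots> = ennreal (b - a)" using ab by simp
  also have "(\<integral>\<^sup>+x. (ennreal (norm (?k x)) * indicator {a..b} x)\<^sup>2 \<partial>lborel)
      = (\<integral>\<^sup>+x\<in>{a..b}. ennreal ((norm (?k x))\<^sup>2) \<partial>lborel)"
    by (intro nn_integral_cong) (auto simp: ennreal_power split: split_indicator)
  also have "ennreal ((1/(b-a))\<^sup>2) * (ennreal (b - a) * (\<integral>\<^sup>+x\<in>{a..b}. ennreal ((norm (?k x))\<^sup>2) \<partial>lborel))
      = ennreal (1/(b-a)) * (\<integral>\<^sup>+x\<in>{a..b}. ennreal ((norm (?k x))\<^sup>2) \<partial>lborel)"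
  proof -
    have "(1/(b-a))\<^sup>2 * (b - a) = 1/(b-a)" using ab by (simp add: power2_eq_square)
    then have "ennreal ((1/(b-a))\<^sup>2) * ennreal (b - a) = ennreal (1/(b-a))"
      using ab by (metis ennreal_mult' diff_ge_0_iff_ge less_imp_le mult.commute zero_le_power2)
    then show ?thesis by (simp add: mult.assoc[symmetric])
  qed
  finally show ?thesis by (simp add: mult_left_mono)
qed

text \<open>The two difference quotients are the averages of \<open>g\<close> over \<open>[x, x+r]\<close> and \<open>[x, x+r/2]\<close>.
  Jensen's inequality, applied to both, bounds the square of their difference by \<open>2 / r\<^sup>2\<close> times
  the integral of \<open>\<bar>g a - g b\<bar>\<^sup>2\<close> over pairs at distance at most \<open>r\<close>. On these pairs the Gagliardo
  kernel is at least \<open>r\<close> to the power \<open>-(1 + 2 s)\<close>.\<close>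

lemma morrey_step:
  fixes f g :: "real \<Rightarrow> 'b::euclidean_space"
  assumes F: "primitive_of f g" and g: "g \<in> L2_circle" and s: "0 < s" and r: "0 < r" "r \<le> 1/2"
  shows "ennreal ((norm ((1/r) *\<^sub>R (f (x + r) - f x) - (1/(r/2)) *\<^sub>R (f (x + r/2) - f x)))\<^sup>2)
    \<le> ennreal (2 * r powr (2 * s - 1)) * gagliardo_sq s g"
proof -
  have [measurable]: "g \<in> borel_measurable borel" by (rule L2_circle_measurable[OF g])
  define q where "q u = (\<integral>\<^sup>+w\<in>{-1/2..1/2}. ennreal ((norm (g (u + w) - g u))\<^sup>2 / \<bar>w\<bar> powr (1 + 2 * s)) \<partial>lborel)" for u
  have [measurable]: "q \<in> borel_measurable borel" unfolding q_def by measurable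
  have qper: "q (u + 1) = q u" for u
  proof -
    have "g (u + 1 + w) = g (u + w)" for w using L2_circle_periodic[OF g, of "u + w"] by (simp add: add_ac)
    then show ?thesis unfolding q_def using L2_circle_periodic[OF g] by simp
  qed
  have gag: "gagliardo_sq s g = (\<integral>\<^sup>+u\<in>{0..1}. q u \<partial>lborel)" unfolding gagliardo_sq_def q_def ..
  note gi = L2_circle_absolutely_integrable[OF g]
  let ?A = "(1/r) *\<^sub>R (f (x + r) - f x)"
  have intA: "integral {x..x+t} g = f (x + t) - f x" if "t > 0" for t
    using primitive_of_has_integral[OF F, of x "x + t"] that by (simp add: integral_unique)
  have inner: "ennreal ((norm (?A - g b))\<^sup>2) \<le> ennreal (r powr (2 * s)) * q b" if b: "b \<in> {x..x+r/2}" for b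
  proof -
    have "ennreal ((norm (?A - g b))\<^sup>2) = ennreal ((norm (g b - (1/(x + r - x)) *\<^sub>R integral {x..x+r} g))\<^sup>2)"
      using intA[OF r(1)] by (simp add: norm_minus_commute)
    also have "\<dots> \<le> ennreal (1/(x+r-x)) * (\<integral>\<^sup>+a\<in>{x..x+r}. ennreal ((norm (g b - g a))\<^sup>2) \<partial>lborel)"
      by (rule norm_minus_average_sq_le[OF gi]) (use r in auto)
    also have "(\<integral>\<^sup>+a\<in>{x..x+r}. ennreal ((norm (g b - g a))\<^sup>2) \<partial>lborel)
        = (\<integral>\<^sup>+w\<in>{x-b..x+r-b}. ennreal ((norm (g b - g (w + b)))\<^sup>2) \<partial>lborel)"
      by (subst nn_integral_shift_interval[of _ _ _ b]) auto
    also have "\<dots> \<le> (\<integral>\<^sup>+w. ennreal (r powr (1 + 2 * s)) *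
        (ennreal ((norm (g (b + w) - g b))\<^sup>2 / \<bar>w\<bar> powr (1 + 2 * s)) * indicator {-1/2..1/2} w) \<partial>lborel)"
    proof (rule nn_integral_mono)
      fix w :: real
      show "ennreal ((norm (g b - g (w + b)))\<^sup>2) * indicator {x-b..x+r-b} w
        \<le> ennreal (r powr (1 + 2 * s)) * (ennreal ((norm (g (b + w) - g b))\<^sup>2 / \<bar>w\<bar> powr (1 + 2 * s)) * indicator {-1/2..1/2} w)"
      proof (cases "w \<in> {x-b..x+r-b} \<and> w \<noteq> 0")
        case True
        then have w: "\<bar>w\<bar> \<le> r" "w \<in> {-1/2..1/2}" using b r by auto
        have "(norm (g (b + w) - g b))\<^sup>2 * (\<bar>w\<bar> powr (1 + 2 * s)) \<le> (norm (g (b + w) - g b))\<^sup>2 * (r powr (1 + 2 * s))"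
          using w s by (intro mult_left_mono powr_mono2) auto
        then have "(norm (g (b + w) - g b))\<^sup>2 \<le> r powr (1 + 2 * s) * ((norm (g (b + w) - g b))\<^sup>2 / \<bar>w\<bar> powr (1 + 2 * s))"
          using True by (simp add: field_simps)
        then have "ennreal ((norm (g (b + w) - g b))\<^sup>2) \<le> ennreal (r powr (1 + 2 * s)) * ennreal ((norm (g (b + w) - g b))\<^sup>2 / \<bar>w\<bar> powr (1 + 2 * s))"
          by (subst ennreal_mult[symmetric]) (auto intro: ennreal_leI)
        then show ?thesis using w True by (simp add: norm_minus_commute add.commute)
      qed (auto split: split_indicator)
    qed
    also have "\<dots> = ennreal (r powr (1 + 2 * s)) * q b" unfolding q_def by (rule nn_integral_cmult) simp
    also have "ennreal (1/(x+r-x)) * (ennreal (r powr (1 + 2 * s)) * q b) = ennreal (r powr (2 * s)) * q b"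
      using r by (simp add: mult.assoc[symmetric] ennreal_mult[symmetric] powr_add)
    finally show ?thesis by (simp add: mult_left_mono)
  qed
  have "ennreal ((norm (?A - (1/(r/2)) *\<^sub>R (f (x + r/2) - f x)))\<^sup>2)
      = ennreal ((norm (?A - (1/(x + r/2 - x)) *\<^sub>R integral {x..x+r/2} g))\<^sup>2)"
    using intA[of "r/2"] r by simp
  also have "\<dots> \<le> ennreal (1/(x+r/2-x)) * (\<integral>\<^sup>+b\<in>{x..x+r/2}. ennreal ((norm (?A - g b))\<^sup>2) \<partial>lborel)"
    by (rule norm_minus_average_sq_le[OF gi]) (use r in auto)
  also have "(\<integral>\<^sup>+b\<in>{x..x+r/2}. ennreal ((norm (?A - g b))\<^sup>2) \<partial>lborel)
      \<le> (\<integral>\<^sup>+b. ennreal (r powr (2 * s)) * (q b * indicator {x..x+1} b) \<partial>lborel)"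
    by (intro nn_integral_mono) (use inner r in \<open>auto split: split_indicator\<close>)
  also have "\<dots> = ennreal (r powr (2 * s)) * gagliardo_sq s g"
    by (simp add: nn_integral_cmult nn_integral_period qper gag)
  also have "ennreal (1/(x+r/2-x)) * (ennreal (r powr (2 * s)) * gagliardo_sq s g)
      = ennreal (2 * r powr (2 * s - 1)) * gagliardo_sq s g"
    using r by (simp add: mult.assoc[symmetric] ennreal_mult[symmetric] powr_diff)
  finally show ?thesis by (simp add: mult_left_mono)
qed

text \<open>Telescoping \<open>morrey_step\<close> over the scales \<open>r / 2 ^ n\<close> gives a geometric series with ratio
  \<open>(1/2) powr (s - 1/2)\<close>, and the difference quotients converge to \<open>T x\<close>.\<close>

lemma morrey_estimate:
  fixes f g :: "real \<Rightarrow> 'b::euclidean_space"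
  assumes F: "primitive_of f g" and g: "g \<in> L2_circle" and s: "1/2 < s"
    and fin: "gagliardo_sq s g < \<infinity>"
    and der: "\<And>x. (f has_vector_derivative T x) (at x)"
    and r: "0 < r" "r \<le> 1/2"
  shows "norm ((1/r) *\<^sub>R (f (x + r) - f x) - T x)
    \<le> sqrt (2 * enn2real (gagliardo_sq s g)) * r powr (s - 1/2) / (1 - (1/2) powr (s - 1/2))"
proof -
  define E where "E = enn2real (gagliardo_sq s g)"
  have E: "gagliardo_sq s g = ennreal E" "E \<ge> 0" using fin by (auto simp: E_def)
  define A where "A \<rho> = (1/\<rho>) *\<^sub>R (f (x + \<rho>) - f x)" for \<rho>
  define \<theta> :: real where "\<theta> = (1/2) powr (s - 1/2)"
  have \<theta>: "0 < \<theta>" "\<theta> < 1" using s by (auto simp: \<theta>_def powr_def ln_div mult_less_0_iff mult_pos_neg)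
  define K where "K = sqrt (2 * E) * r powr (s - 1/2)"
  have K: "K \<ge> 0" using E by (simp add: K_def)
  have step: "norm (A \<rho> - A (\<rho>/2)) \<le> sqrt (2 * E) * \<rho> powr (s - 1/2)" if "0 < \<rho>" "\<rho> \<le> 1/2" for \<rho>
  proof -
    have "ennreal ((norm (A \<rho> - A (\<rho>/2)))\<^sup>2) \<le> ennreal (2 * \<rho> powr (2 * s - 1)) * ennreal E"
      using morrey_step[OF F g _ that, of s x] s by (simp add: A_def E(1))
    then have "(norm (A \<rho> - A (\<rho>/2)))\<^sup>2 \<le> (2 * E) * \<rho> powr (2 * s - 1)"
      using E(2) by (subst (asm) ennreal_mult[symmetric]) (auto simp: mult.commute mult.left_commute)
    then have "norm (A \<rho> - A (\<rho>/2)) \<le> sqrt ((2 * E) * \<rho> powr (2 * s - 1))" by (rule real_le_rsqrt)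
    also have "\<dots> = sqrt (2 * E) * \<rho> powr (s - 1/2)"
    proof -
      have "\<rho> powr (2 * s - 1) = (\<rho> powr (s - 1/2))\<^sup>2"
        by (simp add: power2_eq_square powr_add[symmetric] algebra_simps)
      then show ?thesis by (simp add: real_sqrt_mult)
    qed
    finally show ?thesis .
  qed
  have tele: "norm (A r - A (r / 2^n)) \<le> K * (\<Sum>k<n. \<theta>^k)" for n
  proof (induction n)
    case (Suc n)
    have rn: "0 < r / 2^n" "r / 2^n \<le> 1/2"
      using r by (auto simp: field_simps) (smt (verit) one_le_power)
    have "norm (A (r / 2^n) - A (r / 2^n / 2)) \<le> sqrt (2 * E) * (r / 2^n) powr (s - 1/2)"
      by (rule step[OF rn])
    also have "(r / 2^n) powr (s - 1/2) = r powr (s - 1/2) * \<theta>^n"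
    proof -
      have "(r / 2^n) = r * (1/2)^n" by (simp add: power_divide)
      then show ?thesis using r
        by (simp add: powr_mult \<theta>_def powr_realpow[symmetric] powr_powr mult.commute)
    qed
    finally have "norm (A (r / 2^n) - A (r / 2^Suc n)) \<le> K * \<theta>^n" by (simp add: K_def mult_ac)
    moreover have "norm (A r - A (r / 2^Suc n)) \<le> norm (A r - A (r / 2^n)) + norm (A (r / 2^n) - A (r / 2^Suc n))"
      using norm_triangle_ineq[of "A r - A (r / 2^n)" "A (r / 2^n) - A (r / 2^Suc n)"] by simp
    ultimately show ?case using Suc by (simp add: distrib_left)
  qed simp
  have "K * (\<Sum>k<n. \<theta>^k) \<le> K / (1 - \<theta>)" for n
  proof -
    have "(\<Sum>k<n. \<theta>^k) = (1 - \<theta>^n) / (1 - \<theta>)" using \<theta> by (subst sum_gp_strict) auto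
    also have "\<dots> \<le> 1 / (1 - \<theta>)" using \<theta> by (intro divide_right_mono) auto
    finally show ?thesis using mult_left_mono[OF _ K] by fastforce
  qed
  then have bd: "norm (A r - A (r / 2^n)) \<le> K / (1 - \<theta>)" for n using tele order_trans by blast
  have "(\<lambda>n. A (r / 2^n)) \<longlonglongrightarrow> T x"
  proof -
    have "((\<lambda>h. (1/h) *\<^sub>R (f (x + h) - f x)) \<longlongrightarrow> T x) (at 0)"
    proof -
      have "((\<lambda>h. norm (f (x + h) - f x - h *\<^sub>R T x) / norm h) \<longlongrightarrow> 0) (at 0)"
        using der[of x] by (simp add: has_vector_derivative_def has_derivative_at)
      then have "((\<lambda>h. norm ((1/h) *\<^sub>R (f (x + h) - f x) - T x)) \<longlongrightarrow> 0) (at 0)"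
      proof (rule Lim_transform_eventually)
        have "norm (f (x + h) - f x - h *\<^sub>R T x) / norm h = norm ((1/h) *\<^sub>R (f (x + h) - f x) - T x)"
          if "h \<noteq> 0" for h
        proof -
          have "(1/h) *\<^sub>R (f (x + h) - f x) - T x = (1/h) *\<^sub>R (f (x + h) - f x - h *\<^sub>R T x)"
            using that by (simp add: scaleR_diff_right)
          then show ?thesis by (simp add: divide_inverse mult.commute)
        qed
        then show "\<forall>\<^sub>F h in at 0. norm (f (x + h) - f x - h *\<^sub>R T x) / norm h = norm ((1/h) *\<^sub>R (f (x + h) - f x) - T x)"
          by (simp add: eventually_at_filter)
      qed
      then show ?thesis by (simp add: tendsto_norm_zero_iff LIM_zero_iff)
    qed
    moreover have "filterlim (\<lambda>n. r / 2^n) (at 0) sequentially"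
    proof (rule filterlim_atI)
      show "(\<lambda>n. r / 2^n) \<longlonglongrightarrow> 0"
        using tendsto_mult_right_zero[OF LIMSEQ_power_zero[of "1/2::real"], of r] by (simp add: power_divide)
    qed (use r in auto)
    ultimately show ?thesis unfolding A_def by (rule filterlim_compose)
  qed
  then have "(\<lambda>n. norm (A r - A (r / 2^n))) \<longlonglongrightarrow> norm (A r - T x)" by (intro tendsto_intros)
  then have "norm (A r - T x) \<le> K / (1 - \<theta>)" by (rule LIMSEQ_le_const2) (use bd in auto)
  then show ?thesis by (simp add: A_def K_def \<theta>_def E_def)
qed

lemma primitive_of_cong_AE:
  assumes F: "primitive_of f g" and ae: "AE x in lborel. g x = g' x"
    and "\<And>a b. g' absolutely_integrable_on {a..b}"
  shows "primitive_of f g'"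
proof (rule primitive_ofI[OF assms(3)])
  fix a b :: real assume "a \<le> b"
  have "AE x\<in>{a..b} in lborel. g x = g' x" using ae by (auto elim: eventually_mono)
  from has_integral_AE[OF this] show "integral {a..b} g' = f b - f a"
    using primitive_of_has_integral[OF F \<open>a \<le> b\<close>] by (simp add: integral_unique)
qed

lemma primitive_of_continuous_density:
  fixes f :: "real \<Rightarrow> 'b::euclidean_space"
  assumes F: "primitive_of f g" and g: "continuous_on UNIV g"
  shows "(f has_vector_derivative g x) (at x)"
proof -
  have "((\<lambda>u. integral {x-1..u} g) has_vector_derivative g x) (at x within {x-1..x+1})"
    by (rule integral_has_vector_derivative) (use g continuous_on_subset in auto)
  then have "((\<lambda>u. f (x-1) + integral {x-1..u} g) has_vector_derivative g x) (at x within {x-1..x+1})"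
    by (auto intro!: derivative_eq_intros)
  moreover have "f (x-1) + integral {x-1..u} g = f u" if "u \<in> {x-1..x+1}" for u
    using primitive_of_has_integral[OF F, of "x-1" u] that by (auto simp: integral_unique)
  ultimately have "(f has_vector_derivative g x) (at x within {x-1..x+1})"
    by (intro has_vector_derivative_transform[of x "{x-1..x+1}" f]) auto
  then show ?thesis by (subst (asm) at_within_interior) auto
qed

text \<open>The case \<open>c = 0\<close> of Jensen's inequality; an interval of length at most \<open>1\<close> is covered by
  one period.\<close>

lemma norm_integral_sq_le:
  fixes g :: "real \<Rightarrow> 'b::euclidean_space"
  assumes g: "g \<in> L2_circle" and ab: "a < b" "b \<le> a + 1"
  shows "ennreal ((norm (integral {a..b} g))\<^sup>2) \<le> L2_sq g"
proof -
  have [measurable]: "g \<in> borel_measurable borel" by (rule L2_circle_measurable[OF g])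
  let ?I = "integral {a..b} g"
  have "ennreal ((norm ?I)\<^sup>2) = ennreal ((b-a)\<^sup>2) * ennreal ((norm (0 - (1/(b-a)) *\<^sub>R ?I))\<^sup>2)"
    using ab by (simp add: ennreal_mult[symmetric] power_mult_distrib[symmetric])
  also have "\<dots> \<le> ennreal ((b-a)\<^sup>2) * (ennreal (1/(b-a)) * (\<integral>\<^sup>+x\<in>{a..b}. ennreal ((norm (0 - g x))\<^sup>2) \<partial>lborel))"
    by (intro mult_left_mono norm_minus_average_sq_le L2_circle_absolutely_integrable g) (use ab in auto)
  also have "\<dots> = ennreal (b-a) * (\<integral>\<^sup>+x\<in>{a..b}. ennreal ((norm (g x))\<^sup>2) \<partial>lborel)"
    using ab by (simp add: mult.assoc[symmetric] ennreal_mult[symmetric] power2_eq_square)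
  also have "\<dots> \<le> 1 * (\<integral>\<^sup>+x\<in>{a..a+1}. ennreal ((norm (g x))\<^sup>2) \<partial>lborel)"
    using ab by (intro mult_mono nn_integral_mono) (auto split: split_indicator simp: ennreal_leI simp flip: ennreal_1)
  also have "\<dots> = L2_sq g" using L2_sq_period[OF g] by simp
  finally show ?thesis .
qed

text \<open>By \<open>morrey_estimate\<close> the tangent is the uniform limit of difference quotients, which are
  continuous. Its size is that of the quotient at \<open>r = 1/2\<close>, controlled by \<open>\<integral> \<bar>g\<bar>\<^sup>2\<close>, plus the
  error of the estimate at this scale.\<close>

lemma H1_derivative_fractional:
  fixes f g :: "real \<Rightarrow> 'b::euclidean_space"
  assumes s: "1/2 < s" "s < 1" and F: "primitive_of f g" and g: "g \<in> H_circle s"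
    and der: "\<And>x. (f has_vector_derivative T x) (at x)"
  shows "continuous_on UNIV T"
    and "norm (T x) \<le> (2 + 2 / (1 - (1/2) powr (s - 1/2))) * sqrt (enn2real (L2_sq g + gagliardo_sq s g))"
proof -
  define G where "G = enn2real (gagliardo_sq s g)"
  define E where "E = enn2real (L2_sq g + gagliardo_sq s g)"
  have gL: "g \<in> L2_circle" and fin: "gagliardo_sq s g < \<infinity>" using g s by (auto simp: H_circle_def)
  have finL: "L2_sq g < \<infinity>" using gL by (simp add: L2_circle_def)
  define q :: real where "q = 1 - (1/2) powr (s - 1/2)"
  have q: "q > 0" using s by (auto simp: q_def powr_def ln_div mult_less_0_iff mult_pos_neg)
  note est = morrey_estimate[OF F gL s(1) fin der, folded G_def q_def]
  have GE: "0 \<le> G" "G \<le> E" "enn2real (L2_sq g) \<le> E"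
    using fin finL by (auto simp: G_def E_def intro!: enn2real_mono)
  define A where "A r x = (1/r) *\<^sub>R (f (x + r) - f x)" for r x
  have "uniform_limit UNIV (\<lambda>n x. A (1 / (real n + 2)) x) T sequentially"
  proof (rule uniform_limitI)
    fix e :: real assume "e > 0"
    have lim: "(\<lambda>n. (1 / (real n + 2)) powr (s - 1/2)) \<longlonglongrightarrow> 0"
    proof (rule tendsto_zero_powrI[where b = "s - 1/2"])
      show "(\<lambda>n. 1 / (real n + 2)) \<longlonglongrightarrow> 0"
        using LIMSEQ_ignore_initial_segment[OF lim_1_over_n, of 2] by (simp add: add.commute)
    qed (use s in auto)
    have "(\<lambda>n. sqrt (2 * G) * (1 / (real n + 2)) powr (s - 1/2) / q) \<longlonglongrightarrow> sqrt (2 * G) * 0 / q"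
      using q by (intro tendsto_intros lim) auto
    then have "eventually (\<lambda>n. sqrt (2 * G) * (1 / (real n + 2)) powr (s - 1/2) / q < e) sequentially"
      using \<open>e > 0\<close> by (intro order_tendstoD(2)) auto
    then show "\<forall>\<^sub>F n in sequentially. \<forall>x\<in>UNIV. dist (A (1 / (real n + 2)) x) (T x) < e"
    proof eventually_elim
      case (elim n)
      have "dist (A (1 / (real n + 2)) x) (T x) \<le> sqrt (2 * G) * (1 / (real n + 2)) powr (s - 1/2) / q" for x
        unfolding A_def dist_norm by (rule est) auto
      then show ?case using elim by (meson le_less_trans)
    qed
  qed
  moreover have "continuous_on UNIV (A r)" for r
    unfolding A_def using primitive_of_continuous[OF F]
    by (intro continuous_intros continuous_on_compose2[OF primitive_of_continuous[OF F]]) auto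
  ultimately show "continuous_on UNIV T" by (intro uniform_limit_theorem) auto
  have "ennreal ((norm (f (x + 1/2) - f x))\<^sup>2) \<le> ennreal (enn2real (L2_sq g))"
    using norm_integral_sq_le[OF gL, of x "x + 1/2"] primitive_of_has_integral[OF F, of x "x + 1/2"] finL
    by (simp add: integral_unique)
  then have "(norm (f (x + 1/2) - f x))\<^sup>2 \<le> E" using GE(3) by (subst (asm) ennreal_le_iff) auto
  then have 1: "norm (A (1/2) x) \<le> 2 * sqrt E" by (simp add: A_def real_le_rsqrt)
  have "norm (A (1/2) x - T x) \<le> sqrt (2 * G) * (1/2) powr (s - 1/2) / q"
    unfolding A_def by (rule est) auto
  also have "\<dots> \<le> sqrt (4 * E) * 1 / q"
    using GE q s by (intro divide_right_mono mult_mono real_sqrt_le_mono) (auto simp: q_def)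
  also have "\<dots> = 2 / q * sqrt E" by (simp add: real_sqrt_mult)
  finally have "norm (T x) \<le> 2 * sqrt E + 2 / q * sqrt E"
    using 1 norm_triangle_sub[of "T x" "A (1/2) x"] by (simp add: norm_minus_commute)
  then show "norm (T x) \<le> (2 + 2 / (1 - (1/2) powr (s - 1/2))) * sqrt (enn2real (L2_sq g + gagliardo_sq s g))"
    by (simp add: E_def q_def distrib_right)
qed

text \<open>For \<open>s = 1\<close> the tangent is itself absolutely continuous, with density \<open>g2\<close>. It has mean
  zero over a period since \<open>f\<close> closes up, so it is nowhere larger than its oscillation, which
  Cauchy-Schwarz bounds by the norm of \<open>g2\<close>.\<close>

lemma H1_derivative_integer:
  fixes f g g2 :: "real \<Rightarrow> 'b::euclidean_space"
  assumes F: "primitive_of f g" "\<And>x. f (x + 1) = f x" and g: "has_weak_deriv g g2"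
    and der: "\<And>x. (f has_vector_derivative T x) (at x)"
  shows "continuous_on UNIV T" and "norm (T x) \<le> sqrt (enn2real (L2_sq g2))"
proof -
  have gL: "g \<in> L2_circle" and g2L: "g2 \<in> L2_circle" using g by (auto simp: has_weak_deriv_def)
  obtain G where G: "primitive_of G g2" "\<And>x. G (x + 1) = G x" "AE x in lborel. g x = G x"
    using g by (rule has_weak_deriv_primitive) (rule that)
  have cG: "continuous_on UNIV G" by (rule primitive_of_continuous[OF G(1)])
  have cG': "continuous_on S G" for S using cG continuous_on_subset by blast
  have FG: "primitive_of f G"
    by (rule primitive_of_cong_AE[OF F(1) G(3)]) (intro absolutely_integrable_continuous_real cG')
  have TG: "T = G"
    using primitive_of_continuous_density[OF FG cG] der vector_derivative_unique_at by blast
  then show "continuous_on UNIV T" using cG by simp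
  have fin: "L2_sq g2 < \<infinity>" using g2L by (simp add: L2_circle_def)
  have inc: "norm (G y - G x) \<le> sqrt (enn2real (L2_sq g2))" if "x \<le> y" "y \<le> x + 1" for x y
  proof (cases "x = y")
    case False
    have "ennreal ((norm (G y - G x))\<^sup>2) \<le> ennreal (enn2real (L2_sq g2))"
      using norm_integral_sq_le[OF g2L, of x y] primitive_of_has_integral[OF G(1), of x y] that fin False
      by (simp add: integral_unique)
    then show ?thesis by (intro real_le_rsqrt) (simp add: ennreal_le_iff)
  qed simp
  have i: "G integrable_on {x..x+1}" for x by (intro integrable_continuous_real cG')
  have "integral {x..x+1} G = 0"
    using primitive_of_has_integral[OF FG, of x "x+1"] F(2) by (simp add: integral_unique)
  then have "G x = integral {x..x+1} (\<lambda>y. G x - G y)"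
    by (subst integral_diff) (use i in auto)
  also have "norm \<dots> \<le> integral {x..x+1} (\<lambda>y. sqrt (enn2real (L2_sq g2)))"
    by (rule integral_norm_bound_integral)
      (auto intro!: integrable_continuous_real continuous_intros cG' inc simp: norm_minus_commute[of "G x"])
  finally show "norm (T x) \<le> sqrt (enn2real (L2_sq g2))" using TG by simp
qed

lemma H1_derivative_continuous:
  fixes f :: "real \<Rightarrow> 'b::euclidean_space"
  assumes s: "1/2 < s" "s \<le> 1" and f: "f \<in> H1_circle s"
    and der: "\<And>x. (f has_vector_derivative T x) (at x)"
  shows "continuous_on UNIV T"
proof -
  obtain g where g: "continuous_on UNIV f" "g \<in> H_circle s" "has_weak_deriv f g" "primitive_of f g"
    "\<And>x. f (x + 1) = f x" using f by (rule H1_circleE) (rule that)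
  show ?thesis
  proof (cases "s < 1")
    case True
    then show ?thesis using H1_derivative_fractional(1)[OF s(1) True g(4,2) der] by blast
  next
    case False
    then obtain g2 where "has_weak_deriv g g2" using g(2) s by (auto simp: H_circle_def)
    then show ?thesis using H1_derivative_integer(1)[OF g(4,5) _ der] by blast
  qed
qed

lemma H1_derivative_bound:
  assumes s: "1/2 < s" "s \<le> 1"
  obtains C where "C > 0"
    "\<And>(f :: real \<Rightarrow> 'b::euclidean_space) T x. f \<in> H1_circle s \<Longrightarrow> (\<And>x. (f has_vector_derivative T x) (at x))
      \<Longrightarrow> norm (T x) \<le> C * H1_norm s f"
proof -
  define C where "C = (if s < 1 then 2 + 2 / (1 - (1/2) powr (s - 1/2)) else 1)"
  have q: "1 - (1/2) powr (s - 1/2) > 0" using s by (auto simp: powr_def ln_div mult_less_0_iff mult_pos_neg)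
  have C: "C > 0" using q by (auto simp: C_def intro!: add_pos_pos)
  have "norm (T x) \<le> C * H1_norm s f"
    if f: "f \<in> H1_circle s" and der: "\<And>x. (f has_vector_derivative T x) (at x)"
    for f :: "real \<Rightarrow> 'b" and T x
  proof -
    obtain g where g: "continuous_on UNIV f" "g \<in> H_circle s" "has_weak_deriv f g" "primitive_of f g"
      "\<And>x. f (x + 1) = f x" using f by (rule H1_circleE) (rule that)
    have fin: "H1_energy s f g < top" using H1_energy_finite[OF g(3,2)] by simp
    show ?thesis
    proof (cases "s < 1")
      case True
      have "norm (T x) \<le> C * sqrt (enn2real (L2_sq g + gagliardo_sq s g))"
        using H1_derivative_fractional(2)[OF s(1) True g(4,2) der] True by (simp add: C_def)
      also have "\<dots> \<le> C * H1_norm s f"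
        unfolding H1_norm_eq_energy[OF g(3,2)]
        using C fin True
        by (intro mult_left_mono real_sqrt_le_mono enn2real_mono) (auto simp: H1_energy_def H_seminorm_sq_def add.assoc)
      finally show ?thesis .
    next
      case False
      then have s1: "s = 1" using s by simp
      obtain g2 where g2: "has_weak_deriv g g2" using g(2) s1 by (auto simp: H_circle_def)
      have "norm (T x) \<le> C * sqrt (enn2real (L2_sq g2))"
        using H1_derivative_integer(2)[OF g(4,5) g2 der] s1 by (simp add: C_def)
      also have "\<dots> \<le> C * H1_norm s f"
        unfolding H1_norm_eq_energy[OF g(3,2)]
        using C fin unfolding s1
        by (intro mult_left_mono real_sqrt_le_mono enn2real_mono) (auto simp: H1_energy_def H_seminorm_sq_1[OF g2])
      finally show ?thesis .
    qed
  qed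
  then show ?thesis using C that by blast
qed

lemma curve_lipschitz_on:
  fixes \<gamma> T :: "real \<Rightarrow> 'b::euclidean_space"
  assumes S: "convex S" "x \<in> S" "y \<in> S"
    and d: "\<And>t. t \<in> S \<Longrightarrow> (\<gamma> has_vector_derivative T t) (at t)" and n: "\<And>t. t \<in> S \<Longrightarrow> norm (T t) \<le> B"
  shows "norm (\<gamma> x - \<gamma> y) \<le> B * \<bar>x - y\<bar>"
proof -
  have "onorm (\<lambda>h. h *\<^sub>R T t) \<le> B" if t: "t \<in> S" for t
  proof (rule onorm_bound)
    show "norm (h *\<^sub>R T t) \<le> B * norm h" for h
      using mult_right_mono[OF n[OF t], of "norm h"] by (simp add: mult.commute)
  qed (use order_trans[OF norm_ge_zero n[OF t]] in simp)
  then have "norm (\<gamma> x - \<gamma> y) \<le> B * norm (x - y)"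
    by (intro differentiable_bound[of S \<gamma> "\<lambda>t h. h *\<^sub>R T t"] S)
       (use d in \<open>auto simp: has_vector_derivative_def has_derivative_at_withinI\<close>)
  then show ?thesis by simp
qed

lemma curve_lipschitz:
  fixes \<gamma> T :: "real \<Rightarrow> 'b::euclidean_space"
  assumes "\<And>x. (\<gamma> has_vector_derivative T x) (at x)" and "\<And>x. norm (T x) \<le> B"
  shows "norm (\<gamma> x - \<gamma> y) \<le> B * \<bar>x - y\<bar>"
  by (rule curve_lipschitz_on[of UNIV]) (use assms in auto)

lemma chord_tangent_le:
  fixes K T :: "real \<Rightarrow> 'b::euclidean_space"
  assumes d: "\<And>x. (K has_vector_derivative T x) (at x)"
    and n: "\<And>t. t \<in> closed_segment y x \<Longrightarrow> norm (T t - \<tau>) \<le> \<delta>"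
  shows "norm (K x - K y - (x - y) *\<^sub>R \<tau>) \<le> \<delta> * \<bar>x - y\<bar>"
proof -
  have "norm ((K x - x *\<^sub>R \<tau>) - (K y - y *\<^sub>R \<tau>)) \<le> \<delta> * \<bar>x - y\<bar>"
    by (rule curve_lipschitz_on[of "closed_segment y x" x y "\<lambda>t. K t - t *\<^sub>R \<tau>" "\<lambda>t. T t - \<tau>"])
       (use n in \<open>auto intro!: derivative_eq_intros d\<close>)
  then show ?thesis by (simp add: algebra_simps)
qed

text \<open>A function differs from its mean over a period by at most the supremum of the
  derivative, and the mean is bounded by the \<open>L\<^sup>2\<close> norm.\<close>

lemma H1_sup_bound:
  assumes s: "1/2 < s" "s \<le> 1"
  obtains C where "C > 0"
    "\<And>(f :: real \<Rightarrow> 'b::euclidean_space) T x. f \<in> H1_circle s \<Longrightarrow> (\<And>x. (f has_vector_derivative T x) (at x))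
      \<Longrightarrow> norm (T x) \<le> C * H1_norm s f \<and> norm (f x) \<le> C * H1_norm s f"
proof -
  obtain C where C: "C > 0"
    "\<And>(f :: real \<Rightarrow> 'b) T x. f \<in> H1_circle s \<Longrightarrow> (\<And>x. (f has_vector_derivative T x) (at x))
      \<Longrightarrow> norm (T x) \<le> C * H1_norm s f" using H1_derivative_bound[OF s] by blast
  have "norm (T x) \<le> (C + 1) * H1_norm s f \<and> norm (f x) \<le> (C + 1) * H1_norm s f"
    if f: "f \<in> H1_circle s" and der: "\<And>x. (f has_vector_derivative T x) (at x)"
    for f :: "real \<Rightarrow> 'b" and T x
  proof -
    obtain g where g: "continuous_on UNIV f" "g \<in> H_circle s" "has_weak_deriv f g" "primitive_of f g"
      "\<And>x. f (x + 1) = f x" using f by (rule H1_circleE) (rule that)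
    let ?N = "H1_norm s f"
    have T: "norm (T x) \<le> C * ?N" for x by (rule C(2)[OF f der])
    have cf: "continuous_on S f" for S using g(1) continuous_on_subset by blast
    have fL: "f \<in> L2_circle" by (rule continuous_periodic_L2_circle[OF g(1,5)])
    have "norm (f x - f y) \<le> C * ?N" if "y \<in> {x..x+1}" for y
    proof -
      have "norm (f y - f x) \<le> C * ?N * \<bar>y - x\<bar>" by (rule curve_lipschitz[OF der T])
      also have "\<dots> \<le> C * ?N * 1" using that C(1) H1_norm_nonneg[of s f] by (intro mult_left_mono) auto
      finally show ?thesis by (simp add: norm_minus_commute)
    qed
    then have "norm (integral {x..x+1} (\<lambda>y. f x - f y)) \<le> integral {x..x+1} (\<lambda>y. C * ?N)"
      by (intro integral_norm_bound_integral) (auto intro!: integrable_continuous_real continuous_intros cf)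
    moreover have "integral {x..x+1} (\<lambda>y. f x - f y) = f x - integral {x..x+1} f"
      by (subst integral_diff) (auto intro!: integrable_continuous_real cf)
    ultimately have 1: "norm (f x - integral {x..x+1} f) \<le> C * ?N" by simp
    have "ennreal ((norm (integral {x..x+1} f))\<^sup>2) \<le> L2_sq f" by (rule norm_integral_sq_le[OF fL]) auto
    also have "\<dots> \<le> ennreal (?N\<^sup>2)" unfolding ennreal_H1_norm_sq[OF g(3,2)] H1_energy_def add.assoc
      by (rule add_increasing2) auto
    finally have "norm (integral {x..x+1} f) \<le> ?N"
      using H1_norm_nonneg[of s f] by (subst (asm) ennreal_le_iff) (auto intro: power2_le_imp_le)
    with 1 have "norm (f x) \<le> C * ?N + ?N"
      using norm_triangle_sub[of "f x" "integral {x..x+1} f"] by linarith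
    moreover have "norm (T x) \<le> C * ?N + ?N" using T[of x] H1_norm_nonneg[of s f] by linarith
    ultimately show ?thesis by (simp add: distrib_right)
  qed
  then show ?thesis using C(1) that[of "C + 1"] by force
qed

section \<open>Tangents of knots\<close>

text \<open>Being continuous, the classical tangent is a weak derivative, so it agrees almost
  everywhere with any other and inherits membership in \<^const>\<open>H_circle\<close>.\<close>

lemma knot_tangent:
  fixes \<gamma> :: "real \<Rightarrow> 'b::euclidean_space"
  assumes s: "1/2 < s" "s \<le> 1" and \<gamma>: "\<gamma> \<in> knots s"
  obtains T where "\<And>x. (\<gamma> has_vector_derivative T x) (at x)" "continuous_on UNIV T"
    "\<And>x. T (x + 1) = T x" "\<And>x. norm (T x) = 1" "T \<in> H_circle s" "integral {0..1} T = 0"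
    "\<And>x. \<gamma> (x + 1) = \<gamma> x"
proof -
  have f: "\<gamma> \<in> H1_circle s" using \<gamma> by (simp add: knots_def)
  obtain T where T: "\<And>x. (\<gamma> has_vector_derivative T x) (at x)" "\<And>x. norm (T x) = 1"
    using \<gamma> unfolding knots_def by (auto dest!: choice)
  have cT: "continuous_on UNIV T" by (rule H1_derivative_continuous[OF s f T(1)])
  obtain g where g: "continuous_on UNIV \<gamma>" "g \<in> H_circle s" "has_weak_deriv \<gamma> g" "primitive_of \<gamma> g"
    "\<And>x. \<gamma> (x + 1) = \<gamma> x" using f by (rule H1_circleE) (rule that)
  have "((\<lambda>x. \<gamma> (x + 1)) has_vector_derivative T (x + 1)) (at x)" for x
  proof -
    have "((\<lambda>x::real. x + 1) has_vector_derivative 1) (at x)" by (auto intro!: derivative_eq_intros)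
    from vector_diff_chain_at[OF this T(1)] show ?thesis by (simp add: o_def)
  qed
  then have perT: "T (x + 1) = T x" for x
    using T(1)[of x] g(5) vector_derivative_unique_at by (metis (no_types, lifting) ext)
  have pT: "primitive_of \<gamma> T" by (rule primitive_of_C1[OF T(1) cT])
  have TL: "T \<in> L2_circle" by (rule continuous_periodic_L2_circle[OF cT perT])
  have "AE x in lborel. g x = T x"
    by (rule primitive_of_unique_AE[OF g(4) pT])
       (use H_circle_L2[OF g(2)] TL L2_circle_measurable in auto)
  then have "T \<in> H_circle s" by (rule H_circle_cong_AE(1)[OF g(2) _ TL])
  moreover have "integral {0..1} T = 0"
    using primitive_of_has_integral[OF pT, of 0 1] g(5)[of 0] by (simp add: integral_unique)
  ultimately show ?thesis using that T cT perT g(5) by blast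
qed

section \<open>Ambient isotopies\<close>

lemma C1_on_imp_continuous_on:
  assumes "C1_on S f" shows "continuous_on S f"
  using assms unfolding C1_on_def by (auto intro: has_derivative_continuous_on)

lemma C1_on_compose:
  assumes f: "C1_on UNIV f" and g: "C1_on UNIV g" shows "C1_on UNIV (\<lambda>x. f (g x))"
proof -
  obtain Df where Df: "continuous_on UNIV Df" "\<And>x. (f has_derivative blinfun_apply (Df x)) (at x)"
    using f unfolding C1_on_def by auto
  obtain Dg where Dg: "continuous_on UNIV Dg" "\<And>x. (g has_derivative blinfun_apply (Dg x)) (at x)"
    using g unfolding C1_on_def by auto
  have "continuous_on UNIV g" by (rule C1_on_imp_continuous_on[OF g])
  then have "continuous_on UNIV (\<lambda>x. Df (g x) o\<^sub>L Dg x)"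
    by (intro bounded_bilinear.continuous_on[OF bounded_bilinear_blinfun_compose] Dg(1)
        continuous_on_compose2[OF Df(1)]) auto
  moreover have "((\<lambda>x. f (g x)) has_derivative blinfun_apply (Df (g x) o\<^sub>L Dg x)) (at x)" for x
    using has_derivative_compose[OF Dg(2)[of x] Df(2)[of "g x"]] by (simp add: o_def blinfun_compose.rep_eq)
  ultimately show ?thesis unfolding C1_on_def by auto
qed

lemma C1_diffeo_compose:
  assumes "C1_diffeo f" "C1_diffeo g" shows "C1_diffeo (\<lambda>x. f (g x))"
proof -
  have b: "bij f" "bij g" using assms by (auto simp: C1_diffeo_def)
  have "inv (\<lambda>x. f (g x)) = (\<lambda>x. inv g (inv f x))"
    using o_inv_distrib[OF b] by (simp add: o_def)
  moreover have "bij (\<lambda>x. f (g x))" using bij_comp[OF b(2,1)] by (simp add: o_def)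
  ultimately show ?thesis using assms C1_on_compose by (auto simp: C1_diffeo_def)
qed

lemma C1_diffeo_inv: "C1_diffeo f \<Longrightarrow> C1_diffeo (inv f)"
  by (auto simp: C1_diffeo_def bij_imp_bij_inv inv_inv_eq)

lemma C1_ambient_isotopic_sym:
  fixes \<gamma> \<eta> :: "real \<Rightarrow> 'b::euclidean_space"
  assumes "C1_ambient_isotopic \<gamma> \<eta>" shows "C1_ambient_isotopic \<eta> \<gamma>"
proof -
  obtain F :: "'b \<times> real \<Rightarrow> 'b" where F: "continuous_on (UNIV \<times> {0..1}) F" "\<And>t. t \<in> {0..1} \<Longrightarrow> C1_diffeo (\<lambda>x. F (x, t))"
    "\<And>x. F (x, 0) = x" "(\<lambda>x. F (x, 1)) ` range \<gamma> = range \<eta>"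
    using assms unfolding C1_ambient_isotopic_def by blast
  define k where "k = inv (\<lambda>x. F (x, 1))"
  have d1: "C1_diffeo (\<lambda>x. F (x, 1))" by (rule F(2)) simp
  then have b: "bij (\<lambda>x. F (x, 1))" by (simp add: C1_diffeo_def)
  have dk: "C1_diffeo k" unfolding k_def by (rule C1_diffeo_inv[OF d1])
  then have ck: "continuous_on UNIV k" by (simp add: C1_diffeo_def C1_on_imp_continuous_on)
  have kF: "k (F (x, 1)) = x" and Fk: "F (k x, 1) = x" for x
    using inv_f_f[OF bij_is_inj[OF b], of x] surj_f_inv_f[OF bij_is_surj[OF b], of x]
    unfolding k_def by simp_all
  show ?thesis unfolding C1_ambient_isotopic_def
  proof (intro exI[of _ "\<lambda>p. F (k (fst p), 1 - snd p)"] conjI ballI allI)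
    show "continuous_on (UNIV \<times> {0..1}) (\<lambda>p. F (k (fst p), 1 - snd p))"
      by (rule continuous_on_compose2[OF F(1)])
         (auto intro!: continuous_intros continuous_on_compose2[OF ck])
    show "C1_diffeo (\<lambda>x. F (k (fst (x, t)), 1 - snd (x, t)))" if "t \<in> {0..1}" for t
      using C1_diffeo_compose[OF F(2)[of "1 - t"] dk] that by simp
    show "F (k (fst (x, 0)), 1 - snd (x, 0)) = x" for x using Fk by simp
    have "k ` range \<eta> = range \<gamma>" unfolding F(4)[symmetric] image_image kF by simp
    then show "(\<lambda>x. F (k (fst (x, 1)), 1 - snd (x, 1))) ` range \<eta> = range \<gamma>"
      using F(3) by simp
  qed
qed

lemma C1_ambient_isotopic_trans:
  fixes \<gamma> \<eta> \<zeta> :: "real \<Rightarrow> 'b::euclidean_space"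
  assumes "C1_ambient_isotopic \<gamma> \<eta>" "C1_ambient_isotopic \<eta> \<zeta>" shows "C1_ambient_isotopic \<gamma> \<zeta>"
proof -
  obtain F :: "'b \<times> real \<Rightarrow> 'b" where F: "continuous_on (UNIV \<times> {0..1}) F" "\<And>t. t \<in> {0..1} \<Longrightarrow> C1_diffeo (\<lambda>x. F (x, t))"
    "\<And>x. F (x, 0) = x" "(\<lambda>x. F (x, 1)) ` range \<gamma> = range \<eta>"
    using assms(1) unfolding C1_ambient_isotopic_def by blast
  obtain G :: "'b \<times> real \<Rightarrow> 'b" where G: "continuous_on (UNIV \<times> {0..1}) G" "\<And>t. t \<in> {0..1} \<Longrightarrow> C1_diffeo (\<lambda>x. G (x, t))"
    "\<And>x. G (x, 0) = x" "(\<lambda>x. G (x, 1)) ` range \<eta> = range \<zeta>"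
    using assms(2) unfolding C1_ambient_isotopic_def by blast
  let ?H = "\<lambda>p. if snd p \<le> 1/2 then F (fst p, 2 * snd p) else G (F (fst p, 1), 2 * snd p - 1)"
  show ?thesis unfolding C1_ambient_isotopic_def
  proof (intro exI[of _ ?H] conjI ballI allI)
    show "continuous_on (UNIV \<times> {0..1}) ?H"
    proof (rule continuous_on_cases_le)
      show "continuous_on {p \<in> UNIV \<times> {0..1}. snd p \<le> 1/2} (\<lambda>p. F (fst p, 2 * snd p))"
        by (rule continuous_on_compose2[OF F(1)]) (auto intro!: continuous_intros)
      show "continuous_on {p \<in> UNIV \<times> {0..1}. 1/2 \<le> snd p} (\<lambda>p. G (F (fst p, 1), 2 * snd p - 1))"
        by (rule continuous_on_compose2[OF G(1)])
           (auto intro!: continuous_intros continuous_on_compose2[OF F(1)])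
      fix p :: "'b \<times> real" assume "snd p = 1/2"
      then have *: "2 * snd p = 1" by simp
      show "F (fst p, 2 * snd p) = G (F (fst p, 1), 2 * snd p - 1)" unfolding * by (simp add: G(3))
    qed (auto intro!: continuous_intros)
    show "C1_diffeo (\<lambda>x. ?H (x, t))" if "t \<in> {0..1}" for t
      using F(2)[of "2 * t"] C1_diffeo_compose[OF G(2)[of "2 * t - 1"] F(2)[of 1]] that
      by (cases "t \<le> 1/2") auto
    show "?H (x, 0) = x" for x using F(3) by simp
    show "(\<lambda>x. ?H (x, 1)) ` range \<gamma> = range \<zeta>"
      using F(4) G(4) by (simp add: image_image[symmetric, of "\<lambda>x. G (x, 1)" "\<lambda>x. F (x, 1)"])
  qed
qed

text \<open>Solving \<open>x + k x = p\<close> for \<open>x\<close> means finding the fixed point of the contraction \<open>p - k\<close>.\<close>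

lemma contraction_perturbation_bij:
  fixes k :: "'b::euclidean_space \<Rightarrow> 'b"
  assumes "\<And>x y. norm (k x - k y) \<le> 1/2 * norm (x - y)"
  shows "bij (\<lambda>x. x + k x)" and "norm (x - y) \<le> 2 * norm ((x + k x) - (y + k y))"
proof -
  have 2: "norm (x - y) \<le> 2 * norm ((x + k x) - (y + k y))" for x y
  proof -
    have "norm (x - y) = norm (((x + k x) - (y + k y)) - (k x - k y))" by (simp add: algebra_simps)
    also have "\<dots> \<le> norm ((x + k x) - (y + k y)) + norm (k x - k y)" by (rule norm_triangle_ineq4)
    finally show ?thesis using assms[of x y] by linarith
  qed
  then show "norm (x - y) \<le> 2 * norm ((x + k x) - (y + k y))" .
  have "inj (\<lambda>x. x + k x)"
  proof (rule injI)
    fix x y assume "x + k x = y + k y"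
    then show "x = y" using 2[of x y] by simp
  qed
  moreover have "\<exists>x. p = x + k x" for p
  proof -
    have "\<exists>!x. p - k x = x"
    proof (rule banach_fix_type[of "1/2"])
      show "\<forall>x y. dist (p - k x) (p - k y) \<le> 1/2 * dist x y"
        using assms by (metis diff_diff_eq2 diff_add_cancel dist_norm norm_minus_commute add_diff_cancel_left minus_diff_eq)
    qed auto
    then show ?thesis by (metis diff_add_cancel)
  qed
  then have "surj (\<lambda>x. x + k x)" unfolding surj_def by blast
  ultimately show "bij (\<lambda>x. x + k x)" by (simp add: bij_def)
qed

text \<open>The inverse \<open>I B\<close> of \<open>id + B\<close> exists by contraction, and the resolvent identity
  \<open>I B - I A = I A (A - B) (I B)\<close> makes it Lipschitz in \<open>B\<close>. This is what makes the derivative of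
  an inverse diffeomorphism continuous.\<close>

lemma blinfun_inverse_near_id:
  obtains I :: "('b::euclidean_space \<Rightarrow>\<^sub>L 'b) \<Rightarrow> ('b \<Rightarrow>\<^sub>L 'b)" where
    "\<And>B h. norm B \<le> 1/2 \<Longrightarrow> I B (h + B h) = h" "continuous_on {B. norm B \<le> 1/2} I"
proof -
  define I :: "('b \<Rightarrow>\<^sub>L 'b) \<Rightarrow> ('b \<Rightarrow>\<^sub>L 'b)" where "I B = Blinfun (inv (\<lambda>h. h + B h))" for B
  have *: "I B (h + B h) = h \<and> (I B y) + B (I B y) = y \<and> norm (I B y) \<le> 2 * norm y"
    if B: "norm B \<le> 1/2" for B h y
  proof -
    have c: "norm (B x - B y) \<le> 1/2 * norm (x - y)" for x y
      using norm_blinfun[of B "x - y"] mult_right_mono[OF B, of "norm (x - y)"]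
      by (simp add: blinfun.diff_right)
    note b = contraction_perturbation_bij[of B, OF c]
    let ?f = "\<lambda>h. h + B h"
    have lin: "linear ?f" by (rule linearI) (auto simp: blinfun.add_right blinfun.scaleR_right algebra_simps)
    have l: "linear (inv ?f)" using inj_linear_imp_inv_linear[OF lin bij_is_inj[OF b(1)]] .
    then have "bounded_linear (inv ?f)" by (rule linear_conv_bounded_linear[THEN iffD1])
    then have IB: "blinfun_apply (I B) = inv ?f" unfolding I_def by (rule bounded_linear_Blinfun_apply)
    have 1: "inv ?f (?f h) = h" for h using b(1) bij_is_inj inv_f_f by metis
    have 2: "?f (inv ?f y) = y" for y using b(1) bij_is_surj surj_f_inv_f by metis
    have "norm (inv ?f y - 0) \<le> 2 * norm (?f (inv ?f y) - ?f 0)" by (rule b(2))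
    then have "norm (inv ?f y) \<le> 2 * norm y" unfolding 2 by simp
    then show ?thesis using 1[of h] 2[of y] unfolding IB by simp
  qed
  have lip: "norm (I A - I B) \<le> 4 * norm (A - B)" if "norm A \<le> 1/2" "norm B \<le> 1/2" for A B
  proof (rule norm_blinfun_bound)
    fix y
    have "I A (I B y + A (I B y)) = I B y" using *[OF that(1), of "I B y"] by blast
    moreover have "I B y + A (I B y) = y + (A - B) (I B y)"
      using *[OF that(2), of 0 y] by (simp add: blinfun.diff_left algebra_simps)
    ultimately have "I B y = I A y + I A ((A - B) (I B y))" by (simp add: blinfun.add_right)
    then have "norm ((I A - I B) y) = norm (I A ((A - B) (I B y)))"
      by (simp add: blinfun.diff_left) (metis add_diff_cancel_left' norm_minus_commute)
    also have "\<dots> \<le> 2 * norm ((A - B) (I B y))" using *[OF that(1)] by blast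
    also have "\<dots> \<le> 2 * (norm (A - B) * norm (I B y))" using norm_blinfun by (intro mult_left_mono) auto
    also have "\<dots> \<le> 2 * (norm (A - B) * (2 * norm y))"
      using *[OF that(2)] by (intro mult_left_mono) auto
    finally show "norm ((I A - I B) y) \<le> 4 * norm (A - B) * norm y" by simp
  qed simp
  have "continuous_on {B. norm B \<le> 1/2} I"
    by (rule lipschitz_on_continuous_on[of 4]) (auto intro!: lipschitz_onI simp: dist_norm lip)
  then show ?thesis using that * by blast
qed

text \<open>By the mean value inequality \<open>k\<close> contracts by the factor \<open>1/2\<close>, so the map is bijective
  with a Lipschitz inverse. The inverse is \<open>C\<^sup>1\<close> because its derivative is the inverse of \<open>id + D\<close>,
  which depends continuously on the point.\<close>

lemma C1_diffeo_id_plus: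
  fixes k :: "'b::euclidean_space \<Rightarrow> 'b" and D :: "'b \<Rightarrow> 'b \<Rightarrow>\<^sub>L 'b"
  assumes k: "\<And>x. (k has_derivative D x) (at x)" and D: "continuous_on UNIV D" "\<And>x. norm (D x) \<le> 1/2"
  shows "C1_diffeo (\<lambda>x. x + k x)"
proof -
  let ?f = "\<lambda>x. x + k x"
  have c: "norm (k x - k y) \<le> 1/2 * norm (x - y)" for x y
    by (rule differentiable_bound[of UNIV k "\<lambda>x. blinfun_apply (D x)"])
       (use k D(2) in \<open>auto simp: norm_blinfun.rep_eq[symmetric] has_derivative_at_withinI\<close>)
  note b = contraction_perturbation_bij[of k, OF c]
  have df: "(?f has_derivative blinfun_apply (id_blinfun + D x)) (at x)" for x
    using has_derivative_add[OF has_derivative_ident k[of x]] by (simp add: blinfun.add_left[abs_def])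
  have "C1_on UNIV ?f" unfolding C1_on_def
    by (intro exI[of _ "\<lambda>x. id_blinfun + D x"]) (auto intro!: continuous_intros D df)
  moreover
  obtain I :: "('b \<Rightarrow>\<^sub>L 'b) \<Rightarrow> ('b \<Rightarrow>\<^sub>L 'b)" where
    I: "\<And>B h. norm B \<le> 1/2 \<Longrightarrow> I B (h + B h) = h" "continuous_on {B. norm B \<le> 1/2} I"
    by (rule blinfun_inverse_near_id) (rule that)
  let ?g = "inv ?f"
  have fg: "?f (?g y) = y" for y using b(1) bij_is_surj surj_f_inv_f by metis
  have "norm (?g y - ?g z) \<le> 2 * norm (y - z)" for y z
    using b(2)[of "?g y" "?g z"] unfolding fg .
  then have cg: "continuous_on UNIV ?g"
    by (intro lipschitz_on_continuous_on[of 2]) (auto intro!: lipschitz_onI simp: dist_norm)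
  have "(?g has_derivative I (D (?g y))) (at y)" for y
  proof (rule has_derivative_inverse_basic[where f = ?f and T = UNIV])
    show "(?f has_derivative blinfun_apply (id_blinfun + D (?g y))) (at (?g y))" by (rule df)
    show "blinfun_apply (I (D (?g y))) \<circ> blinfun_apply (id_blinfun + D (?g y)) = id"
      using I(1)[OF D(2)] by (auto simp: fun_eq_iff blinfun.add_left)
    show "isCont ?g y" using cg by (simp add: continuous_on_eq_continuous_at)
  qed (auto simp: fg blinfun.bounded_linear_right)
  moreover have "continuous_on UNIV (\<lambda>y. I (D (?g y)))"
    by (rule continuous_on_compose2[OF I(2) continuous_on_compose2[OF D(1) cg]]) (use D(2) in auto)
  ultimately have "C1_on UNIV ?g" unfolding C1_on_def by auto
  then show ?thesis using \<open>C1_on UNIV ?f\<close> b(1) by (simp add: C1_diffeo_def)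
qed

section \<open>Unit speed knots of class \<open>C\<^sup>1\<close>\<close>

text \<open>The tangent \<open>T\<close> is an explicit argument because knots are compared, interpolated and
  approximated by way of their tangents.\<close>

definition unit_speed_knot :: "(real \<Rightarrow> 'b::euclidean_space) \<Rightarrow> (real \<Rightarrow> 'b) \<Rightarrow> bool" where
  "unit_speed_knot \<gamma> T \<longleftrightarrow> (\<forall>x. (\<gamma> has_vector_derivative T x) (at x)) \<and> continuous_on UNIV T \<and>
     (\<forall>x. T (x + 1) = T x) \<and> (\<forall>x. norm (T x) = 1) \<and> (\<forall>x. \<gamma> (x + 1) = \<gamma> x) \<and> inj_on \<gamma> {0..<1}"

lemma periodic_add_int:
  fixes f :: "real \<Rightarrow> 'b"
  assumes "\<And>x. f (x + 1) = f x" shows "f (x + of_int k) = f x"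
proof -
  interpret periodic_fun_simple' f by standard (rule assms)
  show ?thesis by (rule plus_of_int)
qed

lemma periodic_frac:
  fixes f :: "real \<Rightarrow> 'b"
  assumes "\<And>x. f (x + 1) = f x" shows "f (frac x) = f x"
  using periodic_add_int[of f, OF assms, of x "- \<lfloor>x\<rfloor>"] by (simp add: frac_def)

lemma periodic_uniformly_continuous:
  fixes f :: "real \<Rightarrow> 'b::real_normed_vector"
  assumes c: "continuous_on UNIV f" and p: "\<And>x. f (x + 1) = f x" and "e > 0"
  obtains d where "d > 0" "\<And>x y. \<bar>x - y\<bar> < d \<Longrightarrow> norm (f x - f y) < e"
proof -
  have "uniformly_continuous_on {-1..2} f"
    by (rule compact_uniformly_continuous[OF continuous_on_subset[OF c]]) auto
  then obtain d where d: "d > 0" "\<And>x y. x \<in> {-1..2} \<Longrightarrow> y \<in> {-1..2} \<Longrightarrow> dist x y < d \<Longrightarrow> dist (f x) (f y) < e"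
    unfolding uniformly_continuous_on_def using \<open>e > 0\<close> by metis
  have "norm (f x - f y) < e" if "\<bar>x - y\<bar> < min d 1" for x y
  proof -
    define k where "k = real_of_int (- \<lfloor>x\<rfloor>)"
    have k: "0 \<le> x + k" "x + k < 1" using floor_correct[of x] by (simp_all add: k_def, linarith)
    have "dist (f (x + k)) (f (y + k)) < e"
    proof (rule d(2))
      show "x + k \<in> {-1..2}" "y + k \<in> {-1..2}" using that k by (auto simp: abs_if split: if_splits)
      show "dist (x + k) (y + k) < d" using that by (simp add: dist_real_def)
    qed
    then show ?thesis by (simp only: k_def periodic_add_int[of f, OF p] dist_norm)
  qed
  then show ?thesis using that[of "min d 1"] d(1) by auto
qed

text \<open>On the compact set of pairs whose distance on the circle is between \<open>r\<close> and \<open>1/2\<close> the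
  distance of the points of the knot has a positive minimum. The window \<open>{-1..2}\<close> for the second
  parameter contains all integer translates that are needed.\<close>

lemma knot_separation:
  fixes \<gamma> :: "real \<Rightarrow> 'b::real_normed_vector"
  assumes c: "continuous_on UNIV \<gamma>" and p: "\<And>x. \<gamma> (x + 1) = \<gamma> x" and inj: "inj_on \<gamma> {0..<1}" and "r > 0"
  obtains \<rho> where "\<rho> > 0" "\<And>x u. norm (\<gamma> x - \<gamma> u) < \<rho> \<Longrightarrow> \<exists>k::int. \<bar>x - u - of_int k\<bar> < r"
proof -
  define S where "S = {q \<in> {0..1} \<times> {-1..2}. \<bar>fst q - snd q\<bar> \<le> 1/2 \<and> r \<le> \<bar>fst q - snd q\<bar>}"
  have "closed S" unfolding S_def
    by (intro closed_Collect_conj closed_Times closed_Collect_le continuous_intros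
        closed_Int[of "{0..1} \<times> {-1..2}" "{q. _ q}", unfolded Int_def mem_Collect_eq]) auto
  moreover have "bounded S"
    by (rule bounded_subset[of "{0..1} \<times> {-1..2}"]) (auto simp: S_def intro!: bounded_Times)
  ultimately have cS: "compact S" by (simp add: compact_eq_bounded_closed)
  have pos: "norm (\<gamma> (fst q) - \<gamma> (snd q)) > 0" if "q \<in> S" for q
  proof -
    obtain x u where q: "q = (x, u)" by (cases q)
    have xu: "\<bar>x - u\<bar> \<le> 1/2" "x \<noteq> u" using that \<open>r > 0\<close> by (auto simp: q S_def)
    have "\<gamma> x \<noteq> \<gamma> u"
    proof
      assume "\<gamma> x = \<gamma> u"
      then have "\<gamma> (frac x) = \<gamma> (frac u)" by (simp only: periodic_frac[of \<gamma>, OF p])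
      then have "frac x = frac u" using inj by (auto simp: inj_on_def frac_lt_1)
      then have d: "x - u = of_int (\<lfloor>x\<rfloor> - \<lfloor>u\<rfloor>)" by (simp add: frac_def)
      then have "\<bar>real_of_int (\<lfloor>x\<rfloor> - \<lfloor>u\<rfloor>)\<bar> < 1" using xu(1) by linarith
      then have "\<lfloor>x\<rfloor> - \<lfloor>u\<rfloor> = 0" by linarith
      with d xu(2) show False by simp
    qed
    then show ?thesis by (simp add: q)
  qed
  obtain \<rho> where \<rho>: "\<rho> > 0" "\<And>q. q \<in> S \<Longrightarrow> \<rho> \<le> norm (\<gamma> (fst q) - \<gamma> (snd q))"
  proof (cases "S = {}")
    case False
    have "continuous_on S (\<lambda>q. norm (\<gamma> (fst q) - \<gamma> (snd q)))"
      by (intro continuous_intros continuous_on_compose2[OF c]) auto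
    from continuous_attains_inf[OF cS False this] show ?thesis using that pos by blast
  qed (use that[of 1] in auto)
  have "\<exists>k::int. \<bar>x - u - of_int k\<bar> < r" if n: "norm (\<gamma> x - \<gamma> u) < \<rho>" for x u
  proof (rule ccontr)
    assume no: "\<not> ?thesis"
    \<comment> \<open>Of all translates of \<open>u\<close> by integers, the one closest to \<open>frac x\<close>.\<close>
    define u' where "u' = u + of_int (round (x - u)) + of_int (- \<lfloor>x\<rfloor>)"
    have x': "frac x = x + of_int (- \<lfloor>x\<rfloor>)" by (simp add: frac_def)
    have d: "frac x - u' = x - u - of_int (round (x - u))" by (simp add: x' u'_def)
    have a: "\<bar>frac x - u'\<bar> \<le> 1/2" unfolding d using of_int_round_abs_le[of "x - u"] by (simp add: abs_minus_commute)
    have b: "r \<le> \<bar>frac x - u'\<bar>" unfolding d using no by (simp add: not_less)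
    have "(frac x, u') \<in> S"
    proof -
      have "-1 \<le> u'" "u' \<le> 2" using a frac_ge_0[of x] frac_lt_1[of x] by linarith+
      then show ?thesis using a b by (simp add: S_def frac_lt_1 less_imp_le)
    qed
    then have "\<rho> \<le> norm (\<gamma> (frac x) - \<gamma> u')" using \<rho>(2)[of "(frac x, u')"] by simp
    also have "\<gamma> u' = \<gamma> u" unfolding u'_def by (simp only: periodic_add_int[of \<gamma>, OF p])
    also have "\<gamma> (frac x) = \<gamma> x" by (rule periodic_frac[of \<gamma>, OF p])
    finally show False using n by simp
  qed
  then show ?thesis using that \<rho>(1) by blast
qed

lemma unit_inner_ge:
  fixes a b :: "'b::euclidean_space"
  assumes "norm a = 1" "norm b = 1" "norm (a - b) \<le> 1" shows "a \<bullet> b \<ge> 1/2"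
proof -
  have "(norm (a - b))\<^sup>2 = 2 - 2 * (a \<bullet> b)"
    using assms(1,2) by (simp add: power2_norm_eq_inner inner_diff algebra_simps norm_eq_1 inner_commute)
  moreover have "(norm (a - b))\<^sup>2 \<le> 1" using assms(3) by (simp add: power_le_one)
  ultimately show ?thesis by linarith
qed

text \<open>The lower bound \<open>m\<close> on the slope makes \<open>p\<close> unbounded in both directions, hence onto, and
  its inverse Lipschitz.\<close>

lemma increasing_C1_inverse:
  fixes p v :: "real \<Rightarrow> real"
  assumes p: "\<And>x. (p has_real_derivative v x) (at x)" and m: "m > 0" "\<And>x. m \<le> v x"
  obtains P where "\<And>x. P (p x) = x" "\<And>y. p (P y) = y"
    "\<And>y. (P has_real_derivative 1 / v (P y)) (at y)" "continuous_on UNIV P"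
proof -
  have slope: "m * (y - x) \<le> p y - p x" if "x \<le> y" for x y
  proof (cases "x = y")
    case False
    then have "x < y" using that by simp
    then obtain z where "p y - p x = (y - x) * v z" using MVT2[OF \<open>x < y\<close> p] by blast
    then show ?thesis using mult_left_mono[OF m(2)[of z], of "y - x"] that by (simp add: mult.commute)
  qed simp
  have slope': "m * \<bar>x - y\<bar> \<le> \<bar>p x - p y\<bar>" for x y
    using slope[of x y] slope[of y x] m(1) by (cases "x \<le> y") (auto simp: abs_if)
  have "inj p"
  proof (rule injI)
    fix x y assume "p x = p y" then show "x = y" using slope'[of x y] m(1) by (simp add: mult_le_0_iff)
  qed
  have cp: "isCont p x" for x using p DERIV_isCont by blast
  have "\<exists>x. p x = y" for y
  proof -
    define b where "b = \<bar>y - p 0\<bar> / m"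
    have "b \<ge> 0" "m * b = \<bar>y - p 0\<bar>" using m(1) by (auto simp: b_def)
    then have "p (-b) \<le> y" "y \<le> p b" using slope[of "-b" 0] slope[of 0 b] by auto
    then show ?thesis using IVT[of p "-b" y b] cp \<open>b \<ge> 0\<close> by auto
  qed
  then have "surj p" by (metis surj_def)
  define P where "P = inv p"
  have Pp: "P (p x) = x" for x unfolding P_def using \<open>inj p\<close> by (rule inv_f_f)
  have pP: "p (P y) = y" for y unfolding P_def using \<open>surj p\<close> by (rule surj_f_inv_f)
  have "\<bar>P y - P z\<bar> \<le> (1/m) * \<bar>y - z\<bar>" for y z
    using slope'[of "P y" "P z"] m(1) by (simp add: pP field_simps)
  then have cP: "continuous_on UNIV P"
    using m(1) by (intro lipschitz_on_continuous_on[of "1/m"]) (auto intro!: lipschitz_onI simp: dist_real_def)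
  have "(P has_real_derivative inverse (v (P y))) (at y)" for y
  proof (rule DERIV_inverse_function[where f = p and a = "y - 1" and b = "y + 1"])
    show "v (P y) \<noteq> 0" using m(1) m(2)[of "P y"] by linarith
  qed (use p pP cP in \<open>auto simp: continuous_on_eq_continuous_at\<close>)
  then show ?thesis using that[OF Pp pP _ cP] by (simp add: inverse_eq_divide)
qed

section \<open>Extending vector fields from a knot\<close>

text \<open>The map \<open>h \<mapsto> (a \<bullet> h) *\<^sub>R b\<close>, the form that derivatives of products and of functions of
  one coordinate take.\<close>

definition rank_one :: "'a::euclidean_space \<Rightarrow> 'b::euclidean_space \<Rightarrow> 'a \<Rightarrow>\<^sub>L 'b" where
  "rank_one a b = blinfun_scaleR_left b o\<^sub>L blinfun_inner_right a"

lemma rank_one_apply: "rank_one a b h = (a \<bullet> h) *\<^sub>R b"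
  by (simp add: rank_one_def)

lemma norm_rank_one_le: "norm (rank_one a b) \<le> norm a * norm b"
proof (rule norm_blinfun_bound)
  fix h show "norm (rank_one a b h) \<le> norm a * norm b * norm h"
    using mult_right_mono[OF Cauchy_Schwarz_ineq2[of a h], of "norm b"]
    by (simp add: rank_one_apply mult_ac)
qed simp

lemma continuous_on_rank_one:
  assumes "continuous_on S a" "continuous_on S b" shows "continuous_on S (\<lambda>y. rank_one (a y) (b y))"
  unfolding rank_one_def
  by (intro bounded_bilinear.continuous_on[OF bounded_bilinear_blinfun_compose]
      bounded_linear.continuous_on[OF bounded_linear_blinfun_scaleR_left]
      bounded_linear.continuous_on[OF bounded_linear_blinfun_inner_right] assms)

lemma has_derivative_max_sq: "((\<lambda>z::real. (max 0 z)\<^sup>2) has_real_derivative 2 * max 0 z) (at z)"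
proof -
  consider "z > 0" | "z < 0" | "z = 0" by linarith
  then show ?thesis
  proof cases
    case 1
    have "((\<lambda>z. z\<^sup>2) has_real_derivative 2 * max 0 z) (at z)"
      using 1 by (auto intro!: derivative_eq_intros)
    then show ?thesis
      by (rule has_field_derivative_transform_within_open[of _ _ _ "{0<..}"]) (use 1 in auto)
  next
    case 2
    have "((\<lambda>z. 0) has_real_derivative 2 * max 0 z) (at z)" using 2 by simp
    then show ?thesis
      by (rule has_field_derivative_transform_within_open[of _ _ _ "{..<0}"]) (use 2 in auto)
  next
    case 3
    have "isCont (\<lambda>z::real. max 0 z) z" by (intro continuous_intros)
    then show ?thesis unfolding CARAT_DERIV
      by (intro exI[of _ "\<lambda>z. max 0 z"] conjI allI) (auto simp: 3 power2_eq_square max_def)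
  qed
qed

text \<open>The function is the square of the positive part of \<open>1 - \<bar>y - c\<bar>\<^sup>2 / \<rho>\<^sup>2\<close>, which is just
  smooth enough.\<close>

lemma ball_bump:
  fixes c :: "'b::euclidean_space"
  assumes \<rho>: "\<rho> > 0"
  obtains \<beta> X where "\<And>y. (\<beta> has_derivative (\<lambda>h. X y \<bullet> h)) (at y)" "continuous_on UNIV X"
    "\<And>y. norm (X y) \<le> 4 / \<rho>" "\<And>y. 0 \<le> \<beta> y" "\<And>y. \<beta> y \<le> 1" "\<And>y. \<beta> y > 0 \<longleftrightarrow> norm (y - c) < \<rho>"
proof -
  define k where "k = 1 / \<rho>\<^sup>2"
  define r where "r y = 1 - k * ((y - c) \<bullet> (y - c))" for y
  have rn: "r y = 1 - (norm (y - c) / \<rho>)\<^sup>2" for y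
    by (simp add: r_def k_def power2_norm_eq_inner power_divide)
  have r1: "r y \<le> 1" for y by (simp add: rn)
  have rpos: "r y > 0 \<longleftrightarrow> norm (y - c) < \<rho>" for y
    using \<rho> abs_square_less_1[of "norm (y - c) / \<rho>"] by (simp add: rn)
  define \<beta> where "\<beta> y = (max 0 (r y))\<^sup>2" for y
  define X where "X y = (-(4 * max 0 (r y) * k)) *\<^sub>R (y - c)" for y
  have dr: "(r has_derivative (\<lambda>h. - (k * (2 * ((y - c) \<bullet> h))))) (at y)" for y
    unfolding r_def by (auto intro!: derivative_eq_intros simp: inner_commute)
  have "(\<beta> has_derivative (\<lambda>h. X y \<bullet> h)) (at y)" for y
    using has_derivative_compose[OF dr has_derivative_max_sq[of "r y", unfolded has_field_derivative_def]]
    by (simp add: \<beta>_def[abs_def] X_def mult_ac)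
  moreover have "continuous_on UNIV X" unfolding X_def r_def
    by (intro continuous_intros)
  moreover have "norm (X y) \<le> 4 / \<rho>" for y
  proof (cases "norm (y - c) < \<rho>")
    case True
    moreover have "k \<ge> 0" by (simp add: k_def)
    ultimately have "norm (X y) \<le> (4 * 1 * k) * \<rho>"
      unfolding X_def norm_scaleR using r1[of y] by (intro mult_mono) (auto simp: abs_mult mult_left_le_one_le)
    then show ?thesis using \<rho> by (simp add: k_def power2_eq_square)
  next
    case False
    then have "max 0 (r y) = 0" using rpos[of y] by auto
    then show ?thesis using \<rho> by (simp add: X_def)
  qed
  moreover have "\<beta> y \<le> 1" "0 \<le> \<beta> y" for y using r1[of y] by (auto simp: \<beta>_def intro!: power_le_one)
  moreover have "\<beta> y > 0 \<longleftrightarrow> norm (y - c) < \<rho>" for y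
    using rpos[of y] by (auto simp: \<beta>_def zero_less_power2 max_def)
  ultimately show ?thesis using that by blast
qed

text \<open>Near \<open>u\<close> the orthogonal projection to the tangent line at \<open>u\<close> moves along the knot with
  slope \<open>T x \<bullet> T u \<ge> 1/2\<close>. If the slope is prevented from dropping below \<open>1/2\<close> elsewhere, it
  integrates to a diffeomorphism \<open>q\<close> of the whole line. The parameter \<open>p\<close> is the inverse of \<open>q\<close>
  applied to the projection; hence it is defined on the whole space.\<close>

lemma knot_local_coordinate:
  fixes \<gamma> T :: "real \<Rightarrow> 'b::euclidean_space"
  assumes k: "unit_speed_knot \<gamma> T" and r: "\<And>x. \<bar>x - u\<bar> \<le> r \<Longrightarrow> T x \<bullet> T u \<ge> 1/2"
  obtains p g where "\<And>y. (p has_derivative (\<lambda>h. g y \<bullet> h)) (at y)" "continuous_on UNIV g"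
    "\<And>y. norm (g y) \<le> 2" "\<And>x. \<bar>x - u\<bar> \<le> r \<Longrightarrow> p (\<gamma> x) = x"
proof -
  have d: "\<And>x. (\<gamma> has_vector_derivative T x) (at x)" and cT: "continuous_on UNIV T" and n: "\<And>x. norm (T x) = 1"
    using k by (auto simp: unit_speed_knot_def)
  define v where "v x = max (1/2) (T x \<bullet> T u)" for x
  have cv: "continuous_on UNIV v" unfolding v_def by (intro continuous_intros cT)
  obtain F where F: "primitive_of F v"
    using primitive_exists[OF absolutely_integrable_continuous_real[OF continuous_on_subset[OF cv]]] by blast
  define q where "q x = F x - F u" for x
  have dq: "(q has_real_derivative v x) (at x)" for x
    using primitive_of_continuous_density[OF F cv, of x]
    unfolding q_def has_real_derivative_iff_has_vector_derivative[symmetric] by (auto intro!: derivative_eq_intros)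
  obtain P where P: "\<And>x. P (q x) = x" "\<And>y. q (P y) = y"
    "\<And>y. (P has_real_derivative 1 / v (P y)) (at y)" "continuous_on UNIV P"
    by (rule increasing_C1_inverse[OF dq, of "1/2"]) (auto simp: v_def intro: that)
  have agree: "q x = (\<gamma> x - \<gamma> u) \<bullet> T u" if x: "\<bar>x - u\<bar> \<le> r" for x
  proof -
    let ?f = "\<lambda>x. q x - (\<gamma> x - \<gamma> u) \<bullet> T u"
    have "(?f has_vector_derivative 0) (at y within {u-r..u+r})" if "y \<in> {u-r..u+r}" for y
    proof -
      have "\<bar>y - u\<bar> \<le> r" using that by (auto simp: abs_le_iff)
      then have "v y = T y \<bullet> T u" using r[of y] by (simp add: v_def)
      moreover have "((\<lambda>x. \<gamma> x - \<gamma> u) has_vector_derivative T y) (at y)"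
        using has_vector_derivative_diff[OF d[of y] has_vector_derivative_const] by simp
      then have "((\<lambda>x. (\<gamma> x - \<gamma> u) \<bullet> T u) has_vector_derivative T y \<bullet> T u) (at y)"
        by (rule bounded_linear.has_vector_derivative[OF bounded_linear_inner_left])
      ultimately have "(?f has_vector_derivative 0) (at y)"
        using has_vector_derivative_diff[OF dq[of y, unfolded has_real_derivative_iff_has_vector_derivative]] by fastforce
      then show ?thesis by (rule has_vector_derivative_at_within)
    qed
    then obtain c where c: "\<And>y. y \<in> {u-r..u+r} \<Longrightarrow> ?f y = c"
      using has_vector_derivative_zero_constant[of "{u-r..u+r}" ?f] by (auto simp: convex_real_interval)
    have "x \<in> {u-r..u+r}" "u \<in> {u-r..u+r}" using x by (auto simp: abs_le_iff)
    then have "?f x = ?f u" using c by metis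
    then show ?thesis by (simp add: q_def)
  qed
  define p where "p y = P ((y - \<gamma> u) \<bullet> T u)" for y
  define g where "g y = (1 / v (p y)) *\<^sub>R T u" for y
  have v2: "1/2 \<le> v x" for x by (simp add: v_def)
  have dl: "((\<lambda>y. (y - \<gamma> u) \<bullet> T u) has_derivative (\<lambda>h. h \<bullet> T u)) (at y)" for y
    by (auto intro!: derivative_eq_intros)
  have "(p has_derivative (\<lambda>h. g y \<bullet> h)) (at y)" for y
    using has_derivative_compose[OF dl P(3)[of "(y - \<gamma> u) \<bullet> T u", unfolded has_field_derivative_def]]
    by (simp add: p_def[abs_def] g_def inner_commute)
  moreover have cp: "continuous_on UNIV p" unfolding p_def
    by (intro continuous_intros continuous_on_compose2[OF P(4)]) auto
  have "continuous_on UNIV g" unfolding g_def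
    by (intro continuous_intros continuous_on_compose2[OF cv cp]) (use v2 in \<open>auto simp: not_le dest!: spec\<close>, metis v2 half_gt_zero_iff less_numeral_extra(1) not_less order_less_irrefl order.trans zero_less_divide_1_iff zero_less_numeral)
  moreover have "norm (g y) \<le> 2" for y
    using v2[of "p y"] n[of u] by (simp add: g_def field_simps)
  moreover have "p (\<gamma> x) = x" if "\<bar>x - u\<bar> \<le> r" for x
    using P(1)[of x] agree[OF that] by (simp add: p_def)
  ultimately show ?thesis using that by blast
qed

text \<open>A vector field \<open>\<delta>\<close> along the knot is extended to \<open>h = (\<Sum>i<N. \<beta> i *\<^sub>R (G \<circ> p i))\<close>, where
  the bumps \<open>\<beta> i\<close> are centred at \<open>N\<close> points dense enough on the knot, \<open>p i\<close> is the local parameter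
  near the \<open>i\<close>-th centre, and \<open>G = \<delta> / S\<close> with \<open>S\<close> the sum of the bumps along the knot. Where
  \<open>\<beta> i (\<gamma> x) > 0\<close>, \<open>knot_separation\<close> forces \<open>p i (\<gamma> x)\<close> to be \<open>x\<close> up to an integer, so on the knot
  every summand sees the same value \<open>G x\<close> and the sum is \<open>S x *\<^sub>R G x = \<delta> x\<close>. The division happens
  in the parameter and not in space, so the bumps need not add up to \<open>1\<close>. Everything but \<open>\<delta>\<close>
  depends on the knot only, which is why one constant \<open>C\<close> serves all fields.\<close>

lemma extension_from_knot:
  fixes \<gamma> T :: "real \<Rightarrow> 'b::euclidean_space"
  assumes k: "unit_speed_knot \<gamma> T"
  shows "\<exists>C>0. \<forall>\<delta> \<delta>' e. (\<forall>x. (\<delta> has_vector_derivative \<delta>' x) (at x)) \<longrightarrow> continuous_on UNIV \<delta>' \<longrightarrow>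
      (\<forall>x. \<delta> (x + 1) = \<delta> x) \<longrightarrow> (\<forall>x. norm (\<delta> x) \<le> e) \<longrightarrow> (\<forall>x. norm (\<delta>' x) \<le> e) \<longrightarrow>
      (\<exists>h (D :: 'b \<Rightarrow> 'b \<Rightarrow>\<^sub>L 'b). (\<forall>y. (h has_derivative blinfun_apply (D y)) (at y)) \<and> continuous_on UNIV D
            \<and> (\<forall>y. norm (D y) \<le> C * e) \<and> (\<forall>x. h (\<gamma> x) = \<delta> x))"
proof -
  have d: "\<And>x. (\<gamma> has_vector_derivative T x) (at x)" and cT: "continuous_on UNIV T" and n: "\<And>x. norm (T x) = 1"
    and pT: "\<And>x. T (x + 1) = T x" and p\<gamma>: "\<And>x. \<gamma> (x + 1) = \<gamma> x" and inj: "inj_on \<gamma> {0..<1}"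
    using k by (auto simp: unit_speed_knot_def)
  have c\<gamma>: "continuous_on UNIV \<gamma>" by (rule continuous_on_vector_derivative) (rule d)
  obtain r where r: "r > 0" "\<And>x y. \<bar>x - y\<bar> < r \<Longrightarrow> norm (T x - T y) < 1"
    by (rule periodic_uniformly_continuous[OF cT pT, of 1]) (auto intro: that)
  have r': "T x \<bullet> T u \<ge> 1/2" if "\<bar>x - u\<bar> \<le> r/2" for x u
    using r(2)[of x u] that r(1) n by (intro unit_inner_ge) auto
  obtain \<rho> where \<rho>: "\<rho> > 0" "\<And>x u. norm (\<gamma> x - \<gamma> u) < \<rho> \<Longrightarrow> \<exists>k::int. \<bar>x - u - of_int k\<bar> < r/2"
    by (rule knot_separation[OF c\<gamma> p\<gamma> inj, of "r/2"]) (use r(1) in \<open>auto intro: that\<close>)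
  obtain N0 :: nat where N0: "1 / real (Suc N0) < \<rho>" using nat_approx_posE[OF \<rho>(1)] by metis
  define N where "N = Suc N0"
  define c where "c i = real i / real N" for i
  have "\<forall>i. \<exists>\<beta> X p g. (\<forall>y. (\<beta> has_derivative (\<lambda>h. X y \<bullet> h)) (at y)) \<and> continuous_on UNIV X \<and> (\<forall>y. norm (X y) \<le> 4/\<rho>)
      \<and> (\<forall>y. 0 \<le> \<beta> y \<and> \<beta> y \<le> 1) \<and> (\<forall>y. \<beta> y > 0 \<longleftrightarrow> norm (y - \<gamma> (c i)) < \<rho>)
      \<and> (\<forall>y. (p has_derivative (\<lambda>h. g y \<bullet> h)) (at y)) \<and> continuous_on UNIV g \<and> (\<forall>y. norm (g y) \<le> 2)
      \<and> (\<forall>x. \<bar>x - c i\<bar> \<le> r/2 \<longrightarrow> p (\<gamma> x) = x)" (is "\<forall>i. \<exists>\<beta> X p g. ?P i \<beta> X p g")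
  proof
    fix i
    obtain \<beta> X where 1: "\<And>y. (\<beta> has_derivative (\<lambda>h. X y \<bullet> h)) (at y)" "continuous_on UNIV X"
    "\<And>y. norm (X y) \<le> 4 / \<rho>" "\<And>y. 0 \<le> \<beta> y" "\<And>y. \<beta> y \<le> 1" "\<And>y. \<beta> y > 0 \<longleftrightarrow> norm (y - \<gamma> (c i)) < \<rho>"
      by (rule ball_bump[OF \<rho>(1), of "\<gamma> (c i)"]) (rule that)
    obtain p g where 2: "\<And>y. (p has_derivative (\<lambda>h. g y \<bullet> h)) (at y)" "continuous_on UNIV g"
    "\<And>y. norm (g y) \<le> 2" "\<And>x. \<bar>x - c i\<bar> \<le> r/2 \<Longrightarrow> p (\<gamma> x) = x"
      by (rule knot_local_coordinate[OF k, of "c i" "r/2"]) (use r' that in auto)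
    show "\<exists>\<beta> X p g. ?P i \<beta> X p g"
      by (rule exI[of _ \<beta>], rule exI[of _ X], rule exI[of _ p], rule exI[of _ g]) (use 1 2 in blast)
  qed
  from choice[OF this] obtain \<beta> where "\<forall>i. \<exists>X p g. ?P i (\<beta> i) X p g" by blast
  from choice[OF this] obtain X where "\<forall>i. \<exists>p g. ?P i (\<beta> i) (X i) p g" by blast
  from choice[OF this] obtain p where "\<forall>i. \<exists>g. ?P i (\<beta> i) (X i) (p i) g" by blast
  from choice[OF this] obtain g where loc: "\<And>i. ?P i (\<beta> i) (X i) (p i) (g i)" by blast
  have \<beta>0: "0 \<le> \<beta> i y" and \<beta>1: "\<beta> i y \<le> 1" and Xn: "norm (X i y) \<le> 4/\<rho>" and gn: "norm (g i y) \<le> 2"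
    and \<beta>pos: "\<beta> i y > 0 \<longleftrightarrow> norm (y - \<gamma> (c i)) < \<rho>"
    and d\<beta>: "(\<beta> i has_derivative (\<lambda>h. X i y \<bullet> h)) (at y)" and dp: "(p i has_derivative (\<lambda>h. g i y \<bullet> h)) (at y)"
    and cX: "continuous_on UNIV (X i)" and cg: "continuous_on UNIV (g i)" for i y
    using loc[of i] by blast+
  have c\<beta>: "continuous_on UNIV (\<beta> i)" and cp: "continuous_on UNIV (p i)" for i
    using has_derivative_continuous[OF d\<beta>[of i]] has_derivative_continuous[OF dp[of i]]
    by (simp_all add: continuous_on_eq_continuous_at)
  have coord: "\<exists>k::int. p i (\<gamma> x) = x + of_int k" if "\<beta> i (\<gamma> x) > 0" for i x
  proof -
    have "norm (\<gamma> x - \<gamma> (c i)) < \<rho>" using that \<beta>pos[of i "\<gamma> x"] by simp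
    from \<rho>(2)[OF this] obtain k :: int where "\<bar>x - c i - of_int k\<bar> < r/2" by blast
    then have "\<bar>(x + of_int (- k)) - c i\<bar> \<le> r/2" by (simp add: algebra_simps)
    then have "p i (\<gamma> (x + of_int (- k))) = x + of_int (- k)" using loc by blast
    then show ?thesis by (metis periodic_add_int[of \<gamma>, OF p\<gamma>])
  qed
  define S where "S x = (\<Sum>i<N. \<beta> i (\<gamma> x))" for x
  define S' where "S' x = (\<Sum>i<N. X i (\<gamma> x) \<bullet> T x)" for x
  have Spos: "S x > 0" for x
  proof -
    \<comment> \<open>The last centre not beyond \<open>frac x\<close>; by unit speed its point is within \<open>1 / N < \<rho>\<close> of
      \<open>\<gamma> x\<close>.\<close>
    define i where "i = nat \<lfloor>frac x * real N\<rfloor>"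
    have N: "real N > 0" by (simp add: N_def)
    have fl: "0 \<le> \<lfloor>frac x * real N\<rfloor>" using N by simp
    have i: "real i \<le> frac x * real N" "frac x * real N < real i + 1"
      using fl floor_correct[of "frac x * real N"] by (auto simp: i_def)
    then have "real i < 1 * real N" using mult_strict_right_mono[OF frac_lt_1[of x] N] by linarith
    then have "i < N" by simp
    have "frac x - c i = (frac x * real N - real i) / real N" using N by (simp add: c_def field_simps)
    then have "\<bar>frac x - c i\<bar> \<le> 1 / real N"
      using i by (simp add: divide_right_mono)
    then have "norm (\<gamma> (frac x) - \<gamma> (c i)) \<le> 1 / real N"
      using curve_lipschitz[of \<gamma> T 1 "frac x" "c i", OF d] n by simp
    then have "norm (\<gamma> x - \<gamma> (c i)) < \<rho>" using N0 by (simp add: N_def periodic_frac[of \<gamma>, OF p\<gamma>])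
    then have "\<beta> i (\<gamma> x) > 0" using \<beta>pos by simp
    then show ?thesis unfolding S_def using \<open>i < N\<close> by (intro sum_pos2[of _ i]) (auto simp: \<beta>0)
  qed
  have dS: "(S has_vector_derivative S' x) (at x)" for x
  proof -
    have "((\<lambda>x. \<beta> i (\<gamma> x)) has_vector_derivative X i (\<gamma> x) \<bullet> T x) (at x)" for i
      using has_derivative_compose[OF d[of x, unfolded has_vector_derivative_def] d\<beta>[of i "\<gamma> x"]]
      by (simp add: has_vector_derivative_def)
    then show ?thesis unfolding S_def S'_def by (intro has_vector_derivative_sum) auto
  qed
  have cS: "continuous_on UNIV S" unfolding S_def
    by (intro continuous_intros continuous_on_compose2[OF c\<beta> c\<gamma>]) auto
  have cS': "continuous_on UNIV S'" unfolding S'_def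
    by (intro continuous_intros continuous_on_compose2[OF cX c\<gamma>] cT) auto
  have pS: "S (x + 1) = S x" "S' (x + 1) = S' x" for x by (simp_all add: S_def S'_def p\<gamma> pT)
  obtain B where B: "B > 0" "\<And>x. norm (S' x) \<le> B" by (rule periodic_bounded[OF cS' pS(2)]) (rule that)
  have "continuous_on UNIV (\<lambda>x. 1 / S x)" by (intro continuous_intros cS) (metis Spos less_irrefl)
  then obtain A where A: "A > 0" "\<And>x. norm (1 / S x) \<le> A" by (rule periodic_bounded) (auto simp: pS intro: that)
  define C where "C = real N * (4/\<rho> * A + 2 * (A + B * A\<^sup>2))"
  have "C > 0" unfolding C_def using A B \<rho>(1) by (intro mult_pos_pos add_pos_pos) (auto simp: N_def)
  moreover have "\<exists>h (D :: 'b \<Rightarrow> 'b \<Rightarrow>\<^sub>L 'b). (\<forall>y. (h has_derivative blinfun_apply (D y)) (at y)) \<and> continuous_on UNIV D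
            \<and> (\<forall>y. norm (D y) \<le> C * e) \<and> (\<forall>x. h (\<gamma> x) = \<delta> x)"
    if \<delta>: "\<And>x. (\<delta> has_vector_derivative \<delta>' x) (at x)" "continuous_on UNIV \<delta>'" "\<And>x. \<delta> (x + 1) = \<delta> x"
      and e: "\<And>x. norm (\<delta> x) \<le> e" "\<And>x. norm (\<delta>' x) \<le> e" for \<delta> \<delta>' e
  proof -
    have c\<delta>: "continuous_on UNIV \<delta>" by (rule continuous_on_vector_derivative) (rule \<delta>(1))
    have e0: "e \<ge> 0" using order_trans[OF norm_ge_zero e(1)] .
    define G where "G x = (1 / S x) *\<^sub>R \<delta> x" for x
    define G' where "G' x = (1 / S x) *\<^sub>R \<delta>' x + (- S' x * (1 / S x)\<^sup>2) *\<^sub>R \<delta> x" for x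
    have dG: "(G has_vector_derivative G' x) (at x)" for x
    proof -
      have "((\<lambda>x. 1 / S x) has_real_derivative - S' x * (1 / S x)\<^sup>2) (at x)"
        using dS[of x] Spos[of x] unfolding has_real_derivative_iff_has_vector_derivative[symmetric]
        by (auto intro!: derivative_eq_intros simp: power2_eq_square)
      then show ?thesis unfolding G_def G'_def
        using has_vector_derivative_scaleR[OF _ \<delta>(1)] by fastforce
    qed
    have S0: "S x \<noteq> 0" for x using Spos[of x] by simp
    have cG: "continuous_on UNIV G" "continuous_on UNIV G'" unfolding G_def G'_def
      by (intro continuous_intros cS cS' c\<delta> \<delta>(2); simp add: S0)+
    have Gper: "G (x + 1) = G x" for x by (simp add: G_def pS \<delta>)
    have Gn: "norm (G x) \<le> A * e" for x unfolding G_def norm_scaleR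
      using A e(1)[of x] by (intro mult_mono) auto
    have G'n: "norm (G' x) \<le> (A + B * A\<^sup>2) * e" for x
    proof -
      have "norm (G' x) \<le> norm (1 / S x) * norm (\<delta>' x) + norm (S' x) * (norm (1 / S x))\<^sup>2 * norm (\<delta> x)"
        unfolding G'_def by (rule order_trans[OF norm_triangle_ineq]) (simp add: abs_mult power_abs)
      also have "\<dots> \<le> A * e + B * A\<^sup>2 * e"
        using A B e e0 by (intro add_mono mult_mono power_mono) (auto intro!: mult_nonneg_nonneg)
      finally show ?thesis by (simp add: distrib_right)
    qed
    define h where "h y = (\<Sum>i<N. \<beta> i y *\<^sub>R G (p i y))" for y
    define D where "D y = (\<Sum>i<N. rank_one (X i y) (G (p i y)) + rank_one (\<beta> i y *\<^sub>R g i y) (G' (p i y)))" for y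
    have "(h has_derivative blinfun_apply (D y)) (at y)" for y
    proof -
      have "((\<lambda>y. \<beta> i y *\<^sub>R G (p i y)) has_derivative
          (\<lambda>h. rank_one (X i y) (G (p i y)) h + rank_one (\<beta> i y *\<^sub>R g i y) (G' (p i y)) h)) (at y)" for i
      proof -
        have "((\<lambda>y. G (p i y)) has_derivative (\<lambda>h. (g i y \<bullet> h) *\<^sub>R G' (p i y))) (at y)"
          using has_derivative_compose[OF dp[of i y] dG[of "p i y", unfolded has_vector_derivative_def]] .
        from has_derivative_scaleR[OF d\<beta>[of i y] this] show ?thesis
          by (simp add: rank_one_apply mult.commute add.commute)
      qed
      then have "(h has_derivative (\<lambda>z. \<Sum>i<N. rank_one (X i y) (G (p i y)) z + rank_one (\<beta> i y *\<^sub>R g i y) (G' (p i y)) z)) (at y)"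
        unfolding h_def by (intro has_derivative_sum) auto
      moreover have "blinfun_apply (D y)
          = (\<lambda>z. \<Sum>i<N. rank_one (X i y) (G (p i y)) z + rank_one (\<beta> i y *\<^sub>R g i y) (G' (p i y)) z)"
        by (rule ext) (simp add: D_def blinfun.sum_left blinfun.add_left)
      ultimately show ?thesis by (simp only:)
    qed
    moreover have "continuous_on UNIV D" unfolding D_def
      by (intro continuous_intros continuous_on_rank_one cX cg c\<beta> continuous_on_compose2[OF cG(1) cp]
          continuous_on_compose2[OF cG(2) cp]) auto
    moreover have "norm (D y) \<le> C * e" for y
    proof -
      have "norm (D y) \<le> (\<Sum>i<N. norm (rank_one (X i y) (G (p i y)) + rank_one (\<beta> i y *\<^sub>R g i y) (G' (p i y))))"
        unfolding D_def by (rule norm_sum)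
      also have "\<dots> \<le> (\<Sum>i<N. 4/\<rho> * (A * e) + 2 * ((A + B * A\<^sup>2) * e))"
      proof (rule sum_mono)
        fix i
        have "norm (rank_one (X i y) (G (p i y))) \<le> 4/\<rho> * (A * e)"
          by (rule order_trans[OF norm_rank_one_le])
             (rule mult_mono[OF Xn Gn], use \<rho>(1) in auto)
        moreover have "norm (\<beta> i y *\<^sub>R g i y) \<le> 1 * 2"
          unfolding norm_scaleR using \<beta>0 \<beta>1 gn by (intro mult_mono) auto
        then have "norm (rank_one (\<beta> i y *\<^sub>R g i y) (G' (p i y))) \<le> 2 * ((A + B * A\<^sup>2) * e)"
          by (intro order_trans[OF norm_rank_one_le] mult_mono G'n) auto
        ultimately show "norm (rank_one (X i y) (G (p i y)) + rank_one (\<beta> i y *\<^sub>R g i y) (G' (p i y)))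
          \<le> 4/\<rho> * (A * e) + 2 * ((A + B * A\<^sup>2) * e)"
          by (rule order_trans[OF norm_triangle_ineq add_mono])
      qed
      also have "\<dots> = C * e" by (simp add: C_def algebra_simps)
      finally show ?thesis .
    qed
    moreover have "h (\<gamma> x) = \<delta> x" for x
    proof -
      have "\<beta> i (\<gamma> x) *\<^sub>R G (p i (\<gamma> x)) = \<beta> i (\<gamma> x) *\<^sub>R G x" for i
      proof (cases "\<beta> i (\<gamma> x) > 0")
        case True
        then obtain k :: int where "p i (\<gamma> x) = x + of_int k" using coord by blast
        then show ?thesis by (simp add: periodic_add_int[of G, OF Gper])
      next
        case False
        then have "\<beta> i (\<gamma> x) = 0" using \<beta>0[of i "\<gamma> x"] by simp
        then show ?thesis by simp
      qed
      then have "h (\<gamma> x) = S x *\<^sub>R G x" unfolding h_def S_def scaleR_sum_left by (simp only:)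
      then show ?thesis using S0[of x] by (simp add: G_def)
    qed
    ultimately show ?thesis by blast
  qed
  ultimately show ?thesis by (intro exI[of _ C]) blast
qed

text \<open>The displacement \<open>\<eta> - \<gamma>\<close> is extended to a field \<open>h\<close>, and the space moves along it:
  \<open>F (y, t) = y + t *\<^sub>R h y\<close>. The threshold \<open>1 / (2 * C)\<close> makes the derivative of \<open>h\<close> at most \<open>1/2\<close>,
  as \<open>C1_diffeo_id_plus\<close> requires.\<close>

lemma C1_close_imp_ambient_isotopic:
  fixes \<gamma> T :: "real \<Rightarrow> 'b::euclidean_space"
  assumes k: "unit_speed_knot \<gamma> T"
  obtains e where "e > 0"
    "\<And>\<eta> U. (\<And>x. (\<eta> has_vector_derivative U x) (at x)) \<Longrightarrow> continuous_on UNIV U \<Longrightarrow> (\<And>x. \<eta> (x + 1) = \<eta> x)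
      \<Longrightarrow> (\<And>x. norm (\<eta> x - \<gamma> x) \<le> e) \<Longrightarrow> (\<And>x. norm (U x - T x) \<le> e) \<Longrightarrow> C1_ambient_isotopic \<gamma> \<eta>"
proof -
  obtain C where C: "C > 0" "\<forall>\<delta> \<delta>' e. (\<forall>x. (\<delta> has_vector_derivative \<delta>' x) (at x)) \<longrightarrow> continuous_on UNIV \<delta>' \<longrightarrow>
      (\<forall>x. \<delta> (x + 1) = \<delta> x) \<longrightarrow> (\<forall>x. norm (\<delta> x) \<le> e) \<longrightarrow> (\<forall>x. norm (\<delta>' x) \<le> e) \<longrightarrow>
      (\<exists>h (D :: 'b \<Rightarrow> 'b \<Rightarrow>\<^sub>L 'b). (\<forall>y. (h has_derivative blinfun_apply (D y)) (at y)) \<and> continuous_on UNIV D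
            \<and> (\<forall>y. norm (D y) \<le> C * e) \<and> (\<forall>x. h (\<gamma> x) = \<delta> x))"
    using extension_from_knot[OF k] by blast
  have k': "\<And>x. (\<gamma> has_vector_derivative T x) (at x)" "continuous_on UNIV T" "\<And>x. \<gamma> (x + 1) = \<gamma> x"
    using k by (auto simp: unit_speed_knot_def)
  have "C1_ambient_isotopic \<gamma> \<eta>"
    if \<eta>: "\<And>x. (\<eta> has_vector_derivative U x) (at x)" "continuous_on UNIV U" "\<And>x. \<eta> (x + 1) = \<eta> x"
      "\<And>x. norm (\<eta> x - \<gamma> x) \<le> 1/(2*C)" "\<And>x. norm (U x - T x) \<le> 1/(2*C)" for \<eta> U
  proof -
    have "\<exists>h (D :: 'b \<Rightarrow> 'b \<Rightarrow>\<^sub>L 'b). (\<forall>y. (h has_derivative blinfun_apply (D y)) (at y)) \<and> continuous_on UNIV D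
            \<and> (\<forall>y. norm (D y) \<le> C * (1/(2*C))) \<and> (\<forall>x. h (\<gamma> x) = \<eta> x - \<gamma> x)"
      by (rule C(2)[rule_format, of "\<lambda>x. \<eta> x - \<gamma> x" "\<lambda>x. U x - T x"])
         (use \<eta> k' in \<open>auto intro!: has_vector_derivative_diff continuous_intros\<close>)
    then obtain h and D :: "'b \<Rightarrow> 'b \<Rightarrow>\<^sub>L 'b" where h: "\<And>y. (h has_derivative blinfun_apply (D y)) (at y)" "continuous_on UNIV D"
      "\<And>y. norm (D y) \<le> C * (1/(2*C))" "\<And>x. h (\<gamma> x) = \<eta> x - \<gamma> x" by blast
    have D2: "norm (D y) \<le> 1/2" for y using h(3)[of y] C(1) by simp
    have ch: "continuous_on UNIV h" using has_derivative_continuous[OF h(1)] by (simp add: continuous_on_eq_continuous_at)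
    show ?thesis unfolding C1_ambient_isotopic_def
    proof (intro exI[of _ "\<lambda>q. fst q + snd q *\<^sub>R h (fst q)"] conjI ballI allI)
      show "continuous_on (UNIV \<times> {0..1}) (\<lambda>q. fst q + snd q *\<^sub>R h (fst q))"
        by (intro continuous_intros continuous_on_compose2[OF ch]) auto
      fix t :: real assume t: "t \<in> {0..1}"
      have "C1_diffeo (\<lambda>x. x + t *\<^sub>R h x)"
      proof (rule C1_diffeo_id_plus[where D = "\<lambda>x. t *\<^sub>R D x"])
        show "((\<lambda>x. t *\<^sub>R h x) has_derivative blinfun_apply (t *\<^sub>R D x)) (at x)" for x
          using has_derivative_scaleR_right[OF h(1)[of x], of t] by (simp add: blinfun.scaleR_left[abs_def])
        show "norm (t *\<^sub>R D x) \<le> 1/2" for x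
          using mult_mono[of "\<bar>t\<bar>" 1 "norm (D x)" "1/2"] t D2[of x] by simp
      qed (intro continuous_intros h(2))
      then show "C1_diffeo (\<lambda>x. fst (x, t) + snd (x, t) *\<^sub>R h (fst (x, t)))" by simp
    qed (auto simp: image_image h(4))
  qed
  then show ?thesis by (rule that[of "1/(2*C)", rotated]) (use C(1) in auto)
qed

lemma knot_unit_speed:
  fixes \<gamma> :: "real \<Rightarrow> 'b::euclidean_space"
  assumes s: "1/2 < s" "s \<le> 1" and \<gamma>: "\<gamma> \<in> knots s"
  obtains T where "unit_speed_knot \<gamma> T" "T \<in> H_circle s"
proof -
  obtain T where T: "\<And>x. (\<gamma> has_vector_derivative T x) (at x)" "continuous_on UNIV T"
    "\<And>x. T (x + 1) = T x" "\<And>x. norm (T x) = 1" "T \<in> H_circle s" "integral {0..1} T = 0"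
    "\<And>x. \<gamma> (x + 1) = \<gamma> x"
    by (rule knot_tangent[OF s \<gamma>]) (rule that)
  show ?thesis
    by (rule that[of T]) (use T \<gamma> in \<open>auto simp: unit_speed_knot_def knots_def\<close>)
qed

lemma knots_near_imp_ambient_isotopic:
  fixes \<gamma> :: "real \<Rightarrow> 'b::euclidean_space"
  assumes s: "1/2 < s" "s \<le> 1" and \<gamma>: "\<gamma> \<in> knots s"
  obtains r where "r > 0"
    "\<And>\<eta>. \<eta> \<in> knots s \<Longrightarrow> H1_norm s (\<lambda>x. \<gamma> x - \<eta> x) < r \<Longrightarrow> C1_ambient_isotopic \<gamma> \<eta>"
proof -
  obtain T where T: "unit_speed_knot \<gamma> T" by (rule knot_unit_speed[OF s \<gamma>]) (rule that)
  obtain e where e: "e > 0"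
    "\<And>\<eta> U. (\<And>x. (\<eta> has_vector_derivative U x) (at x)) \<Longrightarrow> continuous_on UNIV U \<Longrightarrow> (\<And>x. \<eta> (x + 1) = \<eta> x)
      \<Longrightarrow> (\<And>x. norm (\<eta> x - \<gamma> x) \<le> e) \<Longrightarrow> (\<And>x. norm (U x - T x) \<le> e) \<Longrightarrow> C1_ambient_isotopic \<gamma> \<eta>"
    using C1_close_imp_ambient_isotopic[OF T] by blast
  obtain C where C: "C > 0"
    "\<And>(f :: real \<Rightarrow> 'b) T x. f \<in> H1_circle s \<Longrightarrow> (\<And>x. (f has_vector_derivative T x) (at x))
      \<Longrightarrow> norm (T x) \<le> C * H1_norm s f \<and> norm (f x) \<le> C * H1_norm s f"
    using H1_sup_bound[OF s] by blast
  have "C1_ambient_isotopic \<gamma> \<eta>" if \<eta>: "\<eta> \<in> knots s" and near: "H1_norm s (\<lambda>x. \<gamma> x - \<eta> x) < e / C" for \<eta>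
  proof -
    obtain U where U: "unit_speed_knot \<eta> U" by (rule knot_unit_speed[OF s \<eta>]) (rule that)
    have f: "(\<lambda>x. \<gamma> x - \<eta> x) \<in> H1_circle s"
      by (rule H1_circle_diff) (use s \<gamma> \<eta> in \<open>auto simp: knots_def\<close>)
    have d: "((\<lambda>x. \<gamma> x - \<eta> x) has_vector_derivative T x - U x) (at x)" for x
      using T U by (intro has_vector_derivative_diff) (auto simp: unit_speed_knot_def)
    have "C * H1_norm s (\<lambda>x. \<gamma> x - \<eta> x) \<le> e" using near C(1) by (simp add: field_simps)
    then have "norm (T x - U x) \<le> e" "norm (\<gamma> x - \<eta> x) \<le> e" for x
      using C(2)[OF f d, of x] by linarith+
    then show ?thesis using U by (intro e(2)[of \<eta> U]) (auto simp: unit_speed_knot_def norm_minus_commute)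
  qed
  then show ?thesis using that[of "e / C"] e(1) C(1) by (metis divide_pos_pos)
qed

lemma (in Metric_space) openin_subtopology_mball:
  assumes "S \<subseteq> M" "A \<subseteq> S" and "\<And>x. x \<in> A \<Longrightarrow> \<exists>r>0. \<forall>y\<in>S. d x y < r \<longrightarrow> y \<in> A"
  shows "openin (subtopology mtopology S) A"
proof -
  have "\<forall>x\<in>A. \<exists>r>0. \<forall>y\<in>S. d x y < r \<longrightarrow> y \<in> A" using assms(3) by blast
  from bchoice[OF this] obtain r where r: "\<And>x. x \<in> A \<Longrightarrow> r x > 0" "\<And>x y. x \<in> A \<Longrightarrow> y \<in> S \<Longrightarrow> d x y < r x \<Longrightarrow> y \<in> A"
    by blast
  have "A = (\<Union>x\<in>A. mball x (r x)) \<inter> S"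
  proof (intro equalityI subsetI)
    fix x assume "x \<in> A"
    then have "x \<in> mball x (r x)" using r(1) assms(1,2) by (auto simp: centre_in_mball_iff)
    then show "x \<in> (\<Union>x\<in>A. mball x (r x)) \<inter> S" using \<open>x \<in> A\<close> assms(2) by blast
  qed (use r(2) in auto)
  then show ?thesis unfolding openin_subtopology by (intro exI[of _ "\<Union>x\<in>A. mball x (r x)"]) auto
qed

text \<open>Ambient isotopy is an equivalence relation with open classes, so the class of \<open>\<gamma>0\<close> and
  its complement separate \<open>M\<close>.\<close>

lemma connected_component_imp_ambient_isotopic:
  fixes \<gamma>0 \<gamma>1 :: "real \<Rightarrow> 'b::euclidean_space"
  assumes s: "1/2 < s" "s \<le> 1" and M: "M \<subseteq> knots s"
    and conn: "connected_component_of (subtopology (H1_topology s) M) \<gamma>0 \<gamma>1"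
  shows "C1_ambient_isotopic \<gamma>0 \<gamma>1"
proof (rule ccontr)
  assume no: "\<not> C1_ambient_isotopic \<gamma>0 \<gamma>1"
  interpret H: Metric_space "H1_circle s" "\<lambda>f g :: real \<Rightarrow> 'b. H1_norm s (\<lambda>x. f x - g x)"
    by (rule Metric_space_H1[OF s(2)])
  let ?X = "subtopology (H1_topology s) M"
  have MH: "M \<subseteq> H1_circle s" using M by (auto simp: knots_def)
  obtain S where S: "connectedin ?X S" "\<gamma>0 \<in> S" "\<gamma>1 \<in> S"
    using conn unfolding connected_component_of_def by blast
  have SM: "S \<subseteq> M" using connectedin_subset_topspace[OF S(1)] by auto
  let ?U = "{\<eta> \<in> M. C1_ambient_isotopic \<gamma>0 \<eta>}" and ?V = "{\<eta> \<in> M. \<not> C1_ambient_isotopic \<gamma>0 \<eta>}"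
  have near: "\<exists>r>0. \<forall>y\<in>M. H1_norm s (\<lambda>x. \<eta> x - y x) < r \<longrightarrow> C1_ambient_isotopic \<eta> y" if "\<eta> \<in> M" for \<eta>
    using knots_near_imp_ambient_isotopic[OF s, of \<eta>] that M by (metis subsetD)
  have oU: "openin ?X ?U" unfolding H1_topology_def
  proof (rule H.openin_subtopology_mball[OF MH])
    show "\<exists>r>0. \<forall>y\<in>M. H1_norm s (\<lambda>x. \<eta> x - y x) < r \<longrightarrow> y \<in> ?U" if "\<eta> \<in> ?U" for \<eta>
      using near[of \<eta>] that C1_ambient_isotopic_trans by blast
  qed auto
  have oV: "openin ?X ?V" unfolding H1_topology_def
  proof (rule H.openin_subtopology_mball[OF MH])
    show "\<exists>r>0. \<forall>y\<in>M. H1_norm s (\<lambda>x. \<eta> x - y x) < r \<longrightarrow> y \<in> ?V" if "\<eta> \<in> ?V" for \<eta>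
      using near[of \<eta>] that C1_ambient_isotopic_trans C1_ambient_isotopic_sym by blast
  qed auto
  have "C1_ambient_isotopic \<gamma>0 \<gamma>0"
    using near[of \<gamma>0] S(2) SM H.mdist_zero MH C1_ambient_isotopic_trans C1_ambient_isotopic_sym
    by (metis subsetD)
  then show False
    using connectedinD[OF S(1) oU oV] S SM no by blast
qed

section \<open>Closed curves of unit vectors and their balancing\<close>

text \<open>The case \<open>w = 0\<close> fits in because \<open>sgn 0 = 0\<close>.\<close>

lemma norm_sgn_diff_le:
  fixes u w :: "'b::euclidean_space"
  assumes "u \<noteq> 0" shows "norm (sgn u - sgn w) \<le> 2 * norm (u - w) / norm u"
proof (cases "w = 0")
  case True
  then show ?thesis using assms by (simp add: norm_sgn)
next
  case False
  have "sgn u - sgn w = (1 / norm u) *\<^sub>R (u - w) + (1 / norm u - 1 / norm w) *\<^sub>R w"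
    by (simp add: sgn_div_norm divide_inverse algebra_simps)
  then have "norm (sgn u - sgn w) \<le> norm (u - w) / norm u + \<bar>1 / norm u - 1 / norm w\<bar> * norm w"
    using norm_triangle_ineq[of "(1 / norm u) *\<^sub>R (u - w)" "(1 / norm u - 1 / norm w) *\<^sub>R w"] by simp
  also have "\<bar>1 / norm u - 1 / norm w\<bar> * norm w = \<bar>norm w - norm u\<bar> / norm u"
  proof -
    have "\<bar>1 / norm u - 1 / norm w\<bar> * norm w = \<bar>(1 / norm u - 1 / norm w) * norm w\<bar>" by (simp add: abs_mult)
    also have "(1 / norm u - 1 / norm w) * norm w = (norm w - norm u) / norm u"
      using assms False by (simp add: field_simps)
    finally show ?thesis by simp
  qed
  also have "\<dots> \<le> norm (u - w) / norm u"
    using norm_triangle_ineq3[of w u] by (intro divide_right_mono) (simp_all add: norm_minus_commute)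
  finally show ?thesis by simp
qed

text \<open>The derivative of \<^const>\<open>sgn\<close>: projection to the complement of \<open>u\<close>, divided by the length of \<open>u\<close>.\<close>

definition dsgn :: "'b::euclidean_space \<Rightarrow> 'b \<Rightarrow>\<^sub>L 'b" where
  "dsgn u = inverse (norm u) *\<^sub>R id_blinfun - rank_one (sgn u) (inverse (norm u) *\<^sub>R sgn u)"

lemma dsgn_apply: "dsgn u h = inverse (norm u) *\<^sub>R h - (sgn u \<bullet> h) *\<^sub>R (inverse (norm u) *\<^sub>R sgn u)"
  by (simp add: dsgn_def blinfun.diff_left blinfun.scaleR_left rank_one_apply)

lemma has_derivative_sgn:
  fixes u :: "'b::euclidean_space"
  assumes "u \<noteq> 0" shows "(sgn has_derivative dsgn u) (at u)"
proof -
  have n: "norm u \<noteq> 0" using assms by simp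
  have "((\<lambda>u. inverse (norm u)) has_derivative (\<lambda>h. - (inverse (norm u) * (sgn u \<bullet> h) * inverse (norm u)))) (at u)"
    by (rule has_derivative_eq_rhs[OF has_derivative_compose[OF has_derivative_norm[OF assms]
          DERIV_inverse[OF n, unfolded has_field_derivative_def]]])
       (simp add: fun_eq_iff inner_commute)
  from has_derivative_scaleR[OF this has_derivative_ident]
  have "((\<lambda>u. inverse (norm u) *\<^sub>R u) has_derivative dsgn u) (at u)"
    by (rule has_derivative_eq_rhs) (auto simp: dsgn_apply sgn_div_norm fun_eq_iff)
  then show ?thesis by (simp add: sgn_div_norm[abs_def])
qed

lemma continuous_on_dsgn: "continuous_on {u. u \<noteq> 0} dsgn"
  unfolding dsgn_def by (intro continuous_intros continuous_on_rank_one) auto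

lemma norm_dsgn_le:
  fixes u :: "'b::euclidean_space"
  assumes "norm u \<ge> 1/2" shows "norm (dsgn u h) \<le> 4 * norm h"
proof -
  have i: "inverse (norm u) \<le> 2" "u \<noteq> 0" using le_imp_inverse_le[OF assms] assms by auto
  have "norm (dsgn u h) \<le> inverse (norm u) * norm h + \<bar>sgn u \<bullet> h\<bar> * (inverse (norm u) * 1)"
    unfolding dsgn_apply by (rule order_trans[OF norm_triangle_ineq4]) (use i in \<open>simp add: norm_sgn abs_mult\<close>)
  also have "\<dots> \<le> 2 * norm h + norm h * (2 * 1)"
    using i Cauchy_Schwarz_ineq2[of "sgn u" h]
    by (intro add_mono mult_mono) (auto simp: norm_sgn)
  finally show ?thesis by simp
qed

text \<open>At the unit vector \<open>\<tau>\<close> the derivative of \<^const>\<open>sgn\<close> is the orthogonal projection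
  \<open>h - (\<tau> \<bullet> h) *\<^sub>R \<tau>\<close>. Within distance \<open>e\<close> of \<open>\<tau>\<close> it changes by at most \<open>8 * e\<close>, and the mean value
  inequality integrates this.\<close>

lemma sgn_near_unit_vector:
  fixes \<tau> :: "'b::euclidean_space"
  assumes \<tau>: "norm \<tau> = 1" and e: "0 \<le> e" "e \<le> 1/2" and uu: "norm (u - \<tau>) \<le> e" "norm (u' - \<tau>) \<le> e"
  shows "norm ((sgn u - sgn u') - ((u - u') - (\<tau> \<bullet> (u - u')) *\<^sub>R \<tau>)) \<le> 8 * e * norm (u - u')"
proof -
  let ?\<Psi> = "\<lambda>u. sgn u - u + (\<tau> \<bullet> u) *\<^sub>R \<tau>"
  have "norm (?\<Psi> u - ?\<Psi> u') \<le> (8 * e) * norm (u - u')"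
  proof (rule differentiable_bound[of "cball \<tau> e" ?\<Psi> "\<lambda>u h. dsgn u h - h + (\<tau> \<bullet> h) *\<^sub>R \<tau>"])
    fix u assume "u \<in> cball \<tau> e"
    then have ut: "norm (u - \<tau>) \<le> e" by (simp add: dist_norm norm_minus_commute)
    have nu: "\<bar>norm u - 1\<bar> \<le> e" using norm_triangle_ineq3[of u \<tau>] ut \<tau> by linarith
    then have nu2: "norm u \<ge> 1/2" using e by linarith
    then have u0: "u \<noteq> 0" by auto
    show "(?\<Psi> has_derivative (\<lambda>h. dsgn u h - h + (\<tau> \<bullet> h) *\<^sub>R \<tau>)) (at u within cball \<tau> e)"
      by (rule has_derivative_at_withinI)
         (intro has_derivative_add has_derivative_diff has_derivative_sgn[OF u0] has_derivative_ident
            has_derivative_scaleR_left has_derivative_inner_right)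
    define a where "a = inverse (norm u)"
    define n where "n = sgn u"
    have a: "\<bar>a - 1\<bar> \<le> 2 * e"
    proof -
      have "a - 1 = (1 - norm u) * a" using u0 by (simp add: a_def field_simps)
      then have "\<bar>a - 1\<bar> = \<bar>norm u - 1\<bar> * a" by (simp add: abs_mult a_def abs_minus_commute)
      also have "\<dots> \<le> e * 2" using nu nu2 e u0 by (intro mult_mono) (auto simp: a_def field_simps)
      finally show ?thesis by simp
    qed
    have n1: "norm n = 1" using u0 by (simp add: n_def norm_sgn)
    have nt: "norm (n - \<tau>) \<le> 2 * e"
    proof -
      have "\<tau> \<noteq> 0" "sgn \<tau> = \<tau>" using \<tau> by (auto simp: sgn_div_norm)
      then show ?thesis
        using norm_sgn_diff_le[of \<tau> u] \<tau> ut unfolding n_def by (simp add: norm_minus_commute)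
    qed
    show "onorm (\<lambda>h. dsgn u h - h + (\<tau> \<bullet> h) *\<^sub>R \<tau>) \<le> 8 * e"
    proof (rule onorm_bound)
      fix h
      have "dsgn u h - h + (\<tau> \<bullet> h) *\<^sub>R \<tau>
        = (a - 1) *\<^sub>R h - ((a - 1) * (n \<bullet> h)) *\<^sub>R n - ((n - \<tau>) \<bullet> h) *\<^sub>R n - (\<tau> \<bullet> h) *\<^sub>R (n - \<tau>)"
        by (simp add: dsgn_apply a_def[symmetric] n_def[symmetric] algebra_simps inner_diff_left)
      then have "norm (dsgn u h - h + (\<tau> \<bullet> h) *\<^sub>R \<tau>)
        \<le> norm ((a - 1) *\<^sub>R h) + norm (((a - 1) * (n \<bullet> h)) *\<^sub>R n) + norm (((n - \<tau>) \<bullet> h) *\<^sub>R n) + norm ((\<tau> \<bullet> h) *\<^sub>R (n - \<tau>))"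
        by (smt (verit) norm_triangle_ineq4)
      also have "\<dots> \<le> 2 * e * norm h + 2 * e * norm h + 2 * e * norm h + norm h * (2 * e)"
      proof (intro add_mono)
        have nh: "\<bar>n \<bullet> h\<bar> \<le> norm h" "\<bar>\<tau> \<bullet> h\<bar> \<le> norm h"
          using Cauchy_Schwarz_ineq2[of n h] Cauchy_Schwarz_ineq2[of \<tau> h] n1 \<tau> by auto
        show "norm ((a - 1) *\<^sub>R h) \<le> 2 * e * norm h" using a by (simp add: mult_right_mono)
        show "norm (((a - 1) * (n \<bullet> h)) *\<^sub>R n) \<le> 2 * e * norm h"
          using mult_mono[OF a nh(1)] e n1 by (simp add: abs_mult)
        have "\<bar>(n - \<tau>) \<bullet> h\<bar> \<le> norm (n - \<tau>) * norm h" by (rule Cauchy_Schwarz_ineq2)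
        also have "\<dots> \<le> 2 * e * norm h" by (intro mult_right_mono nt) auto
        finally show "norm (((n - \<tau>) \<bullet> h) *\<^sub>R n) \<le> 2 * e * norm h" using n1 by simp
        show "norm ((\<tau> \<bullet> h) *\<^sub>R (n - \<tau>)) \<le> norm h * (2 * e)"
          using mult_mono[OF nh(2) nt] by simp
      qed
      finally show "norm (dsgn u h - h + (\<tau> \<bullet> h) *\<^sub>R \<tau>) \<le> 8 * e * norm h" by (simp add: algebra_simps)
    qed (use e in auto)
  qed (use uu in \<open>auto simp: dist_norm norm_minus_commute\<close>)
  moreover have "?\<Psi> u - ?\<Psi> u' = (sgn u - sgn u') - ((u - u') - (\<tau> \<bullet> (u - u')) *\<^sub>R \<tau>)"
    by (simp add: inner_diff_right algebra_simps)
  ultimately show ?thesis by simp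
qed

text \<open>The tangent of a closed curve is not confined to a line: by Rolle's theorem it is
  orthogonal to any given direction somewhere, so each integral is less than \<open>1\<close> for unit \<open>e\<close>. By
  compactness of the sphere the largest of them serves as \<open>q\<close>.\<close>

lemma tangent_not_collinear:
  fixes K T :: "real \<Rightarrow> 'b::euclidean_space"
  assumes d: "\<And>x. (K has_vector_derivative T x) (at x)" and cT: "continuous_on UNIV T"
    and n: "\<And>x. norm (T x) = 1" and cl: "K 1 = K 0"
  obtains q where "0 \<le> q" "q < 1" "\<And>e. integral {0..1} (\<lambda>x. \<bar>T x \<bullet> e\<bar>) \<le> q * norm e"
proof -
  have cT': "continuous_on S T" for S using cT continuous_on_subset by blast
  define f where "f e = integral {0..1} (\<lambda>x. \<bar>T x \<bullet> e\<bar>)" for e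
  have int: "(\<lambda>x. \<bar>T x \<bullet> e\<bar>) integrable_on {0..1}" for e
    by (intro integrable_continuous_real continuous_intros cT')
  have ip: "\<bar>T x \<bullet> e\<bar> \<le> norm e" for x e using Cauchy_Schwarz_ineq2[of "T x" e] n by simp
  have "\<bar>f e - f e'\<bar> \<le> norm (e - e')" for e e'
  proof -
    have "f e - f e' = integral {0..1} (\<lambda>x. \<bar>T x \<bullet> e\<bar> - \<bar>T x \<bullet> e'\<bar>)"
      unfolding f_def by (rule integral_diff[symmetric, OF int int])
    also have "norm \<dots> \<le> integral {0..1} (\<lambda>x::real. norm (e - e'))"
    proof (rule integral_norm_bound_integral)
      show "norm (\<bar>T x \<bullet> e\<bar> - \<bar>T x \<bullet> e'\<bar>) \<le> norm (e - e')" for x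
        using ip[of x "e - e'"] by (simp add: inner_diff_right)
    qed (auto intro!: integrable_diff int)
    finally show ?thesis by simp
  qed
  then have cf: "continuous_on S f" for S
    by (intro lipschitz_on_continuous_on[of 1]) (auto intro!: lipschitz_onI simp: dist_norm)
  have "\<exists>e0\<in>sphere 0 1. \<forall>e\<in>sphere (0::'b) 1. f e \<le> f e0"
    by (rule continuous_attains_sup) (auto intro: cf)
  then obtain e0 :: 'b where e0: "norm e0 = 1" "\<And>e. norm e = 1 \<Longrightarrow> f e \<le> f e0" by auto
  have "f e0 < 1"
  proof -
    have "\<exists>z>0. z < 1 \<and> T z \<bullet> e0 = 0"
    proof -
      have "((\<lambda>x. K x \<bullet> e0) has_vector_derivative T x \<bullet> e0) (at x)" for x
        by (rule bounded_linear.has_vector_derivative[OF bounded_linear_inner_left d])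
      then have D: "((\<lambda>x. K x \<bullet> e0) has_real_derivative T x \<bullet> e0) (at x)" for x
        by (simp add: has_real_derivative_iff_has_vector_derivative)
      have "\<exists>z>0. z < 1 \<and> (K 1 \<bullet> e0) - (K 0 \<bullet> e0) = (1 - 0) * (T z \<bullet> e0)"
        by (rule MVT2) (use D in auto)
      then show ?thesis using cl by auto
    qed
    then obtain z where z: "0 < z" "z < 1" "T z \<bullet> e0 = 0" by blast
    have hi: "((\<lambda>x. 1 - \<bar>T x \<bullet> e0\<bar>) has_integral (1 - f e0)) (cbox 0 1)"
      using has_integral_diff[OF has_integral_const_real[of 1 0 1] integrable_integral[OF int[of e0]]]
      by (simp add: f_def)
    have nn: "0 \<le> 1 - \<bar>T x \<bullet> e0\<bar>" for x using ip[of x e0] e0(1) by simp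
    have "0 \<le> 1 - f e0" by (rule has_integral_nonneg[OF hi nn])
    moreover have "1 - f e0 \<noteq> 0"
    proof
      assume "1 - f e0 = 0"
      then have "((\<lambda>x. 1 - \<bar>T x \<bullet> e0\<bar>) has_integral 0) (cbox 0 1)" using hi by simp
      moreover have "continuous_on (cbox 0 1) (\<lambda>x. 1 - \<bar>T x \<bullet> e0\<bar>)" by (intro continuous_intros cT')
      ultimately have "1 - \<bar>T z \<bullet> e0\<bar> = 0"
        using has_integral_0_cbox_imp_0[of 0 1 "\<lambda>x. 1 - \<bar>T x \<bullet> e0\<bar>" z] nn z by auto
      then show False using z by simp
    qed
    ultimately show ?thesis by simp
  qed
  moreover have "f e \<le> f e0 * norm e" for e
  proof (cases "e = 0")
    case False
    have "f (sgn e) \<le> f e0" by (rule e0(2)) (use False in \<open>simp add: norm_sgn\<close>)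
    moreover have "f (sgn e) = f e / norm e"
      unfolding f_def by (simp add: sgn_div_norm abs_mult divide_inverse mult.commute)
    ultimately show ?thesis using False by (simp add: field_simps)
  qed (simp add: f_def)
  moreover have "0 \<le> f e0" unfolding f_def by (intro integral_nonneg int) auto
  ultimately show ?thesis using that[of "f e0"] by (auto simp: f_def)
qed

definition near_tangent :: "(real \<Rightarrow> 'b::euclidean_space) \<Rightarrow> real \<Rightarrow> (real \<Rightarrow> 'b) \<Rightarrow> bool" where
  "near_tangent T \<eta> w \<longleftrightarrow>
     continuous_on UNIV w \<and> (\<forall>x. w (x + 1) = w x) \<and> (\<forall>x. norm (w x - T x) \<le> \<eta>)"

text \<open>The vector \<open>V w\<close> is the geometric median of \<open>w\<close>, that is, the minimizer of the convex
  function \<open>v \<mapsto> \<integral> \<bar>w - v\<bar>\<close>, whose gradient is \<open>- \<integral> sgn (w - v)\<close>. It is found as the fixed point of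
  the gradient step \<open>G w v = v + \<integral> sgn (w - v)\<close>. For \<open>w\<close> near \<open>T\<close> and small \<open>v\<close> the derivative of this
  step is close to the map \<open>e \<mapsto> \<integral> (T \<bullet> e) T\<close>, of norm at most the number \<open>q < 1\<close> of
  \<open>tangent_not_collinear\<close>. So the step is a contraction, uniformly in \<open>w\<close>, and its fixed point is
  Lipschitz in \<open>w\<close>.\<close>

lemma balancing:
  fixes K T :: "real \<Rightarrow> 'b::euclidean_space"
  assumes d: "\<And>x. (K has_vector_derivative T x) (at x)" and cT: "continuous_on UNIV T"
    and n: "\<And>x. norm (T x) = 1" and cl: "K 1 = K 0"
  shows "\<exists>\<eta>>0. \<exists>C>0. \<exists>V.
    (\<forall>w. near_tangent T \<eta> w \<longrightarrow> integral {0..1} (\<lambda>x. sgn (w x - V w)) = 0) \<and>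
    (\<forall>w w' r. near_tangent T \<eta> w \<longrightarrow> near_tangent T \<eta> w' \<longrightarrow> (\<forall>x. norm (w x - w' x) \<le> r)
       \<longrightarrow> norm (V w - V w') \<le> C * r) \<and>
    (\<forall>w. near_tangent T \<eta> w \<longrightarrow> integral {0..1} (\<lambda>x. sgn (w x)) = 0 \<longrightarrow> V w = 0)"
proof -
  have cT': "continuous_on S T" for S using cT continuous_on_subset by blast
  obtain q where q: "0 \<le> q" "q < 1" "\<And>e. integral {0..1} (\<lambda>x. \<bar>T x \<bullet> e\<bar>) \<le> q * norm e"
    by (rule tangent_not_collinear[OF d cT n cl]) (rule that)
  define \<mu> where "\<mu> = 1 - q"
  \<comment> \<open>Deviating from \<open>T\<close> by \<open>2 * \<epsilon>\<close> costs \<open>16 * \<epsilon> = \<mu> / 2\<close> of the contraction factor. The choice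
    of \<open>\<eta>\<close> gives \<open>2 * \<eta> + (1 - \<mu>/2) * \<epsilon> = \<epsilon>\<close>, so that the ball of radius \<open>\<epsilon>\<close> is mapped into itself.\<close>
  define \<epsilon> where "\<epsilon> = \<mu> / 32"
  define \<eta> where "\<eta> = \<mu> * \<epsilon> / 4"
  have \<mu>: "0 < \<mu>" "\<mu> \<le> 1" using q by (auto simp: \<mu>_def)
  have \<epsilon>: "0 < \<epsilon>" "\<epsilon> \<le> 1/32" using \<mu> by (auto simp: \<epsilon>_def)
  have \<eta>: "0 < \<eta>" "\<eta> \<le> \<epsilon>" using \<mu> \<epsilon> mult_mono[of \<mu> 1 \<epsilon> \<epsilon>] by (auto simp: \<eta>_def)
  let ?adm = "near_tangent T \<eta>"
  define G :: "(real \<Rightarrow> 'b) \<Rightarrow> 'b \<Rightarrow> 'b" where "G w v = v + integral {0..1} (\<lambda>x. sgn (w x - v))" for w v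
  have near: "norm ((w x - v) - T x) \<le> 2 * \<epsilon>" if "?adm w" "norm v \<le> \<epsilon>" "x \<in> {0..1}" for w v x
  proof -
    have "norm ((w x - T x) - v) \<le> norm (w x - T x) + norm v" by (rule norm_triangle_ineq4)
    moreover have "norm (w x - T x) \<le> \<eta>" using that by (auto simp: near_tangent_def)
    ultimately show ?thesis using that(2) \<eta>(2) by (simp add: algebra_simps)
  qed
  have large: "norm (w x - v) \<ge> 1/2" if "?adm w" "norm v \<le> \<epsilon>" "x \<in> {0..1}" for w v x
    using near[OF that] norm_triangle_ineq3[of "w x - v" "T x"] n[of x] \<epsilon>(2) by linarith
  have int: "(\<lambda>x. sgn (w x - v)) integrable_on {0..1}" if "?adm w" "norm v \<le> \<epsilon>" for w v
  proof (intro integrable_continuous_real continuous_on_sgn continuous_intros)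
    show "continuous_on {0..1} w" using that continuous_on_subset by (auto simp: near_tangent_def)
    show "\<forall>x\<in>{0..1}. w x - v \<noteq> 0" using large[OF that] by (metis norm_zero not_one_le_zero half_gt_zero_iff not_le zero_less_one)
  qed
  have contr: "norm (G w v - G w v') \<le> (1 - \<mu>/2) * norm (v - v')"
    if w: "?adm w" and v: "norm v \<le> \<epsilon>" "norm v' \<le> \<epsilon>" for w v v'
  proof -
    let ?e = "v - v'"
    have "G w v - G w v' = integral {0..1} (\<lambda>x::real. ?e) + (integral {0..1} (\<lambda>x. sgn (w x - v)) - integral {0..1} (\<lambda>x. sgn (w x - v')))"
      by (simp add: G_def)
    also have "\<dots> = integral {0..1} (\<lambda>x. ?e + (sgn (w x - v) - sgn (w x - v')))"
      by (subst integral_diff[symmetric, OF int[OF w v(1)] int[OF w v(2)]],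
          subst integral_add[symmetric]) (auto intro!: integrable_diff int w v)
    also have "norm \<dots> \<le> integral {0..1} (\<lambda>x. 16 * \<epsilon> * norm ?e + \<bar>T x \<bullet> ?e\<bar>)"
    proof (rule integral_norm_bound_integral)
      show "(\<lambda>x. ?e + (sgn (w x - v) - sgn (w x - v'))) integrable_on {0..1}"
        by (intro integrable_add integrable_diff int w v) auto
      show "(\<lambda>x. 16 * \<epsilon> * norm ?e + \<bar>T x \<bullet> ?e\<bar>) integrable_on {0..1}"
        by (intro integrable_continuous_real continuous_intros cT')
      fix x :: real assume x: "x \<in> {0..1}"
      let ?R = "(sgn (w x - v) - sgn (w x - v')) - (((w x - v) - (w x - v')) - (T x \<bullet> ((w x - v) - (w x - v'))) *\<^sub>R T x)"
      have R: "norm ?R \<le> 8 * (2 * \<epsilon>) * norm ((w x - v) - (w x - v'))"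
        by (rule sgn_near_unit_vector) (use n \<epsilon> near[OF w v(1) x] near[OF w v(2) x] in auto)
      have "?e + (sgn (w x - v) - sgn (w x - v')) = ?R + (T x \<bullet> ?e) *\<^sub>R T x"
        by (simp add: inner_diff_right algebra_simps)
      then have "norm (?e + (sgn (w x - v) - sgn (w x - v'))) \<le> norm ?R + norm ((T x \<bullet> ?e) *\<^sub>R T x)"
        by (simp only: norm_triangle_ineq)
      also have "\<dots> \<le> 16 * \<epsilon> * norm ?e + \<bar>T x \<bullet> ?e\<bar>"
        using R n[of x] by (simp add: norm_minus_commute)
      finally show "norm (?e + (sgn (w x - v) - sgn (w x - v'))) \<le> 16 * \<epsilon> * norm ?e + \<bar>T x \<bullet> ?e\<bar>" .
    qed
    also have "\<dots> = 16 * \<epsilon> * norm ?e + integral {0..1} (\<lambda>x. \<bar>T x \<bullet> ?e\<bar>)"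
      by (subst integral_add) (auto intro!: integrable_continuous_real continuous_intros cT')
    also have "\<dots> \<le> 16 * \<epsilon> * norm ?e + q * norm ?e" using q(3) by (intro add_left_mono)
    also have "\<dots> = (1 - \<mu>/2) * norm ?e"
    proof -
      have e: "16 * \<epsilon> = \<mu> / 2" and q': "q = 1 - \<mu>" by (simp_all add: \<epsilon>_def \<mu>_def)
      show ?thesis unfolding e q' by (simp add: algebra_simps)
    qed
    finally show ?thesis .
  qed
  have sgnT: "sgn (T x) = T x" for x using n[of x] by (simp add: sgn_div_norm)
  have intT: "integral {0..1} T = 0"
    using primitive_of_has_integral[OF primitive_of_C1[OF d cT], of 0 1] cl by (simp add: integral_unique)
  have self: "norm (G w v) \<le> \<epsilon>" if w: "?adm w" and v: "norm v \<le> \<epsilon>" for w v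
  proof -
    have i0: "(\<lambda>x. sgn (w x)) integrable_on {0..1}" using int[OF w, of 0] \<epsilon> by simp
    have iT: "T integrable_on {0..1}" by (intro integrable_continuous_real cT')
    have "G w 0 = integral {0..1} (\<lambda>x. sgn (w x) - T x)"
      using intT by (subst integral_diff[OF i0 iT]) (simp add: G_def)
    also have "norm \<dots> \<le> integral {0..1} (\<lambda>x::real. 2 * \<eta>)"
    proof (rule integral_norm_bound_integral)
      show "(\<lambda>x. sgn (w x) - T x) integrable_on {0..1}" by (intro integrable_diff i0 iT)
      show "norm (sgn (w x) - T x) \<le> 2 * \<eta>" if "x \<in> {0..1}" for x
      proof -
        have "T x \<noteq> 0" using n[of x] by auto
        moreover have "norm (T x - w x) \<le> \<eta>" using w that by (simp add: near_tangent_def norm_minus_commute)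
        ultimately show ?thesis
          using norm_sgn_diff_le[of "T x" "w x"] n[of x] sgnT[of x] by (simp add: norm_minus_commute)
      qed
    qed auto
    finally have "norm (G w 0) \<le> 2 * \<eta>" by simp
    moreover have "norm (G w v - G w 0) \<le> (1 - \<mu>/2) * norm (v - 0)"
      by (rule contr[OF w v]) (use \<epsilon> in auto)
    moreover have "(1 - \<mu>/2) * norm (v - 0) \<le> (1 - \<mu>/2) * \<epsilon>" using v \<mu> by (intro mult_left_mono) auto
    moreover have "2 * \<eta> + (1 - \<mu>/2) * \<epsilon> = \<epsilon>" by (simp add: \<eta>_def algebra_simps)
    ultimately show ?thesis using norm_triangle_sub[of "G w v" "G w 0"] by linarith
  qed
  define V where "V w = (SOME v. norm v \<le> \<epsilon> \<and> G w v = v)" for w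
  have V: "norm (V w) \<le> \<epsilon>" "G w (V w) = V w" if w: "?adm w" for w
  proof -
    have "\<exists>!v\<in>cball 0 \<epsilon>. G w v = v"
      by (rule Banach_fix[of "cball 0 \<epsilon>" "1 - \<mu>/2"])
         (use \<mu> \<epsilon> self[OF w] contr[OF w] in \<open>auto simp: dist_norm complete_eq_closed\<close>)
    then have "\<exists>v. norm v \<le> \<epsilon> \<and> G w v = v" by auto
    then show "norm (V w) \<le> \<epsilon>" "G w (V w) = V w" unfolding V_def by (metis (mono_tags, lifting) someI_ex)+
  qed
  have V0: "integral {0..1} (\<lambda>x. sgn (w x - V w)) = 0" if "?adm w" for w
    using V(2)[OF that] by (simp add: G_def)
  have Vlip: "norm (V w - V w') \<le> 8 / \<mu> * r"
    if w: "?adm w" "?adm w'" and r: "\<And>x. norm (w x - w' x) \<le> r" for w w' r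
  proof -
    let ?v = "V w" and ?v' = "V w'"
    have "G w ?v' - G w' ?v' = integral {0..1} (\<lambda>x. sgn (w x - ?v') - sgn (w' x - ?v'))"
      unfolding G_def by (subst integral_diff[OF int[OF w(1) V(1)[OF w(2)]] int[OF w(2) V(1)[OF w(2)]]]) simp
    also have "norm \<dots> \<le> integral {0..1} (\<lambda>x::real. 4 * r)"
    proof (rule integral_norm_bound_integral)
      show "(\<lambda>x. sgn (w x - ?v') - sgn (w' x - ?v')) integrable_on {0..1}"
        by (intro integrable_diff int w V)
      fix x :: real assume x: "x \<in> {0..1}"
      have l: "norm (w x - ?v') \<ge> 1/2" by (rule large[OF w(1) V(1)[OF w(2)] x])
      then have "norm (sgn (w x - ?v') - sgn (w' x - ?v')) \<le> 2 * norm ((w x - ?v') - (w' x - ?v')) / norm (w x - ?v')"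
        by (intro norm_sgn_diff_le) auto
      also have "\<dots> \<le> 2 * r / (1/2)" using r[of x] l by (intro frac_le) (auto intro: order_trans[OF norm_ge_zero])
      finally show "norm (sgn (w x - ?v') - sgn (w' x - ?v')) \<le> 4 * r" by simp
    qed auto
    finally have 1: "norm (G w ?v' - G w' ?v') \<le> 4 * r" by simp
    have 2: "norm (G w ?v - G w ?v') \<le> (1 - \<mu>/2) * norm (?v - ?v')"
      by (rule contr[OF w(1) V(1)[OF w(1)] V(1)[OF w(2)]])
    have "?v - ?v' = (G w ?v - G w ?v') + (G w ?v' - G w' ?v')" using V(2)[OF w(1)] V(2)[OF w(2)] by simp
    then have "norm (?v - ?v') \<le> (1 - \<mu>/2) * norm (?v - ?v') + 4 * r"
      using norm_triangle_mono[OF 2 1] by metis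
    then have "\<mu>/2 * norm (?v - ?v') \<le> 4 * r" by (simp add: algebra_simps)
    then show ?thesis using \<mu> by (simp add: field_simps)
  qed
  have Vz: "V w = 0" if w: "?adm w" and z: "integral {0..1} (\<lambda>x. sgn (w x)) = 0" for w
  proof -
    have "G w 0 = 0" using z by (simp add: G_def)
    then have "norm (V w - 0) \<le> (1 - \<mu>/2) * norm (V w - 0)"
      using contr[OF w V(1)[OF w], of 0] V(2)[OF w] \<epsilon> by simp
    then have "\<mu>/2 * norm (V w) \<le> 0" by (simp add: algebra_simps)
    then show ?thesis using \<mu> by (simp add: mult_le_0_iff)
  qed
  have "0 < 8 / \<mu>" using \<mu> by simp
  then show ?thesis using \<eta>(1) V0 Vlip Vz by (intro exI[of _ \<eta>] exI[of _ "8/\<mu>"] exI[of _ V] conjI) auto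
qed

section \<open>Knots with prescribed tangents\<close>

text \<open>At small distances the chord follows the tangent; at larger ones \<open>knot_separation\<close> keeps
  the points apart.\<close>

lemma unit_speed_knot_bilipschitz:
  fixes K T :: "real \<Rightarrow> 'b::euclidean_space"
  assumes k: "unit_speed_knot K T"
  obtains c where "c > 0" "\<And>x y. \<bar>x - y\<bar> \<le> 1/2 \<Longrightarrow> c * \<bar>x - y\<bar> \<le> norm (K x - K y)"
proof -
  have d: "\<And>x. (K has_vector_derivative T x) (at x)" and cT: "continuous_on UNIV T" and n: "\<And>x. norm (T x) = 1"
    and pT: "\<And>x. T (x + 1) = T x" and pK: "\<And>x. K (x + 1) = K x" and inj: "inj_on K {0..<1}"
    using k by (auto simp: unit_speed_knot_def)
  have cK: "continuous_on UNIV K" by (rule continuous_on_vector_derivative) (rule d)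
  obtain r where r: "r > 0" "\<And>x y. \<bar>x - y\<bar> < r \<Longrightarrow> norm (T x - T y) < 1/2"
    by (rule periodic_uniformly_continuous[OF cT pT, of "1/2"]) (auto intro: that)
  define r' where "r' = min r (1/2)"
  have r': "0 < r'" "r' \<le> 1/2" "r' \<le> r" using r by (auto simp: r'_def)
  obtain \<rho> where \<rho>: "\<rho> > 0" "\<And>x u. norm (K x - K u) < \<rho> \<Longrightarrow> \<exists>k::int. \<bar>x - u - of_int k\<bar> < r'"
    by (rule knot_separation[OF cK pK inj r'(1)]) (rule that)
  have "min (1/2) \<rho> * \<bar>x - y\<bar> \<le> norm (K x - K y)" if xy: "\<bar>x - y\<bar> \<le> 1/2" for x y
  proof (cases "\<bar>x - y\<bar> < r'")
    case True
    have "norm (K x - K y - (x - y) *\<^sub>R T y) \<le> 1/2 * \<bar>x - y\<bar>"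
    proof (rule chord_tangent_le[OF d])
      fix t assume "t \<in> closed_segment y x"
      then have "\<bar>t - y\<bar> < r" using True r'(3) by (auto simp: closed_segment_eq_real_ivl split: if_splits)
      then show "norm (T t - T y) \<le> 1/2" using r(2)[of t y] by simp
    qed
    moreover have "\<bar>x - y\<bar> \<le> norm (K x - K y) + norm (K x - K y - (x - y) *\<^sub>R T y)"
      using norm_triangle_ineq4[of "K x - K y" "K x - K y - (x - y) *\<^sub>R T y"] n[of y] by simp
    ultimately have "1/2 * \<bar>x - y\<bar> \<le> norm (K x - K y)" by simp
    moreover have "min (1/2) \<rho> * \<bar>x - y\<bar> \<le> 1/2 * \<bar>x - y\<bar>" by (intro mult_right_mono) auto
    ultimately show ?thesis by linarith
  next
    case False
    have "\<rho> \<le> norm (K x - K y)"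
    proof (rule ccontr)
      assume "\<not> ?thesis"
      then obtain k :: int where k: "\<bar>x - y - of_int k\<bar> < r'" using \<rho>(2)[of x y] by auto
      have "\<bar>real_of_int k\<bar> < 1" using k xy r'(2) by linarith
      then have "k = 0" by linarith
      then show False using k False by simp
    qed
    moreover have "min (1/2) \<rho> * \<bar>x - y\<bar> \<le> \<rho> * 1" using xy \<rho>(1) by (intro mult_mono) auto
    ultimately show ?thesis by simp
  qed
  then show ?thesis using that[of "min (1/2) \<rho>"] \<rho>(1) by auto
qed

text \<open>The increments of a curve with tangent near \<open>T\<close> differ from those of \<open>K\<close> by a small
  multiple of the parameter distance, which cannot compensate the lower bound of
  \<open>unit_speed_knot_bilipschitz\<close>.\<close>

lemma embedding_stable:
  fixes K T :: "real \<Rightarrow> 'b::euclidean_space"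
  assumes k: "unit_speed_knot K T"
  obtains e where "e > 0"
    "\<And>c U. (\<And>x. (c has_vector_derivative U x) (at x)) \<Longrightarrow> (\<And>x. c (x + 1) = c x) \<Longrightarrow>
      (\<And>x. norm (U x - T x) \<le> e) \<Longrightarrow> inj_on c {0..<1}"
proof -
  obtain m where m: "m > 0" "\<And>x y. \<bar>x - y\<bar> \<le> 1/2 \<Longrightarrow> m * \<bar>x - y\<bar> \<le> norm (K x - K y)"
    by (rule unit_speed_knot_bilipschitz[OF k]) (rule that)
  have d: "\<And>x. (K has_vector_derivative T x) (at x)" using k by (auto simp: unit_speed_knot_def)
  have "inj_on c {0..<1}"
    if c: "\<And>x. (c has_vector_derivative U x) (at x)" "\<And>x. c (x + 1) = c x" "\<And>x. norm (U x - T x) \<le> m/2" for c U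
  proof -
    have loc: "x = y" if "c x = c y" "\<bar>x - y\<bar> \<le> 1/2" for x y
    proof -
      have "norm ((c x - K x) - (c y - K y)) \<le> m/2 * \<bar>x - y\<bar>"
        by (rule curve_lipschitz[where \<gamma> = "\<lambda>x. c x - K x" and T = "\<lambda>x. U x - T x"])
           (intro has_vector_derivative_diff c(1) d, rule c(3))
      then have "norm (K x - K y) \<le> m/2 * \<bar>x - y\<bar>" using that(1) by (simp add: norm_minus_commute)
      then have "m * \<bar>x - y\<bar> \<le> m/2 * \<bar>x - y\<bar>" using m(2)[OF that(2)] by linarith
      then show ?thesis using m(1) by (simp add: mult_le_0_iff)
    qed
    show ?thesis
    proof (rule inj_onI)
      fix x y :: real assume xy: "x \<in> {0..<1}" "y \<in> {0..<1}" "c x = c y"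
      consider "\<bar>x - y\<bar> \<le> 1/2" | "x - y > 1/2" | "y - x > 1/2" by linarith
      then show "x = y"
      proof cases
        case 1 then show ?thesis using loc xy by blast
      next
        case 2
        have "x = y + 1" by (rule loc) (use 2 xy c(2)[of y] in auto)
        then show ?thesis using xy by simp
      next
        case 3
        have "x + 1 = y" by (rule loc) (use 3 xy c(2)[of x] in auto)
        then show ?thesis using xy by simp
      qed
    qed
  qed
  then show ?thesis by (rule that[of "m/2", rotated]) (use m(1) in auto)
qed

lemma closed_curve_with_tangent:
  fixes T :: "real \<Rightarrow> 'b::euclidean_space"
  assumes cT: "continuous_on UNIV T" and pT: "\<And>x. T (x + 1) = T x" and z: "integral {0..1} T = 0"
  shows "\<exists>c. c 0 = b \<and> (\<forall>x. (c has_vector_derivative T x) (at x)) \<and> (\<forall>x. c (x + 1) = c x)"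
proof -
  obtain G where G: "primitive_of G T" "G 0 = 0"
    using primitive_exists[OF absolutely_integrable_continuous_real[OF continuous_on_subset[OF cT]]] by blast
  have "G 1 = G 0" using primitive_of_has_integral[OF G(1), of 0 1] z by (simp add: integral_unique)
  then have p: "G (x + 1) = G x" for x by (rule primitive_of_periodic[OF G(1) pT])
  have "((\<lambda>x. b + G x) has_vector_derivative T x) (at x)" for x
    using primitive_of_continuous_density[OF G(1) cT, of x] by (auto intro!: derivative_eq_intros)
  then show ?thesis using G(2) p by (intro exI[of _ "\<lambda>x. b + G x"]) auto
qed

lemma curve_determined_by_tangent:
  fixes c c' :: "real \<Rightarrow> 'b::real_normed_vector"
  assumes "\<And>x. (c has_vector_derivative T x) (at x)" "\<And>x. (c' has_vector_derivative T x) (at x)" "c 0 = c' 0"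
  shows "c = c'"
proof -
  have "((\<lambda>x. c x - c' x) has_vector_derivative 0) (at x)" for x
    using has_vector_derivative_diff[OF assms(1)[of x] assms(2)[of x]] by simp
  then obtain k where "\<And>x. c x - c' x = k"
    using has_vector_derivative_zero_constant[of UNIV "\<lambda>x. c x - c' x"] by auto
  then show ?thesis using assms(3) by (metis eq_iff_diff_eq_0 ext)
qed

lemma knot_from_tangent:
  fixes c U :: "real \<Rightarrow> 'b::euclidean_space"
  assumes c: "\<And>x. (c has_vector_derivative U x) (at x)" "\<And>x. c (x + 1) = c x" and cU: "continuous_on UNIV U"
    and U: "U \<in> H_circle s" "\<And>x. norm (U x) = 1" and inj: "inj_on c {0..<1}"
  shows "c \<in> knots s" "unit_speed_knot c U" "has_weak_deriv c U"
proof -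
  have pU: "U (x + 1) = U x" for x using L2_circle_periodic[OF H_circle_L2[OF U(1)]] .
  show w: "has_weak_deriv c U"
    by (rule primitive_has_weak_deriv[OF primitive_of_C1[OF c(1) cU] c(2) H_circle_L2[OF U(1)]])
  have "continuous_on UNIV c" by (rule continuous_on_vector_derivative) (rule c(1))
  then show "c \<in> knots s" using w U c inj unfolding knots_def H1_circle_def by blast
  show "unit_speed_knot c U" using c cU pU U(2) inj by (auto simp: unit_speed_knot_def)
qed

lemma unit_speed_knot_closed:
  assumes "unit_speed_knot \<gamma> T" shows "integral {0..1} T = 0"
proof -
  have "primitive_of \<gamma> T" by (rule primitive_of_C1) (use assms in \<open>auto simp: unit_speed_knot_def\<close>)
  from primitive_of_has_integral[OF this, of 0 1] have "integral {0..1} T = \<gamma> (0 + 1) - \<gamma> 0" by (simp add: integral_unique)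
  also have "\<gamma> (0 + 1) = \<gamma> 0" using assms unfolding unit_speed_knot_def by blast
  finally show ?thesis by simp
qed

text \<open>The balanced and normalized loop \<open>sgn (w - V w)\<close> is the tangent of a closed curve. Since
  \<open>V\<close> vanishes at \<open>T\<close> and is Lipschitz, this tangent stays as close to \<open>T\<close> as \<open>w\<close> is, up to a factor,
  so \<open>embedding_stable\<close> applies. Loops that are tangents of knots are not changed.\<close>

lemma knots_from_nearby_tangents:
  fixes K T :: "real \<Rightarrow> 'b::euclidean_space"
  assumes K: "unit_speed_knot K T"
  obtains e C V where "e > 0"
    "\<And>w \<delta> x. near_tangent T \<delta> w \<Longrightarrow> \<delta> \<le> e \<Longrightarrow> norm (w x - V w) \<ge> 1/2"
    "\<And>w \<delta> x. near_tangent T \<delta> w \<Longrightarrow> \<delta> \<le> e \<Longrightarrow> norm (sgn (w x - V w) - T x) \<le> C * \<delta>"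
    "\<And>w b. near_tangent T e w \<Longrightarrow> \<exists>c. c 0 = b \<and> (\<forall>x. (c has_vector_derivative sgn (w x - V w)) (at x))
      \<and> (\<forall>x. c (x + 1) = c x) \<and> inj_on c {0..<1}"
    "\<And>w w' r. near_tangent T e w \<Longrightarrow> near_tangent T e w' \<Longrightarrow> (\<forall>x. norm (w x - w' x) \<le> r)
      \<Longrightarrow> norm (V w - V w') \<le> C * r"
    "\<And>\<gamma> U. near_tangent T e U \<Longrightarrow> unit_speed_knot \<gamma> U \<Longrightarrow> V U = 0"
    "C > 0"
proof -
  have d: "\<And>x. (K has_vector_derivative T x) (at x)" and cT: "continuous_on UNIV T" and n: "\<And>x. norm (T x) = 1"
    and pT: "\<And>x. T (x + 1) = T x" and pK: "\<And>x. K (x + 1) = K x"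
    using K by (auto simp: unit_speed_knot_def)
  have K1: "K 1 = K 0" using pK[of 0] by simp
  obtain e0 where e0: "e0 > 0"
    "\<And>c U. (\<And>x. (c has_vector_derivative U x) (at x)) \<Longrightarrow> (\<And>x. c (x + 1) = c x) \<Longrightarrow>
      (\<And>x. norm (U x - T x) \<le> e0) \<Longrightarrow> inj_on c {0..<1}"
    using embedding_stable[OF K] by blast
  obtain \<eta>0 C V where V12: "\<eta>0 > 0" "C > 0" and V345:
    "\<forall>w. near_tangent T \<eta>0 w \<longrightarrow> integral {0..1} (\<lambda>x. sgn (w x - V w)) = 0"
    "\<forall>w w' r. near_tangent T \<eta>0 w \<longrightarrow> near_tangent T \<eta>0 w' \<longrightarrow> (\<forall>x. norm (w x - w' x) \<le> r)
       \<longrightarrow> norm (V w - V w') \<le> C * r"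
    "\<forall>w. near_tangent T \<eta>0 w \<longrightarrow> integral {0..1} (\<lambda>x. sgn (w x)) = 0 \<longrightarrow> V w = 0"
    using balancing[OF d cT n K1] by (elim exE conjE) (rule that; assumption)
  note V = V12 V345[rule_format]
  have mono: "near_tangent T b w" if "near_tangent T a w" "a \<le> b" for a b w
    using that order_trans unfolding near_tangent_def by blast
  have sgn1: "sgn y = y" if "norm y = 1" for y :: 'b using that by (simp add: sgn_div_norm)
  have Vz: "V U = 0" if "near_tangent T \<eta>0 U" "unit_speed_knot \<gamma> U" for \<gamma> U
    by (rule V(5)[OF that(1)])
       (use unit_speed_knot_closed[OF that(2)] that(2) sgn1 in \<open>auto simp: unit_speed_knot_def\<close>)
  have nearT: "near_tangent T \<eta>0 T" using cT pT V(1) by (simp add: near_tangent_def)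
  define e where "e = min \<eta>0 (min (1/2) (e0/2) / (1 + C))"
  have e: "e > 0" "e \<le> \<eta>0" "(1 + C) * e \<le> 1/2" "2 * (1 + C) * e \<le> e0"
  proof -
    show "e > 0" using V e0 by (auto simp: e_def)
    show "e \<le> \<eta>0" by (simp add: e_def)
    have "e \<le> min (1/2) (e0/2) / (1 + C)" by (simp add: e_def)
    then have "(1 + C) * e \<le> min (1/2) (e0/2)" using V(2) by (simp add: field_simps)
    then show "(1 + C) * e \<le> 1/2" "2 * (1 + C) * e \<le> e0" by (auto simp: algebra_simps)
  qed
  have uT: "norm ((w x - V w) - T x) \<le> (1 + C) * \<delta>" if w: "near_tangent T \<delta> w" "\<delta> \<le> e" for w \<delta> x
  proof -
    have wT: "norm (w x - T x) \<le> \<delta>" for x using w(1) by (simp add: near_tangent_def)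
    have "norm (V w - V T) \<le> C * \<delta>"
      by (rule V(4)[OF mono[OF w(1)] nearT wT]) (use w(2) e(2) in linarith)
    then have "norm (V w) \<le> C * \<delta>" using Vz[OF nearT K] by simp
    then show ?thesis using norm_triangle_ineq4[of "w x - T x" "V w"] wT[of x] by (simp add: algebra_simps)
  qed
  have large: "norm (w x - V w) \<ge> 1/2" if w: "near_tangent T \<delta> w" "\<delta> \<le> e" for w \<delta> x
  proof -
    have "(1 + C) * \<delta> \<le> (1 + C) * e" using w(2) V(2) by (intro mult_left_mono) auto
    then show ?thesis
      using uT[OF w, of x] e(3) norm_triangle_ineq3[of "w x - V w" "T x"] n[of x] by linarith
  qed
  have UT: "norm (sgn (w x - V w) - T x) \<le> 2 * (1 + C) * \<delta>" if w: "near_tangent T \<delta> w" "\<delta> \<le> e" for w \<delta> x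
  proof -
    have "T x \<noteq> 0" using n[of x] by auto
    then have "norm (sgn (T x) - sgn (w x - V w)) \<le> 2 * norm (T x - (w x - V w)) / norm (T x)"
      by (rule norm_sgn_diff_le)
    then show ?thesis using uT[OF w, of x] n[of x] sgn1[OF n] by (simp add: norm_minus_commute distrib_right)
  qed
  have closed: "\<exists>c. c 0 = b \<and> (\<forall>x. (c has_vector_derivative sgn (w x - V w)) (at x))
      \<and> (\<forall>x. c (x + 1) = c x) \<and> inj_on c {0..<1}" if w: "near_tangent T e w" for w b
  proof -
    have "w x - V w \<noteq> 0" for x using large[OF w order_refl, of x] by auto
    moreover have w': "continuous_on UNIV w" "\<And>x. w (x + 1) = w x" using w by (auto simp: near_tangent_def)
    ultimately have "continuous_on UNIV (\<lambda>x. sgn (w x - V w))"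
      by (intro continuous_on_sgn continuous_intros) auto
    from closed_curve_with_tangent[OF this _ V(3)[OF mono[OF w e(2)]], of b] w'(2)
    have "\<exists>c. c 0 = b \<and> (\<forall>x. (c has_vector_derivative sgn (w x - V w)) (at x)) \<and> (\<forall>x. c (x + 1) = c x)"
      by (simp only: simp_thms)
    then obtain c where c: "c 0 = b" "\<And>x. (c has_vector_derivative sgn (w x - V w)) (at x)" "\<And>x. c (x + 1) = c x"
      by blast
    have "norm (sgn (w x - V w) - T x) \<le> e0" for x
      using UT[OF w order_refl, of x] e(4) by linarith
    then have "inj_on c {0..<1}" by (rule e0(2)[OF c(2,3)])
    then show ?thesis using c by blast
  qed
  have lip: "norm (V w - V w') \<le> 2 * (1 + C) * r"
    if w: "near_tangent T e w" "near_tangent T e w'" and r: "\<And>x. norm (w x - w' x) \<le> r" for w w' r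
  proof -
    have "r \<ge> 0" using order_trans[OF norm_ge_zero r] .
    then have "C * r \<le> 2 * (1 + C) * r" using V(2) by (intro mult_right_mono) auto
    then show ?thesis using V(4)[OF mono[OF w(1) e(2)] mono[OF w(2) e(2)] r] by linarith
  qed
  show ?thesis
    by (rule that[of e V "2 * (1 + C)"]) (use e(1) V(2) large UT closed lip Vz mono[OF _ e(2)] in auto)
qed

section \<open>Paths of knots in the Sobolev topology\<close>

lemma sq_le_two_squares:
  fixes a b y :: real
  assumes "0 \<le> y" "y \<le> B * (a + b)" shows "y\<^sup>2 \<le> 2 * B\<^sup>2 * (a\<^sup>2 + b\<^sup>2)"
proof -
  have "y\<^sup>2 \<le> B\<^sup>2 * (a + b)\<^sup>2" using power_mono[OF assms(2,1), of 2] by (simp only: power_mult_distrib)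
  also have "\<dots> \<le> B\<^sup>2 * (2 * (a\<^sup>2 + b\<^sup>2))"
    using sum_squares_bound[of a b] by (intro mult_left_mono) (auto simp: power2_sum)
  finally show ?thesis by (simp only: mult_ac)
qed

lemma ennreal_sq_le_two_squares:
  fixes a b y c :: real
  assumes "0 \<le> y" "y \<le> B * (a + b)" "0 \<le> c"
  shows "ennreal (y\<^sup>2 / c) \<le> ennreal (2 * B\<^sup>2) * (ennreal (a\<^sup>2 / c) + ennreal (b\<^sup>2 / c))"
proof -
  have "y\<^sup>2 / c \<le> (2 * B\<^sup>2 * (a\<^sup>2 + b\<^sup>2)) / c"
    by (intro divide_right_mono sq_le_two_squares assms)
  also have "\<dots> = 2 * B\<^sup>2 * (a\<^sup>2 / c + b\<^sup>2 / c)" by (simp add: add_divide_distrib[symmetric])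
  finally have "ennreal (y\<^sup>2 / c) \<le> ennreal (2 * B\<^sup>2 * (a\<^sup>2 / c + b\<^sup>2 / c))" by (rule ennreal_leI)
  also have "\<dots> = ennreal (2 * B\<^sup>2) * (ennreal (a\<^sup>2 / c) + ennreal (b\<^sup>2 / c))"
    using assms(3) by (simp add: ennreal_mult flip: ennreal_plus)
  finally show ?thesis .
qed

lemma gagliardo_integrand_le:
  assumes "\<And>a b. norm (g a - g b) \<le> B * (norm (p a - p b) + norm (q a - q b))"
  shows "gagliardo_integrand s g u w \<le> ennreal (2 * B\<^sup>2) * (gagliardo_integrand s p u w + gagliardo_integrand s q u w)"
  using ennreal_sq_le_two_squares[OF norm_ge_zero assms, of "\<bar>w\<bar> powr (1 + 2 * s)" "u + w" u]
  by (auto simp: gagliardo_integrand_def split: split_indicator)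

lemma nn_integral_dominating_gagliardo:
  fixes p q :: "real \<Rightarrow> 'b::euclidean_space"
  assumes [measurable]: "p \<in> borel_measurable borel" "q \<in> borel_measurable borel"
  shows "(\<integral>\<^sup>+u. (\<integral>\<^sup>+w. ennreal c * (gagliardo_integrand s p u w + gagliardo_integrand s q u w) \<partial>lborel) * indicator {0..1} u \<partial>lborel)
    = ennreal c * (gagliardo_sq s p + gagliardo_sq s q)"
proof -
  note [measurable] = gagliardo_integrand_measurable[OF assms(1)] gagliardo_integrand_measurable[OF assms(2)]
  have "(\<integral>\<^sup>+w. ennreal c * (gagliardo_integrand s p u w + gagliardo_integrand s q u w) \<partial>lborel) * indicator {0..1} u
    = ennreal c * ((\<integral>\<^sup>+w. gagliardo_integrand s p u w \<partial>lborel) * indicator {0..1} u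
      + (\<integral>\<^sup>+w. gagliardo_integrand s q u w \<partial>lborel) * indicator {0..1} u)" for u
    by (subst nn_integral_cmult, simp, subst nn_integral_add) (auto split: split_indicator)
  then show ?thesis unfolding gagliardo_sq_eq
    by (simp only:) (subst nn_integral_cmult, simp, subst nn_integral_add, auto)
qed

lemma gagliardo_sq_le:
  fixes g p q :: "real \<Rightarrow> 'b::euclidean_space"
  assumes "p \<in> borel_measurable borel" "q \<in> borel_measurable borel"
    and le: "\<And>a b. norm (g a - g b) \<le> B * (norm (p a - p b) + norm (q a - q b))"
  shows "gagliardo_sq s g \<le> ennreal (2 * B\<^sup>2) * (gagliardo_sq s p + gagliardo_sq s q)"
  unfolding nn_integral_dominating_gagliardo[OF assms(1,2), symmetric] gagliardo_sq_eq[of s g]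
  by (intro nn_integral_mono mult_right_mono gagliardo_integrand_le le) auto

text \<open>Dominated convergence, for the inner and then for the outer integral. The increments
  of \<open>p\<close> and \<open>q\<close> dominate uniformly in \<open>k\<close>, and the inner dominating integral is finite for almost
  every \<open>u\<close>.\<close>

lemma gagliardo_sq_tendsto_0:
  fixes g :: "nat \<Rightarrow> real \<Rightarrow> 'b::euclidean_space" and p q :: "real \<Rightarrow> 'b"
  assumes [measurable]: "p \<in> borel_measurable borel" "q \<in> borel_measurable borel" "\<And>k. g k \<in> borel_measurable borel"
    and le: "\<And>k a b. norm (g k a - g k b) \<le> B * (norm (p a - p b) + norm (q a - q b))"
    and fin: "gagliardo_sq s p < \<infinity>" "gagliardo_sq s q < \<infinity>"
    and lim: "\<And>x. (\<lambda>k. g k x) \<longlonglongrightarrow> 0"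
  shows "(\<lambda>k. gagliardo_sq s (g k)) \<longlonglongrightarrow> 0"
proof -
  let ?e = "gagliardo_integrand s"
  define D where "D u w = ennreal (2 * B\<^sup>2) * (?e p u w + ?e q u w)" for u w
  note [measurable] = gagliardo_integrand_measurable[OF assms(1)] gagliardo_integrand_measurable[OF assms(2)]
    gagliardo_integrand_measurable[OF assms(3)]
  have [measurable]: "(\<lambda>w. D u w) \<in> borel_measurable borel" "(\<lambda>(u,w). D u w) \<in> borel_measurable (borel \<Otimes>\<^sub>M borel)" for u
    unfolding D_def by measurable
  have pt: "?e (g k) u w \<le> D u w" for k u w unfolding D_def by (rule gagliardo_integrand_le[OF le])
  define J where "J u = (\<integral>\<^sup>+w. D u w \<partial>lborel)" for u
  have [measurable]: "J \<in> borel_measurable borel" unfolding J_def by measurable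
  have Jfin: "(\<integral>\<^sup>+u. J u * indicator {0..1} u \<partial>lborel) < \<infinity>"
    unfolding J_def D_def nn_integral_dominating_gagliardo[OF assms(1,2)]
    using fin by (simp add: ennreal_mult_less_top)
  have elim: "(\<lambda>k. ?e (g k) u w) \<longlonglongrightarrow> 0" for u w
  proof -
    have "(\<lambda>k. (norm (g k (u + w) - g k u))\<^sup>2 / \<bar>w\<bar> powr (1 + 2 * s)) \<longlonglongrightarrow> (norm (0 - 0::'b))\<^sup>2 / \<bar>w\<bar> powr (1 + 2 * s)"
      unfolding divide_inverse by (intro tendsto_intros lim)
    then have "(\<lambda>k. ennreal ((norm (g k (u + w) - g k u))\<^sup>2 / \<bar>w\<bar> powr (1 + 2 * s))) \<longlonglongrightarrow> ennreal 0"
      by (intro tendsto_ennrealI) simp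
    then show ?thesis unfolding gagliardo_integrand_def by (cases "w \<in> {-1/2..1/2}") auto
  qed
  have inner: "(\<lambda>k. \<integral>\<^sup>+w. ?e (g k) u w \<partial>lborel) \<longlonglongrightarrow> 0" if "J u < \<infinity>" for u
  proof -
    have "(\<lambda>k. \<integral>\<^sup>+w. ?e (g k) u w \<partial>lborel) \<longlonglongrightarrow> (\<integral>\<^sup>+w. (0::ennreal) \<partial>(lborel :: real measure))"
      by (rule nn_integral_dominated_convergence[where w = "D u"])
         (use that elim pt in \<open>auto simp: J_def\<close>)
    then show ?thesis by simp
  qed
  have "AE u in lborel. J u * indicator {0..1} u \<noteq> \<infinity>"
    by (rule nn_integral_PInf_AE) (use Jfin in auto)
  then have aelim: "AE u in lborel. (\<lambda>k. (\<integral>\<^sup>+w. ?e (g k) u w \<partial>lborel) * indicator {0..1} u) \<longlonglongrightarrow> 0"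
  proof eventually_elim
    case (elim u)
    show ?case
    proof (cases "u \<in> {0..1::real}")
      case True
      then have "J u < \<infinity>" using elim by (auto simp: less_top)
      from inner[OF this] show ?thesis using True by simp
    qed simp
  qed
  have "(\<lambda>k. gagliardo_sq s (g k)) \<longlonglongrightarrow> (\<integral>\<^sup>+w. (0::ennreal) \<partial>(lborel :: real measure))"
    unfolding gagliardo_sq_eq
  proof (rule nn_integral_dominated_convergence[where w = "\<lambda>u. J u * indicator {0..1} u"])
    show "AE u in lborel. (\<integral>\<^sup>+w. ?e (g k) u w \<partial>lborel) * indicator {0..1} u \<le> J u * indicator {0..1} u" for k
      unfolding J_def by (intro AE_I2 mult_right_mono nn_integral_mono pt) auto
  qed (use Jfin aelim in auto)
  then show ?thesis by simp
qed

lemma L2_sq_tendsto_0: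
  fixes g :: "nat \<Rightarrow> real \<Rightarrow> 'b::euclidean_space" and p q :: "real \<Rightarrow> 'b"
  assumes [measurable]: "p \<in> borel_measurable borel" "q \<in> borel_measurable borel" "\<And>k. g k \<in> borel_measurable borel"
    and le: "\<And>k x. norm (g k x) \<le> B * (norm (p x) + norm (q x))"
    and fin: "L2_sq p < \<infinity>" "L2_sq q < \<infinity>"
    and lim: "\<And>x. (\<lambda>k. g k x) \<longlonglongrightarrow> 0"
  shows "(\<lambda>k. L2_sq (g k)) \<longlonglongrightarrow> 0"
proof -
  let ?D = "\<lambda>x. ennreal (2 * B\<^sup>2) * (ennreal ((norm (p x))\<^sup>2) * indicator {0..1} x + ennreal ((norm (q x))\<^sup>2) * indicator {0..1} x)"
  have pt: "ennreal ((norm (g k x))\<^sup>2) * indicator {0..1} x \<le> ?D x" for k x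
  proof -
    have "ennreal ((norm (g k x))\<^sup>2 / 1) \<le> ennreal (2 * B\<^sup>2) * (ennreal ((norm (p x))\<^sup>2 / 1) + ennreal ((norm (q x))\<^sup>2 / 1))"
      by (intro ennreal_sq_le_two_squares le) auto
    then show ?thesis by (auto split: split_indicator)
  qed
  have lim0: "(\<lambda>k. ennreal ((norm (g k x))\<^sup>2) * indicator {0..1} x) \<longlonglongrightarrow> 0" for x
  proof -
    have "(\<lambda>k. (norm (g k x))\<^sup>2) \<longlonglongrightarrow> (norm (0::'b))\<^sup>2" by (intro tendsto_intros lim)
    then have "(\<lambda>k. ennreal ((norm (g k x))\<^sup>2)) \<longlonglongrightarrow> ennreal 0" by (intro tendsto_ennrealI) simp
    then show ?thesis by (cases "x \<in> {0..1}") auto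
  qed
  have "(\<integral>\<^sup>+x. ?D x \<partial>lborel) = ennreal (2 * B\<^sup>2) * (L2_sq p + L2_sq q)"
    unfolding L2_sq_def by (subst nn_integral_cmult, simp, subst nn_integral_add) auto
  then have Dfin: "(\<integral>\<^sup>+x. ?D x \<partial>lborel) < \<infinity>" using fin by (simp add: ennreal_mult_less_top)
  have "(\<lambda>k. L2_sq (g k)) \<longlonglongrightarrow> (\<integral>\<^sup>+w. (0::ennreal) \<partial>(lborel :: real measure))"
    unfolding L2_sq_def
    by (rule nn_integral_dominated_convergence[where w = ?D])
       (use pt lim0 Dfin in \<open>auto simp del: distrib_left_numeral\<close>)
  then show ?thesis by simp
qed

lemma unit_speed_knot_tangent_unique:
  assumes "unit_speed_knot \<gamma> T" "unit_speed_knot \<gamma> U" shows "T = U"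
proof
  fix x show "T x = U x"
    by (rule vector_derivative_unique_at[of \<gamma> _ x]) (use assms in \<open>auto simp: unit_speed_knot_def\<close>)
qed

lemma L2_circle_dominated:
  fixes g p q :: "real \<Rightarrow> 'b::euclidean_space"
  assumes [measurable]: "g \<in> borel_measurable borel" and per: "\<And>x. g (x + 1) = g x"
    and p: "p \<in> L2_circle" and q: "q \<in> L2_circle"
    and le: "\<And>x. norm (g x) \<le> B * (norm (p x) + norm (q x))"
  shows "g \<in> L2_circle"
proof -
  have [measurable]: "p \<in> borel_measurable borel" "q \<in> borel_measurable borel"
    using p q L2_circle_measurable by auto
  have pt: "ennreal ((norm (g x))\<^sup>2 / 1) \<le> ennreal (2 * B\<^sup>2) * (ennreal ((norm (p x))\<^sup>2 / 1) + ennreal ((norm (q x))\<^sup>2 / 1))" for x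
    by (intro ennreal_sq_le_two_squares le) auto
  have "L2_sq g \<le> (\<integral>\<^sup>+x. ennreal (2 * B\<^sup>2) * (ennreal ((norm (p x))\<^sup>2) * indicator {0..1} x
      + ennreal ((norm (q x))\<^sup>2) * indicator {0..1} x) \<partial>lborel)"
    unfolding L2_sq_def by (intro nn_integral_mono) (use pt in \<open>auto split: split_indicator\<close>)
  also have "\<dots> = ennreal (2 * B\<^sup>2) * (L2_sq p + L2_sq q)"
    unfolding L2_sq_def by (subst nn_integral_cmult, simp, subst nn_integral_add) auto
  also have "\<dots> < \<infinity>" using p q by (simp add: ennreal_mult_less_top L2_circle_def)
  finally show ?thesis using per by (auto simp: L2_circle_def periodic_fun_simple'_def)
qed

text \<open>Normalization is Lipschitz away from \<open>0\<close>, so the increments of \<open>U t\<close> are bounded by those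
  of \<open>w0\<close> and \<open>w1\<close>, for all \<open>t\<close> at once; the constant \<open>v t\<close> cancels. The same bound that makes the
  Gagliardo seminorm finite therefore serves as the dominating function for its continuity in
  \<open>t\<close>. For \<open>s = 1\<close> the chain rule gives the weak derivative of \<open>U t\<close>, which is dominated by those of
  \<open>w0\<close> and \<open>w1\<close> in the same manner.\<close>

lemma normalized_segment_H_circle:
  fixes w0 w1 :: "real \<Rightarrow> 'b::euclidean_space" and v :: "real \<Rightarrow> 'b"
  assumes s: "0 < s" "s \<le> 1"
    and w: "w0 \<in> H_circle s" "w1 \<in> H_circle s" "continuous_on UNIV w0" "continuous_on UNIV w1"
    and v: "continuous_on {0..1} v"
    and large: "\<And>t x. t \<in> {0..1} \<Longrightarrow> norm ((1 - t) *\<^sub>R w0 x + t *\<^sub>R w1 x - v t) \<ge> 1/2"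
  defines "U \<equiv> \<lambda>t x. sgn ((1 - t) *\<^sub>R w0 x + t *\<^sub>R w1 x - v t)"
  shows "t \<in> {0..1} \<Longrightarrow> U t \<in> H_circle s"
    and "(\<And>k::nat. \<tau> k \<in> {0..1}) \<Longrightarrow> t \<in> {0..1} \<Longrightarrow> \<tau> \<longlonglongrightarrow> t \<Longrightarrow>
      (\<lambda>k. H_seminorm_sq s (\<lambda>x. U (\<tau> k) x - U t x)) \<longlonglongrightarrow> 0"
proof -
  define u where "u t x = (1 - t) *\<^sub>R w0 x + t *\<^sub>R w1 x - v t" for t x
  have U: "U t x = sgn (u t x)" for t x by (simp add: U_def u_def)
  have L: "w0 \<in> L2_circle" "w1 \<in> L2_circle" using w H_circle_L2 by auto
  have per: "u t (x + 1) = u t x" for t x using L by (simp add: u_def L2_circle_periodic)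
  have cu: "continuous_on S (u t)" for S t
    unfolding u_def by (intro continuous_intros continuous_on_subset[OF w(3)] continuous_on_subset[OF w(4)]) auto
  have u0: "u t x \<noteq> 0" if "t \<in> {0..1}" for t x using large[OF that, of x] by (auto simp: u_def)
  have cU: "continuous_on UNIV (U t)" if "t \<in> {0..1}" for t
    unfolding U by (intro continuous_on_sgn cu) (use u0[OF that] in auto)
  have UL: "U t \<in> L2_circle" if "t \<in> {0..1}" for t
    by (rule continuous_periodic_L2_circle[OF cU[OF that]]) (simp add: U per)
  have lip: "norm (U t a - U t b) \<le> 4 * (norm (w0 a - w0 b) + norm (w1 a - w1 b))" if t: "t \<in> {0..1}" for t a b
  proof -
    have l: "1/2 \<le> norm (u t a)" using large[OF t, of a] by (simp add: u_def)
    have "norm (U t a - U t b) \<le> 2 * norm (u t a - u t b) / norm (u t a)"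
      unfolding U by (rule norm_sgn_diff_le[OF u0[OF t]])
    also have "\<dots> \<le> 2 * norm (u t a - u t b) / (1/2)" using l by (intro divide_left_mono) auto
    also have "\<dots> = 4 * norm (u t a - u t b)" by simp
    also have "u t a - u t b = (1 - t) *\<^sub>R (w0 a - w0 b) + t *\<^sub>R (w1 a - w1 b)" by (simp add: u_def algebra_simps)
    also have "norm \<dots> \<le> norm (w0 a - w0 b) + norm (w1 a - w1 b)"
      by (rule order_trans[OF norm_triangle_ineq])
         (use t in \<open>auto intro!: add_mono mult_left_le_one_le\<close>)
    finally show ?thesis by simp
  qed
  have ulim: "(\<lambda>k. u (\<tau> k) x) \<longlonglongrightarrow> u t x" if \<tau>: "\<And>k::nat. \<tau> k \<in> {0..1}" "t \<in> {0..1}" "\<tau> \<longlonglongrightarrow> t" for \<tau> t x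
  proof -
    have "(\<lambda>k. v (\<tau> k)) \<longlonglongrightarrow> v t"
      by (rule continuous_on_tendsto_compose[OF v \<tau>(3,2)]) (use \<tau>(1) in simp)
    then show ?thesis unfolding u_def by (intro tendsto_intros \<tau>(3))
  qed
  have "(t \<in> {0..1} \<longrightarrow> U t \<in> H_circle s) \<and> ((\<forall>k::nat. \<tau> k \<in> {0..1}) \<longrightarrow> t \<in> {0..1} \<longrightarrow> \<tau> \<longlonglongrightarrow> t \<longrightarrow>
      (\<lambda>k. H_seminorm_sq s (\<lambda>x. U (\<tau> k) x - U t x)) \<longlonglongrightarrow> 0)" for t \<tau>
  proof (cases "s < 1")
    case True
    have fin: "gagliardo_sq s w0 < \<infinity>" "gagliardo_sq s w1 < \<infinity>" using w True by (auto simp: H_circle_def)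
    have m: "w0 \<in> borel_measurable borel" "w1 \<in> borel_measurable borel" using L L2_circle_measurable by auto
    have "U t \<in> H_circle s" if "t \<in> {0..1}"
    proof -
      have "gagliardo_sq s (U t) \<le> ennreal (2 * 4\<^sup>2) * (gagliardo_sq s w0 + gagliardo_sq s w1)"
        by (rule gagliardo_sq_le[OF m lip[OF that]])
      also have "\<dots> < \<infinity>" using fin by (auto simp: ennreal_mult_less_top)
      finally show ?thesis using UL[OF that] True by (simp add: H_circle_def)
    qed
    moreover have "(\<lambda>k. H_seminorm_sq s (\<lambda>x. U (\<tau> k) x - U t x)) \<longlonglongrightarrow> 0"
      if \<tau>: "\<forall>k::nat. \<tau> k \<in> {0..1}" "t \<in> {0..1}" "\<tau> \<longlonglongrightarrow> t"
    proof -
      have "(\<lambda>k. gagliardo_sq s (\<lambda>x. U (\<tau> k) x - U t x)) \<longlonglongrightarrow> 0"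
      proof (rule gagliardo_sq_tendsto_0[OF m, where B = 8])
        show "(\<lambda>x. U (\<tau> k) x - U t x) \<in> borel_measurable borel" for k
          using L2_circle_measurable[OF UL[OF \<tau>(1)[rule_format, of k]]] L2_circle_measurable[OF UL[OF \<tau>(2)]] by measurable
        show "norm (U (\<tau> k) a - U t a - (U (\<tau> k) b - U t b)) \<le> 8 * (norm (w0 a - w0 b) + norm (w1 a - w1 b))" for k a b
        proof -
          have "norm ((U (\<tau> k) a - U (\<tau> k) b) - (U t a - U t b)) \<le> norm (U (\<tau> k) a - U (\<tau> k) b) + norm (U t a - U t b)"
            by (rule norm_triangle_ineq4)
          then show ?thesis using lip[OF \<tau>(1)[rule_format, of k], of a b] lip[OF \<tau>(2), of a b]
            by (simp add: algebra_simps)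
        qed
        show "(\<lambda>k. U (\<tau> k) x - U t x) \<longlonglongrightarrow> 0" for x
        proof -
          have "(\<lambda>k. U (\<tau> k) x) \<longlonglongrightarrow> U t x"
            unfolding U by (intro tendsto_sgn ulim \<tau>(2,3) u0) (use \<tau>(1) in auto)
          then show ?thesis by (simp add: LIM_zero_iff)
        qed
      qed (use fin in auto)
      then show ?thesis using True by (simp add: H_seminorm_sq_def)
    qed
    ultimately show ?thesis by blast
  next
    case False
    then have s1: "s = 1" using s by simp
    obtain p0 p1 where p: "has_weak_deriv w0 p0" "has_weak_deriv w1 p1"
      using w s1 by (auto simp: H_circle_def)
    have pL: "p0 \<in> L2_circle" "p1 \<in> L2_circle" using p by (auto simp: has_weak_deriv_def)
    have m[measurable]: "p0 \<in> borel_measurable borel" "p1 \<in> borel_measurable borel" using pL L2_circle_measurable by auto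
    define D where "D t x = dsgn (u t x) ((1 - t) *\<^sub>R p0 x + t *\<^sub>R p1 x)" for t x
    have Dn: "norm (D t x) \<le> 4 * (norm (p0 x) + norm (p1 x))" if t: "t \<in> {0..1}" for t x
    proof -
      have "norm (D t x) \<le> 4 * norm ((1 - t) *\<^sub>R p0 x + t *\<^sub>R p1 x)"
        unfolding D_def using large[OF t, of x] by (intro norm_dsgn_le) (simp add: u_def)
      also have "norm ((1 - t) *\<^sub>R p0 x + t *\<^sub>R p1 x) \<le> norm (p0 x) + norm (p1 x)"
        by (rule order_trans[OF norm_triangle_ineq])
           (use t in \<open>auto intro!: add_mono mult_left_le_one_le\<close>)
      finally show ?thesis by simp
    qed
    have Dm: "D t \<in> borel_measurable borel" for t
    proof -
      have [measurable]: "u t \<in> borel_measurable borel" by (rule borel_measurable_continuous_onI[OF cu])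
      have "D t = (\<lambda>x. inverse (norm (u t x)) *\<^sub>R ((1 - t) *\<^sub>R p0 x + t *\<^sub>R p1 x)
          - ((inverse (norm (u t x)) *\<^sub>R u t x) \<bullet> ((1 - t) *\<^sub>R p0 x + t *\<^sub>R p1 x)) *\<^sub>R (inverse (norm (u t x)) *\<^sub>R (inverse (norm (u t x)) *\<^sub>R u t x)))"
        by (rule ext) (simp only: D_def dsgn_apply sgn_div_norm)
      then show ?thesis by simp
    qed
    have DL: "D t \<in> L2_circle" if "t \<in> {0..1}" for t
      by (rule L2_circle_dominated[OF Dm _ pL Dn[OF that]])
         (use pL in \<open>simp add: D_def per L2_circle_periodic\<close>)
    have wd: "has_weak_deriv (U t) (D t)" if t: "t \<in> {0..1}" for t
    proof -
      have 0: "primitive_of w0 p0" "primitive_of w1 p1"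
        using has_weak_deriv_continuous_primitive p w by auto
      have "primitive_of (\<lambda>x. (1 - t) *\<^sub>R w0 x + t *\<^sub>R w1 x - v t) (\<lambda>x. (1 - t) *\<^sub>R p0 x + t *\<^sub>R p1 x - 0)"
        by (intro primitive_of_diff primitive_of_add primitive_of_linear[OF 0(1) bounded_linear_scaleR_right]
            primitive_of_linear[OF 0(2) bounded_linear_scaleR_right] primitive_of_C1) auto
      then have "primitive_of (u t) (\<lambda>x. (1 - t) *\<^sub>R p0 x + t *\<^sub>R p1 x)" by (simp add: u_def[abs_def])
      then have "primitive_of (\<lambda>x. sgn (u t x)) (D t)"
        unfolding D_def by (rule primitive_of_compose[OF _ _ _ _ continuous_on_dsgn])
          (use u0[OF t] has_derivative_sgn in \<open>auto simp: open_Collect_neq\<close>)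
      then show ?thesis unfolding U[abs_def]
        by (rule primitive_has_weak_deriv) (auto simp: per DL[OF t])
    qed
    have "U t \<in> H_circle s" if "t \<in> {0..1}" using wd[OF that] UL[OF that] s1 by (auto simp: H_circle_def)
    moreover have "(\<lambda>k. H_seminorm_sq s (\<lambda>x. U (\<tau> k) x - U t x)) \<longlonglongrightarrow> 0"
      if \<tau>: "\<forall>k::nat. \<tau> k \<in> {0..1}" "t \<in> {0..1}" "\<tau> \<longlonglongrightarrow> t"
    proof -
      have "has_weak_deriv (\<lambda>x. U (\<tau> k) x - U t x) (\<lambda>x. D (\<tau> k) x - D t x)" for k
        using has_weak_deriv_add[OF wd[OF \<tau>(1)[rule_format, of k]] has_weak_deriv_minus[OF wd[OF \<tau>(2)]]] by simp
      then have eq: "H_seminorm_sq s (\<lambda>x. U (\<tau> k) x - U t x) = L2_sq (\<lambda>x. D (\<tau> k) x - D t x)" for k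
        using H_seminorm_sq_1 s1 by blast
      have "(\<lambda>k. L2_sq (\<lambda>x. D (\<tau> k) x - D t x)) \<longlonglongrightarrow> 0"
      proof (rule L2_sq_tendsto_0[OF m, where B = 8])
        show "(\<lambda>x. D (\<tau> k) x - D t x) \<in> borel_measurable borel" for k using Dm[of "\<tau> k"] Dm[of t] by measurable
        show "norm (D (\<tau> k) x - D t x) \<le> 8 * (norm (p0 x) + norm (p1 x))" for k x
          using Dn[OF \<tau>(1)[rule_format, of k], of x] Dn[OF \<tau>(2), of x] norm_triangle_ineq4[of "D (\<tau> k) x" "D t x"]
          by linarith
        show "(\<lambda>k. D (\<tau> k) x - D t x) \<longlonglongrightarrow> 0" for x
        proof -
          have "open {u::'b. u \<noteq> 0}" by (intro open_Collect_neq continuous_intros)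
          from continuous_on_eq_continuous_at[OF this, THEN iffD1, OF continuous_on_dsgn]
          have "isCont dsgn (u t x)" using u0[OF \<tau>(2), of x] by blast
          then have "(\<lambda>k. dsgn (u (\<tau> k) x)) \<longlonglongrightarrow> dsgn (u t x)"
            by (rule isCont_tendsto_compose) (intro ulim \<tau>(2,3), use \<tau>(1) in auto)
          then have "(\<lambda>k. D (\<tau> k) x) \<longlonglongrightarrow> D t x" unfolding D_def
            by (intro blinfun.tendsto tendsto_intros \<tau>(3))
          then show ?thesis by (simp add: LIM_zero_iff)
        qed
      qed (use pL in \<open>auto simp: L2_circle_def\<close>)
      then show ?thesis by (simp add: eq)
    qed
    ultimately show ?thesis by blast
  qed
  then show "t \<in> {0..1} \<Longrightarrow> U t \<in> H_circle s"
    and "(\<And>k::nat. \<tau> k \<in> {0..1}) \<Longrightarrow> t \<in> {0..1} \<Longrightarrow> \<tau> \<longlonglongrightarrow> t \<Longrightarrow>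
      (\<lambda>k. H_seminorm_sq s (\<lambda>x. U (\<tau> k) x - U t x)) \<longlonglongrightarrow> 0" by blast+
qed

text \<open>The lower order parts of the norm are Lipschitz in \<open>t\<close>. The top order seminorm is
  assumed to be continuous along sequences, as dominated convergence delivers it.\<close>

lemma path_of_knots_connected:
  fixes c U :: "real \<Rightarrow> real \<Rightarrow> 'b::euclidean_space"
  assumes s: "0 < s" "s \<le> 1" and M: "M \<subseteq> H1_circle s" and cM: "\<And>t. t \<in> {0..1} \<Longrightarrow> c t \<in> M"
    and w: "\<And>t. t \<in> {0..1} \<Longrightarrow> has_weak_deriv (c t) (U t)" and UH: "\<And>t. t \<in> {0..1} \<Longrightarrow> U t \<in> H_circle s"
    and lip: "\<And>t t' x. t \<in> {0..1} \<Longrightarrow> t' \<in> {0..1} \<Longrightarrow> norm (c t x - c t' x) \<le> B * \<bar>t - t'\<bar>"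
      "\<And>t t' x. t \<in> {0..1} \<Longrightarrow> t' \<in> {0..1} \<Longrightarrow> norm (U t x - U t' x) \<le> B * \<bar>t - t'\<bar>"
    and sem: "\<And>\<tau> t. (\<And>k::nat. \<tau> k \<in> {0..1}) \<Longrightarrow> t \<in> {0..1} \<Longrightarrow> \<tau> \<longlonglongrightarrow> t \<Longrightarrow>
      (\<lambda>k. H_seminorm_sq s (\<lambda>x. U (\<tau> k) x - U t x)) \<longlonglongrightarrow> 0"
  shows "connected_component_of (subtopology (H1_topology s) M) (c 0) (c 1)"
proof -
  interpret H: Metric_space "H1_circle s" "\<lambda>f g :: real \<Rightarrow> 'b. H1_norm s (\<lambda>x. f x - g x)"
    by (rule Metric_space_H1[OF s(2)])
  have seq: "(\<lambda>k. H1_norm s (\<lambda>x. c (\<tau> k) x - c t x)) \<longlonglongrightarrow> 0"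
    if \<tau>: "\<And>k::nat. \<tau> k \<in> {0..1}" "t \<in> {0..1}" "\<tau> \<longlonglongrightarrow> t" for \<tau> t
  proof -
    have wd: "has_weak_deriv (\<lambda>x. c (\<tau> k) x - c t x) (\<lambda>x. U (\<tau> k) x - U t x)" for k
      using has_weak_deriv_add[OF w[OF \<tau>(1)[of k]] has_weak_deriv_minus[OF w[OF \<tau>(2)]]] by simp
    have wH: "(\<lambda>x. U (\<tau> k) x - U t x) \<in> H_circle s" for k
      using H_circle_add(1)[OF s(2) UH[OF \<tau>(1)[of k]] H_circle_minus(1)[OF s(2) UH[OF \<tau>(2)]]] by simp
    have b0: "(\<lambda>k. ennreal ((B * \<bar>\<tau> k - t\<bar>)\<^sup>2)) \<longlonglongrightarrow> 0"
    proof -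
      have "(\<lambda>k. (B * \<bar>\<tau> k - t\<bar>)\<^sup>2) \<longlonglongrightarrow> (B * \<bar>t - t\<bar>)\<^sup>2" by (intro tendsto_intros \<tau>(3))
      then have "(\<lambda>k. ennreal ((B * \<bar>\<tau> k - t\<bar>)\<^sup>2)) \<longlonglongrightarrow> ennreal ((B * \<bar>t - t\<bar>)\<^sup>2)" by (rule tendsto_ennrealI)
      then show ?thesis by simp
    qed
    have 1: "(\<lambda>k. L2_sq (\<lambda>x. c (\<tau> k) x - c t x)) \<longlonglongrightarrow> 0"
      by (rule tendsto_sandwich[OF _ _ tendsto_const b0]) (auto intro!: always_eventually L2_sq_le_sup lip \<tau>)
    have 2: "(\<lambda>k. L2_sq (\<lambda>x. U (\<tau> k) x - U t x)) \<longlonglongrightarrow> 0"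
      by (rule tendsto_sandwich[OF _ _ tendsto_const b0]) (auto intro!: always_eventually L2_sq_le_sup lip \<tau>)
    have "(\<lambda>k. H1_energy s (\<lambda>x. c (\<tau> k) x - c t x) (\<lambda>x. U (\<tau> k) x - U t x)) \<longlonglongrightarrow> 0 + 0 + 0"
      unfolding H1_energy_def by (intro tendsto_add 1 2 sem \<tau>)
    then have "(\<lambda>k. enn2real (H1_energy s (\<lambda>x. c (\<tau> k) x - c t x) (\<lambda>x. U (\<tau> k) x - U t x))) \<longlonglongrightarrow> 0"
      by (intro tendsto_enn2real) auto
    then have "(\<lambda>k. sqrt (enn2real (H1_energy s (\<lambda>x. c (\<tau> k) x - c t x) (\<lambda>x. U (\<tau> k) x - U t x)))) \<longlonglongrightarrow> sqrt 0"
      by (rule tendsto_real_sqrt)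
    then show ?thesis by (simp add: H1_norm_eq_energy[OF wd wH])
  qed
  have "continuous_map (top_of_set {0..1}) H.mtopology c"
    unfolding H.continuous_map_to_metric
  proof (intro ballI allI impI)
    fix t e :: real assume t: "t \<in> topspace (top_of_set {0..1})" and e: "e > 0"
    then have t1: "t \<in> {0..1}" by simp
    have "((\<lambda>r. H1_norm s (\<lambda>x. c r x - c t x)) \<longlongrightarrow> 0) (at t within {0..1})"
      unfolding tendsto_at_iff_sequentially by (auto simp: o_def intro!: seq t1)
    then obtain d where d: "d > 0" "\<And>r. r \<in> {0..1} \<Longrightarrow> r \<noteq> t \<Longrightarrow> dist r t < d \<Longrightarrow> H1_norm s (\<lambda>x. c r x - c t x) < e"
      using e unfolding tendsto_iff eventually_at by (auto simp: dist_real_def)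
    let ?U = "{0..1} \<inter> ball t d"
    have "c r \<in> H.mball (c t) e" if "r \<in> ?U" for r
    proof (cases "r = t")
      case True
      then show ?thesis using cM[OF t1] M e H.zero[of "c t" "c t"] by (simp add: H.in_mball subset_iff)
    next
      case False
      then have "H1_norm s (\<lambda>x. c r x - c t x) < e" using d(2)[of r] that by (auto simp: dist_commute)
      then show ?thesis using cM[OF t1] cM[of r] that M H.commute[of "c r" "c t"] by (auto simp: H.in_mball)
    qed
    then show "\<exists>U. openin (top_of_set {0..1}) U \<and> t \<in> U \<and> (\<forall>y\<in>U. c y \<in> H.mball (c t) e)"
      using t1 d(1) by (intro exI[of _ ?U]) auto
  qed
  then have "continuous_map (top_of_set {0..1}) (subtopology (H1_topology s) M) c"
    unfolding H1_topology_def continuous_map_in_subtopology using cM by auto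
  then have "connectedin (subtopology (H1_topology s) M) (c ` {0..1})"
    by (rule connectedin_continuous_map_image) simp
  then show ?thesis unfolding connected_component_of_def by (intro exI[of _ "c ` {0..1}"]) auto
qed

lemma bounded_by_period:
  fixes f :: "real \<Rightarrow> 'b::real_normed_vector"
  assumes p: "\<And>x. f (x + 1) = f x" and le: "\<And>x. x \<in> {0..1} \<Longrightarrow> norm (f x) \<le> B"
  shows "norm (f x) \<le> B"
  using le[of "frac x"] periodic_frac[of f, OF p, of x] by (simp add: frac_lt_1 less_imp_le)

text \<open>The path interpolates the tangents linearly, balances, normalizes and integrates. The
  base point runs along the segment from \<open>\<gamma> 0\<close> to \<open>\<eta> 0\<close>, so the path stays in \<^const>\<open>knots_at\<close> if both
  ends do. At the ends nothing is changed by balancing, so the path really joins \<open>\<gamma>\<close> and \<open>\<eta>\<close>.\<close>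

lemma close_knots_connected:
  fixes K T :: "real \<Rightarrow> 'b::euclidean_space"
  assumes s: "1/2 < s" "s \<le> 1" and K: "unit_speed_knot K T"
  obtains e where "e > 0"
    "\<And>M z \<gamma> \<eta> T\<gamma> T\<eta>. M = knots s \<or> M = knots_at s z \<Longrightarrow> \<gamma> \<in> M \<Longrightarrow> \<eta> \<in> M \<Longrightarrow>
      unit_speed_knot \<gamma> T\<gamma> \<Longrightarrow> unit_speed_knot \<eta> T\<eta> \<Longrightarrow>
      (\<And>x. norm (T\<gamma> x - T x) \<le> e) \<Longrightarrow> (\<And>x. norm (T\<eta> x - T x) \<le> e) \<Longrightarrow>
      connected_component_of (subtopology (H1_topology s) M) \<gamma> \<eta>"
proof -
  obtain e C V where e: "e > 0"
    and large: "\<And>w \<delta> x. near_tangent T \<delta> w \<Longrightarrow> \<delta> \<le> e \<Longrightarrow> norm (w x - V w) \<ge> 1/2"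
    and UT: "\<And>w \<delta> x. near_tangent T \<delta> w \<Longrightarrow> \<delta> \<le> e \<Longrightarrow> norm (sgn (w x - V w) - T x) \<le> C * \<delta>"
    and closed: "\<And>w b. near_tangent T e w \<Longrightarrow> \<exists>c. c 0 = b \<and> (\<forall>x. (c has_vector_derivative sgn (w x - V w)) (at x))
      \<and> (\<forall>x. c (x + 1) = c x) \<and> inj_on c {0..<1}"
    and Vlip: "\<And>w w' r. near_tangent T e w \<Longrightarrow> near_tangent T e w' \<Longrightarrow> (\<forall>x. norm (w x - w' x) \<le> r)
      \<Longrightarrow> norm (V w - V w') \<le> C * r"
    and Vz: "\<And>\<gamma> U. near_tangent T e U \<Longrightarrow> unit_speed_knot \<gamma> U \<Longrightarrow> V U = 0"
    and C: "C > 0"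
    by (rule knots_from_nearby_tangents[OF K]) (rule that)
  have "connected_component_of (subtopology (H1_topology s) M) \<gamma> \<eta>"
    if M: "M = knots s \<or> M = knots_at s z" and mem: "\<gamma> \<in> M" "\<eta> \<in> M"
      and k: "unit_speed_knot \<gamma> T\<gamma>" "unit_speed_knot \<eta> T\<eta>"
      and close: "\<And>x. norm (T\<gamma> x - T x) \<le> e" "\<And>x. norm (T\<eta> x - T x) \<le> e" for M z \<gamma> \<eta> T\<gamma> T\<eta>
  proof -
    have kn: "\<gamma> \<in> knots s" "\<eta> \<in> knots s" using M mem by (auto simp: knots_at_def)
    have H: "T\<gamma> \<in> H_circle s" "T\<eta> \<in> H_circle s"
      using knot_unit_speed[OF s kn(1)] knot_unit_speed[OF s kn(2)] k unit_speed_knot_tangent_unique by metis+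
    have c: "continuous_on UNIV T\<gamma>" "continuous_on UNIV T\<eta>" and nn: "\<And>x. norm (T\<gamma> x) = 1" "\<And>x. norm (T\<eta> x) = 1"
      using k by (auto simp: unit_speed_knot_def)
    have sgn1: "sgn y = y" if "norm y = 1" for y :: 'b using that by (simp add: sgn_div_norm)
    define w where "w t x = (1 - t) *\<^sub>R T\<gamma> x + t *\<^sub>R T\<eta> x" for t x
    have cw: "continuous_on S (w t)" for S t
      unfolding w_def by (intro continuous_intros continuous_on_subset[OF c(1)] continuous_on_subset[OF c(2)]) auto
    have wT: "norm (w t x - T x) \<le> e" if t: "t \<in> {0..1}" for t x
    proof -
      have "w t x - T x = (1 - t) *\<^sub>R (T\<gamma> x - T x) + t *\<^sub>R (T\<eta> x - T x)" by (simp add: w_def algebra_simps)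
      also have "norm \<dots> \<le> (1 - t) * norm (T\<gamma> x - T x) + t * norm (T\<eta> x - T x)"
        by (rule order_trans[OF norm_triangle_ineq]) (use t in simp)
      also have "\<dots> \<le> (1 - t) * e + t * e" using t close by (intro add_mono mult_left_mono) auto
      finally show ?thesis by (simp add: algebra_simps)
    qed
    have perw: "w t (x + 1) = w t x" for t x
      using k by (simp add: w_def unit_speed_knot_def)
    have near: "near_tangent T e (w t)" if "t \<in> {0..1}" for t
      using wT[OF that] cw perw by (simp add: near_tangent_def)
    have ww: "norm (w t x - w t' x) \<le> 2 * \<bar>t - t'\<bar>" for t t' x
    proof -
      have "w t x - w t' x = (t - t') *\<^sub>R (T\<eta> x - T\<gamma> x)" by (simp add: w_def algebra_simps)
      moreover have "norm (T\<eta> x - T\<gamma> x) \<le> 2" using norm_triangle_ineq4[of "T\<eta> x" "T\<gamma> x"] nn by simp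
      ultimately show ?thesis using mult_left_mono[of "norm (T\<eta> x - T\<gamma> x)" 2 "\<bar>t - t'\<bar>"] by simp
    qed
    define v where "v t = V (w t)" for t
    have vv: "norm (v t - v t') \<le> C * (2 * \<bar>t - t'\<bar>)" if "t \<in> {0..1}" "t' \<in> {0..1}" for t t'
      unfolding v_def by (rule Vlip) (intro near that allI ww)+
    have cv: "continuous_on {0..1} v"
      by (rule lipschitz_on_continuous_on[of "C * 2"]) (auto intro!: lipschitz_onI simp: dist_norm dist_real_def vv[unfolded mult.assoc[symmetric]] less_imp_le[OF C])
    define u where "u t x = w t x - v t" for t x
    have large_u: "norm (u t x) \<ge> 1/2" if t: "t \<in> {0..1}" for t x
      using large[OF near[OF t] order_refl, of x] by (simp add: u_def v_def)
    have uu: "norm (u t x - u t' x) \<le> (2 + 2 * C) * \<bar>t - t'\<bar>" if "t \<in> {0..1}" "t' \<in> {0..1}" for t t' x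
    proof -
      have "norm ((w t x - w t' x) - (v t - v t')) \<le> norm (w t x - w t' x) + norm (v t - v t')" by (rule norm_triangle_ineq4)
      then show ?thesis using ww[of t x t'] vv[OF that] by (simp add: u_def algebra_simps)
    qed
    define U where "U t x = sgn (u t x)" for t x
    have U_eq: "U = (\<lambda>t x. sgn ((1 - t) *\<^sub>R T\<gamma> x + t *\<^sub>R T\<eta> x - v t))" by (simp add: U_def u_def w_def fun_eq_iff)
    have u0: "u t x \<noteq> 0" if "t \<in> {0..1}" for t x using large_u[OF that, of x] by auto
    have U1: "norm (U t x) = 1" if "t \<in> {0..1}" for t x using u0[OF that] by (simp add: U_def norm_sgn)
    define B where "B = 4 * (2 + 2 * C)"
    have Ulip: "norm (U t x - U t' x) \<le> B * \<bar>t - t'\<bar>" if t: "t \<in> {0..1}" "t' \<in> {0..1}" for t t' x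
    proof -
      have "norm (U t x - U t' x) \<le> 2 * norm (u t x - u t' x) / norm (u t x)"
        unfolding U_def by (rule norm_sgn_diff_le[OF u0[OF t(1)]])
      also have "\<dots> \<le> 2 * norm (u t x - u t' x) / (1/2)" using large_u[OF t(1), of x] by (intro divide_left_mono) auto
      also have "\<dots> \<le> B * \<bar>t - t'\<bar>" using mult_left_mono[OF uu[OF t, of x], of 4] by (simp add: B_def algebra_simps)
      finally show ?thesis .
    qed
    have cU: "continuous_on UNIV (U t)" if t: "t \<in> {0..1}" for t
      unfolding U_def by (intro continuous_on_sgn) (auto simp: u0[OF t], auto simp: u_def intro!: continuous_intros cw)
    have UH: "U t \<in> H_circle s" if "t \<in> {0..1}" for t unfolding U_eq
      by (rule normalized_segment_H_circle(1)[OF _ s(2) H c cv _ that])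
         (use s large_u in \<open>auto simp: u_def w_def\<close>)
    have sem: "(\<lambda>k. H_seminorm_sq s (\<lambda>x. U (\<tau> k) x - U t x)) \<longlonglongrightarrow> 0"
      if "\<And>k::nat. \<tau> k \<in> {0..1}" "t \<in> {0..1}" "\<tau> \<longlonglongrightarrow> t" for \<tau> t unfolding U_eq
      by (rule normalized_segment_H_circle(2)[OF _ s(2) H c cv _ that])
         (use s large_u in \<open>auto simp: u_def w_def\<close>)
    define b where "b t = (1 - t) *\<^sub>R \<gamma> 0 + t *\<^sub>R \<eta> 0" for t
    have "\<forall>t\<in>{0..1}. \<exists>c. c 0 = b t \<and> (\<forall>x. (c has_vector_derivative U t x) (at x)) \<and> (\<forall>x. c (x + 1) = c x)
        \<and> inj_on c {0..<1}"
      using closed[OF near] by (auto simp: U_def u_def v_def)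
    from bchoice[OF this] obtain p where p: "\<And>t. t \<in> {0..1} \<Longrightarrow> p t 0 = b t"
      "\<And>t x. t \<in> {0..1} \<Longrightarrow> (p t has_vector_derivative U t x) (at x)"
      "\<And>t x. t \<in> {0..1} \<Longrightarrow> p t (x + 1) = p t x" "\<And>t. t \<in> {0..1} \<Longrightarrow> inj_on (p t) {0..<1}" by blast
    have pk: "p t \<in> knots s" "has_weak_deriv (p t) (U t)" if t: "t \<in> {0..1}" for t
      using knot_from_tangent[OF p(2)[OF t] p(3)[OF t] cU[OF t] UH[OF t] U1[OF t] p(4)[OF t]] by blast+
    have pM: "p t \<in> M" if t: "t \<in> {0..1}" for t
    proof -
      have "b t = z" if "M = knots_at s z"
        using mem that by (simp add: b_def knots_at_def scaleR_add_left[symmetric])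
      then show ?thesis using M pk(1)[OF t] p(1)[OF t] by (auto simp: knots_at_def)
    qed
    have plip: "norm (p t x - p t' x) \<le> (norm (\<gamma> 0 - \<eta> 0) + B) * \<bar>t - t'\<bar>" if t: "t \<in> {0..1}" "t' \<in> {0..1}" for t t' x
    proof (rule bounded_by_period[where f = "\<lambda>x. p t x - p t' x"])
      show "p t (x + 1) - p t' (x + 1) = p t x - p t' x" for x using p(3) t by simp
      fix x :: real assume x: "x \<in> {0..1}"
      have "norm ((p t x - p t' x) - (p t 0 - p t' 0)) \<le> (B * \<bar>t - t'\<bar>) * \<bar>x - 0\<bar>"
        by (rule curve_lipschitz[where T = "\<lambda>x. U t x - U t' x"])
           (intro has_vector_derivative_diff p(2) t, rule Ulip[OF t])
      also have "\<dots> \<le> (B * \<bar>t - t'\<bar>) * 1" using x C by (intro mult_left_mono) (auto simp: B_def)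
      finally have 1: "norm ((p t x - p t' x) - (p t 0 - p t' 0)) \<le> B * \<bar>t - t'\<bar>" by simp
      have "p t 0 - p t' 0 = (t' - t) *\<^sub>R (\<gamma> 0 - \<eta> 0)" using p(1) t by (simp add: b_def algebra_simps)
      then have 2: "norm (p t 0 - p t' 0) = norm (\<gamma> 0 - \<eta> 0) * \<bar>t - t'\<bar>" by (simp add: abs_minus_commute)
      have "norm (p t x - p t' x) \<le> norm ((p t x - p t' x) - (p t 0 - p t' 0)) + norm (p t 0 - p t' 0)"
        using norm_triangle_ineq[of "(p t x - p t' x) - (p t 0 - p t' 0)" "p t 0 - p t' 0"] by simp
      then show "norm (p t x - p t' x) \<le> (norm (\<gamma> 0 - \<eta> 0) + B) * \<bar>t - t'\<bar>" using 1 2 by (simp add: distrib_right)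
    qed
    have Ulip': "norm (U t x - U t' x) \<le> (norm (\<gamma> 0 - \<eta> 0) + B) * \<bar>t - t'\<bar>" if t: "t \<in> {0..1}" "t' \<in> {0..1}" for t t' x
      unfolding distrib_right by (rule add_increasing[OF _ Ulip[OF t]]) simp
    have "connected_component_of (subtopology (H1_topology s) M) (p 0) (p 1)"
      by (rule path_of_knots_connected[where U = U and B = "norm (\<gamma> 0 - \<eta> 0) + B"])
         (use s M pM pk UH plip Ulip' sem in \<open>auto simp: knots_def knots_at_def\<close>)
    moreover have "p 0 = \<gamma>"
    proof (rule curve_determined_by_tangent)
      have w0: "w 0 = T\<gamma>" by (simp add: w_def fun_eq_iff)
      have "V T\<gamma> = 0" using Vz[of "T\<gamma>", OF _ k(1)] near[of 0] w0 by simp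
      then have "U 0 x = T\<gamma> x" for x using sgn1[OF nn(1)] by (simp add: U_def u_def v_def w0)
      then show "(p 0 has_vector_derivative T\<gamma> x) (at x)" for x using p(2)[of 0 x] by simp
      show "(\<gamma> has_vector_derivative T\<gamma> x) (at x)" for x using k by (simp add: unit_speed_knot_def)
      show "p 0 0 = \<gamma> 0" using p(1)[of 0] by (simp add: b_def)
    qed
    moreover have "p 1 = \<eta>"
    proof (rule curve_determined_by_tangent)
      have w1: "w 1 = T\<eta>" by (simp add: w_def fun_eq_iff)
      have "V T\<eta> = 0" using Vz[of "T\<eta>", OF _ k(2)] near[of 1] w1 by simp
      then have "U 1 x = T\<eta> x" for x using sgn1[OF nn(2)] by (simp add: U_def u_def v_def w1)
      then show "(p 1 has_vector_derivative T\<eta> x) (at x)" for x using p(2)[of 1 x] by simp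
      show "(\<eta> has_vector_derivative T\<eta> x) (at x)" for x using k by (simp add: unit_speed_knot_def)
      show "p 1 0 = \<eta> 0" using p(1)[of 1] by (simp add: b_def)
    qed
    ultimately show ?thesis by simp
  qed
  then show ?thesis by (rule that[OF e])
qed

section \<open>Approximating \<open>C\<^sup>1\<close> knots by Sobolev knots\<close>

lemma nn_integral_abs_powr_finite:
  fixes a :: real
  assumes "a > -1"
  shows "(\<integral>\<^sup>+w\<in>{-1/2..1/2}. ennreal (\<bar>w\<bar> powr a) \<partial>lborel) < \<infinity>"
proof -
  let ?I = "(\<integral>\<^sup>+w\<in>{0..1/2}. ennreal (\<bar>w\<bar> powr a) \<partial>lborel)"
  have "(\<lambda>w::real. w powr a) absolutely_integrable_on {0..1/2}"
    using integrable_on_powr_from_0[OF assms, of "1/2"] by (subst absolutely_integrable_on_iff_nonneg) auto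
  then have "set_integrable lborel {0..1/2} (\<lambda>w::real. w powr a)"
    by (subst borel_absolutely_integrable_iff[symmetric]) auto
  then have "(\<integral>\<^sup>+w. ennreal (norm (indicator {0..1/2} w *\<^sub>R (w powr a))) \<partial>lborel) < \<infinity>"
    unfolding set_integrable_def by (simp add: integrable_iff_bounded)
  also have "(\<integral>\<^sup>+w. ennreal (norm (indicator {0..1/2} w *\<^sub>R (w powr a))) \<partial>lborel) = ?I"
    by (intro nn_integral_cong) (auto split: split_indicator)
  finally have I: "?I < \<infinity>" .
  have "(\<integral>\<^sup>+w\<in>{-1/2..0}. ennreal (\<bar>w\<bar> powr a) \<partial>lborel) = ?I"
    by (subst nn_integral_real_affine[of _ "-1" 0]) (auto intro!: nn_integral_cong split: split_indicator)
  moreover have "(\<integral>\<^sup>+w\<in>{-1/2..1/2}. ennreal (\<bar>w\<bar> powr a) \<partial>lborel)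
      \<le> (\<integral>\<^sup>+w. ennreal (\<bar>w\<bar> powr a) * indicator {-1/2..0} w + ennreal (\<bar>w\<bar> powr a) * indicator {0..1/2} w \<partial>lborel)"
    by (intro nn_integral_mono) (auto split: split_indicator)
  then have "(\<integral>\<^sup>+w\<in>{-1/2..1/2}. ennreal (\<bar>w\<bar> powr a) \<partial>lborel)
      \<le> (\<integral>\<^sup>+w\<in>{-1/2..0}. ennreal (\<bar>w\<bar> powr a) \<partial>lborel) + ?I"
    by (subst (asm) nn_integral_add) auto
  ultimately show ?thesis using I by (simp add: order_le_less_trans)
qed

text \<open>The squared increments are of order \<open>w\<^sup>2\<close>, which leaves \<open>\<bar>w\<bar> powr (1 - 2 * s)\<close> in the
  Gagliardo integral. This is integrable for \<open>s < 1\<close>.\<close>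

lemma C1_in_H_circle:
  fixes U :: "real \<Rightarrow> 'b::euclidean_space"
  assumes s: "0 < s" "s \<le> 1" and d: "\<And>x. (U has_vector_derivative U' x) (at x)"
    and c: "continuous_on UNIV U'" and p: "\<And>x. U (x + 1) = U x" "\<And>x. U' (x + 1) = U' x"
  shows "U \<in> H_circle s"
proof -
  have cU: "continuous_on UNIV U" by (rule continuous_on_vector_derivative) (rule d)
  have L: "U \<in> L2_circle" "U' \<in> L2_circle"
    by (rule continuous_periodic_L2_circle[OF cU p(1)], rule continuous_periodic_L2_circle[OF c p(2)])
  show ?thesis
  proof (cases "s < 1")
    case True
    obtain B where B: "B > 0" "\<And>x. norm (U' x) \<le> B" by (rule periodic_bounded[OF c p(2)]) (rule that)
    have pt: "(norm (U (u + w) - U u))\<^sup>2 / \<bar>w\<bar> powr (1 + 2 * s) \<le> B\<^sup>2 * \<bar>w\<bar> powr (1 - 2 * s)" for u w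
    proof (cases "w = 0")
      case False
      have "norm (U (u + w) - U u) \<le> B * \<bar>(u + w) - u\<bar>" by (rule curve_lipschitz[OF d B(2)])
      then have "(norm (U (u + w) - U u))\<^sup>2 \<le> (B * \<bar>w\<bar>)\<^sup>2" by (intro power_mono) auto
      then have "(norm (U (u + w) - U u))\<^sup>2 / \<bar>w\<bar> powr (1 + 2 * s) \<le> (B * \<bar>w\<bar>)\<^sup>2 / \<bar>w\<bar> powr (1 + 2 * s)"
        by (intro divide_right_mono) auto
      also have "\<dots> = B\<^sup>2 * (\<bar>w\<bar> powr 2 / \<bar>w\<bar> powr (1 + 2 * s))"
        using False by (simp add: power_mult_distrib powr_numeral)
      also have "\<bar>w\<bar> powr 2 / \<bar>w\<bar> powr (1 + 2 * s) = \<bar>w\<bar> powr (1 - 2 * s)"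
        unfolding powr_diff[symmetric] by simp
      finally show ?thesis .
    qed simp
    let ?J = "\<integral>\<^sup>+w\<in>{-1/2..1/2}. ennreal (\<bar>w\<bar> powr (1 - 2 * s)) \<partial>lborel"
    have "(\<integral>\<^sup>+w\<in>{-1/2..1/2}. ennreal ((norm (U (u + w) - U u))\<^sup>2 / \<bar>w\<bar> powr (1 + 2 * s)) \<partial>lborel) \<le> ennreal (B\<^sup>2) * ?J" for u
    proof -
      have "(\<integral>\<^sup>+w\<in>{-1/2..1/2}. ennreal ((norm (U (u + w) - U u))\<^sup>2 / \<bar>w\<bar> powr (1 + 2 * s)) \<partial>lborel)
        \<le> (\<integral>\<^sup>+w. ennreal (B\<^sup>2) * (ennreal (\<bar>w\<bar> powr (1 - 2 * s)) * indicator {-1/2..1/2} w) \<partial>lborel)"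
        by (intro nn_integral_mono) (auto simp: ennreal_mult[symmetric] intro!: ennreal_leI pt split: split_indicator)
      also have "\<dots> = ennreal (B\<^sup>2) * ?J" by (rule nn_integral_cmult) auto
      finally show ?thesis .
    qed
    then have "gagliardo_sq s U \<le> (\<integral>\<^sup>+u. (ennreal (B\<^sup>2) * ?J) * indicator {0..1} u \<partial>(lborel :: real measure))"
      unfolding gagliardo_sq_def by (intro nn_integral_mono mult_right_mono) auto
    also have "\<dots> = ennreal (B\<^sup>2) * ?J" by (subst nn_integral_cmult) auto
    also have "\<dots> < \<infinity>" using nn_integral_abs_powr_finite[of "1 - 2 * s"] True by (auto simp: ennreal_mult_less_top)
    finally show ?thesis using True L by (simp add: H_circle_def)
  next
    case False
    have "has_weak_deriv U U'" by (rule primitive_has_weak_deriv[OF primitive_of_C1[OF d c] p(1) L(2)])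
    then show ?thesis using False L by (auto simp: H_circle_def)
  qed
qed

text \<open>The symmetric difference quotient \<open>w\<close> of \<open>K\<close> is uniformly close to \<open>T\<close> and, unlike \<open>T\<close>,
  continuously differentiable. Balancing and normalizing it keeps both properties and yields
  the tangent of a closed curve.\<close>

lemma knot_approximation:
  fixes K T :: "real \<Rightarrow> 'b::euclidean_space"
  assumes s: "1/2 < s" "s \<le> 1" and K: "unit_speed_knot K T" and "r > 0"
  shows "\<exists>\<gamma> U. \<gamma> \<in> knots s \<and> \<gamma> 0 = b \<and> unit_speed_knot \<gamma> U \<and> (\<forall>x. norm (U x - T x) \<le> r)"
proof -
  have d: "\<And>x. (K has_vector_derivative T x) (at x)" and cT: "continuous_on UNIV T" and n: "\<And>x. norm (T x) = 1"
    and pT: "\<And>x. T (x + 1) = T x" and pK: "\<And>x. K (x + 1) = K x"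
    using K by (auto simp: unit_speed_knot_def)
  obtain e C V where e: "e > 0"
    and large: "\<And>w \<delta> x. near_tangent T \<delta> w \<Longrightarrow> \<delta> \<le> e \<Longrightarrow> norm (w x - V w) \<ge> 1/2"
    and UT: "\<And>w \<delta> x. near_tangent T \<delta> w \<Longrightarrow> \<delta> \<le> e \<Longrightarrow> norm (sgn (w x - V w) - T x) \<le> C * \<delta>"
    and closed: "\<And>w b. near_tangent T e w \<Longrightarrow> \<exists>c. c 0 = b \<and> (\<forall>x. (c has_vector_derivative sgn (w x - V w)) (at x))
      \<and> (\<forall>x. c (x + 1) = c x) \<and> inj_on c {0..<1}"
    and Vlip: "\<And>w w' r. near_tangent T e w \<Longrightarrow> near_tangent T e w' \<Longrightarrow> (\<forall>x. norm (w x - w' x) \<le> r)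
      \<Longrightarrow> norm (V w - V w') \<le> C * r"
    and Vz: "\<And>\<gamma> U. near_tangent T e U \<Longrightarrow> unit_speed_knot \<gamma> U \<Longrightarrow> V U = 0"
    and C: "C > 0"
    by (rule knots_from_nearby_tangents[OF K]) (rule that)
  define \<delta> where "\<delta> = min e (r / C)"
  have \<delta>: "\<delta> > 0" "\<delta> \<le> e" "C * \<delta> \<le> r" using e C \<open>r > 0\<close> by (auto simp: \<delta>_def min_def field_simps)
  obtain h0 where h0: "h0 > 0" "\<And>x y. \<bar>x - y\<bar> < h0 \<Longrightarrow> norm (T x - T y) < \<delta>"
    by (rule periodic_uniformly_continuous[OF cT pT \<delta>(1)]) (rule that)
  define h where "h = h0 / 2"
  have h: "h > 0" "h < h0" using h0 by (auto simp: h_def)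
  define w where "w x = (1 / (2 * h)) *\<^sub>R (K (x + h) - K (x - h))" for x
  define w' where "w' x = (1 / (2 * h)) *\<^sub>R (T (x + h) - T (x - h))" for x
  have dw: "(w has_vector_derivative w' x) (at x)" for x
  proof -
    have s1: "((\<lambda>x. x + c) has_vector_derivative 1) (at x)" for c :: real by (auto intro!: derivative_eq_intros)
    have "((\<lambda>x. K (x + c)) has_vector_derivative T (x + c)) (at x)" for c
      using vector_diff_chain_at[OF s1[of c] d[of "x + c"]] by (simp add: o_def)
    from has_vector_derivative_diff[OF this[of h] this[of "-h"]]
    have "((\<lambda>x. K (x + h) - K (x - h)) has_vector_derivative T (x + h) - T (x - h)) (at x)" by simp
    then show ?thesis unfolding w_def w'_def
      by (rule bounded_linear.has_vector_derivative[OF bounded_linear_scaleR_right])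
  qed
  have pw: "w (x + 1) = w x" "w' (x + 1) = w' x" for x
    using pK[of "x + h"] pK[of "x - h"] pT[of "x + h"] pT[of "x - h"] by (simp_all add: w_def w'_def algebra_simps)
  have cw: "continuous_on S w" for S
    by (rule continuous_on_subset[OF continuous_on_vector_derivative[of UNIV w w']]) (auto intro: dw)
  have cw': "continuous_on S w'" for S unfolding w'_def
    by (intro continuous_intros continuous_on_compose2[OF cT]) auto
  have wT: "norm (w x - T x) \<le> \<delta>" for x
  proof -
    have "norm (K (x + h) - K (x - h) - ((x + h) - (x - h)) *\<^sub>R T x) \<le> \<delta> * \<bar>(x + h) - (x - h)\<bar>"
    proof (rule chord_tangent_le[OF d])
      fix t assume "t \<in> closed_segment (x - h) (x + h)"
      then have "\<bar>t - x\<bar> < h0" using h by (auto simp: closed_segment_eq_real_ivl split: if_splits)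
      then show "norm (T t - T x) \<le> \<delta>" using h0(2)[of t x] by simp
    qed
    moreover have "K (x + h) - K (x - h) - ((x + h) - (x - h)) *\<^sub>R T x = (2 * h) *\<^sub>R (w x - T x)"
      using h(1) by (simp add: w_def algebra_simps)
    ultimately have "(2 * h) * norm (w x - T x) \<le> (2 * h) * \<delta>" using h(1) by (simp add: mult.commute)
    then show ?thesis using h(1) by simp
  qed
  have near: "near_tangent T \<delta> w" using cw pw wT by (simp add: near_tangent_def)
  then have near': "near_tangent T e w" using order_trans[OF _ \<delta>(2)] by (auto simp: near_tangent_def)
  define u where "u x = w x - V w" for x
  have u0: "u x \<noteq> 0" for x using large[OF near \<delta>(2), of x] by (auto simp: u_def)
  define U where "U x = sgn (u x)" for x
  have UT': "norm (U x - T x) \<le> r" for x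
    using UT[OF near \<delta>(2), of x] \<delta>(3) by (simp add: U_def u_def)
  have du: "(u has_vector_derivative w' x) (at x)" for x
    using has_vector_derivative_diff[OF dw has_vector_derivative_const] unfolding u_def by simp
  have dU: "(U has_vector_derivative dsgn (u x) (w' x)) (at x)" for x
    using has_derivative_compose[OF du[of x, unfolded has_vector_derivative_def] has_derivative_sgn[OF u0[of x]]]
    by (simp add: has_vector_derivative_def U_def[abs_def] blinfun.scaleR_right)
  have cu: "continuous_on UNIV u" unfolding u_def by (intro continuous_intros cw)
  have cU': "continuous_on UNIV (\<lambda>x. dsgn (u x) (w' x))"
    by (intro continuous_intros cw' continuous_on_compose2[OF continuous_on_dsgn cu]) (use u0 in auto)
  have pU: "U (x + 1) = U x" "dsgn (u (x + 1)) (w' (x + 1)) = dsgn (u x) (w' x)" for x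
    by (simp_all add: U_def u_def pw)
  have UH: "U \<in> H_circle s" by (rule C1_in_H_circle[OF _ s(2) dU cU' pU]) (use s in simp)
  have cU: "continuous_on UNIV U" by (rule continuous_on_vector_derivative) (rule dU)
  obtain c where c: "c 0 = b" "\<And>x. (c has_vector_derivative U x) (at x)" "\<And>x. c (x + 1) = c x" "inj_on c {0..<1}"
    using closed[OF near'] unfolding U_def u_def by blast
  have "norm (U x) = 1" for x using u0[of x] by (simp add: U_def norm_sgn)
  then have "c \<in> knots s" "unit_speed_knot c U" using knot_from_tangent[OF c(2,3) cU UH _ c(4)] by blast+
  then show ?thesis using c(1) UT' by blast
qed

section \<open>Parametrizing an isotopy by arclength\<close>

text \<open>\<open>S\<close> is the arclength for the speed \<open>v\<close>, and \<open>\<psi>\<close> is its inverse, scaled so as to commute with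
  the period.\<close>

lemma arclength_inverse:
  fixes v :: "real \<Rightarrow> real"
  assumes c: "continuous_on UNIV v" and p: "\<And>x. v (x + 1) = v x" and m: "m > 0" "\<And>x. m \<le> v x"
  shows "\<exists>S \<psi>. S 0 = 0 \<and> (\<forall>x. (S has_real_derivative v x) (at x)) \<and> S 1 > 0 \<and> (\<forall>a. S (\<psi> a) = S 1 * a)
    \<and> (\<forall>x. \<psi> (S x / S 1) = x) \<and> (\<forall>a. (\<psi> has_real_derivative S 1 / v (\<psi> a)) (at a)) \<and> (\<forall>a. \<psi> (a + 1) = \<psi> a + 1)
    \<and> (\<forall>a. 0 \<le> a \<longrightarrow> a < 1 \<longrightarrow> 0 \<le> \<psi> a \<and> \<psi> a < 1)"
proof -
  obtain S where S: "primitive_of S v" "S 0 = 0"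
    using primitive_exists[OF absolutely_integrable_continuous_real[OF continuous_on_subset[OF c]]] by blast
  have dS: "(S has_real_derivative v x) (at x)" for x
    using primitive_of_continuous_density[OF S(1) c] by (simp add: has_real_derivative_iff_has_vector_derivative)
  have mono: "S x < S y" if "x < y" for x y
    by (rule DERIV_pos_imp_increasing[OF that]) (use dS m in \<open>meson less_le_trans\<close>)
  have S1: "S 1 > 0" using mono[of 0 1] S(2) by simp
  obtain P where P: "\<And>x. P (S x) = x" "\<And>y. S (P y) = y"
    "\<And>y. (P has_real_derivative 1 / v (P y)) (at y)"
    by (rule increasing_C1_inverse[OF dS m]) (rule that)
  have Sper: "S (x + 1) = S x + S 1" for x
  proof -
    have "primitive_of (\<lambda>x. S (x + 1) - S x) (\<lambda>x. 0)"
      using primitive_of_diff[OF primitive_of_shift[OF S(1), of 1] S(1)] p by simp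
    from primitive_of_unique_const[OF this, of x 0] show ?thesis using S(2) by simp
  qed
  define \<psi> where "\<psi> a = P (S 1 * a)" for a
  have S\<psi>: "S (\<psi> a) = S 1 * a" for a by (simp add: \<psi>_def P)
  have \<psi>S: "\<psi> (S x / S 1) = x" for x using S1 by (simp add: \<psi>_def P)
  have d\<psi>: "(\<psi> has_real_derivative S 1 / v (\<psi> a)) (at a)" for a
    unfolding \<psi>_def by (rule DERIV_chain2[OF P(3), THEN DERIV_cong]) (auto intro!: derivative_eq_intros)
  have \<psi>1: "\<psi> (a + 1) = \<psi> a + 1" for a
  proof -
    have "S (\<psi> a + 1) = S 1 * (a + 1)" unfolding Sper S\<psi> by (simp add: algebra_simps)
    then show ?thesis using P(1)[of "\<psi> a + 1"] by (simp add: \<psi>_def)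
  qed
  have "0 \<le> \<psi> a \<and> \<psi> a < 1" if a: "0 \<le> a" "a < 1" for a
  proof (rule ccontr)
    assume "\<not> ?thesis"
    then consider "\<psi> a < 0" | "\<psi> a = 1" | "1 < \<psi> a" by linarith
    then show False
    proof cases
      case 1
      then have "S 1 * a < 0" using mono[of "\<psi> a" 0] S(2) S\<psi>[of a] by simp
      then show False using S1 a by (simp add: mult_less_0_iff)
    next
      case 2
      then show False using S\<psi>[of a] S1 a by simp
    next
      case 3
      then have "S 1 < S 1 * a" using mono[of 1 "\<psi> a"] S\<psi>[of a] by simp
      then show False using S1 a by simp
    qed
  qed
  then show ?thesis using S(2) dS S1 S\<psi> \<psi>S d\<psi> \<psi>1 by blast
qed

text \<open>A derivative within the strip restricts to full derivatives along its horizontal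
  lines.\<close>

lemma C1_isotopy_velocity:
  fixes J :: "real \<times> real \<Rightarrow> 'b::euclidean_space"
  assumes J: "C1_on (UNIV \<times> {0..1}) J" and emb: "\<And>\<sigma>. \<sigma> \<in> {0..1} \<Longrightarrow> C1_embedding (\<lambda>x. J (x, \<sigma>))"
  obtains E :: "real \<times> real \<Rightarrow> 'b" where "continuous_on (UNIV \<times> {0..1}) E"
    "\<And>x \<sigma>. \<sigma> \<in> {0..1} \<Longrightarrow> ((\<lambda>x. J (x, \<sigma>)) has_vector_derivative E (x, \<sigma>)) (at x)"
    "\<And>x \<sigma>. \<sigma> \<in> {0..1} \<Longrightarrow> E (x, \<sigma>) \<noteq> 0" "\<And>x \<sigma>. \<sigma> \<in> {0..1} \<Longrightarrow> E (x + 1, \<sigma>) = E (x, \<sigma>)"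
    "\<And>x \<sigma>. \<sigma> \<in> {0..1} \<Longrightarrow> J (x + 1, \<sigma>) = J (x, \<sigma>)" "\<And>\<sigma>. \<sigma> \<in> {0..1} \<Longrightarrow> inj_on (\<lambda>x. J (x, \<sigma>)) {0..<1}"
proof -
  obtain D :: "real \<times> real \<Rightarrow> (real \<times> real) \<Rightarrow>\<^sub>L 'b" where D: "continuous_on (UNIV \<times> {0..1}) D"
    "\<And>p. p \<in> UNIV \<times> {0..1} \<Longrightarrow> (J has_derivative blinfun_apply (D p)) (at p within UNIV \<times> {0..1})"
    using J unfolding C1_on_def by blast
  define E where "E p = D p (1, 0)" for p
  have cE: "continuous_on (UNIV \<times> {0..1}) E" unfolding E_def by (intro continuous_intros D(1))
  have dE: "((\<lambda>x. J (x, \<sigma>)) has_vector_derivative E (x, \<sigma>)) (at x)" if \<sigma>: "\<sigma> \<in> {0..1}" for x \<sigma>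
  proof -
    have "((\<lambda>x. (x, \<sigma>)) has_derivative (\<lambda>h. (h, 0))) (at x)" by (auto intro!: derivative_eq_intros)
    moreover have "(J has_derivative blinfun_apply (D (x, \<sigma>))) (at (x, \<sigma>) within range (\<lambda>x. (x, \<sigma>)))"
      by (rule has_derivative_subset[OF D(2)]) (use \<sigma> in auto)
    ultimately have "((\<lambda>x. J (x, \<sigma>)) has_derivative (\<lambda>h. D (x, \<sigma>) (h, 0))) (at x)"
      by (rule has_derivative_in_compose)
    moreover have "D (x, \<sigma>) (h, 0) = h *\<^sub>R E (x, \<sigma>)" for h
      unfolding E_def by (simp flip: blinfun.scaleR_right)
    ultimately show ?thesis by (simp add: has_vector_derivative_def)
  qed
  have per: "J (x + 1, \<sigma>) = J (x, \<sigma>)" if "\<sigma> \<in> {0..1}" for x \<sigma>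
    using emb[OF that] by (simp add: C1_embedding_def periodic_fun_simple'_def)
  have perE: "E (x + 1, \<sigma>) = E (x, \<sigma>)" if \<sigma>: "\<sigma> \<in> {0..1}" for x \<sigma>
  proof (rule vector_derivative_unique_at)
    have "((\<lambda>x::real. x + 1) has_vector_derivative 1) (at x)" by (auto intro!: derivative_eq_intros)
    from vector_diff_chain_at[OF this dE[OF \<sigma>]]
    show "((\<lambda>x. J (x, \<sigma>)) has_vector_derivative E (x + 1, \<sigma>)) (at x)" by (simp add: o_def per[OF \<sigma>])
  qed (rule dE[OF \<sigma>])
  have E0: "E (x, \<sigma>) \<noteq> 0" if \<sigma>: "\<sigma> \<in> {0..1}" for x \<sigma>
    using emb[OF \<sigma>] vector_derivative_at[OF dE[OF \<sigma>, of x]] by (auto simp: C1_embedding_def)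
  have "inj_on (\<lambda>x. J (x, \<sigma>)) {0..<1}" if "\<sigma> \<in> {0..1}" for \<sigma> using emb[OF that] by (simp add: C1_embedding_def)
  then show ?thesis using that[OF cE dE E0 perE per] by blast
qed

text \<open>Each stage of the isotopy is scaled to length \<open>1\<close> and parametrized by arclength. The
  tangents are compared by uniform continuity of the normalized velocity on a compact period,
  after the parameters \<open>\<psi> \<tau> a\<close> and \<open>\<psi> \<sigma> a\<close> of the same arclength have been shown to be close: the
  arclengths of neighbouring stages are close and their slopes are bounded below by \<open>m\<close>.\<close>

lemma isotopy_unit_speed:
  fixes \<gamma>0 \<gamma>1 :: "real \<Rightarrow> 'b::euclidean_space"
  assumes iso: "C1_isotopic \<gamma>0 \<gamma>1" and k: "unit_speed_knot \<gamma>0 T0" "unit_speed_knot \<gamma>1 T1"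
  obtains K T :: "real \<Rightarrow> real \<Rightarrow> 'b" where "\<And>\<sigma>. \<sigma> \<in> {0..1} \<Longrightarrow> unit_speed_knot (K \<sigma>) (T \<sigma>)" "T 0 = T0" "T 1 = T1"
    "\<And>\<sigma> e. \<sigma> \<in> {0..1} \<Longrightarrow> e > 0 \<Longrightarrow> \<exists>d>0. \<forall>\<tau>\<in>{0..1}. \<bar>\<tau> - \<sigma>\<bar> < d \<longrightarrow> (\<forall>x. norm (T \<tau> x - T \<sigma> x) \<le> e)"
proof -
  obtain J :: "real \<times> real \<Rightarrow> 'b" where J: "C1_on (UNIV \<times> {0..1}) J" "\<And>x. J (x, 0) = \<gamma>0 x" "\<And>x. J (x, 1) = \<gamma>1 x"
    "\<And>\<sigma>. \<sigma> \<in> {0..1} \<Longrightarrow> C1_embedding (\<lambda>x. J (x, \<sigma>))"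
    using iso unfolding C1_isotopic_def by blast
  obtain E where E: "continuous_on (UNIV \<times> {0..1}) E"
    "\<And>x \<sigma>. \<sigma> \<in> {0..1} \<Longrightarrow> ((\<lambda>x. J (x, \<sigma>)) has_vector_derivative E (x, \<sigma>)) (at x)"
    "\<And>x \<sigma>. \<sigma> \<in> {0..1} \<Longrightarrow> E (x, \<sigma>) \<noteq> 0" "\<And>x \<sigma>. \<sigma> \<in> {0..1} \<Longrightarrow> E (x + 1, \<sigma>) = E (x, \<sigma>)"
    "\<And>x \<sigma>. \<sigma> \<in> {0..1} \<Longrightarrow> J (x + 1, \<sigma>) = J (x, \<sigma>)" "\<And>\<sigma>. \<sigma> \<in> {0..1} \<Longrightarrow> inj_on (\<lambda>x. J (x, \<sigma>)) {0..<1}"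
    by (rule C1_isotopy_velocity[OF J(1,4)]) (assumption, rule that)
  let ?Q = "{0..1::real} \<times> {0..1::real}"
  have cQ: "compact ?Q" by (intro compact_Times) auto
  have cEQ: "continuous_on ?Q E" by (rule continuous_on_subset[OF E(1)]) auto
  have cE\<sigma>: "continuous_on UNIV (\<lambda>x. E (x, \<sigma>))" if "\<sigma> \<in> {0..1}" for \<sigma>
    by (rule continuous_on_compose2[OF E(1)]) (use that in \<open>auto intro!: continuous_intros\<close>)
  define v where "v \<sigma> x = norm (E (x, \<sigma>))" for \<sigma> x
  have cv: "continuous_on UNIV (v \<sigma>)" if "\<sigma> \<in> {0..1}" for \<sigma>
    unfolding v_def by (intro continuous_intros cE\<sigma>[OF that])
  have pv: "v \<sigma> (x + 1) = v \<sigma> x" if "\<sigma> \<in> {0..1}" for \<sigma> x by (simp add: v_def E(4)[OF that])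
  obtain m where m: "m > 0" "\<And>x \<sigma>. \<sigma> \<in> {0..1} \<Longrightarrow> m \<le> v \<sigma> x"
  proof -
    have "\<exists>p\<in>?Q. \<forall>q\<in>?Q. norm (E p) \<le> norm (E q)"
      by (rule continuous_attains_inf[OF cQ]) (auto intro!: continuous_intros cEQ)
    then obtain p where p: "p \<in> ?Q" "\<And>q. q \<in> ?Q \<Longrightarrow> norm (E p) \<le> norm (E q)" by blast
    have "norm (E p) > 0" using p(1) E(3) by (cases p) auto
    moreover have "norm (E p) \<le> v \<sigma> x" if \<sigma>: "\<sigma> \<in> {0..1}" for x \<sigma>
    proof -
      have "norm (E p) \<le> v \<sigma> (frac x)" unfolding v_def by (rule p(2)) (use \<sigma> in \<open>simp add: frac_lt_1 less_imp_le\<close>)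
      also have "\<dots> = v \<sigma> x" by (rule periodic_frac[of "v \<sigma>"]) (rule pv[OF \<sigma>])
      finally show ?thesis .
    qed
    ultimately show ?thesis using that by blast
  qed
  let ?P = "\<lambda>\<sigma> S \<psi>. S 0 = 0 \<and> (\<forall>x. (S has_real_derivative v \<sigma> x) (at x)) \<and> S 1 > 0 \<and> (\<forall>a. S (\<psi> a) = S 1 * a)
    \<and> (\<forall>x. \<psi> (S x / S 1) = x) \<and> (\<forall>a. (\<psi> has_real_derivative S 1 / v \<sigma> (\<psi> a)) (at a)) \<and> (\<forall>a. \<psi> (a + 1) = \<psi> a + 1)
    \<and> (\<forall>a. 0 \<le> a \<longrightarrow> a < 1 \<longrightarrow> 0 \<le> \<psi> a \<and> \<psi> a < (1::real))"
  have "\<forall>\<sigma>\<in>{0..1}. \<exists>S \<psi>. ?P \<sigma> S \<psi>"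
    by (intro ballI arclength_inverse[where m = m] cv pv m)
  from bchoice[OF this] obtain S where "\<forall>\<sigma>\<in>{0..1}. \<exists>\<psi>. ?P \<sigma> (S \<sigma>) \<psi>" by blast
  from bchoice[OF this] obtain \<psi> where "\<forall>\<sigma>\<in>{0..1}. ?P \<sigma> (S \<sigma>) (\<psi> \<sigma>)" by blast
  then have P: "?P \<sigma> (S \<sigma>) (\<psi> \<sigma>)" if "\<sigma> \<in> {0..1}" for \<sigma> using that by blast
  have S0: "S \<sigma> 0 = 0" and dS: "(S \<sigma> has_real_derivative v \<sigma> x) (at x)" and S1: "S \<sigma> 1 > 0"
    and S\<psi>: "S \<sigma> (\<psi> \<sigma> a) = S \<sigma> 1 * a" and \<psi>S: "\<psi> \<sigma> (S \<sigma> x / S \<sigma> 1) = x"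
    and d\<psi>: "(\<psi> \<sigma> has_real_derivative S \<sigma> 1 / v \<sigma> (\<psi> \<sigma> a)) (at a)" and \<psi>1: "\<psi> \<sigma> (a + 1) = \<psi> \<sigma> a + 1"
    and \<psi>01: "0 \<le> a \<Longrightarrow> a < 1 \<Longrightarrow> 0 \<le> \<psi> \<sigma> a \<and> \<psi> \<sigma> a < 1"
    if "\<sigma> \<in> {0..1}" for \<sigma> x a using P[OF that] by blast+
  define K where "K \<sigma> a = (1 / S \<sigma> 1) *\<^sub>R J (\<psi> \<sigma> a, \<sigma>)" for \<sigma> a
  define T where "T \<sigma> a = sgn (E (\<psi> \<sigma> a, \<sigma>))" for \<sigma> a
  have perT: "T \<sigma> (a + 1) = T \<sigma> a" if "\<sigma> \<in> {0..1}" for \<sigma> a by (simp add: T_def \<psi>1[OF that] E(4)[OF that])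
  have knot: "unit_speed_knot (K \<sigma>) (T \<sigma>)" if \<sigma>: "\<sigma> \<in> {0..1}" for \<sigma>
    unfolding unit_speed_knot_def
  proof (intro conjI allI)
    fix x
    have "((\<lambda>a. J (\<psi> \<sigma> a, \<sigma>)) has_vector_derivative (S \<sigma> 1 / v \<sigma> (\<psi> \<sigma> x)) *\<^sub>R E (\<psi> \<sigma> x, \<sigma>)) (at x)"
      using vector_diff_chain_at[OF d\<psi>[OF \<sigma>, of x, unfolded has_real_derivative_iff_has_vector_derivative] E(2)[OF \<sigma>]]
      by (simp add: o_def)
    then have "(K \<sigma> has_vector_derivative (1 / S \<sigma> 1) *\<^sub>R ((S \<sigma> 1 / v \<sigma> (\<psi> \<sigma> x)) *\<^sub>R E (\<psi> \<sigma> x, \<sigma>))) (at x)"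
      unfolding K_def by (rule bounded_linear.has_vector_derivative[OF bounded_linear_scaleR_right])
    moreover have "(1 / S \<sigma> 1) *\<^sub>R ((S \<sigma> 1 / v \<sigma> (\<psi> \<sigma> x)) *\<^sub>R E (\<psi> \<sigma> x, \<sigma>)) = T \<sigma> x"
      using S1[OF \<sigma>] by (simp add: T_def v_def sgn_div_norm divide_inverse)
    ultimately show "(K \<sigma> has_vector_derivative T \<sigma> x) (at x)" by simp
    show "T \<sigma> (x + 1) = T \<sigma> x" by (rule perT[OF \<sigma>])
    show "norm (T \<sigma> x) = 1" using E(3)[OF \<sigma>] by (simp add: T_def norm_sgn)
    show "K \<sigma> (x + 1) = K \<sigma> x" by (simp add: K_def \<psi>1[OF \<sigma>] E(5)[OF \<sigma>])
  next
    have c\<psi>: "continuous_on UNIV (\<psi> \<sigma>)" using DERIV_isCont[OF d\<psi>[OF \<sigma>]] by (simp add: continuous_on_eq_continuous_at)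
    show "continuous_on UNIV (T \<sigma>)" unfolding T_def
      by (intro continuous_on_sgn continuous_on_compose2[OF cE\<sigma>[OF \<sigma>] c\<psi>]) (use E(3)[OF \<sigma>] in auto)
    show "inj_on (K \<sigma>) {0..<1}"
    proof (rule inj_onI)
      fix a b assume ab: "a \<in> {0..<1}" "b \<in> {0..<1}" "K \<sigma> a = K \<sigma> b"
      then have "J (\<psi> \<sigma> a, \<sigma>) = J (\<psi> \<sigma> b, \<sigma>)" using S1[OF \<sigma>] by (simp add: K_def)
      moreover have "\<psi> \<sigma> a \<in> {0..<1}" "\<psi> \<sigma> b \<in> {0..<1}" using \<psi>01[OF \<sigma>] ab by auto
      ultimately have "\<psi> \<sigma> a = \<psi> \<sigma> b" using E(6)[OF \<sigma>] by (auto simp: inj_on_def)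
      then have "S \<sigma> 1 * a = S \<sigma> 1 * b" using S\<psi>[OF \<sigma>] by metis
      then show "a = b" using S1[OF \<sigma>] by simp
    qed
  qed
  \<comment> \<open>A stage that already has unit speed is not reparametrized.\<close>
  have end_tangent: "T \<sigma> = T'" if \<sigma>: "\<sigma> \<in> {0..1}" and k': "unit_speed_knot \<gamma> T'" "\<And>x. J (x, \<sigma>) = \<gamma> x" for \<sigma> \<gamma> T'
  proof
    fix a
    have ET: "E (x, \<sigma>) = T' x" for x
      by (rule vector_derivative_unique_at[OF E(2)[OF \<sigma>, of x]]) (use k' in \<open>simp add: unit_speed_knot_def\<close>)
    have nT: "norm (T' x) = 1" for x using k'(1) by (simp add: unit_speed_knot_def)
    have "((\<lambda>x. S \<sigma> x - x) has_vector_derivative 0) (at x)" for x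
      using has_vector_derivative_diff[OF dS[OF \<sigma>, of x, unfolded has_real_derivative_iff_has_vector_derivative] has_vector_derivative_id]
      by (simp add: v_def ET nT)
    then obtain c where "\<And>x. S \<sigma> x - x = c"
      using has_vector_derivative_zero_constant[of UNIV "\<lambda>x. S \<sigma> x - x"] by auto
    then have Sx: "S \<sigma> x = x" for x using S0[OF \<sigma>] by (metis diff_0_right eq_iff_diff_eq_0)
    have "\<psi> \<sigma> a = a" using \<psi>S[OF \<sigma>, of a] by (simp add: Sx)
    then show "T \<sigma> a = T' a" by (simp add: T_def ET sgn_div_norm nT)
  qed
  have cont: "\<exists>d>0. \<forall>\<tau>\<in>{0..1}. \<bar>\<tau> - \<sigma>\<bar> < d \<longrightarrow> (\<forall>x. norm (T \<tau> x - T \<sigma> x) \<le> e)"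
    if \<sigma>: "\<sigma> \<in> {0..1}" and e: "e > 0" for \<sigma> e
  proof -
    have "uniformly_continuous_on ?Q (\<lambda>p. sgn (E p))"
      by (intro compact_uniformly_continuous[OF _ cQ] continuous_on_sgn cEQ) (use E(3) in auto)
    then obtain d1 where d1: "d1 > 0" "\<And>p q. p \<in> ?Q \<Longrightarrow> q \<in> ?Q \<Longrightarrow> dist p q < d1 \<Longrightarrow> dist (sgn (E p)) (sgn (E q)) < e"
      unfolding uniformly_continuous_on_def using e by metis
    \<comment> \<open>If the speeds differ by \<open>\<kappa>\<close> the parameters differ by at most \<open>2 * \<kappa> / m = d1 / 4\<close>;
      together with \<open>\<bar>\<tau> - \<sigma>\<bar> < d1 / 2\<close> this stays below \<open>d1\<close>.\<close>
    define \<kappa> where "\<kappa> = m * d1 / 8"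
    have \<kappa>: "\<kappa> > 0" using m d1 by (simp add: \<kappa>_def)
    have "uniformly_continuous_on ?Q (\<lambda>p. norm (E p))"
      by (intro compact_uniformly_continuous[OF _ cQ] continuous_intros cEQ)
    then obtain d2 where d2: "d2 > 0" "\<And>p q. p \<in> ?Q \<Longrightarrow> q \<in> ?Q \<Longrightarrow> dist p q < d2 \<Longrightarrow> dist (norm (E p)) (norm (E q)) < \<kappa>"
      unfolding uniformly_continuous_on_def using \<kappa> by metis
    have "norm (T \<tau> x - T \<sigma> x) \<le> e" if \<tau>: "\<tau> \<in> {0..1}" and close: "\<bar>\<tau> - \<sigma>\<bar> < min d2 (d1/2)" for \<tau> x
    proof -
      have vc: "norm (v \<tau> x - v \<sigma> x) \<le> \<kappa>" for x
      proof (rule bounded_by_period[where f = "\<lambda>x. v \<tau> x - v \<sigma> x"])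
        fix x :: real assume "x \<in> {0..1}"
        then have "dist (norm (E (x, \<tau>))) (norm (E (x, \<sigma>))) < \<kappa>"
          by (intro d2(2)) (use \<tau> \<sigma> close in \<open>auto simp: dist_Pair_Pair dist_real_def\<close>)
        then show "norm (v \<tau> x - v \<sigma> x) \<le> \<kappa>" by (simp add: v_def dist_real_def)
      qed (simp only: pv[OF \<tau>] pv[OF \<sigma>])
      have Sc: "\<bar>S \<tau> y - S \<sigma> y\<bar> \<le> \<kappa>" if y: "y \<in> {0..1}" for y
      proof -
        have "norm ((S \<tau> y - S \<sigma> y) - (S \<tau> 0 - S \<sigma> 0)) \<le> \<kappa> * \<bar>y - 0\<bar>"
          by (rule curve_lipschitz[where T = "\<lambda>x. v \<tau> x - v \<sigma> x"])
             (intro has_vector_derivative_diff dS[unfolded has_real_derivative_iff_has_vector_derivative] \<tau> \<sigma>, rule vc)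
        also have "\<dots> \<le> \<kappa> * 1" using y \<kappa> by (intro mult_left_mono) auto
        finally show ?thesis by (simp add: S0[OF \<tau>] S0[OF \<sigma>])
      qed
      have main: "norm (T \<tau> a - T \<sigma> a) \<le> e" if a: "a \<in> {0..<1}" for a
      proof -
        define y where "y = \<psi> \<tau> a"
        define x where "x = \<psi> \<sigma> a"
        have y: "y \<in> {0..1}" and x: "x \<in> {0..1}" using \<psi>01[OF \<tau>, of a] \<psi>01[OF \<sigma>, of a] a by (auto simp: y_def x_def)
        have slope: "m * \<bar>x - y\<bar> \<le> \<bar>S \<sigma> x - S \<sigma> y\<bar>"
        proof -
          have le: "m * (q - p) \<le> S \<sigma> q - S \<sigma> p" if pq: "p < q" for p q
          proof -
            obtain z where "S \<sigma> q - S \<sigma> p = (q - p) * v \<sigma> z" using MVT2[OF pq dS[OF \<sigma>]] by blast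
            then show ?thesis using mult_left_mono[OF m(2)[OF \<sigma>, of z], of "q - p"] pq by (simp add: mult.commute)
          qed
          show ?thesis using le[of x y] le[of y x] m(1) by (cases x y rule: linorder_cases) auto
        qed
        have "S \<sigma> x - S \<sigma> y = (S \<sigma> 1 - S \<tau> 1) * a + (S \<tau> y - S \<sigma> y)"
          unfolding x_def y_def by (simp add: S\<psi>[OF \<sigma>] S\<psi>[OF \<tau>] algebra_simps)
        also have "\<bar>\<dots>\<bar> \<le> \<bar>S \<sigma> 1 - S \<tau> 1\<bar> * \<bar>a\<bar> + \<bar>S \<tau> y - S \<sigma> y\<bar>"
          by (rule order_trans[OF abs_triangle_ineq]) (simp add: abs_mult)
        also have "\<dots> \<le> \<kappa> * 1 + \<kappa>"
          using Sc[of 1] Sc[OF y] a \<kappa> by (intro add_mono mult_mono) (auto simp: abs_minus_commute)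
        finally have "m * \<bar>x - y\<bar> \<le> 2 * \<kappa>" using slope by simp
        then have "m * \<bar>x - y\<bar> \<le> m * (d1/4)" by (simp add: \<kappa>_def mult.commute)
        then have xy: "\<bar>x - y\<bar> \<le> d1/4" using m(1) by simp
        have "dist (y, \<tau>) (x, \<sigma>) \<le> dist y x + dist \<tau> \<sigma>"
          unfolding dist_Pair_Pair by (rule sqrt_sum_squares_le_sum) auto
        also have "\<dots> < d1" using xy close d1(1) by (simp add: dist_real_def abs_minus_commute)
        finally have "dist (sgn (E (y, \<tau>))) (sgn (E (x, \<sigma>))) < e"
          by (intro d1(2)) (use x y \<tau> \<sigma> in auto)
        then show ?thesis by (simp add: T_def y_def x_def dist_norm)
      qed
      have "T \<tau> (frac x) = T \<tau> x" "T \<sigma> (frac x) = T \<sigma> x"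
        using periodic_frac[of "T \<tau>", OF perT[OF \<tau>]] periodic_frac[of "T \<sigma>", OF perT[OF \<sigma>]] by auto
      then show ?thesis using main[of "frac x"] by (simp add: frac_lt_1)
    qed
    then show ?thesis using d1(1) d2(1) by (intro exI[of _ "min d2 (d1/2)"]) auto
  qed
  show ?thesis
    by (rule that[of K T]) (use knot end_tangent[OF _ k(1) J(2)] end_tangent[OF _ k(2) J(3)] cont in auto)
qed

section \<open>Components of the space of knots\<close>

text \<open>For each \<open>\<sigma>\<close> the knots of \<open>M\<close> with tangents within \<open>e \<sigma>\<close> of the stage \<open>\<sigma>\<close> lie in a single
  component (\<open>close_knots_connected\<close>), and there are some (\<open>knot_approximation\<close>), although the
  stage itself need not belong to \<open>M\<close>. Neighbouring stages share such a knot, so the component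
  is locally constant along the interval. At the ends \<open>\<gamma>0\<close> and \<open>\<gamma>1\<close> themselves are among these
  knots.\<close>

lemma C1_isotopic_imp_connected_component:
  fixes \<gamma>0 \<gamma>1 :: "real \<Rightarrow> 'b::euclidean_space"
  assumes s: "1/2 < s" "s \<le> 1" and M: "M = knots s \<or> M = knots_at s z"
    and mem: "\<gamma>0 \<in> M" "\<gamma>1 \<in> M" and iso: "C1_isotopic \<gamma>0 \<gamma>1"
  shows "connected_component_of (subtopology (H1_topology s) M) \<gamma>0 \<gamma>1"
proof -
  let ?con = "connected_component_of (subtopology (H1_topology s) M)"
  have kn: "\<gamma>0 \<in> knots s" "\<gamma>1 \<in> knots s" using M mem by (auto simp: knots_at_def)
  obtain T0 where T0: "unit_speed_knot \<gamma>0 T0" by (rule knot_unit_speed[OF s kn(1)]) (rule that)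
  obtain T1 where T1: "unit_speed_knot \<gamma>1 T1" by (rule knot_unit_speed[OF s kn(2)]) (rule that)
  obtain K T :: "real \<Rightarrow> real \<Rightarrow> 'b" where KT: "\<And>\<sigma>. \<sigma> \<in> {0..1} \<Longrightarrow> unit_speed_knot (K \<sigma>) (T \<sigma>)" "T 0 = T0" "T 1 = T1"
    "\<And>\<sigma> e. \<sigma> \<in> {0..1} \<Longrightarrow> e > 0 \<Longrightarrow> \<exists>d>0. \<forall>\<tau>\<in>{0..1}. \<bar>\<tau> - \<sigma>\<bar> < d \<longrightarrow> (\<forall>x. norm (T \<tau> x - T \<sigma> x) \<le> e)"
    by (rule isotopy_unit_speed[OF iso T0 T1]) (rule that)
  define near where "near \<sigma> r \<gamma> \<longleftrightarrow> \<gamma> \<in> M \<and> (\<exists>U. unit_speed_knot \<gamma> U \<and> (\<forall>x. norm (U x - T \<sigma> x) \<le> r))" for \<sigma> r \<gamma>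
  have "\<forall>\<sigma>\<in>{0..1}. \<exists>e>0. \<forall>\<alpha> \<beta>. near \<sigma> e \<alpha> \<longrightarrow> near \<sigma> e \<beta> \<longrightarrow> ?con \<alpha> \<beta>"
  proof
    fix \<sigma> :: real assume \<sigma>: "\<sigma> \<in> {0..1}"
    obtain e where e: "e > 0"
      "\<And>M z \<gamma> \<eta> T\<gamma> T\<eta>. M = knots s \<or> M = knots_at s z \<Longrightarrow> \<gamma> \<in> M \<Longrightarrow> \<eta> \<in> M \<Longrightarrow>
      unit_speed_knot \<gamma> T\<gamma> \<Longrightarrow> unit_speed_knot \<eta> T\<eta> \<Longrightarrow>
      (\<And>x. norm (T\<gamma> x - T \<sigma> x) \<le> e) \<Longrightarrow> (\<And>x. norm (T\<eta> x - T \<sigma> x) \<le> e) \<Longrightarrow>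
      connected_component_of (subtopology (H1_topology s) M) \<gamma> \<eta>"
      using close_knots_connected[OF s KT(1)[OF \<sigma>]] by blast
    have "?con \<alpha> \<beta>" if "near \<sigma> e \<alpha>" "near \<sigma> e \<beta>" for \<alpha> \<beta>
    proof -
      obtain U where "\<alpha> \<in> M" "unit_speed_knot \<alpha> U" "\<And>x. norm (U x - T \<sigma> x) \<le> e"
        using \<open>near \<sigma> e \<alpha>\<close> unfolding near_def by blast
      moreover obtain U' where "\<beta> \<in> M" "unit_speed_knot \<beta> U'" "\<And>x. norm (U' x - T \<sigma> x) \<le> e"
        using \<open>near \<sigma> e \<beta>\<close> unfolding near_def by blast
      ultimately show ?thesis by (intro e(2)[OF M])
    qed
    then show "\<exists>e>0. \<forall>\<alpha> \<beta>. near \<sigma> e \<alpha> \<longrightarrow> near \<sigma> e \<beta> \<longrightarrow> ?con \<alpha> \<beta>" using e(1) by blast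
  qed
  from bchoice[OF this] obtain e where e: "\<And>\<sigma>. \<sigma> \<in> {0..1} \<Longrightarrow> e \<sigma> > 0"
    "\<And>\<sigma> \<alpha> \<beta>. \<sigma> \<in> {0..1} \<Longrightarrow> near \<sigma> (e \<sigma>) \<alpha> \<Longrightarrow> near \<sigma> (e \<sigma>) \<beta> \<Longrightarrow> ?con \<alpha> \<beta>" by blast
  have exists: "\<exists>\<alpha>. near \<sigma> r \<alpha>" if \<sigma>: "\<sigma> \<in> {0..1}" and "r > 0" for \<sigma> r
  proof -
    obtain \<alpha> U where \<alpha>: "\<alpha> \<in> knots s" "\<alpha> 0 = \<gamma>0 0" "unit_speed_knot \<alpha> U" "\<forall>x. norm (U x - T \<sigma> x) \<le> r"
      using knot_approximation[OF s KT(1)[OF \<sigma>] \<open>r > 0\<close>, of "\<gamma>0 0"] by blast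
    then have "\<alpha> \<in> M" using M mem by (auto simp: knots_at_def)
    then show ?thesis using \<alpha> unfolding near_def by blast
  qed
  define R where "R \<sigma> \<tau> \<longleftrightarrow> (\<forall>\<alpha> \<beta>. near \<sigma> (e \<sigma>) \<alpha> \<longrightarrow> near \<tau> (e \<tau>) \<beta> \<longrightarrow> ?con \<alpha> \<beta>)" for \<sigma> \<tau>
  have "R 0 1"
  proof (rule connected_equivalence_relation[of "{0..1}"])
    show "R \<tau> \<sigma>" if "R \<sigma> \<tau>" for \<sigma> \<tau>
      using that unfolding R_def by (metis connected_component_of_sym)
    show "R \<sigma> \<rho>" if "R \<sigma> \<tau>" "R \<tau> \<rho>" "\<sigma> \<in> {0..1}" "\<tau> \<in> {0..1}" "\<rho> \<in> {0..1}" for \<sigma> \<tau> \<rho>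
      using that(1,2) exists[OF that(4) e(1)[OF that(4)]] unfolding R_def by (metis connected_component_of_trans)
    fix \<sigma> :: real assume \<sigma>: "\<sigma> \<in> {0..1}"
    obtain d where d: "d > 0" "\<And>\<tau> x. \<tau> \<in> {0..1} \<Longrightarrow> \<bar>\<tau> - \<sigma>\<bar> < d \<Longrightarrow> norm (T \<tau> x - T \<sigma> x) \<le> e \<sigma> / 2"
      using KT(4)[OF \<sigma>, of "e \<sigma> / 2"] e(1)[OF \<sigma>] by auto
    have "R \<sigma> \<tau>" if \<tau>: "\<tau> \<in> {0..1}" "\<bar>\<tau> - \<sigma>\<bar> < d" for \<tau>
      unfolding R_def
    proof (intro allI impI)
      fix \<alpha> \<beta> assume \<alpha>: "near \<sigma> (e \<sigma>) \<alpha>" and \<beta>: "near \<tau> (e \<tau>) \<beta>"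
      obtain \<delta> where \<delta>: "near \<tau> (min (e \<tau>) (e \<sigma> / 2)) \<delta>"
        using exists[OF \<tau>(1), of "min (e \<tau>) (e \<sigma> / 2)"] e(1)[OF \<tau>(1)] e(1)[OF \<sigma>] by auto
      then obtain U where U: "\<delta> \<in> M" "unit_speed_knot \<delta> U" "\<And>x. norm (U x - T \<tau> x) \<le> min (e \<tau>) (e \<sigma> / 2)"
        unfolding near_def by blast
      have "norm (U x - T \<tau> x) \<le> e \<tau>" "norm (U x - T \<tau> x) \<le> e \<sigma> / 2" for x using U(3)[of x] by simp_all
      moreover from this have "norm (U x - T \<sigma> x) \<le> e \<sigma>" for x
        using d(2)[OF \<tau>, of x] norm_triangle_ineq[of "U x - T \<tau> x" "T \<tau> x - T \<sigma> x"]
        by (smt (verit) diff_add_cancel add_diff_eq field_sum_of_halves)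
      ultimately have "near \<tau> (e \<tau>) \<delta>" "near \<sigma> (e \<sigma>) \<delta>" using U(1,2) unfolding near_def by blast+
      then show "?con \<alpha> \<beta>" using e(2)[OF \<sigma> \<alpha>] e(2)[OF \<tau>(1) _ \<beta>] connected_component_of_trans by metis
    qed
    then show "\<exists>X. openin (top_of_set {0..1}) X \<and> \<sigma> \<in> X \<and> (\<forall>\<tau>\<in>X. R \<sigma> \<tau>)"
      using \<sigma> d(1) by (intro exI[of _ "{0..1} \<inter> ball \<sigma> d"]) (auto simp: dist_real_def abs_minus_commute)
  qed auto
  moreover have "near 0 (e 0) \<gamma>0" using mem T0 e(1)[of 0] KT(2) unfolding near_def by auto
  moreover have "near 1 (e 1) \<gamma>1" using mem T1 e(1)[of 1] KT(3) unfolding near_def by auto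
  ultimately show ?thesis unfolding R_def by blast
qed

theorem theorem3p9:
  fixes s :: real and z :: "real ^ 'n"
    and M :: "(real \<Rightarrow> real ^ 'n) set" and \<gamma>0 \<gamma>1 :: "real \<Rightarrow> real ^ 'n"
  assumes "CARD('n) \<ge> 2" and "1 / 2 < s" and "s \<le> 1"
    and "M = knots s \<or> M = knots_at s z"
    and "\<gamma>0 \<in> M" and "\<gamma>1 \<in> M"
  shows "(connected_component_of (subtopology (H1_topology s) M) \<gamma>0 \<gamma>1
            \<longrightarrow> C1_ambient_isotopic \<gamma>0 \<gamma>1)
       \<and> (C1_isotopic \<gamma>0 \<gamma>1
            \<longrightarrow> connected_component_of (subtopology (H1_topology s) M) \<gamma>0 \<gamma>1)"
proof -
  have "M \<subseteq> knots s" using assms(4) by (auto simp: knots_at_def)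
  then show ?thesis
    using connected_component_imp_ambient_isotopic[OF assms(2,3)]
      C1_isotopic_imp_connected_component[OF assms(2-6)] by blast
qed

end
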